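(* Let $\tilde w\in\mathrm{FC}(\tilde C_n)$ be alternating, i.e. $\tilde w\in(\mathrm{ALT})$. Then $\mathtt{dec}_A(\tilde w)=\tilde\theta(\tilde b_{\tilde w})$.
   Context: Let $n\ge 2$. $\tilde C_n$ is the Coxeter group with generators $\tilde s_1,\dots,\tilde s_{n+1}$ whose Coxeter graph is the path $\tilde s_1-\cdots-\tilde s_{n+1}$, the edges $\{\tilde s_1,\tilde s_2\}$, $\{\tilde s_n,\tilde s_{n+1}\}$ having label $4$ and the others label $3$; $A_{n+1}$ has generators $s_1,\dots,s_{n+1}$ and Coxeter graph the path with all labels $3$. $\mathrm{FC}(\cdot)$ is the set of fully commutative elements (any two reduced expressions are related by commutation relations only). The heap $H(w)$ of a FC element $w$ with reduced expression $s_{a_1}\cdots s_{a_l}$ is the poset on $\{1,\dots,l\}$ generated by $i\prec j$ if $i<j$ and $s_{a_i},s_{a_j}$ do not commute, with $i$ labeled $s_{a_i}$; it is drawn from top to bottom, nodes with the $i$-th label in column $i$. $\tilde w$ (or $H(\tilde w)$) is alternating, written $\tilde w\in(\mathrm{ALT})$, if for every pair of non-commuting generators $s,t$ the chain of nodes labeled $s$ or $t$ has alternating labels. Alternating heaps are drawn so that each edge of the Hasse diagram joins nodes in adjacent columns at heights differing by one. TEMPERLEY-LIEB ALGEBRA. $\mathrm{TL}(\tilde C_n)$ is the unital $\mathbb Z[\delta]$-algebra generated by $\tilde b_1,\dots,\tilde b_{n+1}$ with relations $\tilde b_i^2=\delta\tilde b_i$; $\tilde b_i\tilde b_j=\tilde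 b_j\tilde b_i$ if $|i-j|>1$; $\tilde b_i\tilde b_j\tilde b_i=\tilde b_i$ if $|i-j|=1$, $i,j\in\{2,\dots,n\}$; $\tilde b_i\tilde b_j\tilde b_i\tilde b_j=2\tilde b_i\tilde b_j$ if $\{i,j\}=\{1,2\}$ or $\{n,n+1\}$. For $\tilde w=\tilde s_{i_1}\cdots\tilde s_{i_k}$ reduced and FC, $\tilde b_{\tilde w}=\tilde b_{i_1}\cdots\tilde b_{i_k}$. DIAGRAMS. The standard $(n+2)$-box has nodes $1,\dots,n+2$ on the north face and $1',\dots,(n+2)'$ on the south face, left to right. A pseudo diagram is an isotopy class of finitely many disjoint curves (edges) in the box, joining the nodes in pairs or closed (loops); an edge is propagating if it joins the two faces; $\mathbf a(d)$ is the number of non-propagating edges on the north face. The product $d'd$ places $d'$ on top of $d$. The simple diagram $d_i$ has edges $(i,i+1)$, $(i',(i+1)')$ and all other edges vertical $(j,j')$. Modulo removing a loop with a factor $\delta$, for $w=s_{i_1}\cdots s_{i_k}\in\mathrm{FC}(A_{n+1})$ (reduced) put $d_w=d_{i_1}\cdots d_{i_k}$; $w\mapsto d_w$ is a bijection onto loop-free diagrams. For $\tilde w=\tilde s_{i_1}\cdots\tilde s_{i_k}\in\mathrm{FC}(\tilde C_n)$ (reduced) put $d(\tilde w)=d_{i_1}\cdots d_{i_k}=\delta^{\alpha(\tilde w)}d_{\tau(\tilde w)}$, defining $\alpha(\tilde w)\ge0$ and $\tau(\tilde w)\in\mathrm{FC}(A_{n+1})$; as a concrete diagram $d(\tilde w)$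 is $d_{\tau(\tilde w)}$ with $\alpha(\tilde w)$ loops. DECORATED DIAGRAMS. Edges may carry finite words in the decorations $\bullet,\blacktriangle$ (black), $\circ,\vartriangle$ (white), read from north to south on propagating edges and from the left node to the right node on non-propagating ones (on loops, words are taken up to cyclic permutation and reversal); no decorations are allowed if $\mathbf a(d)=0$; all decorated edges must be simultaneously deformable so as to take black decorations to the left wall and white ones to the right wall without crossing other edges. The word on an edge is a single block, except on propagating edges when $\mathbf a(d)=1$: there words are split into blocks whose relative vertical positions are part of the data; decorations on propagating edges lie below those on the north non-propagating edge and above those on the south one; no decoration on another propagating edge lies in the vertical range of a block; adjacent blocks may be conjoined into a larger block only if these requirements are not violated. Diagrams are taken up to isotopy preserving relative vertical positions of blocks. They are multiplied by concatenation, conjoining adjacent blocks, over $\mathbb Z[\delta]$, modulo the following relations for adjacent decorations in a block: $\bullet\bullet=\blacktriangle$, $\bullet\blacktriangle=\blacktriangle\bullet=2\bullet$, $\circ\circ=\vartriangle$, $\circ\vartriangle=\vartriangle\circ=2\circ$; and a loop that is undecorated, or carries only one $\blacktriangle$, or only one $\vartriangle$, equals $\delta$. $\mathbb D(\tilde C_n)$ is the subalgebra generated by $\tilde d_1,\dots,\tilde d_{n+1}$, where $\tilde d_i=d_i$ for $2\le i\le n$, $\tilde d_1$ is $d_1$ with one $\bullet$ on each of $(1,2)$, $(1',2')$, and $\tilde d_{n+1}$ is $d_{n+1}$ with one $\circ$ on each of $(n+1,n+2)$, $((n+1)',(n+2)')$. $\tilde\theta:\mathrm{TL}(\tilde C_n)\to\mathbb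 D(\tilde C_n)$ is the algebra morphism with $\tilde b_i\mapsto\tilde d_i$. SNAKE PATHS in an alternating heap $H$. A right-down (right-up) step goes along an edge from column $i$ to column $i+1$, downwards (upwards); left steps similarly. An up-down path moves always in the same horizontal direction with alternately up and down steps, as far as possible. A left (right) fork is a convex chain labeled $\tilde s_1\tilde s_2\tilde s_1$ ($\tilde s_{n+1}\tilde s_n\tilde s_{n+1}$). For a left fork $f$: $\gamma^{top}$ starts at the top node of $f$ with a right-down step and follows the up-down path to the right until its last node $p$. If $p$ has label $\tilde s_{n+1}$ and either (a) $p$ is reached by a right-down step and there is a node $p'$ labeled $\tilde s_{n+1}$ just above $p$ in its column, or (b) $p$ is reached by a right-up step and there is such a $p'$ just below $p$, then the path passes from $p$ to $p'$ (crossing the right fork with extreme nodes $p,p'$) and continues from $p'$ along the up-down path to the left, with first step left-down in case (a) and left-up in case (b); on reaching column $1$ the mirror-image rule applies, and so on; otherwise the path stops. If it never stops it forms a cycle and $\gamma(H,f)=\gamma_\infty$. Otherwise it ends in a node $B_x$ labeled $\tilde s_x$; $\gamma^{bot}$ is defined in the same way starting at the bottom node of $f$ with a right-up step, and ends in a node $B_y$ labeled $\tilde s_y$; $\gamma(H,f)=\gamma_{x,y}$ is the path from $B_x$ to $B_y$ obtained by traversing $\gamma^{top}$ backwards, crossing $f$ from top to bottom, and traversing $\gamma^{bot}$ forwards. For a right fork exchange left and right. If $\gamma_{x,y}$ crosses both left and right forks, it is oriented as obtained from a left fork. To $\gamma=\gamma_{x,y}$ associate nodes $h,k$ of the box: if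 the last step of $\gamma^{top}$ (reaching $B_x$) is right-down, left-down, right-up, left-up, then $h=x+1$, $x$, $(x+1)'$, $x'$ respectively; $k$ is defined likewise from the last step of $\gamma^{bot}$ and $y$. Then $(h,k)_\gamma$ is an edge of $d_{\tau(\tilde w)}$ when $H=H(\tilde w)$; cycles $\gamma_\infty$ correspond one-to-one to the loops of $d(\tilde w)$. DECORATION ALGORITHM. For $\tilde w\in(\mathrm{ALT})$ start from the undecorated concrete diagram $d(\tilde w)$. If $H=H(\tilde w)$ has no forks, go directly to the final step. Otherwise fix a fork $f$ of $H$: if $\gamma(H,f)=\gamma_\infty$, replace one undecorated loop by a loop decorated with one $\blacktriangle$ and one $\vartriangle$; if $\gamma(H,f)=\gamma\ne\gamma_\infty$, then going from $h$ to $k$ add to the edge $(h,k)_\gamma$ of $d_{\tau(\tilde w)}$ a $\blacktriangle$ (resp. $\vartriangle$) each time the oriented path $\gamma$ crosses a left (resp. right) fork, in the order in which $\gamma$ crosses them. Iterate, each time starting from a fork not yet crossed by the paths used. Final step: add a $\bullet$ (resp. $\circ$) as first decoration (the one adjacent to the node) to the edges starting from $1$ and $1'$ (resp. from $n+2$ and $(n+2)'$) in $d_{\tau(\tilde w)}$, except if there is an edge joining $1$ to $1'$ (resp. $n+2$ to $(n+2)'$). The result is $\mathtt{dec}_A(\tilde w)$.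
   Formalization: In the final step the exception for an edge joining 1 to 1' (resp. n+2 to (n+2)') is applied only if that edge is still undecorated; read literally the claim fails, e.g. n=3, w=s1 s3 s2 s1 s4 s3, where the edge 5–5' carries ∘▲∘. *)

theory Defs
  imports
    Complex_Main
    "HOL-Library.Multiset"
    "HOL-Library.Poly_Mapping"
    "HOL-Computational_Algebra.Polynomial"
    "HOL-Algebra.QuotRing"
begin

section \<open>The Coxeter group of affine type C and its fully commutative elements\<close>

text \<open>The generator with index \<open>i\<close> is the number \<open>i \<in> {1..n+1}\<close>; words in the generators are lists.
  Elements of the group are classes of words modulo the Coxeter relations.\<close>

definition gens :: "nat \<Rightarrow> nat set" where
  "gens n = {1..n+1}"

definition cox_m :: "nat \<Rightarrow> nat \<Rightarrow> nat \<Rightarrow> nat" where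
  "cox_m n i j =
     (if i = j then 1
      else if {i, j} = {1, 2} \<or> {i, j} = {n, n+1} then 4
      else if j = i + 1 \<or> i = j + 1 then 3
      else 2)"

fun alt_word :: "nat \<Rightarrow> nat \<Rightarrow> nat \<Rightarrow> nat list" where
  "alt_word 0 i j = []"
| "alt_word (Suc k) i j = i # alt_word k j i"

inductive cox_step :: "nat \<Rightarrow> nat list \<Rightarrow> nat list \<Rightarrow> bool" for n where
  cancel: "i \<in> gens n \<Longrightarrow> cox_step n (p @ [i, i] @ q) (p @ q)"
| braid: "i \<in> gens n \<Longrightarrow> j \<in> gens n \<Longrightarrow> i \<noteq> j \<Longrightarrow>
    cox_step n (p @ alt_word (cox_m n i j) i j @ q) (p @ alt_word (cox_m n i j) j i @ q)"

definition cox_eq :: "nat \<Rightarrow> (nat list \<times> nat list) set" where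
  "cox_eq n = {(u, v). u \<in> lists (gens n) \<and> v \<in> lists (gens n) \<and> equivclp (cox_step n) u v}"

definition coxeter_group :: "nat \<Rightarrow> nat list set set" where
  "coxeter_group n = lists (gens n) // cox_eq n"

definition reduced_exprs :: "nat list set \<Rightarrow> nat list set" where
  "reduced_exprs w = {u \<in> w. \<forall>v\<in>w. length u \<le> length v}"

inductive comm_step :: "nat \<Rightarrow> nat list \<Rightarrow> nat list \<Rightarrow> bool" for n where
  "cox_m n i j = 2 \<Longrightarrow> comm_step n (p @ [i, j] @ q) (p @ [j, i] @ q)"

definition FC :: "nat \<Rightarrow> nat list set set" where
  "FC n = {w \<in> coxeter_group n.
     \<forall>u\<in>reduced_exprs w. \<forall>v\<in>reduced_exprs w. equivclp (comm_step n) u v}"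

text \<open>The nodes of the heap of a reduced word \<open>u\<close> are the positions \<open>i < length u\<close>,
  with labels \<open>u ! i\<close>. The nodes with label \<open>s\<close> or \<open>t\<close>, for non-commuting \<open>s, t\<close>, form a
  chain on which the heap order is the order of positions.\<close>

definition alternating :: "nat \<Rightarrow> nat list \<Rightarrow> bool" where
  "alternating n u \<longleftrightarrow>
     (\<forall>s\<in>gens n. \<forall>t\<in>gens n. cox_m n s t \<ge> 3 \<longrightarrow> distinct_adj (filter (\<lambda>x. x = s \<or> x = t) u))"

definition ALT :: "nat \<Rightarrow> nat list set set" where
  "ALT n = {w \<in> FC n. \<forall>u\<in>reduced_exprs w. alternating n u}"


section \<open>Algebras by generators and relations\<close>

text \<open>The monoid algebra of \<open>M\<close>: finitely supported functions on the carrier of \<open>M\<close>.\<close>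

definition monoid_algebra ::
    "('m, 'x) monoid_scheme \<Rightarrow> ('m \<Rightarrow>\<^sub>0 'r::comm_ring_1) ring" where
  "monoid_algebra M = \<lparr>
     carrier = {f. Poly_Mapping.keys f \<subseteq> carrier M},
     mult = (\<lambda>f g. \<Sum>x\<in>Poly_Mapping.keys f. \<Sum>y\<in>Poly_Mapping.keys g.
               Poly_Mapping.single (x \<otimes>\<^bsub>M\<^esub> y) (Poly_Mapping.lookup f x * Poly_Mapping.lookup g y)),
     one = Poly_Mapping.single \<one>\<^bsub>M\<^esub> 1,
     zero = 0,
     add = (+) \<rparr>"

definition delta :: "int poly" where
  "delta = [:0, 1:]"

text \<open>Algebras over the polynomial ring in \<open>delta\<close> occur below as rings \<open>A\<close> together with their
  structure map \<open>s\<close> from that ring.\<close>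

inductive_set subalgebra_gen ::
    "('a, 'x) ring_scheme \<Rightarrow> (int poly \<Rightarrow> 'a) \<Rightarrow> 'a set \<Rightarrow> 'a set" for A s X where
  gen: "x \<in> X \<Longrightarrow> x \<in> subalgebra_gen A s X"
| scalar: "s c \<in> subalgebra_gen A s X"
| add: "x \<in> subalgebra_gen A s X \<Longrightarrow> y \<in> subalgebra_gen A s X \<Longrightarrow> x \<oplus>\<^bsub>A\<^esub> y \<in> subalgebra_gen A s X"
| mult: "x \<in> subalgebra_gen A s X \<Longrightarrow> y \<in> subalgebra_gen A s X \<Longrightarrow> x \<otimes>\<^bsub>A\<^esub> y \<in> subalgebra_gen A s X"

definition algebra_hom ::
    "('a, 'x) ring_scheme \<Rightarrow> (int poly \<Rightarrow> 'a) \<Rightarrow> ('b, 'y) ring_scheme \<Rightarrow> (int poly \<Rightarrow> 'b) \<Rightarrow> ('a \<Rightarrow> 'b) set" where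
  "algebra_hom A s B t = {h \<in> ring_hom A B. \<forall>c. h (s c) = t c}"


section \<open>The Temperley--Lieb algebra\<close>

definition word_monoid :: "nat \<Rightarrow> nat list monoid" where
  "word_monoid n = \<lparr>carrier = lists (gens n), mult = (@), one = []\<rparr>"

definition free_alg :: "nat \<Rightarrow> (nat list \<Rightarrow>\<^sub>0 int poly) ring" where
  "free_alg n = monoid_algebra (word_monoid n)"

definition TL_rels :: "nat \<Rightarrow> (nat list \<Rightarrow>\<^sub>0 int poly) set" where
  "TL_rels n =
     {Poly_Mapping.single [i, i] 1 - Poly_Mapping.single [i] delta | i. i \<in> gens n}
   \<union> {Poly_Mapping.single [i, j] 1 - Poly_Mapping.single [j, i] 1 | i j.
        i \<in> gens n \<and> j \<in> gens n \<and> (i + 1 < j \<or> j + 1 < i)}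
   \<union> {Poly_Mapping.single [i, j, i] 1 - Poly_Mapping.single [i] 1 | i j.
        i \<in> {2..n} \<and> j \<in> {2..n} \<and> (j = i + 1 \<or> i = j + 1)}
   \<union> {Poly_Mapping.single [i, j, i, j] 1 - Poly_Mapping.single [i, j] 2 | i j.
        {i, j} = {1, 2} \<or> {i, j} = {n, n+1}}"

definition TL_ideal :: "nat \<Rightarrow> (nat list \<Rightarrow>\<^sub>0 int poly) set" where
  "TL_ideal n = genideal (free_alg n) (TL_rels n)"

definition TL :: "nat \<Rightarrow> (nat list \<Rightarrow>\<^sub>0 int poly) set ring" where
  "TL n = free_alg n Quot TL_ideal n"

definition TL_scalar :: "nat \<Rightarrow> int poly \<Rightarrow> (nat list \<Rightarrow>\<^sub>0 int poly) set" where
  "TL_scalar n c = TL_ideal n +>\<^bsub>free_alg n\<^esub> Poly_Mapping.single [] c"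

definition b_gen :: "nat \<Rightarrow> nat \<Rightarrow> (nat list \<Rightarrow>\<^sub>0 int poly) set" where
  "b_gen n i = TL_ideal n +>\<^bsub>free_alg n\<^esub> Poly_Mapping.single [i] 1"

definition b_word :: "nat \<Rightarrow> nat list \<Rightarrow> (nat list \<Rightarrow>\<^sub>0 int poly) set" where
  "b_word n u = foldr (\<lambda>i x. b_gen n i \<otimes>\<^bsub>TL n\<^esub> x) u \<one>\<^bsub>TL n\<^esub>"


section \<open>Decorated diagrams\<close>

datatype node = North nat | South nat

datatype deco = Bullet | BTriangle | Circle | WTriangle

definition black :: "deco \<Rightarrow> bool" where
  "black c \<longleftrightarrow> c = Bullet \<or> c = BTriangle"

text \<open>A (decorated) diagram up to isotopy:
  \<open>mate x\<close> is the other end of the edge at the node \<open>x\<close>;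
  \<open>word x\<close> is the word on that edge, read from \<open>x\<close> towards \<open>mate x\<close>;
  \<open>loops\<close> is the multiset of the loops, each given by its word up to rotation and reversal;
  \<open>vert\<close> is only used if there is exactly one non-propagating edge on the north face, and then
  is the list of all decorations on propagating edges, from top to bottom. In that case there
  are at least two propagating edges, black decorations can only occur on the leftmost one and
  white decorations only on the rightmost one, so this list determines the words on the
  propagating edges; its maximal runs of one colour are the blocks.\<close>

record ddiag =
  mate :: "node \<Rightarrow> node"
  word :: "node \<Rightarrow> deco list"
  loops :: "deco list set multiset"
  vert :: "deco list"

definition cyc :: "deco list \<Rightarrow> deco list set" where
  "cyc w = {rotate k w | k. True} \<union> {rotate k (rev w) | k. True}"

definition node_list :: "nat \<Rightarrow> node list" where
  "node_list m = map North [1..<m+1] @ map South [1..<m+1]"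

abbreviation nodes :: "nat \<Rightarrow> node set" where
  "nodes m \<equiv> set (node_list m)"

definition a_val :: "(node \<Rightarrow> node) \<Rightarrow> nat" where
  "a_val f = card {i. \<exists>j. f (North i) = North j \<and> i < j}"

definition prop_list :: "nat \<Rightarrow> (node \<Rightarrow> node) \<Rightarrow> node list" where
  "prop_list m f = filter (\<lambda>x. \<exists>j. f x = South j) (map North [1..<m+1])"

text \<open>Deformability. The boundary of the box is parametrised clockwise by real numbers, so that
  the right wall is the interval \<open>(m, m+1)\<close> and the left wall is \<open>(2m, \<infinity>)\<close>. Every decoration
  is taken to a point of its wall, which replaces each decorated edge or loop by a
  chain of chords with ends on the boundary; no two of these chords may cross. For undecorated
  edges this is the requirement that edges do not cross.\<close>

fun pos :: "nat \<Rightarrow> node \<Rightarrow> real" where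
  "pos m (North i) = real i"
| "pos m (South i) = 2 * real m + 1 - real i"

definition on_wall :: "nat \<Rightarrow> deco \<Rightarrow> real \<Rightarrow> bool" where
  "on_wall m c t \<longleftrightarrow> (if black c then 2 * real m < t else real m < t \<and> t < real m + 1)"

definition chords :: "real list \<Rightarrow> (real \<times> real) set" where
  "chords ts = set (zip ts (tl ts))"

definition noncrossing :: "(real \<times> real) set \<Rightarrow> bool" where
  "noncrossing C \<longleftrightarrow>
     (\<forall>(a, b)\<in>C. \<forall>(c, e)\<in>C. \<not> (min a b < min c e \<and> min c e < max a b \<and> max a b < max c e))"

definition deformable :: "nat \<Rightarrow> ddiag \<Rightarrow> bool" where
  "deformable m d \<longleftrightarrow>
     (\<exists>(T :: node \<Rightarrow> real list) (ls :: (deco list \<times> real list) list).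
        let E = filter (\<lambda>x. pos m x < pos m (mate d x)) (node_list m) in
          loops d = mset (map (\<lambda>(w, ts). cyc w) ls) \<and>
          (\<forall>x\<in>set E. list_all2 (on_wall m) (word d x) (T x)) \<and>
          (\<forall>(w, ts)\<in>set ls. list_all2 (on_wall m) w ts) \<and>
          distinct (concat (map T E) @ concat (map snd ls)) \<and>
          noncrossing ((\<Union>x\<in>set E. chords (pos m x # T x @ [pos m (mate d x)]))
                       \<union> (\<Union>(w, ts)\<in>set ls. chords (ts @ [hd ts]))))"

definition decorated_diagram :: "nat \<Rightarrow> ddiag \<Rightarrow> bool" where
  "decorated_diagram n d \<longleftrightarrow> (let m = n + 2 in
     (\<forall>x\<in>nodes m. mate d x \<in> nodes m \<and> mate d x \<noteq> x \<and> mate d (mate d x) = x \<and>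
                   word d (mate d x) = rev (word d x)) \<and>
     (\<forall>x. x \<notin> nodes m \<longrightarrow> mate d x = x \<and> word d x = []) \<and>
     deformable m d \<and>
     (a_val (mate d) = 0 \<longrightarrow> (\<forall>x. word d x = []) \<and> (\<forall>c\<in>#loops d. c = cyc [])) \<and>
     (if a_val (mate d) = 1
      then (let ws = concat (map (word d) (prop_list m (mate d))) in
              filter black (vert d) = filter black ws \<and>
              filter (\<lambda>c. \<not> black c) (vert d) = filter (\<lambda>c. \<not> black c) ws)
      else vert d = []))"

definition id_diag :: "nat \<Rightarrow> ddiag" where
  "id_diag n = \<lparr>
     mate = (\<lambda>x. if x \<in> nodes (n + 2)
                 then (case x of North i \<Rightarrow> South i | South i \<Rightarrow> North i) else x),
     word = (\<lambda>_. []), loops = {#}, vert = []\<rparr>"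

text \<open>Product: \<open>d1\<close> on top of \<open>d2\<close>. A curve of the product is a sequence of edges of the two
  diagrams. Each of them is encoded by its starting point, a pair of a flag (whether the edge
  belongs to the upper diagram \<open>d1\<close>) and a node of that diagram. The bound \<open>2 * m\<close> on the number
  of passages suffices, since a curve passes at most once through each of the \<open>m\<close> gluing points,
  and a closed curve is back at its start after at most \<open>m\<close> passages.\<close>

fun glue_next :: "ddiag \<Rightarrow> ddiag \<Rightarrow> bool \<times> node \<Rightarrow> (bool \<times> node) option" where
  "glue_next d1 d2 (True, x) =
     (case mate d1 x of North j \<Rightarrow> None | South j \<Rightarrow> Some (False, North j))"
| "glue_next d1 d2 (False, x) =
     (case mate d2 x of South j \<Rightarrow> None | North j \<Rightarrow> Some (True, South j))"

fun seg_word :: "ddiag \<Rightarrow> ddiag \<Rightarrow> bool \<times> node \<Rightarrow> deco list" where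
  "seg_word d1 d2 (b, x) = word (if b then d1 else d2) x"

fun seg_end :: "ddiag \<Rightarrow> ddiag \<Rightarrow> bool \<times> node \<Rightarrow> node" where
  "seg_end d1 d2 (b, x) = mate (if b then d1 else d2) x"

primrec trail :: "nat \<Rightarrow> ddiag \<Rightarrow> ddiag \<Rightarrow> bool \<times> node \<Rightarrow> (bool \<times> node) list" where
  "trail 0 d1 d2 s = [s]"
| "trail (Suc k) d1 d2 s =
     s # (case glue_next d1 d2 s of None \<Rightarrow> [] | Some t \<Rightarrow> trail k d1 d2 t)"

fun entry :: "node \<Rightarrow> bool \<times> node" where
  "entry (North i) = (True, North i)"
| "entry (South i) = (False, South i)"

fun node_index :: "node \<Rightarrow> nat" where
  "node_index (North i) = i"
| "node_index (South i) = i"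

definition curve :: "nat \<Rightarrow> ddiag \<Rightarrow> ddiag \<Rightarrow> node \<Rightarrow> (bool \<times> node) list" where
  "curve m d1 d2 x = trail (2 * m) d1 d2 (entry x)"

definition prod_mate :: "nat \<Rightarrow> ddiag \<Rightarrow> ddiag \<Rightarrow> node \<Rightarrow> node" where
  "prod_mate m d1 d2 x = (if x \<in> nodes m then seg_end d1 d2 (last (curve m d1 d2 x)) else x)"

definition closed_at :: "nat \<Rightarrow> ddiag \<Rightarrow> ddiag \<Rightarrow> nat \<Rightarrow> bool" where
  "closed_at m d1 d2 i \<longleftrightarrow>
     glue_next d1 d2 (last (trail (2 * m) d1 d2 (False, North i))) \<noteq> None"

definition closed_curve :: "nat \<Rightarrow> ddiag \<Rightarrow> ddiag \<Rightarrow> nat \<Rightarrow> (bool \<times> node) list" where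
  "closed_curve m d1 d2 i =
     (False, North i) #
       takeWhile (\<lambda>s. s \<noteq> (False, North i)) (tl (trail (2 * m) d1 d2 (False, North i)))"

text \<open>Each closed curve is counted once, from its gluing point with the smallest index.\<close>

definition new_loops :: "nat \<Rightarrow> ddiag \<Rightarrow> ddiag \<Rightarrow> deco list set multiset" where
  "new_loops m d1 d2 =
     image_mset (\<lambda>i. cyc (concat (map (seg_word d1 d2) (closed_curve m d1 d2 i))))
       (mset_set {i \<in> {1..m}. closed_at m d1 d2 i \<and>
          (\<forall>s\<in>set (closed_curve m d1 d2 i). i \<le> node_index (snd s))})"

text \<open>A propagating edge of the product starts with a propagating edge of \<open>d1\<close>, ends with a
  propagating edge of \<open>d2\<close>, and in between runs along edges that are non-propagating in \<open>d1\<close> or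
  \<open>d2\<close>; the decorations of the latter are below those on propagating edges
  of \<open>d1\<close> and above those on propagating edges of \<open>d2\<close>.\<close>

definition dmul :: "nat \<Rightarrow> ddiag \<Rightarrow> ddiag \<Rightarrow> ddiag" where
  "dmul n d1 d2 = (let m = n + 2; f = prod_mate m d1 d2 in \<lparr>
     mate = f,
     word = (\<lambda>x. if x \<in> nodes m then concat (map (seg_word d1 d2) (curve m d1 d2 x)) else []),
     loops = loops d1 + loops d2 + new_loops m d1 d2,
     vert = (if a_val f = 1
             then vert d1
                  @ concat (map (\<lambda>x. concat (map (seg_word d1 d2) (butlast (tl (curve m d1 d2 x)))))
                                (prop_list m f))
                  @ vert d2
             else []) \<rparr>)"

definition diag_monoid :: "nat \<Rightarrow> ddiag monoid" where
  "diag_monoid n = \<lparr>carrier = {d. decorated_diagram n d}, mult = dmul n, one = id_diag n\<rparr>"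

definition diag_alg :: "nat \<Rightarrow> (ddiag \<Rightarrow>\<^sub>0 int poly) ring" where
  "diag_alg n = monoid_algebra (diag_monoid n)"

inductive deco_rule :: "deco list \<Rightarrow> int poly \<Rightarrow> deco list \<Rightarrow> bool" where
  "deco_rule [Bullet, Bullet] 1 [BTriangle]"
| "deco_rule [Bullet, BTriangle] 2 [Bullet]"
| "deco_rule [BTriangle, Bullet] 2 [Bullet]"
| "deco_rule [Circle, Circle] 1 [WTriangle]"
| "deco_rule [Circle, WTriangle] 2 [Circle]"
| "deco_rule [WTriangle, Circle] 2 [Circle]"

text \<open>\<open>diag_rel d c d'\<close>: the relation \<open>d = c d'\<close>. In \<open>block\<close> the words
  on propagating edges of \<open>d\<close> and \<open>d'\<close> are determined by \<open>vert d\<close> and \<open>vert d'\<close>.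
  In \<open>edge\<close> the edge cannot be propagating if \<open>a_val (mate d) = 1\<close>, because \<open>vert\<close> is kept.\<close>

inductive diag_rel :: "nat \<Rightarrow> ddiag \<Rightarrow> int poly \<Rightarrow> ddiag \<Rightarrow> bool" for n where
  edge: "decorated_diagram n d \<Longrightarrow> decorated_diagram n d' \<Longrightarrow> deco_rule r c r' \<Longrightarrow>
     x \<in> nodes (n + 2) \<Longrightarrow>
     word d x = p @ r @ q \<Longrightarrow> word d' x = p @ r' @ q \<Longrightarrow>
     (\<forall>y. y \<noteq> x \<and> y \<noteq> mate d x \<longrightarrow> word d' y = word d y) \<Longrightarrow>
     mate d' = mate d \<Longrightarrow> loops d' = loops d \<Longrightarrow> vert d' = vert d \<Longrightarrow>
     diag_rel n d c d'"
| block: "decorated_diagram n d \<Longrightarrow> decorated_diagram n d' \<Longrightarrow> deco_rule r c r' \<Longrightarrow>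
     vert d = p @ r @ q \<Longrightarrow> vert d' = p @ r' @ q \<Longrightarrow>
     (\<forall>x\<in>nodes (n + 2). x \<notin> set (prop_list (n + 2) (mate d)) \<and>
          mate d x \<notin> set (prop_list (n + 2) (mate d)) \<longrightarrow> word d' x = word d x) \<Longrightarrow>
     mate d' = mate d \<Longrightarrow> loops d' = loops d \<Longrightarrow>
     diag_rel n d c d'"
| loop: "decorated_diagram n d \<Longrightarrow> decorated_diagram n d' \<Longrightarrow> deco_rule r c r' \<Longrightarrow>
     loops d = L + {#cyc (r @ q)#} \<Longrightarrow> d' = d\<lparr>loops := L + {#cyc (r' @ q)#}\<rparr> \<Longrightarrow>
     diag_rel n d c d'"
| delta: "decorated_diagram n d \<Longrightarrow> decorated_diagram n d' \<Longrightarrow>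
     w \<in> {[], [BTriangle], [WTriangle]} \<Longrightarrow>
     loops d = L + {#cyc w#} \<Longrightarrow> d' = d\<lparr>loops := L\<rparr> \<Longrightarrow>
     diag_rel n d delta d'"

definition diag_ideal :: "nat \<Rightarrow> (ddiag \<Rightarrow>\<^sub>0 int poly) set" where
  "diag_ideal n = genideal (diag_alg n)
     {Poly_Mapping.single d 1 - Poly_Mapping.single d' c | d c d'. diag_rel n d c d'}"

definition diag_class :: "nat \<Rightarrow> ddiag \<Rightarrow> (ddiag \<Rightarrow>\<^sub>0 int poly) set" where
  "diag_class n d = diag_ideal n +>\<^bsub>diag_alg n\<^esub> Poly_Mapping.single d 1"

definition D_scalar :: "nat \<Rightarrow> int poly \<Rightarrow> (ddiag \<Rightarrow>\<^sub>0 int poly) set" where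
  "D_scalar n c = diag_ideal n +>\<^bsub>diag_alg n\<^esub> Poly_Mapping.single (id_diag n) c"

text \<open>The simple diagram with index \<open>i\<close>, with the word \<open>w\<close> on its two non-propagating edges.\<close>

definition simple_diag :: "nat \<Rightarrow> nat \<Rightarrow> deco list \<Rightarrow> ddiag" where
  "simple_diag n i w = (id_diag n)\<lparr>
     mate := (mate (id_diag n))
       (North i := North (i+1), North (i+1) := North i,
        South i := South (i+1), South (i+1) := South i),
     word := (\<lambda>_. [])
       (North i := w, North (i+1) := rev w, South i := w, South (i+1) := rev w)\<rparr>"

definition d_gen :: "nat \<Rightarrow> nat \<Rightarrow> ddiag" where
  "d_gen n i = simple_diag n i (if i = 1 then [Bullet] else if i = n + 1 then [Circle] else [])"

definition D_alg :: "nat \<Rightarrow> (ddiag \<Rightarrow>\<^sub>0 int poly) set ring" where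
  "D_alg n = (diag_alg n Quot diag_ideal n)
     \<lparr>carrier := subalgebra_gen (diag_alg n Quot diag_ideal n) (D_scalar n)
                  ((\<lambda>i. diag_class n (d_gen n i)) ` gens n)\<rparr>"

text \<open>The undecorated concrete diagram of a word, with all its loops.\<close>

definition concrete_diag :: "nat \<Rightarrow> nat list \<Rightarrow> ddiag" where
  "concrete_diag n u = foldr (\<lambda>i d. dmul n (simple_diag n i []) d) u (id_diag n)"


section \<open>Heaps, forks and snake paths\<close>

definition heap_less :: "nat \<Rightarrow> nat list \<Rightarrow> nat \<Rightarrow> nat \<Rightarrow> bool" where
  "heap_less n u = tranclp (\<lambda>i j. i < j \<and> j < length u \<and> cox_m n (u ! i) (u ! j) \<ge> 3)"

definition heap_cover :: "nat \<Rightarrow> nat list \<Rightarrow> nat \<Rightarrow> nat \<Rightarrow> bool" where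
  "heap_cover n u i j \<longleftrightarrow> heap_less n u i j \<and> \<not> (\<exists>k. heap_less n u i k \<and> heap_less n u k j)"

text \<open>A fork is given by its extreme nodes \<open>(t, b)\<close>, the top and the bottom one.\<close>

definition is_fork :: "nat \<Rightarrow> nat list \<Rightarrow> nat \<Rightarrow> nat \<Rightarrow> nat \<times> nat \<Rightarrow> bool" where
  "is_fork n u s s' f \<longleftrightarrow> (case f of (t, b) \<Rightarrow>
     \<exists>k. heap_less n u t k \<and> heap_less n u k b \<and>
         u ! t = s \<and> u ! k = s' \<and> u ! b = s \<and>
         (\<forall>x. heap_less n u t x \<and> heap_less n u x b \<longrightarrow> x = k))"

definition left_forks :: "nat \<Rightarrow> nat list \<Rightarrow> (nat \<times> nat) set" where
  "left_forks n u = {f. is_fork n u 1 2 f}"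

definition right_forks :: "nat \<Rightarrow> nat list \<Rightarrow> (nat \<times> nat) set" where
  "right_forks n u = {f. is_fork n u (n+1) n f}"

definition forks :: "nat \<Rightarrow> nat list \<Rightarrow> (nat \<times> nat) set" where
  "forks n u = left_forks n u \<union> right_forks n u"

datatype hdir = Leftward | Rightward
datatype vdir = Upward | Downward

fun hflip :: "hdir \<Rightarrow> hdir" where
  "hflip Leftward = Rightward"
| "hflip Rightward = Leftward"

fun vflip :: "vdir \<Rightarrow> vdir" where
  "vflip Upward = Downward"
| "vflip Downward = Upward"

text \<open>In an alternating heap a node has at most one edge in each of the four directions.\<close>

definition is_step :: "nat \<Rightarrow> nat list \<Rightarrow> hdir \<Rightarrow> vdir \<Rightarrow> nat \<Rightarrow> nat \<Rightarrow> bool" where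
  "is_step n u h v i j \<longleftrightarrow>
     (if v = Downward then heap_cover n u i j else heap_cover n u j i) \<and>
     (if h = Rightward then u ! j = u ! i + 1 else u ! i = u ! j + 1)"

definition step_to :: "nat \<Rightarrow> nat list \<Rightarrow> hdir \<Rightarrow> vdir \<Rightarrow> nat \<Rightarrow> nat option" where
  "step_to n u h v i =
     (if \<exists>j. is_step n u h v i j then Some (THE j. is_step n u h v i j) else None)"

definition just_above :: "nat \<Rightarrow> nat list \<Rightarrow> nat \<Rightarrow> nat \<Rightarrow> bool" where
  "just_above n u p q \<longleftrightarrow> u ! p = u ! q \<and> heap_less n u p q \<and>
     \<not> (\<exists>k. u ! k = u ! q \<and> heap_less n u p k \<and> heap_less n u k q)"

fun end_column :: "nat \<Rightarrow> hdir \<Rightarrow> nat" where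
  "end_column n Rightward = n + 1"
| "end_column n Leftward = 1"

text \<open>A state \<open>(i, h, v)\<close> of a path is the current node with the direction of the step that
  reached it. \<open>path_next\<close> yields the next state and the fork crossed in passing to it, if any.\<close>

type_synonym state = "nat \<times> hdir \<times> vdir"

fun path_next :: "nat \<Rightarrow> nat list \<Rightarrow> state \<Rightarrow> (state \<times> (nat \<times> nat) option) option" where
  "path_next n u (i, h, v) =
     (case step_to n u h (vflip v) i of
        Some j \<Rightarrow> Some ((j, h, vflip v), None)
      | None \<Rightarrow>
          (let beyond = (\<lambda>p. if v = Downward then just_above n u p i else just_above n u i p) in
           if u ! i = end_column n h \<and> (\<exists>p. beyond p)
           then (let p = (THE p. beyond p) in
                 case step_to n u (hflip h) v p of
                   Some j \<Rightarrow> Some ((j, hflip h, v), Some (if v = Downward then (p, i) else (i, p)))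
                 | None \<Rightarrow> None)
           else None))"

text \<open>\<open>path_ends n u s fs s'\<close>: the path from state \<open>s\<close> stops in state \<open>s'\<close>, after
  crossing the forks \<open>fs\<close> in this order.\<close>

inductive path_ends :: "nat \<Rightarrow> nat list \<Rightarrow> state \<Rightarrow> (nat \<times> nat) list \<Rightarrow> state \<Rightarrow> bool" for n u where
  stop: "path_next n u s = None \<Longrightarrow> path_ends n u s [] s"
| move: "path_next n u s = Some (t, None) \<Longrightarrow> path_ends n u t fs s' \<Longrightarrow> path_ends n u s fs s'"
| cross: "path_next n u s = Some (t, Some f) \<Longrightarrow> path_ends n u t fs s' \<Longrightarrow>
    path_ends n u s (f # fs) s'"

inductive_set path_crosses :: "nat \<Rightarrow> nat list \<Rightarrow> state \<Rightarrow> (nat \<times> nat) set" for n u s where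
  "(\<lambda>s t. \<exists>g. path_next n u s = Some (t, g))\<^sup>*\<^sup>* s t \<Longrightarrow>
   path_next n u t = Some (t', Some f) \<Longrightarrow> f \<in> path_crosses n u s"

definition start_dir :: "nat \<Rightarrow> nat list \<Rightarrow> nat \<times> nat \<Rightarrow> hdir" where
  "start_dir n u f = (if f \<in> left_forks n u then Rightward else Leftward)"

definition top_start :: "nat \<Rightarrow> nat list \<Rightarrow> nat \<times> nat \<Rightarrow> state" where
  "top_start n u f = (let h = start_dir n u f in (the (step_to n u h Downward (fst f)), h, Downward))"

definition bot_start :: "nat \<Rightarrow> nat list \<Rightarrow> nat \<times> nat \<Rightarrow> state" where
  "bot_start n u f = (let h = start_dir n u f in (the (step_to n u h Upward (snd f)), h, Upward))"

definition is_cycle :: "nat \<Rightarrow> nat list \<Rightarrow> nat \<times> nat \<Rightarrow> bool" where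
  "is_cycle n u f \<longleftrightarrow> \<not> (\<exists>fs s. path_ends n u (top_start n u f) fs s)"

definition crossed_by :: "nat \<Rightarrow> nat list \<Rightarrow> nat \<times> nat \<Rightarrow> (nat \<times> nat) set" where
  "crossed_by n u f =
     insert f (path_crosses n u (top_start n u f) \<union> path_crosses n u (bot_start n u f))"

definition top_path :: "nat \<Rightarrow> nat list \<Rightarrow> nat \<times> nat \<Rightarrow> (nat \<times> nat) list \<times> state" where
  "top_path n u f = (THE (fs, s). path_ends n u (top_start n u f) fs s)"

definition bot_path :: "nat \<Rightarrow> nat list \<Rightarrow> nat \<times> nat \<Rightarrow> (nat \<times> nat) list \<times> state" where
  "bot_path n u f = (THE (fs, s). path_ends n u (bot_start n u f) fs s)"

definition fork_seq :: "nat \<Rightarrow> nat list \<Rightarrow> nat \<times> nat \<Rightarrow> (nat \<times> nat) list" where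
  "fork_seq n u f = rev (fst (top_path n u f)) @ [f] @ fst (bot_path n u f)"

fun end_node :: "nat list \<Rightarrow> state \<Rightarrow> node" where
  "end_node u (i, Rightward, Downward) = North (u ! i + 1)"
| "end_node u (i, Leftward, Downward) = North (u ! i)"
| "end_node u (i, Rightward, Upward) = South (u ! i + 1)"
| "end_node u (i, Leftward, Upward) = South (u ! i)"

text \<open>A path (not a cycle) that crosses both left and right forks is oriented as obtained from a
  left fork.\<close>

definition oriented_start :: "nat \<Rightarrow> nat list \<Rightarrow> nat \<times> nat \<Rightarrow> nat \<times> nat" where
  "oriented_start n u f =
     (case filter (\<lambda>g. g \<in> left_forks n u) (fork_seq n u f) of
        [] \<Rightarrow> f
      | g # _ \<Rightarrow> if f \<in> left_forks n u then f else g)"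


section \<open>The decoration algorithm\<close>

definition fork_deco :: "nat \<Rightarrow> nat list \<Rightarrow> nat \<times> nat \<Rightarrow> deco" where
  "fork_deco n u f = (if f \<in> left_forks n u then BTriangle else WTriangle)"

definition add_word :: "node \<Rightarrow> node \<Rightarrow> deco list \<Rightarrow> ddiag \<Rightarrow> ddiag" where
  "add_word h k w d = d\<lparr>word := (word d)(h := word d h @ w, k := rev w @ word d k)\<rparr>"

definition decorate_path :: "nat \<Rightarrow> nat list \<Rightarrow> nat \<times> nat \<Rightarrow> ddiag \<Rightarrow> ddiag" where
  "decorate_path n u f d =
     (if is_cycle n u f
      then d\<lparr>loops := loops d - {#cyc []#} + {#cyc [BTriangle, WTriangle]#}\<rparr>
      else (let g = oriented_start n u f in
            add_word (end_node u (snd (top_path n u g))) (end_node u (snd (bot_path n u g)))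
              (map (fork_deco n u) (fork_seq n u g)) d))"

text \<open>The list argument gives the order in which forks are considered as starting forks; \<open>X\<close>
  is the set of the forks crossed so far.\<close>

primrec fork_phase ::
    "nat \<Rightarrow> nat list \<Rightarrow> (nat \<times> nat) list \<Rightarrow> (nat \<times> nat) set \<Rightarrow> ddiag \<Rightarrow> ddiag" where
  "fork_phase n u [] X d = d"
| "fork_phase n u (f # fs) X d =
     (if f \<in> X then fork_phase n u fs X d
      else fork_phase n u fs (X \<union> crossed_by n u f) (decorate_path n u f d))"

definition add_first :: "deco \<Rightarrow> node \<Rightarrow> ddiag \<Rightarrow> ddiag" where
  "add_first c x d = d\<lparr>word :=
     (word d)(x := c # word d x, mate d x := word d (mate d x) @ [c])\<rparr>"

text \<open>The exception in the final step is for an edge from \<open>North i\<close> to \<open>South i\<close> that is still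
  undecorated, that is, a vertical strand not touched by any node of the heap in the extreme
  column. The diagram can also contain an edge from \<open>North i\<close> to \<open>South i\<close> that has got triangles
  from forks, and such an edge receives both end decorations: for \<open>n = 3\<close> and the word
  \<open>[1, 3, 2, 1, 4, 3]\<close>, the edge from \<open>North 5\<close> to \<open>South 5\<close> carries
  \<open>[Circle, BTriangle, Circle]\<close> in the product of the generators.\<close>

definition end_decorations :: "deco \<Rightarrow> nat \<Rightarrow> ddiag \<Rightarrow> ddiag" where
  "end_decorations c i d =
     (if mate d (North i) = South i \<and> word d (North i) = [] then d
      else add_first c (South i) (add_first c (North i) d))"

text \<open>Relative vertical positions, relevant if \<open>a_val (mate d) = 1\<close> only: black decorations come
  from nodes of the heap in the first column, white ones from nodes in the last
  column, and they are placed at the corresponding heights.\<close>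

definition set_heights :: "nat \<Rightarrow> nat list \<Rightarrow> ddiag \<Rightarrow> ddiag" where
  "set_heights n u d = d\<lparr>vert :=
     (if a_val (mate d) = 1
      then (let ws = concat (map (word d) (prop_list (n + 2) (mate d)));
                bs = filter black ws; cs = filter (\<lambda>c. \<not> black c) ws in
            if \<exists>i j. u ! i = 1 \<and> u ! j = n + 1 \<and> heap_less n u i j then bs @ cs else cs @ bs)
      else [])\<rparr>"

definition dec_A :: "nat \<Rightarrow> nat list \<Rightarrow> (nat \<times> nat) list \<Rightarrow> ddiag" where
  "dec_A n u fs =
     set_heights n u
       (end_decorations Circle (n + 2)
         (end_decorations Bullet 1
           (fork_phase n u fs {} (concrete_diag n u))))"

end

theory Submission
  imports Defs
begin

text \<open>The edges of a product of generators are strands that travel through the layers of the word and turn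
  at its letters. In an alternating heap a snake path follows such a strand, from one turn to the next. A strand that
  crosses a fork turns at both extreme nodes of the fork, where it picks up two equal decorations that contract to
  a triangle; single bullets and circles remain only at the ends of the edges. Each step of a
  snake path shifts the position in the column by an amount depending on column and directions only, so a cycle
  closes after one lap, crossing one left and one right fork, and its loop contracts to one with a black and a white
  triangle. Relative heights of black and white decorations matter only if \<open>a_val = 1\<close> and both end
  generators occur; then the word is \<open>[1, ..., n + 1]\<close> or its reverse, and there are no forks at all.\<close>

section \<open>Classes of words and diagrams\<close>

text \<open>Both sides are classes in a quotient, and the product of the generators is carried to
  the result of the algorithm using only the relations of coefficient 1, which turn two equal
  bullets or circles into a triangle; neither \<delta> nor the factor 2 ever appears. The obstacle
  is that such a relation is available only between decorated diagrams. For the product itself this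
  comes from the ring axioms, but after each contraction deformability has to be proved again:
  dropping one of two neighbouring wall points replaces two sides of a triangle of chords by the
  third, which creates no crossing. Edges can be traversed in both directions, while the algorithm
  fixes an orientation; strands are therefore orbits of a partial map with a reversing involution,
  and forks are compared through the undirected strand they lie on. Loops are not reached from the
  box at all. They are counted by induction on the word, each by the unique letter 1 at the foot of
  its left fork.\<close>

lemma genideal_cases:
  "genideal R S = UNIV \<or> ring R \<and> ideal (genideal R S) R \<and> S \<subseteq> genideal R S"
proof (cases "\<exists>I. ideal I R \<and> S \<subseteq> I")
  case True
  then obtain I where I: "ideal I R" "S \<subseteq> I" by blast
  then interpret I: ideal I R by simp
  have "S \<subseteq> carrier R" using I(2) I.a_subset by blast
  then show ?thesis
    using I.genideal_ideal I.genideal_self I.ring_axioms by blast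
next
  case False
  \<comment> \<open>\<open>genideal\<close> is an intersection of ideals; over the empty family it
    is \<open>UNIV\<close>.\<close>
  then have "{I. ideal I R \<and> S \<subseteq> I} = {}" by blast
  then have "genideal R S = UNIV" unfolding genideal_def by (simp only: Inter_empty)
  then show ?thesis ..
qed

lemma single_carrier_iff:
  "Poly_Mapping.single x (1 :: 'r::comm_ring_1) \<in> carrier (monoid_algebra M) \<longleftrightarrow> x \<in> carrier M"
  by (auto simp: monoid_algebra_def)

lemma single_mult:
  "Poly_Mapping.single x (1 :: 'r::comm_ring_1) \<otimes>\<^bsub>monoid_algebra M\<^esub> Poly_Mapping.single y 1 =
     Poly_Mapping.single (x \<otimes>\<^bsub>M\<^esub> y) 1"
  by (simp add: monoid_algebra_def)

lemma coset_monoid_algebra: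
  "I +>\<^bsub>monoid_algebra M\<^esub> x = {h + x | h. h \<in> I}"
  by (auto simp: a_r_coset_def r_coset_def monoid_algebra_def)

lemma coset_UNIV: "(UNIV :: ('m \<Rightarrow>\<^sub>0 'r::comm_ring_1) set) +>\<^bsub>monoid_algebra M\<^esub> x = UNIV"
proof -
  have "y = (y - x) + x" for y :: "'m \<Rightarrow>\<^sub>0 'r" by simp
  then show ?thesis unfolding coset_monoid_algebra by blast
qed

lemma coset_eqI:
  fixes x y :: "'m \<Rightarrow>\<^sub>0 'r::comm_ring_1"
  assumes "ideal I (monoid_algebra M)" "x \<in> carrier (monoid_algebra M)" "y - x \<in> I"
  shows "I +>\<^bsub>monoid_algebra M\<^esub> y = I +>\<^bsub>monoid_algebra M\<^esub> x"
proof -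
  interpret I: ideal I "monoid_algebra M" by fact
  have "y = (y - x) + x" by simp
  then have "y \<in> I +>\<^bsub>monoid_algebra M\<^esub> x"
    unfolding coset_monoid_algebra using assms(3) by blast
  then show ?thesis
    using I.a_repr_independence[of y I x] assms(2) I.a_subgroup by simp
qed

text \<open>The disjunction covers the degenerate quotient too, in which every coset and every
  product of cosets is \<open>UNIV\<close>.\<close>

lemma quot_mult_single:
  assumes "I = UNIV \<or> ideal I (monoid_algebra M) \<and> x \<in> carrier M \<and> y \<in> carrier M"
  shows "(I +>\<^bsub>monoid_algebra M\<^esub> Poly_Mapping.single x (1 :: 'r::comm_ring_1))
           \<otimes>\<^bsub>monoid_algebra M Quot I\<^esub> (I +>\<^bsub>monoid_algebra M\<^esub> Poly_Mapping.single y 1)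
         = I +>\<^bsub>monoid_algebra M\<^esub> Poly_Mapping.single (x \<otimes>\<^bsub>M\<^esub> y) 1"
  using assms
proof
  assume "I = UNIV"
  then show ?thesis by (simp add: FactRing_def rcoset_mult_def coset_UNIV)
next
  assume A: "ideal I (monoid_algebra M) \<and> x \<in> carrier M \<and> y \<in> carrier M"
  then show ?thesis
    by (simp add: FactRing_def ideal.rcoset_mult_add single_carrier_iff single_mult)
qed

lemma b_word_eq_coset:
  assumes "set u \<subseteq> gens n"
  shows "b_word n u = TL_ideal n +>\<^bsub>free_alg n\<^esub> Poly_Mapping.single u 1"
  using assms
proof (induction u)
  case Nil
  show ?case
    by (simp add: b_word_def TL_def FactRing_def free_alg_def monoid_algebra_def word_monoid_def)
next
  case (Cons i u)
  have i: "i \<in> gens n" and u: "set u \<subseteq> gens n"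
    using Cons.prems by simp_all
  have I: "TL_ideal n = UNIV \<or> ideal (TL_ideal n) (free_alg n)"
    unfolding TL_ideal_def using genideal_cases[of "free_alg n" "TL_rels n"] by blast
  have "b_word n (i # u) = b_gen n i \<otimes>\<^bsub>TL n\<^esub> b_word n u" by (simp add: b_word_def)
  also have "\<dots> = TL_ideal n +>\<^bsub>free_alg n\<^esub> Poly_Mapping.single ([i] \<otimes>\<^bsub>word_monoid n\<^esub> u) 1"
    unfolding b_gen_def TL_def Cons.IH[OF u] free_alg_def
    using I Cons.prems by (intro quot_mult_single) (auto simp: word_monoid_def free_alg_def)
  finally show ?case by (simp add: word_monoid_def)
qed

lemma coset_single_in_TL:
  assumes "set u \<subseteq> gens n"
  shows "TL_ideal n +>\<^bsub>free_alg n\<^esub> Poly_Mapping.single u 1 \<in> carrier (TL n)"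
proof -
  have "Poly_Mapping.single u 1 \<in> carrier (free_alg n)"
    unfolding free_alg_def single_carrier_iff using assms by (auto simp: word_monoid_def)
  then show ?thesis
    by (auto simp: TL_def FactRing_def A_RCOSETS_def' a_r_coset_def r_coset_def)
qed

text \<open>The decorations \<open>c\<close> are a parameter, so that the product of the generators
  (\<open>gen_deco\<close>) and the undecorated concrete diagram (empty words) are treated by the
  same lemmas.\<close>

definition word_diag :: "nat \<Rightarrow> (nat \<Rightarrow> deco list) \<Rightarrow> nat list \<Rightarrow> ddiag" where
  "word_diag n c u = foldr (\<lambda>i d. dmul n (simple_diag n i (c i)) d) u (id_diag n)"

definition gen_deco :: "nat \<Rightarrow> nat \<Rightarrow> deco list" where
  "gen_deco n i = (if i = 1 then [Bullet] else if i = n + 1 then [Circle] else [])"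

lemma d_gen_eq: "d_gen n i = simple_diag n i (gen_deco n i)"
  by (simp add: d_gen_def gen_deco_def)

lemma word_diag_simps [simp]:
  "word_diag n c [] = id_diag n"
  "word_diag n c (i # u) = dmul n (simple_diag n i (c i)) (word_diag n c u)"
  by (simp_all add: word_diag_def)

lemma concrete_diag_eq: "concrete_diag n u = word_diag n (\<lambda>_. []) u"
  by (simp add: concrete_diag_def word_diag_def)

text \<open>The classes live in a quotient by an ideal only if the diagrams form a ring, i.e. if
  products of decorated diagrams are decorated diagrams and multiplication is associative. We
  need not check this: otherwise there is no ideal at all, the generated ideal is \<open>UNIV\<close>,
  and all classes coincide.\<close>

lemma diag_ideal_cases:
  "diag_ideal n = UNIV \<or> ring (diag_alg n) \<and> ideal (diag_ideal n) (diag_alg n) \<and>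
     (\<forall>d c d'. diag_rel n d c d' \<longrightarrow>
        Poly_Mapping.single d 1 - Poly_Mapping.single d' c \<in> diag_ideal n)"
  using genideal_cases[of "diag_alg n" "{Poly_Mapping.single d 1 - Poly_Mapping.single d' c | d c d'. diag_rel n d c d'}"]
  unfolding diag_ideal_def[symmetric] by blast

lemma diag_class_UNIV: "diag_ideal n = UNIV \<Longrightarrow> diag_class n d = UNIV"
  by (simp add: diag_class_def diag_alg_def coset_UNIV)

lemma decorated_id_diag: "ring (diag_alg n) \<Longrightarrow> decorated_diagram n (id_diag n)"
proof -
  assume "ring (diag_alg n)"
  then have "\<one>\<^bsub>diag_alg n\<^esub> \<in> carrier (diag_alg n)" by (simp add: ring.ring_simprules)
  moreover have "\<one>\<^bsub>diag_alg n\<^esub> = Poly_Mapping.single (id_diag n) 1"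
    by (simp add: diag_alg_def monoid_algebra_def diag_monoid_def)
  ultimately show ?thesis
    using single_carrier_iff[of "id_diag n" "diag_monoid n", where 'r = "int poly"]
    by (simp add: diag_alg_def diag_monoid_def)
qed

text \<open>In a ring the carrier is closed under products, in particular of basis elements; so
  closure of the decorated diagrams under gluing is read off from the ring axioms.\<close>

lemma decorated_dmul:
  assumes "ring (diag_alg n)" "decorated_diagram n d" "decorated_diagram n d'"
  shows "decorated_diagram n (dmul n d d')"
proof -
  have c: "Poly_Mapping.single e 1 \<in> carrier (diag_alg n) \<longleftrightarrow> decorated_diagram n e" for e
    using single_carrier_iff[of e "diag_monoid n", where 'r = "int poly"]
    by (simp add: diag_alg_def diag_monoid_def)
  have "Poly_Mapping.single d 1 \<otimes>\<^bsub>diag_alg n\<^esub> Poly_Mapping.single d' 1 \<in> carrier (diag_alg n)"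
    by (rule ring.ring_simprules(5)) (use assms c in auto)
  then show ?thesis
    unfolding diag_alg_def single_mult
    using c[of "dmul n d d'"] by (simp add: diag_alg_def diag_monoid_def)
qed

lemma diag_class_eqI:
  assumes "ring (diag_alg n)" "ideal (diag_ideal n) (diag_alg n)"
    "\<And>d c d'. diag_rel n d c d' \<Longrightarrow>
        Poly_Mapping.single d 1 - Poly_Mapping.single d' c \<in> diag_ideal n"
    "diag_rel n d 1 d'"
  shows "diag_class n d = diag_class n d'"
proof -
  have "decorated_diagram n d'" using assms(4) by (cases rule: diag_rel.cases) auto
  then have "Poly_Mapping.single d' 1 \<in> carrier (diag_alg n)"
    unfolding diag_alg_def by (subst single_carrier_iff) (simp add: diag_monoid_def)
  then show ?thesis
    unfolding diag_class_def using assms(2) assms(3)[OF assms(4)]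
    unfolding diag_alg_def by (intro coset_eqI)
qed

text \<open>A homomorphism sends the product of the generators to the product of their images, and
  cosets of carrier elements multiply like their representatives. For the latter the representatives
  must be decorated diagrams, hence the second conjunct in the induction.\<close>

lemma theta_b_word:
  assumes \<theta>: "\<theta> \<in> algebra_hom (TL n) (TL_scalar n) (D_alg n) (D_scalar n)"
    and gen: "\<And>i. i \<in> gens n \<Longrightarrow> \<theta> (b_gen n i) = diag_class n (d_gen n i)"
    and dec: "\<And>i. i \<in> gens n \<Longrightarrow> decorated_diagram n (d_gen n i)"
    and u: "set u \<subseteq> gens n"
  shows "\<theta> (b_word n u) = diag_class n (word_diag n (gen_deco n) u)
    \<and> (ring (diag_alg n) \<longrightarrow> decorated_diagram n (word_diag n (gen_deco n) u))"
  using u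
proof (induction u)
  case Nil
  have "\<theta> \<one>\<^bsub>TL n\<^esub> = \<one>\<^bsub>D_alg n\<^esub>"
    using \<theta> by (simp add: algebra_hom_def ring_hom_def)
  then show ?case
    by (simp add: b_word_def D_alg_def FactRing_def diag_class_def diag_alg_def monoid_algebra_def
        diag_monoid_def decorated_id_diag[unfolded diag_alg_def monoid_algebra_def diag_monoid_def])
next
  case (Cons i u)
  let ?P = "word_diag n (gen_deco n) u"
  have i: "i \<in> gens n" and u: "set u \<subseteq> gens n"
    using Cons.prems by simp_all
  have c: "b_gen n i \<in> carrier (TL n)" "b_word n u \<in> carrier (TL n)"
    using coset_single_in_TL[of "[i]" n] coset_single_in_TL[of u n] i u
    by (simp_all add: b_gen_def b_word_eq_coset)
  have "\<theta> (b_word n (i # u)) = \<theta> (b_gen n i \<otimes>\<^bsub>TL n\<^esub> b_word n u)" by (simp add: b_word_def)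
  also have "\<dots> = \<theta> (b_gen n i) \<otimes>\<^bsub>D_alg n\<^esub> \<theta> (b_word n u)"
    using \<theta> c by (simp add: algebra_hom_def ring_hom_def)
  also have "\<dots> = diag_class n (d_gen n i) \<otimes>\<^bsub>diag_alg n Quot diag_ideal n\<^esub> diag_class n ?P"
    using Cons.IH u gen[OF i] by (simp add: D_alg_def)
  also have "\<dots> = diag_class n (d_gen n i \<otimes>\<^bsub>diag_monoid n\<^esub> ?P)"
    using diag_ideal_cases[of n] Cons.IH u dec[OF i]
    unfolding diag_class_def diag_alg_def
    by (intro quot_mult_single) (auto simp: diag_monoid_def)
  finally show ?case
    using Cons.IH u dec[OF i] decorated_dmul by (auto simp: d_gen_eq diag_monoid_def)
qed

section \<open>Orbits of partial maps\<close>

primrec walk :: "('a \<Rightarrow> 'a option) \<Rightarrow> 'a \<Rightarrow> 'a list \<Rightarrow> 'a \<Rightarrow> bool" where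
  "walk f s [] t \<longleftrightarrow> s = t"
| "walk f s (x # xs) t \<longleftrightarrow> x = s \<and> (\<exists>s'. f s = Some s' \<and> walk f s' xs t)"

definition terminating :: "('a \<Rightarrow> 'a option) \<Rightarrow> 'a \<Rightarrow> bool" where
  "terminating f s \<longleftrightarrow> (\<exists>xs e. walk f s xs e \<and> f e = None)"

text \<open>The list of a walk contains its start but not its end, so walks concatenate without
  overlap, and so do outputs attached to the states that are left.\<close>

lemma walk_append: "walk f s (xs @ ys) t \<longleftrightarrow> (\<exists>r. walk f s xs r \<and> walk f r ys t)"
  by (induction xs arbitrary: s) auto

lemma walk_snoc: "walk f s (xs @ [x]) t \<longleftrightarrow> walk f s xs x \<and> f x = Some t"
  by (auto simp: walk_append)

lemma walk_trans: "walk f s xs t \<Longrightarrow> walk f t ys r \<Longrightarrow> walk f s (xs @ ys) r"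
  by (auto simp: walk_append)

text \<open>Determinism: two walks from one state agree as long as both last.\<close>

lemma walk_compare:
  assumes "walk f s xs t" "walk f s ys r"
  shows "(\<exists>zs. ys = xs @ zs \<and> walk f t zs r) \<or> (\<exists>zs. xs = ys @ zs \<and> walk f r zs t)"
  using assms
proof (induction xs arbitrary: s ys)
  case (Cons x xs)
  show ?case
  proof (cases ys)
    case Nil
    then show ?thesis using Cons.prems by auto
  next
    case (Cons y ys')
    with Cons.prems obtain s' where "f s = Some s'" "walk f s' xs t" "walk f s' ys' r" "x = y"
      by auto
    with Cons.IH[of s' ys'] Cons show ?thesis by auto
  qed
qed auto

lemma walk_end_unique:
  assumes "walk f s xs t" "walk f s ys r" "f t = None" "f r = None"
  shows "ys = xs \<and> r = t"
proof -
  have "zs = [] \<and> a = b" if "walk f a zs b" "f a = None" for zs a b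
    using that by (cases zs) auto
  then show ?thesis using walk_compare[OF assms(1,2)] assms(3,4) by fastforce
qed

lemma walk_to_end:
  assumes "walk f s xs t" "walk f s ys e" "f e = None"
  shows "\<exists>zs. ys = xs @ zs \<and> walk f t zs e"
proof -
  have "zs = [] \<and> e = b" if "walk f e zs b" for zs b
    using that assms(3) by (cases zs) auto
  then show ?thesis using walk_compare[OF assms(1,2)] by fastforce
qed

lemma walk_terminating_iff:
  assumes "walk f s xs t" shows "terminating f s \<longleftrightarrow> terminating f t"
proof
  assume "terminating f s"
  then show "terminating f t"
    using walk_to_end[OF assms] unfolding terminating_def by blast
next
  assume "terminating f t"
  then show "terminating f s"
    using walk_trans[OF assms] unfolding terminating_def by blast
qed

lemma walk_in_closed:
  assumes "walk f s xs t" "s \<in> D" "\<forall>a b. a \<in> D \<longrightarrow> f a = Some b \<longrightarrow> b \<in> D"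
  shows "t \<in> D" "set xs \<subseteq> D"
proof -
  have "t \<in> D \<and> set xs \<subseteq> D"
    using assms(1,2)
  proof (induction xs arbitrary: s)
    case (Cons x xs)
    then obtain s' where "x = s" "f s = Some s'" "walk f s' xs t" by auto
    moreover have "s' \<in> D" using calculation(2) Cons.prems(2) assms(3) by blast
    ultimately show ?case using Cons.IH[of s'] Cons.prems(2) by simp
  qed simp
  then show "t \<in> D" "set xs \<subseteq> D" by auto
qed

lemma walk_predecessor:
  assumes "walk f s xs t" "y \<in> set (xs @ [t])"
  shows "y = s \<or> (\<exists>z\<in>set xs. f z = Some y)"
  using assms
proof (induction xs arbitrary: s)
  case (Cons x xs)
  then obtain s' where *: "x = s" "f s = Some s'" "walk f s' xs t" by auto
  have "y = s \<or> y \<in> set (xs @ [t])" using Cons.prems *(1) by auto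
  then show ?case using Cons.IH[OF *(3)] * by auto
qed auto

lemma walk_split:
  assumes "walk f s xs t" "y \<in> set xs"
  shows "\<exists>as bs. xs = as @ bs \<and> bs \<noteq> [] \<and> walk f s as y \<and> walk f y bs t"
proof -
  obtain as bs where xs: "xs = as @ y # bs" using assms(2) split_list by metis
  with assms(1) obtain r where "walk f s as r" "walk f r (y # bs) t"
    by (auto simp only: walk_append)
  moreover from this have "r = y" by auto
  ultimately show ?thesis using xs by blast
qed

text \<open>A first repeated state would have two predecessors, or it would be the start, which has
  none.\<close>

lemma walk_distinct:
  assumes inj: "\<forall>a b c. f a = Some c \<longrightarrow> f b = Some c \<longrightarrow> a = b"
    and no_pred: "\<forall>a. f a \<noteq> Some s"
    and "walk f s xs t"
  shows "distinct (xs @ [t])"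
  using assms(3)
proof (induction xs arbitrary: t rule: rev_induct)
  case (snoc x xs)
  then have w: "walk f s xs x" "f x = Some t" by (simp_all add: walk_snoc)
  have d: "distinct (xs @ [x])" using snoc.IH[OF w(1)] .
  have "t \<notin> set (xs @ [x])"
  proof
    assume "t \<in> set (xs @ [x])"
    then consider "t = s" | z where "z \<in> set xs" "f z = Some t"
      using walk_predecessor[OF w(1)] by blast
    then show False
    proof cases
      case 2
      then have "z = x" using inj w(2) by blast
      then show False using 2(1) d by simp
    qed (use no_pred w(2) in blast)
  qed
  then show ?case using d by auto
qed simp

text \<open>By injectivity a walk from a state without predecessor never repeats a state. All states
  after the first lie in \<open>S\<close>, so \<open>card S\<close> bounds the number of steps; the
  fuel in the gluing of diagrams is compared with this bound.\<close>

lemma walk_terminates: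
  assumes inj: "\<forall>a b c. f a = Some c \<longrightarrow> f b = Some c \<longrightarrow> a = b"
    and no_pred: "\<forall>a. f a \<noteq> Some s"
    and "s \<in> D" "\<forall>a b. a \<in> D \<longrightarrow> f a = Some b \<longrightarrow> b \<in> D \<and> b \<in> S" "finite S"
  shows "\<exists>xs e. walk f s xs e \<and> f e = None \<and> length xs \<le> card S"
proof (rule ccontr)
  assume no: "\<not> ?thesis"
  have len: "length xs \<le> card S" if w: "walk f s xs t" for xs t
  proof (cases xs)
    case (Cons x ys)
    have "set (ys @ [t]) \<subseteq> S"
    proof
      fix y assume y: "y \<in> set (ys @ [t])"
      then have "y \<noteq> s" using walk_distinct[OF inj no_pred w] Cons w by auto
      then obtain z where "z \<in> set xs" "f z = Some y"
        using walk_predecessor[OF w, of y] y Cons by auto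
      moreover have "set xs \<subseteq> D" using walk_in_closed(2)[OF w assms(3)] assms(4) by blast
      ultimately show "y \<in> S" using assms(4) by blast
    qed
    moreover have "distinct (ys @ [t])" using walk_distinct[OF inj no_pred w] Cons by simp
    ultimately have "length (ys @ [t]) \<le> card S"
      using card_mono[OF assms(5)] distinct_card by metis
    then show ?thesis using Cons by simp
  qed simp
  have "\<exists>xs t. walk f s xs t \<and> length xs = k" for k
  proof (induction k)
    case (Suc k)
    then obtain xs t where xs: "walk f s xs t" "length xs = k" by blast
    then obtain t' where "f t = Some t'" using no len by fastforce
    then have "walk f s (xs @ [t]) t'" using xs by (simp add: walk_snoc)
    then show ?case using xs(2) by (metis length_append_singleton)
  qed auto
  then obtain xs t where "walk f s xs t" "length xs = Suc (card S)" by blast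
  then show False using len by fastforce
qed

text \<open>The states are oriented positions on curves; \<open>r\<close> turns the orientation
  round and conjugates \<open>f\<close> into its inverse. Finiteness of \<open>D\<close> makes every
  orbit in it stop or close up.\<close>

locale reversible =
  fixes f :: "'a \<Rightarrow> 'a option" and r :: "'a \<Rightarrow> 'a" and D :: "'a set"
  assumes r_r: "r (r s) = s"
    and f_r: "f s = Some t \<Longrightarrow> f (r t) = Some (r s)"
    and finite_D: "finite D"
    and f_D: "s \<in> D \<Longrightarrow> f s = Some t \<Longrightarrow> t \<in> D"
    and r_D: "s \<in> D \<Longrightarrow> r s \<in> D"
begin

lemma f_inj: "f a = Some c \<Longrightarrow> f b = Some c \<Longrightarrow> a = b"
  using f_r r_r by (metis option.inject)

lemma no_pred: "f e = None \<Longrightarrow> f a \<noteq> Some (r e)"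
  using f_r[of a "r e"] r_r by auto

text \<open>Reversal sends the step from \<open>a\<close> to \<open>b\<close> to the step from
  \<open>r b\<close> to \<open>r a\<close>, so outputs attached to steps come out backwards.\<close>

lemma walk_rev:
  assumes "walk f s xs t"
  shows "\<exists>ys. walk f (r t) ys (r s) \<and>
     (\<forall>out :: 'a \<Rightarrow> 'b list. (\<forall>a b. f a = Some b \<longrightarrow> out (r b) = rev (out a)) \<longrightarrow>
        concat (map out ys) = rev (concat (map out xs)))"
  using assms
proof (induction xs arbitrary: s)
  case (Cons x xs)
  then obtain s' where s': "x = s" "f s = Some s'" "walk f s' xs t" by auto
  from Cons.IH[OF s'(3)] obtain ys where ys: "walk f (r t) ys (r s')"
    "\<And>out :: 'a \<Rightarrow> 'b list. (\<forall>a b. f a = Some b \<longrightarrow> out (r b) = rev (out a)) \<Longrightarrow>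
        concat (map out ys) = rev (concat (map out xs))" by blast
  have "walk f (r t) (ys @ [r s']) (r s)"
    using ys(1) f_r[OF s'(2)] by (simp add: walk_snoc)
  moreover have "concat (map out (ys @ [r s'])) = rev (concat (map out (x # xs)))"
    if "\<forall>a b. f a = Some b \<longrightarrow> out (r b) = rev (out a)" for out :: "'a \<Rightarrow> 'b list"
    using ys(2)[OF that] that s' by simp
  ultimately show ?case by blast
qed (auto intro: exI[of _ "[]"])

lemma walk_rev':
  assumes "walk f s xs t" shows "\<exists>ys. walk f (r t) ys (r s) \<and> length ys = length xs"
proof -
  \<comment> \<open>The output \<open>[()]\<close> at every step turns the statement about words
    into one about lengths.\<close>
  obtain ys where ys: "walk f (r t) ys (r s)"
    "concat (map (\<lambda>_. [()]) ys) = rev (concat (map (\<lambda>_. [()]) xs))"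
    using walk_rev[OF assms, where 'b = unit] by (elim exE conjE allE[of _ "\<lambda>_. [()]"]) simp
  moreover have "length (concat (map (\<lambda>_. [()]) zs)) = length zs" for zs :: "'a list"
    by (induction zs) auto
  ultimately show ?thesis by (metis length_rev)
qed

lemma walk_back_compare:
  assumes "walk f s xs t" "walk f s' ys t"
  shows "(\<exists>zs. walk f s zs s') \<or> (\<exists>zs. walk f s' zs s)"
proof -
  obtain xs' ys' where "walk f (r t) xs' (r s)" "walk f (r t) ys' (r s')"
    using walk_rev'[OF assms(1)] walk_rev'[OF assms(2)] by blast
  from walk_compare[OF this] show ?thesis using walk_rev' r_r by metis
qed

lemma terminating_from_start:
  assumes "s \<in> D" "\<And>a. f a \<noteq> Some s" shows "terminating f s"
proof -
  have "\<exists>xs e. walk f s xs e \<and> f e = None \<and> length xs \<le> card D"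
    by (rule walk_terminates[where D = D]) (use assms f_inj f_D finite_D in blast)+
  then show ?thesis unfolding terminating_def by blast
qed

text \<open>The final state turned round has no predecessor, so its orbit stops; and this orbit runs
  back along the walk, through \<open>r s\<close>.\<close>

lemma terminating_r:
  assumes "terminating f s" "s \<in> D" shows "terminating f (r s)"
proof -
  obtain xs e where e: "walk f s xs e" "f e = None" using assms(1) by (auto simp: terminating_def)
  have "e \<in> D" using walk_in_closed(1)[OF e(1) assms(2)] f_D by blast
  then have "terminating f (r e)"
    using terminating_from_start[of "r e"] r_D no_pred[OF e(2)] by blast
  moreover obtain ys where "walk f (r e) ys (r s)" using walk_rev'[OF e(1)] by blast
  ultimately show ?thesis using walk_terminating_iff by metis
qed

definition same_strand :: "'a \<Rightarrow> 'a \<Rightarrow> bool" where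
  "same_strand = equivclp (\<lambda>s t. f s = Some t \<or> t = r s)"

lemma same_strand_refl [simp]: "same_strand s s"
  by (simp add: same_strand_def)

lemma same_strand_sym: "same_strand s t \<Longrightarrow> same_strand t s"
  by (simp add: same_strand_def equivclp_sym)

lemma same_strand_trans: "same_strand s t \<Longrightarrow> same_strand t u \<Longrightarrow> same_strand s u"
  unfolding same_strand_def by (rule equivclp_trans)

lemma same_strand_step: "f s = Some t \<Longrightarrow> same_strand s t"
  by (simp add: same_strand_def r_into_equivclp)

lemma same_strand_r: "same_strand s (r s)"
  by (simp add: same_strand_def r_into_equivclp)

lemma same_strand_walk: "walk f s xs t \<Longrightarrow> same_strand s t"
  by (induction xs arbitrary: s) (auto intro: same_strand_trans same_strand_step)

lemma same_strand_walk_mem: "walk f s xs t \<Longrightarrow> y \<in> set xs \<Longrightarrow> same_strand s y"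
  using walk_split same_strand_walk by metis

definition comparable :: "'a \<Rightarrow> 'a \<Rightarrow> bool" where
  "comparable s t \<longleftrightarrow> (\<exists>xs. walk f s xs t) \<or> (\<exists>xs. walk f t xs s)"

lemma comparable_step: "comparable s t \<Longrightarrow> f t = Some t' \<Longrightarrow> comparable s t'"
  unfolding comparable_def
proof (elim disjE exE)
  fix xs assume "walk f s xs t" "f t = Some t'"
  then have "walk f s (xs @ [t]) t'" by (simp add: walk_snoc)
  then show "(\<exists>xs. walk f s xs t') \<or> (\<exists>xs. walk f t' xs s)" by blast
next
  fix xs assume *: "walk f t xs s" "f t = Some t'"
  show "(\<exists>xs. walk f s xs t') \<or> (\<exists>xs. walk f t' xs s)"
  proof (cases xs)
    case Nil
    then have "walk f s [s] t'" using * by simp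
    then show ?thesis by blast
  qed (use * in auto)
qed

lemma comparable_unstep:
  assumes "comparable s t'" "f t = Some t'" shows "comparable s t"
proof -
  have t: "walk f t [t] t'" using assms(2) by simp
  from assms(1) show ?thesis
    unfolding comparable_def
  proof (elim disjE exE)
    fix xs assume "walk f s xs t'"
    from walk_back_compare[OF this t] show "(\<exists>xs. walk f s xs t) \<or> (\<exists>xs. walk f t xs s)" .
  next
    fix xs assume "walk f t' xs s"
    from walk_trans[OF t this] show "(\<exists>xs. walk f s xs t) \<or> (\<exists>xs. walk f t xs s)" by blast
  qed
qed

text \<open>A zigzag of steps, inverse steps and reversals collapses to one directed walk, since
  comparability survives a step in either direction and reversal exchanges the two.\<close>

lemma same_strand_comparable: "same_strand s t \<Longrightarrow> comparable s t \<or> comparable s (r t)"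
  unfolding same_strand_def
proof (induction rule: equivclp_induct)
  case base
  have "walk f s [] s" by simp
  then show ?case unfolding comparable_def by blast
next
  case (step y z)
  from step(2) consider "f y = Some z" | "f z = Some y" | "z = r y" | "y = r z" by blast
  then show ?case
    using step(3) comparable_step comparable_unstep f_r r_r by cases metis+
qed

lemma same_strand_terminating:
  assumes "same_strand s t" "s \<in> D" "t \<in> D" shows "terminating f s \<longleftrightarrow> terminating f t"
proof -
  have c: "terminating f s \<longleftrightarrow> terminating f a" if "comparable s a" for a
    using that walk_terminating_iff unfolding comparable_def by metis
  have "terminating f t \<longleftrightarrow> terminating f (r t)"
    using terminating_r[of t] terminating_r[of "r t"] r_D assms(3) r_r by auto
  then show ?thesis using same_strand_comparable[OF assms(1)] c by blast
qed

text \<open>Whole laps are stripped off until the remaining walk is part of a single lap.\<close>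

lemma walk_from_closed:
  assumes "walk f s xs s" "xs \<noteq> []" "walk f s zs a"
  shows "a \<in> set xs"
  using assms(3)
proof (induction "length zs" arbitrary: zs rule: less_induct)
  case less
  from walk_compare[OF assms(1) less.prems] show ?case
  proof (elim disjE exE conjE)
    fix ws assume "zs = xs @ ws" "walk f s ws a"
    then show ?thesis using less.hyps[of ws] assms(2) by simp
  next
    fix ws assume ws: "xs = zs @ ws" "walk f a ws s"
    show ?thesis
    proof (cases ws)
      case Nil
      then show ?thesis using ws assms(1,2) by (cases xs) auto
    qed (use ws in auto)
  qed
qed

lemma same_strand_in_closed:
  assumes "walk f s xs s" "xs \<noteq> []" "same_strand s t"
  shows "t \<in> set xs \<or> r t \<in> set xs"
proof -
  have "a \<in> set xs" if "comparable s a" for a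
  proof -
    \<comment> \<open>Reversed, the walk into \<open>s\<close> becomes a walk from
      \<open>r s\<close>, which runs on the reversed lap. So \<open>r a\<close> lies on that lap and
      walks on to \<open>r s\<close>; reversing once more leads from \<open>s\<close> to
      \<open>a\<close>.\<close>
    have "\<exists>ys. walk f s ys a" if w: "walk f a zs s" for zs
    proof -
      obtain zs' where zs': "walk f (r s) zs' (r a)" using walk_rev'[OF w] by blast
      obtain xs' where xs': "walk f (r s) xs' (r s)" "length xs' = length xs"
        using walk_rev'[OF assms(1)] by blast
      then have "r a \<in> set xs'" using walk_from_closed[OF xs'(1) _ zs'] assms(2) by fastforce
      then obtain ys where "walk f (r a) ys (r s)" using walk_split[OF xs'(1)] by blast
      from walk_rev'[OF this] show ?thesis using r_r by metis
    qed
    then show ?thesis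
      using that walk_from_closed[OF assms(1,2)] unfolding comparable_def by blast
  qed
  then show ?thesis using same_strand_comparable[OF assms(3)] by blast
qed

end

section \<open>Strands of products of simple diagrams\<close>

text \<open>A strand of the product diagram of a word \<open>u\<close> is followed in small steps: the state
  \<open>(g, x, v)\<close> is the point of column \<open>x\<close> between the letters \<open>g - 1\<close> and \<open>g\<close>, left in direction \<open>v\<close>.\<close>

type_synonym point = "nat \<times> nat \<times> vdir"

fun sstep :: "nat list \<Rightarrow> point \<Rightarrow> point option" where
  "sstep u (g, x, Downward) = (if g < length u then
     Some (if x = u ! g then (g, x + 1, Upward)
           else if x = u ! g + 1 then (g, u ! g, Upward) else (g + 1, x, Downward)) else None)"
| "sstep u (g, x, Upward) = (if 0 < g \<and> g \<le> length u then
     Some (if x = u ! (g - 1) then (g, x + 1, Downward)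
           else if x = u ! (g - 1) + 1 then (g, u ! (g - 1), Downward) else (g - 1, x, Upward)) else None)"

fun turn_letter :: "nat list \<Rightarrow> point \<Rightarrow> nat option" where
  "turn_letter u (g, x, Downward) =
     (if g < length u \<and> (x = u ! g \<or> x = u ! g + 1) then Some g else None)"
| "turn_letter u (g, x, Upward) =
     (if 0 < g \<and> (x = u ! (g - 1) \<or> x = u ! (g - 1) + 1) then Some (g - 1) else None)"

definition deco_out :: "(nat \<Rightarrow> deco list) \<Rightarrow> nat list \<Rightarrow> point \<Rightarrow> deco list" where
  "deco_out c u s = (case turn_letter u s of None \<Rightarrow> [] | Some g \<Rightarrow> c (u ! g))"

fun srev :: "point \<Rightarrow> point" where
  "srev (g, x, v) = (g, x, vflip v)"

fun start :: "nat list \<Rightarrow> node \<Rightarrow> point" where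
  "start u (North x) = (0, x, Downward)"
| "start u (South x) = (length u, x, Upward)"

definition finish :: "nat list \<Rightarrow> node \<Rightarrow> point" where
  "finish u x = srev (start u x)"

definition points :: "nat \<Rightarrow> nat list \<Rightarrow> point set" where
  "points n u = {0..length u} \<times> {1..n+2} \<times> UNIV"

lemma vflip_vflip [simp]: "vflip (vflip v) = v"
  by (cases v) auto

lemma hflip_hflip [simp]: "hflip (hflip h) = h"
  by (cases h) auto

lemma srev_srev [simp]: "srev (srev s) = s"
  by (cases s) auto

lemma sstep_srev: "sstep u s = Some t \<Longrightarrow> sstep u (srev t) = Some (srev s)"
  by (cases "(u, s)" rule: sstep.cases) (auto split: if_splits)

lemma turn_letter_srev:
  "sstep u s = Some t \<Longrightarrow> turn_letter u (srev t) = turn_letter u s"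
  by (cases "(u, s)" rule: sstep.cases) (auto split: if_splits)

lemma deco_out_srev:
  assumes "sstep u s = Some t" "\<And>i. rev (c i) = c i"
  shows "deco_out c u (srev t) = rev (deco_out c u s)"
  using turn_letter_srev[OF assms(1)] assms(2) by (simp add: deco_out_def split: option.splits)

lemma finish_simps [simp]:
  "finish u (North x) = (0, x, Upward)" "finish u (South x) = (length u, x, Downward)"
  by (simp_all add: finish_def)

lemma sstep_finish [simp]: "sstep u (finish u x) = None"
  by (cases x) auto

lemma finish_inj [simp]: "finish u x = finish u y \<longleftrightarrow> x = y"
  by (cases x; cases y) auto

lemma start_inj [simp]: "start u x = start u y \<longleftrightarrow> x = y"
  by (cases x; cases y) auto

lemma in_nodes [simp]:
  "North i \<in> nodes m \<longleftrightarrow> 1 \<le> i \<and> i \<le> m" "South i \<in> nodes m \<longleftrightarrow> 1 \<le> i \<and> i \<le> m"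
  by (auto simp: node_list_def)

lemma sstep_NoneE:
  assumes "sstep u s = None" "s \<in> points n u"
  shows "\<exists>x. x \<in> nodes (n + 2) \<and> s = finish u x"
proof (cases "(u, s)" rule: sstep.cases)
  case (1 u' g x)
  then show ?thesis using assms
    by (intro exI[of _ "South x"]) (auto simp: points_def split: if_splits)
next
  case (2 u' g x)
  then show ?thesis using assms
    by (intro exI[of _ "North x"]) (auto simp: points_def split: if_splits)
qed

lemma start_points: "x \<in> nodes (n + 2) \<Longrightarrow> start u x \<in> points n u"
  by (cases x) (auto simp: points_def)

lemma strand_reversible:
  assumes "set u \<subseteq> gens n" shows "reversible (sstep u) srev (points n u)"
proof
  fix s t assume st: "s \<in> points n u" "sstep u s = Some t"
  have "u ! g \<in> gens n" if "g < length u" for g using assms that by auto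
  then have "u ! g \<ge> 1 \<and> u ! g \<le> n + 1 \<and> u ! g \<le> n + 2" if "g < length u" for g
    using that by (force simp: gens_def)
  note this[of "fst s"] this[of "fst s - 1"]
  with st show "t \<in> points n u"
    by (cases "(u, s)" rule: sstep.cases) (auto simp: points_def split: if_splits)
next
  have "finite (UNIV :: vdir set)"
    by (rule finite_subset[of _ "{Upward, Downward}"]) (auto intro: vdir.exhaust)
  then show "finite (points n u)" by (simp add: points_def)
qed (auto simp: sstep_srev points_def)

lemma sstep_not_srev: "sstep u s \<noteq> Some (srev s)"
  by (cases "(u, s)" rule: sstep.cases) auto

lemma srev_neq [simp]: "srev s \<noteq> s"
  by (cases s; cases "snd (snd s)") auto

text \<open>Both ends of such a walk can be cut off: if it begins with a step to \<open>s'\<close>,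
  its last step comes from \<open>srev s'\<close>. In the middle there remains a state equal to its
  own reversal or a step that only turns round, and neither exists. Hence no edge of a diagram
  returns to its node.\<close>

lemma no_walk_srev: "\<not> walk (sstep u) s xs (srev s)"
proof (induction "length xs" arbitrary: s xs rule: less_induct)
  case less
  show ?case
  proof
    assume w: "walk (sstep u) s xs (srev s)"
    show False
    proof (cases xs)
      case Nil
      then show False using w srev_neq[of s] by simp
    next
      case (Cons x ys)
      then obtain s' where s': "sstep u s = Some s'" "walk (sstep u) s' ys (srev s)" using w by auto
      show False
      proof (cases ys rule: rev_cases)
        case Nil
        then show False using s' sstep_not_srev[of u s] by simp
      next
        case (snoc zs z)
        then have z: "walk (sstep u) s' zs z" "sstep u z = Some (srev s)"
          using s'(2) by (simp_all add: walk_snoc)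
        then have "srev z = s'" using sstep_srev[OF z(2)] s'(1) by simp
        then show False using less[of zs s'] z(1) snoc Cons by auto
      qed
    qed
  qed
qed

fun shift :: "point \<Rightarrow> point" where
  "shift (g, x, v) = (Suc g, x, v)"

text \<open>A new first letter adds one level on top. Nothing changes below it, as long as the
  strand has not reached the top of \<open>u\<close>, where it used to stop and now goes on.\<close>

lemma sstep_shift: "sstep u s = Some t \<Longrightarrow> sstep (i # u) (shift s) = Some (shift t)"
  by (cases "(u, s)" rule: sstep.cases) (auto split: if_splits)

lemma turn_letter_shift:
  "sstep u s = Some t \<Longrightarrow> turn_letter (i # u) (shift s) = map_option Suc (turn_letter u s)"
  by (cases "(u, s)" rule: sstep.cases) (auto split: if_splits)

lemma walk_shift:
  assumes "walk (sstep u) s xs t"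
  shows "walk (sstep (i # u)) (shift s) (map shift xs) (shift t)"
  using assms
proof (induction xs arbitrary: s)
  case (Cons x xs)
  then obtain s' where "x = s" "sstep u s = Some s'" "walk (sstep u) s' xs t" by auto
  then show ?case using Cons.IH[of s'] sstep_shift[of u s s'] by auto
qed simp

lemma deco_out_shift:
  assumes "walk (sstep u) s xs t"
  shows "concat (map (deco_out c (i # u)) (map shift xs)) = concat (map (deco_out c u) xs)"
  using assms
proof (induction xs arbitrary: s)
  case (Cons x xs)
  then obtain s' where s': "x = s" "sstep u s = Some s'" "walk (sstep u) s' xs t" by auto
  have "deco_out c (i # u) (shift s) = deco_out c u s"
    unfolding deco_out_def turn_letter_shift[OF s'(2)] by (simp split: option.splits)
  then show ?case using Cons.IH[OF s'(3)] s'(1) by simp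
qed simp

lemma mate_simple_diag:
  "mate (simple_diag n i w) x =
     (if x = North i then North (i+1) else if x = North (i+1) then North i
      else if x = South i then South (i+1) else if x = South (i+1) then South i
      else if x \<in> nodes (n+2) then (case x of North j \<Rightarrow> South j | South j \<Rightarrow> North j) else x)"
  by (auto simp: simple_diag_def id_diag_def)

lemma word_simple_diag:
  "word (simple_diag n i w) x =
     (if x = North i \<or> x = South i then w else if x = North (i+1) \<or> x = South (i+1) then rev w else [])"
  by (auto simp: simple_diag_def)

lemma trail_walk:
  assumes "walk (glue_next d1 d2) s xs e" "glue_next d1 d2 e = None" "length xs \<le> k"
  shows "trail k d1 d2 s = xs @ [e]"
  using assms
proof (induction xs arbitrary: s k)
  case Nil
  then show ?case by (cases k) auto
next
  case (Cons x xs)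
  then obtain s' where s': "x = s" "glue_next d1 d2 s = Some s'" "walk (glue_next d1 d2) s' xs e" by auto
  obtain k' where "k = Suc k'" using Cons.prems(3) by (cases k) auto
  then show ?case using Cons.IH[OF s'(3) Cons.prems(2), of k'] Cons.prems(3) s' by simp
qed

text \<open>Translates segments of a glued curve into points: the simple diagram on top is the layer
  between the levels 0 and 1, and the lower diagram starts at level 1.\<close>

fun seg_start :: "nat list \<Rightarrow> bool \<times> node \<Rightarrow> point" where
  "seg_start u (True, North x) = (0, x, Downward)"
| "seg_start u (True, South x) = (1, x, Upward)"
| "seg_start u (False, y) = shift (start u y)"

definition strand_of :: "nat \<Rightarrow> (nat \<Rightarrow> deco list) \<Rightarrow> nat list \<Rightarrow> node \<Rightarrow> point list \<Rightarrow> bool" where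
  "strand_of n c u x ls \<longleftrightarrow> walk (sstep u) (start u x) ls (finish u (mate (word_diag n c u) x)) \<and>
     concat (map (deco_out c u) ls) = word (word_diag n c u) x"

text \<open>A segment in the upper diagram is a single step through the layer of \<open>i\<close>; a
  segment in the lower one is a whole strand of \<open>u\<close>, moved down by one level.\<close>

lemma seg_strand:
  assumes "i \<in> gens n" "\<And>i. rev (c i) = c i"
    and IH: "\<And>x. x \<in> nodes (n + 2) \<Longrightarrow> \<exists>ls. strand_of n c u x ls"
    and y: "y \<in> nodes (n + 2)"
  defines "d1 \<equiv> simple_diag n i (c i)" and "d2 \<equiv> word_diag n c u"
  shows "\<exists>ls. walk (sstep (i # u)) (seg_start u (b, y)) ls
      (case glue_next d1 d2 (b, y) of Some t \<Rightarrow> seg_start u t | None \<Rightarrow> finish (i # u) (seg_end d1 d2 (b, y)))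
    \<and> concat (map (deco_out c (i # u)) ls) = seg_word d1 d2 (b, y)"
proof (cases b)
  case True
  have i: "1 \<le> i" "i \<le> n + 1" using assms(1) by (auto simp: gens_def)
  show ?thesis
  proof (cases y)
    case (North x)
    then show ?thesis using True y i assms(2)
      by (intro exI[of _ "[(0, x, Downward)]"])
         (auto simp: d1_def mate_simple_diag word_simple_diag deco_out_def)
  next
    case (South x)
    then show ?thesis using True y i assms(2)
      by (intro exI[of _ "[(1, x, Upward)]"])
         (auto simp: d1_def mate_simple_diag word_simple_diag deco_out_def)
  qed
next
  case False
  from IH[OF y] obtain ls where ls: "strand_of n c u y ls" by blast
  then have w: "walk (sstep u) (start u y) ls (finish u (mate d2 y))"
    and o: "concat (map (deco_out c u) ls) = word d2 y"
    by (simp_all add: strand_of_def d2_def)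
  from walk_shift[OF w, of i]
  have w': "walk (sstep (i # u)) (seg_start u (b, y)) (map shift ls) (shift (finish u (mate d2 y)))"
    using False by simp
  have "concat (map (deco_out c (i # u)) (map shift ls)) = seg_word d1 d2 (b, y)"
    using deco_out_shift[OF w, of c i] o False by simp
  moreover have "shift (finish u (mate d2 y)) =
     (case glue_next d1 d2 (b, y) of Some t \<Rightarrow> seg_start u t | None \<Rightarrow> finish (i # u) (seg_end d1 d2 (b, y)))"
    using False by (cases "mate d2 y") auto
  ultimately show ?thesis using w' by metis
qed

text \<open>The strand from \<open>x\<close>, walked backwards, is the strand from its mate. The
  claim about strands is an assumption here because the lemma is applied inside the induction that
  proves it.\<close>

lemma mate_involution_of_strands:
  assumes "set u \<subseteq> gens n" "x \<in> nodes (n + 2)"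
    and S: "\<And>x. x \<in> nodes (n + 2) \<Longrightarrow> mate (word_diag n c u) x \<in> nodes (n + 2) \<and> (\<exists>ls. strand_of n c u x ls)"
  shows "mate (word_diag n c u) (mate (word_diag n c u) x) = x" "mate (word_diag n c u) x \<noteq> x"
proof -
  interpret reversible "sstep u" srev "points n u" by (rule strand_reversible) fact
  let ?f = "mate (word_diag n c u)"
  obtain ls where ls: "walk (sstep u) (start u x) ls (finish u (?f x))"
    using S[OF assms(2)] by (auto simp: strand_of_def)
  obtain ls' where ls': "walk (sstep u) (start u (?f x)) ls' (finish u (?f (?f x)))"
    using S S[OF assms(2)] by (auto simp: strand_of_def)
  obtain ys where "walk (sstep u) (start u (?f x)) ys (finish u x)"
    using walk_rev'[OF ls] by (auto simp: finish_def)
  with ls' have "finish u (?f (?f x)) = finish u x" using walk_end_unique sstep_finish by metis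
  then show "?f (?f x) = x" by simp
  show "?f x \<noteq> x" using ls no_walk_srev by (metis finish_def)
qed

lemma mate_outside: "x \<notin> nodes (n + 2) \<Longrightarrow> mate (word_diag n c u) x = x \<and> word (word_diag n c u) x = []"
  by (cases u) (auto simp: id_diag_def dmul_def prod_mate_def Let_def)

lemma strand_walk_glue:
  assumes "i \<in> gens n" "\<And>i. rev (c i) = c i"
    and IH: "\<And>x. x \<in> nodes (n + 2) \<Longrightarrow> mate (word_diag n c u) x \<in> nodes (n + 2) \<and> (\<exists>ls. strand_of n c u x ls)"
  defines "d1 \<equiv> simple_diag n i (c i)" and "d2 \<equiv> word_diag n c u"
  assumes w: "walk (glue_next d1 d2) s xs e" "glue_next d1 d2 e = None" "snd s \<in> nodes (n + 2)"
  shows "seg_end d1 d2 e \<in> nodes (n + 2) \<and> (\<exists>ls. walk (sstep (i # u)) (seg_start u s) ls (finish (i # u) (seg_end d1 d2 e))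
     \<and> concat (map (deco_out c (i # u)) ls) = concat (map (seg_word d1 d2) (xs @ [e])))"
proof -
  have i: "1 \<le> i" "i \<le> n + 1" using assms(1) by (auto simp: gens_def)
  have m1: "mate d1 y \<in> nodes (n + 2)" if "y \<in> nodes (n + 2)" for y
    using that i by (cases y rule: node.exhaust) (auto simp: d1_def mate_simple_diag)
  have m2: "mate d2 y \<in> nodes (n + 2)" if "y \<in> nodes (n + 2)" for y
    using that IH by (simp add: d2_def)
  have SS: "\<exists>ls. walk (sstep (i # u)) (seg_start u s) ls
      (case glue_next d1 d2 s of Some t \<Rightarrow> seg_start u t | None \<Rightarrow> finish (i # u) (seg_end d1 d2 s))
    \<and> concat (map (deco_out c (i # u)) ls) = seg_word d1 d2 s" if "snd s \<in> nodes (n + 2)" for s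
    using seg_strand[where c = c, OF assms(1,2), where u = u and y = "snd s" and b = "fst s", unfolded prod.collapse] IH that unfolding d1_def d2_def by simp
  from w show ?thesis
  proof (induction xs arbitrary: s)
    case Nil
    obtain b y where s: "s = (b, y)" by (cases s)
    then show ?case using SS[of s] Nil m1 m2 by (cases b) auto
  next
    case (Cons x xs)
    then obtain s' where s': "x = s" "glue_next d1 d2 s = Some s'" "walk (glue_next d1 d2) s' xs e" by auto
    obtain b y where s: "s = (b, y)" by (cases s)
    have "snd s' \<in> nodes (n + 2)"
      using s'(2) s Cons.prems(3) m1[of y] m2[of y] by (cases b) (auto split: node.splits)
    from Cons.IH[OF s'(3) Cons.prems(2) this] obtain ls' where
      ls': "seg_end d1 d2 e \<in> nodes (n + 2)" "walk (sstep (i # u)) (seg_start u s') ls' (finish (i # u) (seg_end d1 d2 e))"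
        "concat (map (deco_out c (i # u)) ls') = concat (map (seg_word d1 d2) (xs @ [e]))" by blast
    obtain ls where ls: "walk (sstep (i # u)) (seg_start u s) ls (seg_start u s')"
      "concat (map (deco_out c (i # u)) ls) = seg_word d1 d2 s"
      using SS[OF Cons.prems(3)] s'(2) by auto
    have "walk (sstep (i # u)) (seg_start u s) (ls @ ls') (finish (i # u) (seg_end d1 d2 e))"
      using walk_trans[OF ls(1) ls'(2)] .
    moreover have "concat (map (deco_out c (i # u)) (ls @ ls')) = concat (map (seg_word d1 d2) ((x # xs) @ [e]))"
      using ls(2) ls'(3) s'(1) by simp
    ultimately show ?case using ls'(1) by blast
  qed
qed

lemma glue_terminates:
  assumes x: "x \<in> nodes m"
    and d1: "\<And>y. mate d1 (mate d1 y) = y" "\<And>y. y \<in> nodes m \<Longrightarrow> mate d1 y \<in> nodes m"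
    and d2: "\<And>y. mate d2 (mate d2 y) = y" "\<And>y. y \<in> nodes m \<Longrightarrow> mate d2 y \<in> nodes m"
  shows "\<exists>xs e. walk (glue_next d1 d2) (entry x) xs e \<and> glue_next d1 d2 e = None \<and> length xs \<le> 2 * m"
proof -
  \<comment> \<open>After each passage the curve enters one of the \<open>m\<close> south nodes of
    \<open>d1\<close> or of the \<open>m\<close> north nodes of \<open>d2\<close>; this gives
    exactly the bound \<open>2 * m\<close> used as fuel in \<open>curve\<close>.\<close>
  let ?S = "(\<lambda>j. (True, South j)) ` {1..m} \<union> (\<lambda>j. (False, North j)) ` {1..m}"
  have S: "card ?S \<le> 2 * m"
    by (rule order_trans[OF card_Un_le]) (auto intro!: order_trans[OF add_mono[OF card_image_le card_image_le]])
  have "\<exists>xs e. walk (glue_next d1 d2) (entry x) xs e \<and> glue_next d1 d2 e = None \<and> length xs \<le> card ?S"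
  proof (rule walk_terminates[where D = "UNIV \<times> nodes m"])
    show "\<forall>a b c. glue_next d1 d2 a = Some c \<longrightarrow> glue_next d1 d2 b = Some c \<longrightarrow> a = b"
    proof (intro allI impI)
      fix a b c assume ab: "glue_next d1 d2 a = Some c" "glue_next d1 d2 b = Some c"
      obtain p y q z where *: "a = (p, y)" "b = (q, z)" by (cases a; cases b)
      have "p = q" using ab * by (cases p; cases q) (auto split: node.splits)
      moreover have "mate (if p then d1 else d2) y = mate (if p then d1 else d2) z"
        using ab * \<open>p = q\<close> by (cases p) (auto split: node.splits)
      ultimately show "a = b" using * d1(1) d2(1) by (metis (full_types))
    qed
    show "\<forall>a. glue_next d1 d2 a \<noteq> Some (entry x)"
    proof
      fix a :: "bool \<times> node"
      obtain p y where "a = (p, y)" by (cases a)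
      then show "glue_next d1 d2 a \<noteq> Some (entry x)" by (cases p; cases x) (auto split: node.splits)
    qed
    show "\<forall>a b. a \<in> UNIV \<times> nodes m \<longrightarrow> glue_next d1 d2 a = Some b \<longrightarrow> b \<in> UNIV \<times> nodes m \<and> b \<in> ?S"
    proof (intro allI impI)
      fix a b assume ab: "a \<in> UNIV \<times> nodes m" "glue_next d1 d2 a = Some b"
      obtain p y where a: "a = (p, y)" by (cases a)
      show "b \<in> UNIV \<times> nodes m \<and> b \<in> ?S"
        using ab a d1(2)[of y] d2(2)[of y] by (cases p) (auto split: node.splits)
    qed
    show "entry x \<in> UNIV \<times> nodes m" using x by (cases x rule: node.exhaust) simp_all
  qed simp
  then show ?thesis using S order_trans by blast
qed

lemma mate_simple_diag_involution:
  assumes "i \<in> gens n"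
  shows "mate (simple_diag n i w) (mate (simple_diag n i w) y) = y"
    "y \<in> nodes (n + 2) \<Longrightarrow> mate (simple_diag n i w) y \<in> nodes (n + 2)"
proof -
  have i: "1 \<le> i" "i \<le> n + 1" using assms(1) by (auto simp: gens_def)
  show "mate (simple_diag n i w) (mate (simple_diag n i w) y) = y"
    using i by (cases y rule: node.exhaust) (auto simp: mate_simple_diag)
  show "y \<in> nodes (n + 2) \<Longrightarrow> mate (simple_diag n i w) y \<in> nodes (n + 2)"
    by (cases y rule: node.exhaust) (use i in \<open>auto simp: mate_simple_diag\<close>)
qed

text \<open>The bridge from diagrams to strands: a curve of the product with one more letter is a
  chain of segments, each of them a piece of a strand by the induction hypothesis. From here on
  mates and words are computed by following points through the layers.\<close>

theorem word_diag_strands: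
  assumes "set u \<subseteq> gens n" "\<And>i. rev (c i) = c i" "x \<in> nodes (n + 2)"
  shows "mate (word_diag n c u) x \<in> nodes (n + 2) \<and> (\<exists>ls. strand_of n c u x ls)"
  using assms(1,3)
proof (induction u arbitrary: x)
  case Nil
  then show ?case
    by (cases x) (auto simp: strand_of_def id_diag_def intro!: exI[of _ "[]"])
next
  case (Cons i u)
  let ?d1 = "simple_diag n i (c i)" and ?d2 = "word_diag n c u"
  have i: "i \<in> gens n" and u: "set u \<subseteq> gens n" using Cons.prems by auto
  note IH = Cons.IH[OF u]
  have inv: "mate ?d2 (mate ?d2 y) = y" for y
    using mate_involution_of_strands(1)[OF u _ IH] mate_outside[of y n c u]
    by (cases "y \<in> nodes (n + 2)") auto
  obtain xs e where w: "walk (glue_next ?d1 ?d2) (entry x) xs e" "glue_next ?d1 ?d2 e = None" "length xs \<le> 2 * (n + 2)"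
    using glue_terminates[OF Cons.prems(2), of ?d1 ?d2] mate_simple_diag_involution[OF i] inv IH by blast
  have c: "curve (n + 2) ?d1 ?d2 x = xs @ [e]"
    unfolding curve_def by (rule trail_walk[OF w])
  have "snd (entry x) \<in> nodes (n + 2)" using Cons.prems(2) by (cases x rule: node.exhaust) auto
  from strand_walk_glue[OF i assms(2) IH w(1,2) this] obtain ls where
    ls: "seg_end ?d1 ?d2 e \<in> nodes (n + 2)"
      "walk (sstep (i # u)) (seg_start u (entry x)) ls (finish (i # u) (seg_end ?d1 ?d2 e))"
      "concat (map (deco_out c (i # u)) ls) = concat (map (seg_word ?d1 ?d2) (xs @ [e]))" by blast
  have m: "mate (word_diag n c (i # u)) x = seg_end ?d1 ?d2 e"
    using Cons.prems(2) by (simp add: dmul_def Let_def prod_mate_def c del: add_2_eq_Suc')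
  have wd: "word (word_diag n c (i # u)) x = concat (map (seg_word ?d1 ?d2) (xs @ [e]))"
    using Cons.prems(2) by (simp add: dmul_def Let_def c del: add_2_eq_Suc')
  have "seg_start u (entry x) = start (i # u) x" by (cases x) auto
  then show ?case using ls unfolding strand_of_def m wd by auto
qed

lemma gens_bounds: "i \<in> gens n \<longleftrightarrow> 1 \<le> i \<and> i \<le> n + 1"
  by (auto simp: gens_def)

lemma word_diag_mate:
  assumes "set u \<subseteq> gens n" "\<And>i. rev (c i) = c i"
  shows "mate (word_diag n c u) (mate (word_diag n c u) x) = x"
    and "x \<in> nodes (n + 2) \<Longrightarrow> mate (word_diag n c u) x \<noteq> x"
    and "x \<in> nodes (n + 2) \<Longrightarrow> mate (word_diag n c u) x \<in> nodes (n + 2)"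
  using mate_involution_of_strands[OF assms(1) _ word_diag_strands[OF assms]]
    word_diag_strands[OF assms] mate_outside[of x n c u]
  by (cases "x \<in> nodes (n + 2)"; simp)+

text \<open>Decorations do not influence \<open>sstep\<close>, and a strand has only one
  end.\<close>

lemma mate_word_diag_cong:
  assumes "set u \<subseteq> gens n" "\<And>i. rev (c i) = c i" "\<And>i. rev (c' i) = c' i"
  shows "mate (word_diag n c u) = mate (word_diag n c' u)"
proof
  fix x
  show "mate (word_diag n c u) x = mate (word_diag n c' u) x"
  proof (cases "x \<in> nodes (n + 2)")
    case True
    obtain ls ls' where "strand_of n c u x ls" "strand_of n c' u x ls'"
      using word_diag_strands[where c = c, OF assms(1,2) True] word_diag_strands[where c = c', OF assms(1,3) True] by blast
    then have "finish u (mate (word_diag n c u) x) = finish u (mate (word_diag n c' u) x)"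
      unfolding strand_of_def using walk_end_unique sstep_finish by metis
    then show ?thesis by simp
  qed (simp add: mate_outside del: add_2_eq_Suc')
qed

text \<open>The only edge of the simple diagram between south nodes joins \<open>i\<close> and
  \<open>i + 1\<close>, so a closed curve consists of this edge and an edge of \<open>d\<close>
  between the same two points. Every other curve leaves the line of gluing points within four
  segments.\<close>

lemma new_loops_simple_diag:
  assumes i: "1 \<le> i" "i + 1 \<le> m" and m: "m = n + 2"
    and inv: "\<And>x. mate d (mate d x) = x" and nofix: "\<And>x. x \<in> nodes m \<Longrightarrow> mate d x \<noteq> x"
    and nod: "\<And>x. x \<in> nodes m \<Longrightarrow> mate d x \<in> nodes m"
    and w: "rev w = w"
  shows "new_loops m (simple_diag n i w) d =
     (if mate d (North i) = North (i + 1) then {#cyc (word d (North i) @ w)#} else {#})"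
proof -
  let ?e = "simple_diag n i w"
  have inv': "mate d x = y \<longleftrightarrow> mate d y = x" for x y using inv by metis
  \<comment> \<open>Four unfoldings of \<open>trail\<close> show that an open curve leaves;
    \<open>k\<close> is the fuel that remains.\<close>
  have "4 \<le> 2 * m" using i by simp
  then obtain k where "2 * m = 4 + k" using le_Suc_ex by blast
  then have k: "2 * m = Suc (Suc (Suc (Suc k)))" by simp
  have me: "mate ?e (South j) = (if j = i then South (i + 1) else if j = i + 1 then South i else North j)"
    if "1 \<le> j" "j \<le> m" for j
    using that m by (auto simp: mate_simple_diag)
  have open_case: "\<not> closed_at m ?e d j"
    if j: "1 \<le> j" "j \<le> m" and no: "\<not> (mate d (North i) = North (i + 1) \<and> (j = i \<or> j = i + 1))" for j
  proof (cases "mate d (North j)")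
    case (South y)
    then show ?thesis by (simp add: closed_at_def k)
  next
    case (North a)
    have a: "1 \<le> a" "a \<le> m" "a \<noteq> j"
      using nod[of "North j"] nofix[of "North j"] j North by auto
    have ma: "mate d (North a) = North j" using North inv' by simp
    show ?thesis
    proof (cases "a = i \<or> a = i + 1")
      case False
      then show ?thesis using North a by (simp add: closed_at_def k me)
    next
      case True
      define b where "b = (if a = i then i + 1 else i)"
      have b: "1 \<le> b" "b \<le> m" "b \<noteq> a" using i True by (auto simp: b_def)
      have mb: "mate ?e (South a) = South b" using True a me[of a] by (auto simp: b_def)
      show ?thesis
      proof (cases "mate d (North b)")
        case (South y)
        then show ?thesis using North mb by (simp add: closed_at_def k)
      next
        case N: (North a')
        have a': "1 \<le> a'" "a' \<le> m" "a' \<noteq> b"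
          using nod[of "North b"] nofix[of "North b"] b N by auto
        have "a' \<noteq> a"
        proof
          assume "a' = a"
          then have "mate d (North a) = North b" using N inv' by simp
          then have "j = b" using ma by simp
          then show False using no ma True North by (auto simp: b_def split: if_splits)
        qed
        then have "mate ?e (South a') = North a'"
          using a' True me[of a'] by (auto simp: b_def split: if_splits)
        then show ?thesis using North mb N by (simp add: closed_at_def k)
      qed
    qed
  qed
  show ?thesis
  proof (cases "mate d (North i) = North (i + 1)")
    case False
    then have "{j \<in> {1..m}. closed_at m ?e d j \<and>
        (\<forall>s\<in>set (closed_curve m ?e d j). j \<le> node_index (snd s))} = {}"
      using open_case by auto
    then show ?thesis using False unfolding new_loops_def by (simp only: mset_set.empty image_mset_empty if_False)
  next
    case True
    then have T2: "mate d (North (i + 1)) = North i" using inv' by simp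
    have mi: "mate ?e (South i) = South (i + 1)" "mate ?e (South (i + 1)) = South i"
      using me[of i] me[of "i + 1"] i by auto
    let ?C = "{(False, North i), (True, South (i+1)), (False, North (i+1)), (True, South i)}"
    have C: "last (trail k ?e d s) \<in> ?C" if "s \<in> ?C" for k s
      using that
    proof (induction k arbitrary: s)
      case (Suc k)
      have "\<exists>t. glue_next ?e d s = Some t \<and> t \<in> ?C"
        using Suc.prems True T2 mi by auto
      then obtain t where t: "glue_next ?e d s = Some t" "t \<in> ?C" by blast
      moreover have "trail k ?e d t \<noteq> []" by (cases k) auto
      ultimately show ?case using Suc.IH[OF t(2)] by simp
    qed auto
    have closed: "closed_at m ?e d j" if "j = i \<or> j = i + 1" for j
    proof -
      have "last (trail (2 * m) ?e d (False, North j)) \<in> ?C" using C that by auto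
      then show ?thesis unfolding closed_at_def using True T2 mi by auto
    qed
    have hd: "\<exists>ys. trail k ?e d s = s # ys" for k s by (cases k) auto
    obtain ys where ys: "trail (Suc (Suc k)) ?e d (False, North i) = (False, North i) # ys" using hd by blast
    have c1: "closed_curve m ?e d i = [(False, North i), (True, South (i + 1))]"
      unfolding closed_curve_def k using True mi ys by simp
    \<comment> \<open>The loop is also met from \<open>i + 1\<close>, in the other direction, but
      there it contains a point with smaller index. So it is counted at \<open>i\<close>
      only.\<close>
    have c2: "(True, South i) \<in> set (closed_curve m ?e d (i + 1))"
      unfolding closed_curve_def k using T2 mi by simp
    have "{j \<in> {1..m}. closed_at m ?e d j \<and>
        (\<forall>s\<in>set (closed_curve m ?e d j). j \<le> node_index (snd s))} = {i}"
    proof (intro equalityI subsetI)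
      fix j assume j: "j \<in> {j \<in> {1..m}. closed_at m ?e d j \<and>
        (\<forall>s\<in>set (closed_curve m ?e d j). j \<le> node_index (snd s))}"
      then have "j = i \<or> j = i + 1" using open_case[of j] by auto
      moreover have "j \<noteq> i + 1" using j c2 by fastforce
      ultimately show "j \<in> {i}" by simp
    next
      fix j assume "j \<in> {i}"
      then show "j \<in> {j \<in> {1..m}. closed_at m ?e d j \<and>
        (\<forall>s\<in>set (closed_curve m ?e d j). j \<le> node_index (snd s))}"
        using closed[of i] c1 i by auto
    qed
    then show ?thesis using True w unfolding new_loops_def by (simp add: c1 word_simple_diag)
  qed
qed

lemma loops_word_diag_Cons:
  assumes "set (i # u) \<subseteq> gens n" "\<And>i. rev (c i) = c i"
  defines "d \<equiv> word_diag n c u"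
  shows "loops (word_diag n c (i # u)) = loops d +
     (if mate d (North i) = North (i + 1) then {#cyc (word d (North i) @ c i)#} else {#})"
proof -
  have u: "set u \<subseteq> gens n" using assms(1) by auto
  have "new_loops (n + 2) (simple_diag n i (c i)) d =
     (if mate d (North i) = North (i + 1) then {#cyc (word d (North i) @ c i)#} else {#})"
    using assms(1,2) word_diag_mate[OF u assms(2)] unfolding d_def
    by (intro new_loops_simple_diag) (auto simp: gens_bounds simp del: add_2_eq_Suc')
  then show ?thesis
    by (simp add: dmul_def Let_def d_def simple_diag_def id_diag_def del: add_2_eq_Suc')
qed

section \<open>Simple diagrams are decorated diagrams\<close>

lemma a_val_simple_diag:
  assumes "i \<in> gens n" shows "a_val (mate (simple_diag n i w)) = 1"
proof -
  have "{k. \<exists>j. mate (simple_diag n i w) (North k) = North j \<and> k < j} = {i}"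
    by (auto simp: mate_simple_diag split: if_splits)
  then show ?thesis by (simp add: a_val_def)
qed

lemma noncrossing_mono: "noncrossing C \<Longrightarrow> C' \<subseteq> C \<Longrightarrow> noncrossing C'"
  unfolding noncrossing_def by blast

definition crosses :: "real \<times> real \<Rightarrow> real \<times> real \<Rightarrow> bool" where
  "crosses p q \<longleftrightarrow> (case (p, q) of ((a, b), (c, e)) \<Rightarrow>
     min a b < min c e \<and> min c e < max a b \<and> max a b < max c e)"

lemma noncrossing_alt: "noncrossing C \<longleftrightarrow> (\<forall>p\<in>C. \<forall>q\<in>C. \<not> crosses p q)"
  by (auto simp: noncrossing_def crosses_def)

lemma deformable_simple_diag:
  assumes i: "1 \<le> i" "i \<le> n + 1"
    and w: "w = [] \<or> i = 1 \<and> w = [Bullet] \<or> i = n + 1 \<and> w = [Circle]"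
  shows "deformable (n + 2) (simple_diag n i w)"
proof -
  define m where "m = n + 2"
  let ?d = "simple_diag n i w"
  \<comment> \<open>The boundary is parametrised clockwise: the left wall is run upwards, so the
    south decoration (\<open>tS\<close>) comes before the north one there, and the right wall is run
    downwards, where it comes after it. Otherwise the chords of the two edges would cross.\<close>
  define tN where "tN = (if w = [Bullet] then 2 * real m + 2 else real m + 1/3)"
  define tS where "tS = (if w = [Bullet] then 2 * real m + 1 else real m + 2/3)"
  define T where "T x = (if w = [] then [] else if x = North i then [tN]
      else if x = South (i + 1) then [tS] else [])" for x
  define E where "E = filter (\<lambda>x. pos m x < pos m (mate ?d x)) (node_list m)"
  define V where "V = {(real j, 2 * real m + 1 - real j) | j. (real j \<le> real i - 1 \<or> real i + 2 \<le> real j) \<and> 1 \<le> j \<and> real j \<le> real m}"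
  define Q where "Q = (if w = [] then {(real i, real i + 1), (2 * real m - real i, 2 * real m + 1 - real i)}
     else {(real i, tN), (tN, real i + 1), (2 * real m - real i, tS), (tS, 2 * real m + 1 - real i)})"
  have E: "x \<in> set E \<Longrightarrow> x = North i \<or> x = South (i + 1) \<or>
      (\<exists>j. x = North j \<and> j \<noteq> i \<and> j \<noteq> i + 1 \<and> 1 \<le> j \<and> j \<le> m)" for x
    using i unfolding E_def m_def
    by (cases x) (auto simp: mate_simple_diag split: if_splits simp del: add_2_eq_Suc')
  have "chords (pos m x # T x @ [pos m (mate ?d x)]) \<subseteq> V \<union> Q" if "x \<in> set E" for x
    using E[OF that]
  proof (elim disjE exE conjE)
    fix j assume j: "x = North j" "j \<noteq> i" "j \<noteq> i + 1" "1 \<le> j" "j \<le> m"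
    then have "mate ?d x = South j" "T x = []" by (auto simp: mate_simple_diag T_def m_def)
    moreover have "real j \<le> real i - 1 \<or> real i + 2 \<le> real j" using j by linarith
    ultimately show ?thesis using j by (auto simp: chords_def V_def)
  next
    assume "x = North i"
    then show ?thesis by (auto simp: chords_def T_def Q_def mate_simple_diag)
  next
    assume "x = South (i + 1)"
    then show ?thesis by (auto simp: chords_def T_def Q_def mate_simple_diag)
  qed
  moreover have "noncrossing (V \<union> Q)"
  proof -
    have VV: "\<not> crosses p q" if "p \<in> V" "q \<in> V" for p q
      using that unfolding V_def crosses_def by (auto simp: min_def max_def)
    have rm: "real m = real n + 2" by (simp add: m_def)
    have ri: "real i \<le> real n + 1" using i(2) by linarith
    have QQ: "\<not> crosses p q" if "p \<in> Q" "q \<in> Q" for p q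
      using that w i rm ri unfolding Q_def crosses_def tN_def tS_def
      by (auto simp: min_def max_def split: if_splits)
    have VQ: "\<not> crosses p q \<and> \<not> crosses q p" if "p \<in> V" "q \<in> Q" for p q
    proof -
      obtain j where p: "p = (real j, 2 * real m + 1 - real j)" "real j \<le> real i - 1 \<or> real i + 2 \<le> real j" "1 \<le> j" "real j \<le> real m"
        using \<open>p \<in> V\<close> unfolding V_def by blast
      have j1: "1 \<le> real j" using p(3) by simp
      show ?thesis
        using w that(2) i rm ri j1 p(2,4) unfolding p(1) Q_def crosses_def tN_def tS_def
        by (elim disjE) (auto simp: min_def max_def split: if_splits)
    qed
    show ?thesis unfolding noncrossing_alt using VV QQ VQ by blast
  qed
  ultimately have nc: "noncrossing (\<Union>x\<in>set E. chords (pos m x # T x @ [pos m (mate ?d x)]))"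
    by (meson UN_least noncrossing_mono)
  have "list_all2 (on_wall m) (word ?d x) (T x)" if "x \<in> set E" for x
    using E[OF that] w i
    by (auto simp: word_simple_diag T_def on_wall_def black_def tN_def tS_def m_def)
  moreover have "distinct (concat (map T E))"
  proof -
    have "distinct E" unfolding E_def node_list_def by (auto simp: distinct_map inj_on_def)
    moreover have "distinct (concat (map T xs))"
      if "distinct xs" for xs
      using that
    proof (induction xs)
      case (Cons x xs)
      have "set (T x) \<inter> (\<Union>y\<in>set xs. set (T y)) = {}"
        using Cons.prems unfolding T_def tN_def tS_def by (auto split: if_splits)
      moreover have "distinct (T x)" by (simp add: T_def)
      ultimately show ?case using Cons by auto
    qed simp
    ultimately show ?thesis by blast
  qed
  moreover have "loops ?d = {#}" by (simp add: simple_diag_def id_diag_def)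
  ultimately show ?thesis
    using nc unfolding deformable_def Let_def m_def[symmetric] E_def[symmetric]
    by (intro exI[of _ T] exI[of _ "[]"]) auto
qed

lemma decorated_simple_diag:
  assumes i: "i \<in> gens n"
    and w: "w = [] \<or> i = 1 \<and> w = [Bullet] \<or> i = n + 1 \<and> w = [Circle]"
  shows "decorated_diagram n (simple_diag n i w)"
proof -
  let ?d = "simple_diag n i w"
  have i': "1 \<le> i" "i \<le> n + 1" using i by (auto simp: gens_bounds)
  have r: "rev w = w" using w by auto
  have 1: "mate ?d x \<in> nodes (n+2) \<and> mate ?d x \<noteq> x \<and> mate ?d (mate ?d x) = x \<and>
      word ?d (mate ?d x) = rev (word ?d x)" if "x \<in> nodes (n + 2)" for x
    using that i' r mate_simple_diag_involution[OF i]
    by (cases x rule: node.exhaust) (auto simp: mate_simple_diag word_simple_diag)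
  have 2: "mate ?d x = x \<and> word ?d x = []" if "x \<notin> nodes (n + 2)" for x
    using that i' by (cases x rule: node.exhaust) (auto simp: mate_simple_diag word_simple_diag)
  have "map (word ?d) (prop_list (n + 2) (mate ?d)) = map (\<lambda>_. []) (prop_list (n + 2) (mate ?d))"
    by (intro map_cong) (auto simp: prop_list_def word_simple_diag mate_simple_diag split: if_splits)
  then have ws: "concat (map (word ?d) (prop_list (n + 2) (mate ?d))) = []" by simp
  have v: "vert ?d = []" by (simp add: simple_diag_def id_diag_def)
  show ?thesis
    unfolding decorated_diagram_def Let_def
    using 1 2 deformable_simple_diag[OF i' w] a_val_simple_diag[OF i, of w] ws v
    by (simp del: add_2_eq_Suc')
qed

lemma decorated_d_gen: "i \<in> gens n \<Longrightarrow> decorated_diagram n (d_gen n i)"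
  unfolding d_gen_eq by (rule decorated_simple_diag) (auto simp: gen_deco_def)

section \<open>Alternating heaps\<close>

text \<open>Consecutive occurrences of letters from \<open>A\<close>. For one column, or two
  adjacent ones, this expresses \<open>just_above\<close>, forks and heap covers by positions in the
  word alone.\<close>

definition nextin :: "nat list \<Rightarrow> nat set \<Rightarrow> nat \<Rightarrow> nat \<Rightarrow> bool" where
  "nextin u A p q \<longleftrightarrow> p < q \<and> q < length u \<and> u ! p \<in> A \<and> u ! q \<in> A \<and> (\<forall>k. p < k \<and> k < q \<longrightarrow> u ! k \<notin> A)"

lemma nextin_exists:
  assumes "p < k" "k < length u" "u ! p \<in> A" "u ! k \<in> A"
  shows "\<exists>q. nextin u A p q \<and> q \<le> k"
proof -
  let ?P = "\<lambda>q. p < q \<and> u ! q \<in> A"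
  have "?P k" using assms by simp
  then have "?P (LEAST q. ?P q)" "(LEAST q. ?P q) \<le> k" by (fact LeastI, fact Least_le)
  moreover have "u ! j \<notin> A" if "p < j" "j < (LEAST q. ?P q)" for j
    using that not_less_Least by blast
  ultimately show ?thesis using assms unfolding nextin_def by (intro exI[of _ "LEAST q. ?P q"]) auto
qed

lemma previn_exists:
  assumes "k < p" "p < length u" "u ! p \<in> A" "u ! k \<in> A"
  shows "\<exists>q. nextin u A q p \<and> k \<le> q"
proof -
  let ?P = "\<lambda>q. q < p \<and> u ! q \<in> A"
  have b: "\<forall>y. ?P y \<longrightarrow> y \<le> p" by simp
  define g where "g = (GREATEST q. ?P q)"
  have "?P k" using assms by simp
  then have "?P g" "k \<le> g"
    unfolding g_def using GreatestI_nat[of ?P k p] Greatest_le_nat[of ?P k p] b by blast+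
  moreover have "u ! j \<notin> A" if "g < j" "j < p" for j
    using that Greatest_le_nat[of ?P j p] b unfolding g_def by fastforce
  ultimately show ?thesis using assms unfolding nextin_def by blast
qed

lemma nextin_unique: "nextin u A p q \<Longrightarrow> nextin u A p q' \<Longrightarrow> q = q'"
  unfolding nextin_def by (cases q q' rule: linorder_cases) auto

lemma previn_unique: "nextin u A p q \<Longrightarrow> nextin u A p' q \<Longrightarrow> p = p'"
  unfolding nextin_def by (cases p p' rule: linorder_cases) auto

lemma distinct_adj_filter_nth:
  assumes d: "distinct_adj (filter P u)" and pq: "p < q" "q < length u" "P (u ! p)" "P (u ! q)"
    and no: "\<And>k. p < k \<Longrightarrow> k < q \<Longrightarrow> \<not> P (u ! k)"
  shows "u ! p \<noteq> u ! q"
proof -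
  define mid where "mid = take (q - p - 1) (drop (p + 1) u)"
  have "u = take p u @ u ! p # drop (p + 1) u" using pq by (simp add: id_take_nth_drop)
  moreover have "drop (p + 1) u = mid @ u ! q # drop (q + 1) u"
    using pq id_take_nth_drop[of "q - p - 1" "drop (p + 1) u"] by (simp add: mid_def)
  ultimately have u: "u = take p u @ u ! p # mid @ u ! q # drop (q + 1) u" by simp
  have "filter P mid = []"
    using no pq by (auto simp: mid_def filter_empty_conv in_set_conv_nth)
  then have "filter P u = filter P (take p u) @ u ! p # u ! q # filter P (drop (q + 1) u)"
    by (subst u) (use pq in simp)
  then show ?thesis using d by (auto simp: distinct_adj_append_iff)
qed

lemma cox_m_ge_3: "n \<ge> 2 \<Longrightarrow> cox_m n i j \<ge> 3 \<longleftrightarrow> j = i + 1 \<or> i = j + 1"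
  by (auto simp: cox_m_def doubleton_eq_iff)

text \<open>Beyond the extreme columns the value is \<open>0\<close> or \<open>n + 2\<close>, which
  is never a letter; \<open>nextv_end\<close> relies on this.\<close>

fun nb :: "hdir \<Rightarrow> nat \<Rightarrow> nat" where
  "nb Rightward c = c + 1"
| "nb Leftward c = c - 1"

definition nextv :: "nat list \<Rightarrow> nat set \<Rightarrow> vdir \<Rightarrow> nat \<Rightarrow> nat \<Rightarrow> bool" where
  "nextv u A v p q \<longleftrightarrow> (if v = Downward then nextin u A p q else nextin u A q p)"

lemma nextv_unique: "nextv u A v p q \<Longrightarrow> nextv u A v p q' \<Longrightarrow> q = q'"
  by (cases v) (auto simp: nextv_def intro: nextin_unique previn_unique)

lemma nextv_flip: "nextv u A v p q \<longleftrightarrow> nextv u A (vflip v) q p"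
  by (cases v) (auto simp: nextv_def)

lemma nextv_bounds: "nextv u A v p q \<Longrightarrow> p < length u \<and> q < length u \<and> p \<noteq> q"
  by (cases v) (auto simp: nextv_def nextin_def)

lemma nextv_in: "nextv u A v p q \<Longrightarrow> u ! p \<in> A \<and> u ! q \<in> A"
  by (cases v) (auto simp: nextv_def nextin_def)

lemma nextv_exists:
  assumes "(if v = Downward then p < k else k < p)" "p < length u" "k < length u" "u ! p \<in> A" "u ! k \<in> A"
  shows "\<exists>q. nextv u A v p q"
proof (cases v)
  case Upward
  then show ?thesis using assms previn_exists[of k p u A] by (auto simp: nextv_def)
next
  case Downward
  then show ?thesis using assms nextin_exists[of p k u A] by (auto simp: nextv_def)
qed

lemma nextin_cong_on:
  assumes "set u \<inter> A = set u \<inter> B" shows "nextin u A p q \<longleftrightarrow> nextin u B p q"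
proof -
  have "u ! k \<in> A \<longleftrightarrow> u ! k \<in> B" if "k < length u" for k
    using assms nth_mem[OF that] by blast
  then show ?thesis unfolding nextin_def by (metis less_trans)
qed

lemma nextv_cong_on:
  assumes "set u \<inter> A = set u \<inter> B" shows "nextv u A v p q \<longleftrightarrow> nextv u B v p q"
  using nextin_cong_on[OF assms] by (simp add: nextv_def)

locale alternating_word =
  fixes n :: nat and u :: "nat list"
  assumes n2: "n \<ge> 2" and gens: "set u \<subseteq> gens n" and alternating: "alternating n u"
begin

lemma letter: "i < length u \<Longrightarrow> 1 \<le> u ! i \<and> u ! i \<le> n + 1"
  using gens nth_mem[of i u] gens_bounds by blast

lemma nextin_neq:
  assumes "nextin u {c, d} p q" "d = c + 1 \<or> c = d + 1" "c \<in> gens n" "d \<in> gens n"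
  shows "u ! p \<noteq> u ! q"
proof -
  have "distinct_adj (filter (\<lambda>x. x = c \<or> x = d) u)"
    using alternating assms(2-) cox_m_ge_3[OF n2] unfolding alternating_def by blast
  then show ?thesis
    by (rule distinct_adj_filter_nth) (use assms(1) in \<open>auto simp: nextin_def\<close>)
qed

text \<open>The chain of the letters \<open>c\<close> and \<open>d\<close> alternates: what follows
  \<open>p\<close> in it is a \<open>d\<close>, and what follows that \<open>d\<close> is a
  \<open>c\<close>, hence \<open>q\<close>. This provides the middle nodes of forks and lets
  adjacent columns advance in step.\<close>

lemma between_exists:
  assumes "nextin u {c} p q" "d = c + 1 \<or> c = d + 1" "c \<in> gens n" "d \<in> gens n"
  shows "\<exists>k. nextin u {c, d} p k \<and> nextin u {c, d} k q \<and> u ! k = d"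
proof -
  have pq: "p < q" "q < length u" "u ! p = c" "u ! q = c" using assms(1) by (auto simp: nextin_def)
  then obtain k where k: "nextin u {c, d} p k" "k \<le> q" using nextin_exists[of p q u "{c, d}"] by auto
  then have "u ! k = d" using nextin_neq[OF k(1) assms(2-)] pq by (auto simp: nextin_def)
  then have "k < q" using k(2) pq assms(2) by (metis le_neq_implies_less n_not_Suc_n Suc_eq_plus1)
  then obtain k' where k': "nextin u {c, d} k k'" "k' \<le> q"
    using nextin_exists[of k q u "{c, d}"] pq \<open>u ! k = d\<close> by auto
  have "u ! k' = c" using nextin_neq[OF k'(1) assms(2-)] \<open>u ! k = d\<close> k'(1) by (auto simp: nextin_def)
  moreover have "p < k'" using k(1) k'(1) by (auto simp: nextin_def)
  ultimately have "k' = q" using assms(1) k'(2) by (auto simp: nextin_def)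
  then show ?thesis using k(1) k'(1) \<open>u ! k = d\<close> by blast
qed

lemma neighbour: "c \<in> gens n \<Longrightarrow> \<exists>d\<in>gens n. d = c + 1 \<or> c = d + 1"
  using n2 by (intro bexI[of _ "if c = 1 then 2 else c - 1"]) (auto simp: gens_bounds)

abbreviation hstep :: "nat \<Rightarrow> nat \<Rightarrow> bool" where
  "hstep i j \<equiv> i < j \<and> j < length u \<and> cox_m n (u ! i) (u ! j) \<ge> 3"

lemma heap_lessI: "i < j \<Longrightarrow> j < length u \<Longrightarrow> u ! j = u ! i + 1 \<or> u ! i = u ! j + 1 \<Longrightarrow> heap_less n u i j"
  unfolding heap_less_def using cox_m_ge_3[OF n2] by (intro tranclp.r_into_trancl) blast

lemma heap_less_trans: "heap_less n u i j \<Longrightarrow> heap_less n u j k \<Longrightarrow> heap_less n u i k"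
  unfolding heap_less_def by (rule tranclp_trans)

lemma heap_less_bounds:
  assumes "heap_less n u i j" shows "i < j \<and> j < length u"
  using assms unfolding heap_less_def by (induction rule: tranclp_induct) auto

lemma heap_less_first:
  assumes "heap_less n u i j"
  shows "\<exists>k. i < k \<and> k \<le> j \<and> (u ! k = u ! i + 1 \<or> u ! i = u ! k + 1) \<and> (k = j \<or> heap_less n u k j)"
proof -
  obtain k where k: "hstep i k" "hstep\<^sup>*\<^sup>* k j"
    using tranclpD[OF assms[unfolded heap_less_def]] by blast
  have "k = j \<or> heap_less n u k j"
    unfolding heap_less_def using rtranclpD[OF k(2)] by blast
  moreover from this have "k \<le> j" using heap_less_bounds[of k j] by (elim disjE) simp_all
  moreover have "u ! k = u ! i + 1 \<or> u ! i = u ! k + 1" using k(1) cox_m_ge_3[OF n2] by blast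
  ultimately show ?thesis using k(1) by blast
qed

lemma heap_less_last:
  assumes "heap_less n u i j"
  shows "\<exists>k. i \<le> k \<and> k < j \<and> (u ! j = u ! k + 1 \<or> u ! k = u ! j + 1) \<and> (k = i \<or> heap_less n u i k)"
  using assms[unfolded heap_less_def]
proof (induction rule: tranclp_induct)
  case (base y)
  then show ?case using cox_m_ge_3[OF n2] by (intro exI[of _ i]) auto
next
  case (step y z)
  then have "heap_less n u i y" unfolding heap_less_def by simp
  then show ?case
    using step(2) cox_m_ge_3[OF n2] heap_less_bounds[of i y] by (intro exI[of _ y]) auto
qed

text \<open>\<open>cox_m\<close> is 1 for equal labels, so two nodes of one column are not directly
  related. A node of a neighbouring column, which alternation puts between them, relates
  them.\<close>

lemma heap_less_same:
  assumes "i < j" "j < length u" "u ! i = u ! j" shows "heap_less n u i j"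
proof -
  let ?c = "u ! i"
  have "?c \<in> gens n" using gens assms by auto
  then obtain d where d: "d \<in> gens n" "d = ?c + 1 \<or> ?c = d + 1" using neighbour by blast
  obtain q where q: "nextin u {?c} i q" "q \<le> j" using nextin_exists[of i j u "{?c}"] assms by auto
  obtain k where "nextin u {?c, d} i k" "nextin u {?c, d} k q" "u ! k = d"
    using between_exists[OF q(1) d(2) \<open>?c \<in> gens n\<close> d(1)] by blast
  then have k: "i < k" "k < j" "u ! k = d" using q(2) by (auto simp: nextin_def)
  then have "heap_less n u i k" "heap_less n u k j"
    using d assms by (auto intro!: heap_lessI)
  then show ?thesis by (rule heap_less_trans)
qed

text \<open>Labels change by one along a generating relation, so a chain cannot jump over column
  \<open>b\<close>.\<close>

lemma heap_less_crosses_column: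
  assumes "heap_less n u i j" "u ! i < b \<and> b < u ! j \<or> u ! j < b \<and> b < u ! i"
  shows "\<exists>k. i < k \<and> k < j \<and> u ! k = b"
  using assms(1)[unfolded heap_less_def] assms(2)
proof (induction rule: tranclp_induct)
  case (base y)
  then show ?case using cox_m_ge_3[OF n2] by auto
next
  case (step y z)
  have iy: "i < y" using step(1) heap_less_bounds unfolding heap_less_def by blast
  have yz: "y < z" "u ! z = u ! y + 1 \<or> u ! y = u ! z + 1" using step(2) cox_m_ge_3[OF n2] by auto
  show ?case
  proof (cases "u ! y = b")
    case True
    then show ?thesis using iy yz by blast
  next
    case False
    then have "u ! i < b \<and> b < u ! y \<or> u ! y < b \<and> b < u ! i" using step.prems yz(2) by auto
    then show ?thesis using step.IH yz(1) by fastforce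
  qed
qed

text \<open>Suppose that a node of another column lies between \<open>p\<close> and \<open>q\<close>
  in the heap. The chain joining it to the node in the column farther from it passes through the
  nearer column, and so meets a letter that \<open>nextin\<close> excludes.\<close>

lemma heap_cover_iff:
  assumes "u ! q = u ! p + 1 \<or> u ! p = u ! q + 1"
  shows "heap_cover n u p q \<longleftrightarrow> nextin u {u ! p, u ! q} p q"
proof
  assume c: "heap_cover n u p q"
  then have pq: "p < q" "q < length u" using heap_less_bounds[of p q] unfolding heap_cover_def by auto
  have "u ! k \<notin> {u ! p, u ! q}" if k: "p < k" "k < q" for k
  proof
    assume "u ! k \<in> {u ! p, u ! q}"
    then have "heap_less n u p k" "heap_less n u k q"
      using k pq assms heap_less_same[of p k] heap_less_same[of k q] heap_lessI[of p k] heap_lessI[of k q] by auto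
    then show False using c unfolding heap_cover_def by blast
  qed
  then show "nextin u {u ! p, u ! q} p q" using pq by (auto simp: nextin_def)
next
  assume nx: "nextin u {u ! p, u ! q} p q"
  then have pq: "p < q" "q < length u" by (auto simp: nextin_def)
  have no: "u ! k \<noteq> u ! p \<and> u ! k \<noteq> u ! q" if "p < k" "k < q" for k
    using nx that by (auto simp: nextin_def)
  have False if k: "heap_less n u p k" "heap_less n u k q" for k
  proof -
    have b: "p < k" "k < q" using heap_less_bounds[OF k(1)] heap_less_bounds[OF k(2)] by auto
    have nk: "u ! k \<noteq> u ! p" "u ! k \<noteq> u ! q" using no[OF b] by auto
    consider "u ! q < u ! k \<and> u ! q = u ! p + 1" | "u ! k < u ! p \<and> u ! q = u ! p + 1"
      | "u ! p < u ! k \<and> u ! p = u ! q + 1" | "u ! k < u ! q \<and> u ! p = u ! q + 1"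
      using nk assms by linarith
    then show False
    proof cases
      case 1
      then obtain j where "p < j" "j < k" "u ! j = u ! q"
        using heap_less_crosses_column[OF k(1), of "u ! q"] by auto
      then show False using no[of j] b by auto
    next
      case 2
      then obtain j where "k < j" "j < q" "u ! j = u ! p"
        using heap_less_crosses_column[OF k(2), of "u ! p"] by auto
      then show False using no[of j] b by auto
    next
      case 3
      then obtain j where "k < j" "j < q" "u ! j = u ! p"
        using heap_less_crosses_column[OF k(2), of "u ! p"] by auto
      then show False using no[of j] b by auto
    next
      case 4
      then obtain j where "p < j" "j < k" "u ! j = u ! q"
        using heap_less_crosses_column[OF k(1), of "u ! q"] by auto
      then show False using no[of j] b by auto
    qed
  qed
  then show "heap_cover n u p q" using heap_lessI[OF pq assms] unfolding heap_cover_def by blast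
qed

lemma is_step_iff:
  assumes "i < length u"
  shows "is_step n u h v i j \<longleftrightarrow> nextv u {u ! i, nb h (u ! i)} v i j \<and> u ! j = nb h (u ! i)"
proof -
  have *: "(if h = Rightward then u ! j = u ! i + 1 else u ! i = u ! j + 1) \<longleftrightarrow> u ! j = nb h (u ! i)"
    using letter[OF assms] by (cases h) auto
  show ?thesis
  proof (cases "u ! j = nb h (u ! i)")
    case True
    then have adj: "u ! j = u ! i + 1 \<or> u ! i = u ! j + 1" using letter[OF assms] by (cases h) auto
    have c1: "heap_cover n u i j \<longleftrightarrow> nextin u {u ! i, u ! j} i j"
      by (rule heap_cover_iff) (rule adj)
    have "heap_cover n u j i \<longleftrightarrow> nextin u {u ! j, u ! i} j i"
      by (rule heap_cover_iff) (use adj in blast)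
    then have c2: "heap_cover n u j i \<longleftrightarrow> nextin u {u ! i, u ! j} j i" by (simp only: insert_commute)
    show ?thesis
      using * True c1 c2 unfolding is_step_def nextv_def True[symmetric] by argo
  qed (use * in \<open>auto simp: is_step_def\<close>)
qed

lemma step_to_iff:
  assumes "i < length u"
  shows "step_to n u h v i = Some j \<longleftrightarrow> nextv u {u ! i, nb h (u ! i)} v i j \<and> u ! j = nb h (u ! i)"
proof -
  have u1: "j = j'" if "is_step n u h v i j" "is_step n u h v i j'" for j j'
    using that nextv_unique[of u "{u ! i, nb h (u ! i)}" v i j j'] unfolding is_step_iff[OF assms] by blast
  show ?thesis
  proof (cases "\<exists>j. is_step n u h v i j")
    case True
    then obtain k where k: "is_step n u h v i k" by blast
    then have "(THE j. is_step n u h v i j) = k" using u1 by blast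
    then show ?thesis using k u1 True unfolding step_to_def is_step_iff[OF assms, symmetric] by auto
  next
    case False
    then show ?thesis unfolding step_to_def is_step_iff[OF assms, symmetric] by auto
  qed
qed

lemma nextv_letter:
  assumes "nextv u {u ! i, nb h (u ! i)} v i j" "u ! i \<noteq> end_column n h"
  shows "u ! j = nb h (u ! i)"
proof -
  have i: "i < length u" using nextv_bounds[OF assms(1)] by simp
  have "u ! i \<in> gens n \<and> nb h (u ! i) \<in> gens n \<and> (nb h (u ! i) = u ! i + 1 \<or> u ! i = nb h (u ! i) + 1)"
    using letter[OF i] assms(2) by (cases h) (auto simp: gens_bounds)
  then have "u ! i \<noteq> u ! j"
    using assms(1) nextin_neq[of "u ! i" "nb h (u ! i)" i j] nextin_neq[of "u ! i" "nb h (u ! i)" j i]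
    by (cases v) (auto simp: nextv_def)
  then show ?thesis using nextv_in[OF assms(1)] by auto
qed

lemma step_to_inner:
  assumes "i < length u" "u ! i \<noteq> end_column n h"
  shows "step_to n u h v i = Some j \<longleftrightarrow> nextv u {u ! i, nb h (u ! i)} v i j"
  unfolding step_to_iff[OF assms(1)] using nextv_letter[of i h v j] assms(2) by argo

lemma step_to_end:
  assumes "i < length u" "u ! i = end_column n h" shows "step_to n u h v i = None"
proof (rule ccontr)
  assume "step_to n u h v i \<noteq> None"
  then obtain j where "nextv u {u ! i, nb h (u ! i)} v i j" "u ! j = nb h (u ! i)"
    using step_to_iff[OF assms(1)] by blast
  then have "j < length u" "u ! j = nb h (u ! i)" using nextv_bounds by blast+
  then show False using letter[of j] assms(2) by (cases h) auto
qed

lemma nextv_end: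
  assumes "u ! i = end_column n h"
  shows "nextv u {u ! i, nb h (u ! i)} v i j \<longleftrightarrow> nextv u {u ! i} v i j"
proof -
  have "nb h (u ! i) \<notin> set u" using assms gens by (cases h) (auto simp: gens_bounds)
  then show ?thesis by (intro nextv_cong_on) auto
qed

lemma just_above_iff: "just_above n u p q \<longleftrightarrow> nextin u {u ! q} p q"
proof
  assume j: "just_above n u p q"
  then have "p < q" "q < length u" "u ! p = u ! q"
    using heap_less_bounds[of p q] unfolding just_above_def by auto
  moreover have "u ! k \<noteq> u ! q" if k: "p < k" "k < q" for k
  proof
    assume "u ! k = u ! q"
    then have "heap_less n u p k" "heap_less n u k q"
      using k calculation heap_less_same[of p k] heap_less_same[of k q] by auto
    then show False using j \<open>u ! k = u ! q\<close> unfolding just_above_def by blast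
  qed
  ultimately show "nextin u {u ! q} p q" by (auto simp: nextin_def)
next
  assume nx: "nextin u {u ! q} p q"
  then have pq: "p < q" "q < length u" "u ! p = u ! q" "\<And>k. p < k \<Longrightarrow> k < q \<Longrightarrow> u ! k \<noteq> u ! q"
    unfolding nextin_def by blast+
  have "heap_less n u p q" by (rule heap_less_same) fact+
  moreover have "\<not> (u ! k = u ! q \<and> heap_less n u p k \<and> heap_less n u k q)" for k
    using pq(4)[of k] heap_less_bounds[of p k] heap_less_bounds[of k q] by blast
  ultimately show "just_above n u p q"
    using pq(3) unfolding just_above_def by blast
qed

text \<open>An extreme column has only one adjacent column, and alternation puts exactly one node of
  it between consecutive nodes of the extreme one. So the convexity of the chain is
  automatic.\<close>

lemma is_fork_iff:
  assumes s: "s = 1 \<and> s' = 2 \<or> s = n + 1 \<and> s' = n"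
  shows "is_fork n u s s' (t, b) \<longleftrightarrow> nextin u {s} t b"
proof
  assume "is_fork n u s s' (t, b)"
  then obtain k where k: "heap_less n u t k" "heap_less n u k b" "u ! t = s" "u ! k = s'" "u ! b = s"
    "\<And>x. heap_less n u t x \<Longrightarrow> heap_less n u x b \<Longrightarrow> x = k" unfolding is_fork_def prod.case by blast
  have tb: "t < b" "b < length u" using heap_less_bounds[OF k(1)] heap_less_bounds[OF k(2)] by auto
  have "u ! j \<noteq> s" if j: "t < j" "j < b" for j
  proof
    assume "u ! j = s"
    then have "heap_less n u t j" "heap_less n u j b"
      using j tb k(3,5) heap_less_same[of t j] heap_less_same[of j b] by auto
    then show False using k(4,6) \<open>u ! j = s\<close> s n2 by auto
  qed
  then show "nextin u {s} t b" using tb k(3,5) by (auto simp: nextin_def)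
next
  assume nx: "nextin u {s} t b"
  then have tb: "t < b" "b < length u" "u ! t = s" "u ! b = s" by (auto simp: nextin_def)
  have sg: "s \<in> gens n" "s' \<in> gens n" "s' = s + 1 \<or> s = s' + 1" using s n2 by (auto simp: gens_bounds)
  from between_exists[OF nx sg(3,1,2)] obtain k where
    k: "nextin u {s, s'} t k" "nextin u {s, s'} k b" "u ! k = s'" by blast
  have only: "x = k" if "t < x" "x < b" "u ! x = s'" for x
    using k that by (metis insertCI linorder_neqE_nat nextin_def)
  have nbs: "u ! y = s'" if "y < length u" "u ! y = s + 1 \<or> s = u ! y + 1" for y
    using s letter[OF that(1)] that(2) by auto
  have "x = k" if x: "heap_less n u t x" "heap_less n u x b" for x
  proof -
    have xb: "t < x" "x < b" using heap_less_bounds[OF x(1)] heap_less_bounds[OF x(2)] by auto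
    obtain y where y: "t < y" "y \<le> x" "u ! y = s + 1 \<or> s = u ! y + 1" "y = x \<or> heap_less n u y x"
      using heap_less_first[OF x(1)] tb by auto
    have "y = k" using only[of y] nbs[of y] y xb tb by auto
    obtain z where z: "x \<le> z" "z < b" "s = u ! z + 1 \<or> u ! z = s + 1" "z = x \<or> heap_less n u x z"
      using heap_less_last[OF x(2)] tb by auto
    have "z = k" using only[of z] nbs[of z] z xb tb by auto
    show "x = k" using \<open>y = k\<close> \<open>z = k\<close> y z by auto
  qed
  moreover have "heap_less n u t k" "heap_less n u k b"
    using k sg tb by (auto simp: nextin_def intro!: heap_lessI)
  ultimately show "is_fork n u s s' (t, b)" 
    using tb k(3) unfolding is_fork_def prod.case by blast
qed

lemma left_forks_iff: "(t, b) \<in> left_forks n u \<longleftrightarrow> nextin u {1} t b"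
  by (simp add: left_forks_def is_fork_iff)

lemma right_forks_iff: "(t, b) \<in> right_forks n u \<longleftrightarrow> nextin u {n + 1} t b"
  by (simp add: right_forks_def is_fork_iff)

lemma forks_iff: "(t, b) \<in> forks n u \<longleftrightarrow> nextin u {u ! b} t b \<and> (u ! b = 1 \<or> u ! b = n + 1)"
proof -
  have *: "nextin u {c} t b \<longleftrightarrow> nextin u {u ! b} t b \<and> u ! b = c" for c
    by (auto simp: nextin_def)
  show ?thesis
    unfolding forks_def Un_iff left_forks_iff right_forks_iff *[of 1] *[of "n + 1"] by blast
qed

lemma forks_unique: "(t, b) \<in> forks n u \<Longrightarrow> (t', b) \<in> forks n u \<Longrightarrow> t = t'"
  unfolding forks_iff using previn_unique[of u "{u ! b}" t b t'] by blast

end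

section \<open>Snake paths and strands\<close>

text \<open>The letter \<open>i\<close> lies between the levels \<open>i\<close> and
  \<open>i + 1\<close>: from above it is met at \<open>i\<close>, from below at
  \<open>i + 1\<close>.\<close>

definition arrive :: "vdir \<Rightarrow> nat \<Rightarrow> nat" where
  "arrive v i = (if v = Downward then i else i + 1)"

text \<open>The letter \<open>c\<close> touches the box columns \<open>c\<close> and
  \<open>c + 1\<close>; a path going right arrives on the left one.\<close>

definition leg :: "hdir \<Rightarrow> nat \<Rightarrow> nat" where
  "leg h c = (if h = Rightward then c else c + 1)"

text \<open>The point at which a strand meets the node \<open>i\<close> of the heap when the snake path reaches
  \<open>i\<close> in the state \<open>(i, h, v)\<close>.\<close>

definition arrival :: "nat list \<Rightarrow> state \<Rightarrow> point" where
  "arrival u s = (case s of (i, h, v) \<Rightarrow> (arrive v i, leg h (u ! i), v))"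

text \<open>A fork is recorded at the turn on top of its lower extreme node. This turn starts
  \<open>Downward\<close> in both orientations, so a strand and its reversal record the same
  forks.\<close>

definition fork_out :: "nat \<Rightarrow> nat list \<Rightarrow> point \<Rightarrow> (nat \<times> nat) list" where
  "fork_out n u s = (case s of (g, x, v) \<Rightarrow>
     if v = Downward \<and> turn_letter u s \<noteq> None \<and> (\<exists>t. (t, g) \<in> forks n u)
     then [(THE t. (t, g) \<in> forks n u, g)] else [])"

lemma vflip_eq [simp]: "vflip v = Downward \<longleftrightarrow> v = Upward" "vflip v = Upward \<longleftrightarrow> v = Downward"
  by (cases v; simp)+

lemma fork_out_srev:
  assumes "sstep u s = Some t" shows "fork_out n u (srev t) = rev (fork_out n u s)"
  using assms turn_letter_srev[OF assms]
  by (cases "(u, s)" rule: sstep.cases) (auto simp: fork_out_def split: if_splits)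

lemma outputs_without_turn:
  assumes "\<forall>s\<in>set ls. turn_letter u s = None"
  shows "concat (map (deco_out c u) ls) = []" "concat (map (fork_out n u) ls) = []"
  using assms by (auto simp: deco_out_def fork_out_def split: prod.splits)

lemma travel_down:
  assumes "g \<le> g'" "g' \<le> length u" "\<And>k. g \<le> k \<Longrightarrow> k < g' \<Longrightarrow> x \<noteq> u ! k \<and> x \<noteq> u ! k + 1"
  shows "\<exists>ls. walk (sstep u) (g, x, Downward) ls (g', x, Downward) \<and> (\<forall>s\<in>set ls. turn_letter u s = None)"
  using assms
proof (induction "g' - g" arbitrary: g)
  case 0
  then show ?case by (intro exI[of _ "[]"]) auto
next
  case (Suc k)
  have "\<exists>ls. walk (sstep u) (Suc g, x, Downward) ls (g', x, Downward) \<and> (\<forall>s\<in>set ls. turn_letter u s = None)"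
    by (rule Suc(1)) (use Suc(2-) in auto)
  then obtain ls where "walk (sstep u) (Suc g, x, Downward) ls (g', x, Downward)" "\<forall>s\<in>set ls. turn_letter u s = None"
    by blast
  moreover have "g < length u" "x \<noteq> u ! g" "x \<noteq> u ! g + 1" using Suc(2-) by auto
  ultimately show ?case by (intro exI[of _ "(g, x, Downward) # ls"]) auto
qed

lemma travel_up:
  assumes "g' \<le> g" "g \<le> length u" "\<And>k. g' \<le> k \<Longrightarrow> k < g \<Longrightarrow> x \<noteq> u ! k \<and> x \<noteq> u ! k + 1"
  shows "\<exists>ls. walk (sstep u) (g, x, Upward) ls (g', x, Upward) \<and> (\<forall>s\<in>set ls. turn_letter u s = None)"
  using assms
proof (induction "g - g'" arbitrary: g)
  case 0
  then show ?case by (intro exI[of _ "[]"]) auto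
next
  case (Suc k)
  have "\<exists>ls. walk (sstep u) (g - 1, x, Upward) ls (g', x, Upward) \<and> (\<forall>s\<in>set ls. turn_letter u s = None)"
    by (rule Suc(1)) (use Suc(2-) in auto)
  then obtain ls where "walk (sstep u) (g - 1, x, Upward) ls (g', x, Upward)" "\<forall>s\<in>set ls. turn_letter u s = None"
    by blast
  moreover have "0 < g" "x \<noteq> u ! (g - 1)" "x \<noteq> u ! (g - 1) + 1" using Suc(2-) by auto
  ultimately show ?case using Suc(4) by (intro exI[of _ "(g, x, Upward) # ls"]) auto
qed

lemma travel:
  assumes "nextv u A v p q" "\<And>k. k < length u \<Longrightarrow> x = u ! k \<or> x = u ! k + 1 \<Longrightarrow> u ! k \<in> A"
  shows "\<exists>ls. walk (sstep u) (arrive (vflip v) p, x, v) ls (arrive v q, x, v) \<and> (\<forall>s\<in>set ls. turn_letter u s = None)"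
proof (cases v)
  case Downward
  then have nx: "nextin u A p q" using assms(1) by (simp add: nextv_def)
  have "x \<noteq> u ! k \<and> x \<noteq> u ! k + 1" if "p + 1 \<le> k" "k < q" for k
    using nx assms(2)[of k] that unfolding nextin_def by fastforce
  moreover have "p + 1 \<le> q" "q \<le> length u" using nx by (auto simp: nextin_def)
  ultimately show ?thesis unfolding arrive_def Downward
    using travel_down[of "p + 1" q u x] by simp
next
  case Upward
  then have nx: "nextin u A q p" using assms(1) by (simp add: nextv_def)
  have "x \<noteq> u ! k \<and> x \<noteq> u ! k + 1" if "q + 1 \<le> k" "k < p" for k
    using nx assms(2)[of k] that unfolding nextin_def by fastforce
  moreover have "q + 1 \<le> p" "p \<le> length u" using nx by (auto simp: nextin_def)
  ultimately show ?thesis unfolding arrive_def Upward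
    using travel_up[of "q + 1" p u x] by simp
qed

lemma travel_out:
  assumes "\<not> (\<exists>q. nextv u A v p q)" "p < length u" "u ! p \<in> A"
    "\<And>k. k < length u \<Longrightarrow> x = u ! k \<or> x = u ! k + 1 \<Longrightarrow> u ! k \<in> A"
  shows "\<exists>ls. walk (sstep u) (arrive (vflip v) p, x, v) ls (finish u (if v = Downward then South x else North x)) \<and>
    (\<forall>s\<in>set ls. turn_letter u s = None)"
proof -
  have no: "u ! k \<notin> A" if "if v = Downward then p < k else k < p" "k < length u" for k
    using nextv_exists[of v p k u A] assms(1-3) that by blast
  have nt: "x \<noteq> u ! k \<and> x \<noteq> u ! k + 1" if "if v = Downward then p < k else k < p" "k < length u" for k
    using no[OF that] assms(4)[OF that(2)] by blast
  show ?thesis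
  proof (cases v)
    case Downward
    then show ?thesis unfolding arrive_def
      using travel_down[of "p + 1" "length u" u x] assms(2) nt by simp
  next
    case Upward
    then show ?thesis unfolding arrive_def
      using travel_up[of 0 p u x] assms(2) nt by simp
  qed
qed

context alternating_word
begin

lemma sstep_arrival:
  assumes "i < length u"
  shows "sstep u (arrival u (i, h, v)) = Some (arrive v i, leg (hflip h) (u ! i), vflip v)"
    and "turn_letter u (arrival u (i, h, v)) = Some i"
  using assms by (cases v; cases h; auto simp: arrival_def arrive_def leg_def)+

lemma touching_leg:
  assumes "1 \<le> c" shows "leg (hflip h) c = k \<or> leg (hflip h) c = k + 1 \<longleftrightarrow> k \<in> {c, nb h c}"
  using assms by (cases h) (auto simp: leg_def)

text \<open>After the turn at \<open>i\<close> the strand runs on the other leg, a box column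
  touched only by the letters \<open>u ! i\<close> and \<open>nb h (u ! i)\<close>, until the next
  of these occurs. If that letter is in the column of \<open>i\<close> again, the horizontal
  direction is reversed, hence the conditional.\<close>

lemma turn_and_travel:
  assumes "nextv u {u ! i, nb h (u ! i)} (vflip v) i q"
  shows "\<exists>ls. walk (sstep u) (arrival u (i, h, v)) ls
      (arrival u (q, if u ! q = leg (hflip h) (u ! i) then Rightward else Leftward, vflip v)) \<and>
    ls \<noteq> [] \<and> concat (map (deco_out c u) ls) = c (u ! i) \<and>
    concat (map (fork_out n u) ls) = fork_out n u (arrival u (i, h, v))"
proof -
  have i: "i < length u" "q < length u" using nextv_bounds[OF assms] by auto
  let ?x = "leg (hflip h) (u ! i)"
  have t: "?x = u ! k \<or> ?x = u ! k + 1 \<longleftrightarrow> u ! k \<in> {u ! i, nb h (u ! i)}" for k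
    using touching_leg letter[OF i(1)] by blast
  obtain ls where ls: "walk (sstep u) (arrive v i, ?x, vflip v) ls (arrive (vflip v) q, ?x, vflip v)"
    "\<forall>s\<in>set ls. turn_letter u s = None"
    using travel[OF assms, of ?x] t by auto
  have "?x = leg (if u ! q = ?x then Rightward else Leftward) (u ! q)"
    using t[of q] nextv_in[OF assms] by (auto simp: leg_def[of _ "u ! q"])
  then have e: "(arrive (vflip v) q, ?x, vflip v) = arrival u (q, if u ! q = ?x then Rightward else Leftward, vflip v)"
    by (simp only: arrival_def prod.case)
  have "walk (sstep u) (arrival u (i, h, v)) (arrival u (i, h, v) # ls) (arrive (vflip v) q, ?x, vflip v)"
    using ls(1) sstep_arrival(1)[OF i(1)] by simp
  then show ?thesis
    using outputs_without_turn[OF ls(2)] sstep_arrival(2)[OF i(1), of h v]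
    unfolding e by (intro exI[of _ "arrival u (i, h, v) # ls"]) (simp add: deco_out_def[of c u "arrival u (i, h, v)"])
qed

lemma end_node_eq: "end_node u (i, h, v) = (if v = Downward then North else South) (leg (hflip h) (u ! i))"
  by (cases h; cases v) (auto simp: leg_def)

lemma turn_and_exit:
  assumes "\<not> (\<exists>q. nextv u {u ! i, nb h (u ! i)} (vflip v) i q)" "i < length u"
  shows "\<exists>ls. walk (sstep u) (arrival u (i, h, v)) ls (finish u (end_node u (i, h, v))) \<and>
    concat (map (deco_out c u) ls) = c (u ! i) \<and>
    concat (map (fork_out n u) ls) = fork_out n u (arrival u (i, h, v))"
proof -
  let ?x = "leg (hflip h) (u ! i)"
  have t: "?x = u ! k \<or> ?x = u ! k + 1 \<longleftrightarrow> u ! k \<in> {u ! i, nb h (u ! i)}" for k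
    using touching_leg letter[OF assms(2)] by blast
  obtain ls where ls: "walk (sstep u) (arrive v i, ?x, vflip v) ls
      (finish u (if vflip v = Downward then South ?x else North ?x))"
    "\<forall>s\<in>set ls. turn_letter u s = None"
    using travel_out[OF assms, of ?x] t by auto
  have e: "(if vflip v = Downward then South ?x else North ?x) = end_node u (i, h, v)"
    by (cases v) (simp_all add: end_node_eq)
  have "walk (sstep u) (arrival u (i, h, v)) (arrival u (i, h, v) # ls) (finish u (end_node u (i, h, v)))"
    using ls(1) sstep_arrival(1)[OF assms(2)] unfolding e by simp
  then show ?thesis
    using outputs_without_turn[OF ls(2)] sstep_arrival(2)[OF assms(2), of h v]
    by (intro exI[of _ "arrival u (i, h, v) # ls"]) (simp add: deco_out_def[of c u "arrival u (i, h, v)"])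
qed

text \<open>Names the local function of \<open>path_next\<close>, so that it can be folded and
  rewritten.\<close>

definition beyond :: "vdir \<Rightarrow> nat \<Rightarrow> nat \<Rightarrow> bool" where
  "beyond v i p \<longleftrightarrow> (if v = Downward then just_above n u p i else just_above n u i p)"

lemma beyond_iff: "beyond v i p \<longleftrightarrow> nextv u {u ! i} (vflip v) i p"
proof -
  have "nextin u {u ! p} i p \<longleftrightarrow> nextin u {u ! i} i p" by (auto simp: nextin_def)
  then show ?thesis by (cases v) (auto simp: beyond_def nextv_def just_above_iff)
qed

lemma end_column_hflip: "u ! i = end_column n h \<Longrightarrow> u ! i \<noteq> end_column n (hflip h)"
  using n2 by (cases h) auto

lemma path_next_inner:
  assumes "i < length u" "u ! i \<noteq> end_column n h"
  shows "path_next n u (i, h, v) =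
    (if \<exists>q. nextv u {u ! i, nb h (u ! i)} (vflip v) i q
     then Some ((THE q. nextv u {u ! i, nb h (u ! i)} (vflip v) i q, h, vflip v), None) else None)"
proof (cases "\<exists>q. nextv u {u ! i, nb h (u ! i)} (vflip v) i q")
  case True
  then obtain q where q: "nextv u {u ! i, nb h (u ! i)} (vflip v) i q" by blast
  then have "(THE q. nextv u {u ! i, nb h (u ! i)} (vflip v) i q) = q"
    by (intro the_equality) (auto intro: nextv_unique)
  then show ?thesis using q step_to_inner[OF assms, of "vflip v" q] by auto
next
  case False
  then have "step_to n u h (vflip v) i = None"
    using step_to_inner[OF assms, of "vflip v"] by (cases "step_to n u h (vflip v) i") auto
  then show ?thesis using False assms(2) by (auto simp: Let_def)
qed

lemma path_next_end:
  assumes "i < length u" "u ! i = end_column n h"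
  shows "\<not> (\<exists>p. beyond v i p) \<Longrightarrow> path_next n u (i, h, v) = None"
    and "beyond v i p \<Longrightarrow> \<exists>j. nextv u {u ! p, nb (hflip h) (u ! p)} v p j \<and> u ! j = nb (hflip h) (u ! i) \<and>
      path_next n u (i, h, v) = Some ((j, hflip h, v), Some (if v = Downward then (p, i) else (i, p)))"
proof -
  have st: "step_to n u h (vflip v) i = None" by (rule step_to_end[OF assms])
  show "\<not> (\<exists>p. beyond v i p) \<Longrightarrow> path_next n u (i, h, v) = None"
    using st by (simp add: beyond_def Let_def)
  assume b: "beyond v i p"
  then have nx: "nextv u {u ! i} (vflip v) i p" by (simp only: beyond_iff)
  have p: "p < length u" "u ! p = u ! i" using nextv_bounds[OF nx] nextv_in[OF nx] by auto
  then have pe: "u ! p \<noteq> end_column n (hflip h)" using end_column_hflip assms(2) by metis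
  have the: "(THE p. beyond v i p) = p"
    using b nextv_unique unfolding beyond_iff by blast
  have "nextv u {u ! p} v p i" using nx nextv_flip[of u "{u ! i}" v p i] p by simp
  then have pi: "if v = Downward then p < i else i < p" by (auto simp: nextv_def nextin_def)
  have "\<exists>j. nextv u {u ! p, nb (hflip h) (u ! p)} v p j"
    by (rule nextv_exists[OF pi]) (use p assms(1) in auto)
  then obtain j where j: "nextv u {u ! p, nb (hflip h) (u ! p)} v p j" by blast
  have "step_to n u (hflip h) v p = Some j" using j step_to_inner[OF p(1) pe] by simp
  then have "path_next n u (i, h, v) = Some ((j, hflip h, v), Some (if v = Downward then (p, i) else (i, p)))"
    using st b the assms(2) by (simp only: path_next.simps beyond_def[symmetric] Let_def option.case) auto
  then show "\<exists>j. nextv u {u ! p, nb (hflip h) (u ! p)} v p j \<and> u ! j = nb (hflip h) (u ! i) \<and>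
      path_next n u (i, h, v) = Some ((j, hflip h, v), Some (if v = Downward then (p, i) else (i, p)))"
    using j nextv_letter[OF j pe] p(2) by auto
qed

lemma fork_out_arrival:
  assumes "i < length u"
  shows "fork_out n u (arrival u (i, h, v)) =
    (if v = Downward \<and> (\<exists>t. (t, i) \<in> forks n u) then [(THE t. (t, i) \<in> forks n u, i)] else [])"
  using sstep_arrival(2)[OF assms, of h v]
  by (auto simp: fork_out_def arrival_def arrive_def)

lemma fork_out_arrival_fork:
  assumes "(t, i) \<in> forks n u" "i < length u"
  shows "fork_out n u (arrival u (i, h, Downward)) = [(t, i)]"
proof -
  have "(THE t. (t, i) \<in> forks n u) = t" using assms(1) forks_unique by blast
  then show ?thesis using assms by (auto simp: fork_out_arrival)
qed

lemma fork_out_arrival_inner: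
  assumes "i < length u" "u ! i \<noteq> 1" "u ! i \<noteq> n + 1"
  shows "fork_out n u (arrival u (i, h, v)) = []"
  using assms by (simp add: fork_out_arrival forks_iff)

text \<open>A step in direction \<open>h\<close> cannot end in the column where that direction
  begins. If a valid state is not in the end column of \<open>h\<close> either, its column is inner,
  and nothing is decorated there.\<close>

definition valid :: "state \<Rightarrow> bool" where
  "valid s \<longleftrightarrow> (case s of (i, h, v) \<Rightarrow> i < length u \<and> u ! i \<noteq> end_column n (hflip h))"

definition fork_word :: "nat \<times> nat \<Rightarrow> deco list" where
  "fork_word f = (if f \<in> left_forks n u then [Bullet, Bullet] else [Circle, Circle])"

text \<open>The decoration next to the box node \<open>x\<close> on a strand that touches some
  letter; strands touching none are the exception in \<open>strand_word\<close>.\<close>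

definition exit_word :: "node \<Rightarrow> deco list" where
  "exit_word x = (if node_index x = 1 then [Bullet] else if node_index x = n + 2 then [Circle] else [])"

lemma left_not_right: "f \<in> left_forks n u \<Longrightarrow> f \<notin> right_forks n u"
  using n2 by (cases f) (auto simp: left_forks_iff right_forks_iff nextin_def)

lemma fork_word_eq: "(t, b) \<in> forks n u \<Longrightarrow> fork_word (t, b) = gen_deco n (u ! b) @ gen_deco n (u ! b)"
  using n2 by (auto simp: fork_word_def left_forks_iff forks_iff gen_deco_def nextin_def)

text \<open>One step of the path is one turn of the strand, or two if it crosses a fork: at
  \<open>i\<close> and at the other extreme node \<open>p\<close>. Each of the two turns gives one
  decoration of \<open>fork_word\<close>, while only the one on top of the lower node records the
  fork.\<close>

lemma path_next_walk:
  assumes "i < length u" "path_next n u (i, h, v) = Some (t, fo)"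
  shows "\<exists>ls. walk (sstep u) (arrival u (i, h, v)) ls (arrival u t) \<and> ls \<noteq> [] \<and>
    concat (map (deco_out (gen_deco n) u) ls) = (case fo of None \<Rightarrow> gen_deco n (u ! i) | Some f \<Rightarrow> fork_word f) \<and>
    concat (map (fork_out n u) ls) = (case fo of None \<Rightarrow> fork_out n u (arrival u (i, h, v)) | Some f \<Rightarrow> [f])"
    and "valid t" and "fo = None \<longleftrightarrow> u ! i \<noteq> end_column n h"
    and "fo = Some f \<Longrightarrow> f \<in> forks n u \<and> (u ! fst f = end_column n h) \<and> (u ! snd f = end_column n h)"
    and "t = (j, h', v') \<Longrightarrow> (if u ! i = end_column n h then h' = hflip h \<and> v' = v else h' = h \<and> v' = vflip v)
        \<and> u ! j = nb h' (u ! i)"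
proof -
  have "(\<exists>ls. walk (sstep u) (arrival u (i, h, v)) ls (arrival u t) \<and> ls \<noteq> [] \<and>
    concat (map (deco_out (gen_deco n) u) ls) = (case fo of None \<Rightarrow> gen_deco n (u ! i) | Some f \<Rightarrow> fork_word f) \<and>
    concat (map (fork_out n u) ls) = (case fo of None \<Rightarrow> fork_out n u (arrival u (i, h, v)) | Some f \<Rightarrow> [f])) \<and>
    valid t \<and> (fo = None \<longleftrightarrow> u ! i \<noteq> end_column n h) \<and>
    (\<forall>f. fo = Some f \<longrightarrow> f \<in> forks n u \<and> (u ! fst f = end_column n h) \<and> (u ! snd f = end_column n h)) \<and>
    (\<forall>j h' v'. t = (j, h', v') \<longrightarrow> (if u ! i = end_column n h then h' = hflip h \<and> v' = v else h' = h \<and> v' = vflip v)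
        \<and> u ! j = nb h' (u ! i))"
  proof (cases "u ! i = end_column n h")
    case False
    with assms obtain q where q: "nextv u {u ! i, nb h (u ! i)} (vflip v) i q"
      unfolding path_next_inner[OF assms(1) False] by (auto split: if_splits)
    then have "(THE q. nextv u {u ! i, nb h (u ! i)} (vflip v) i q) = q"
      by (intro the_equality) (auto intro: nextv_unique)
    then have t: "t = (q, h, vflip v)" "fo = None"
      using assms(2) q unfolding path_next_inner[OF assms(1) False] by (auto split: if_splits)
    have uq: "u ! q = nb h (u ! i)" by (rule nextv_letter[OF q False])
    have "(if u ! q = leg (hflip h) (u ! i) then Rightward else Leftward) = h"
      using uq letter[OF assms(1)] by (cases h) (auto simp: leg_def)
    moreover have "valid t"
      using t(1) uq letter[OF assms(1)] nextv_bounds[OF q] by (cases h) (auto simp: valid_def)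
    ultimately show ?thesis using turn_and_travel[OF q, of "gen_deco n"] t uq False by auto
  next
    case True
    then have "\<exists>p. beyond v i p" using path_next_end(1)[OF assms(1) True] assms(2) by fastforce
    then obtain p where b: "beyond v i p" by blast
    from path_next_end(2)[OF assms(1) True b] assms(2) obtain j where
      j: "nextv u {u ! p, nb (hflip h) (u ! p)} v p j" "u ! j = nb (hflip h) (u ! i)"
        "t = (j, hflip h, v)" "fo = Some (if v = Downward then (p, i) else (i, p))" by auto
    define f where "f = (if v = Downward then (p, i) else (i, p))"
    have nx: "nextv u {u ! i} (vflip v) i p" using b by (simp only: beyond_iff)
    have p: "p < length u" "u ! p = u ! i" using nextv_bounds[OF nx] nextv_in[OF nx] by auto
    have e: "u ! i = 1 \<or> u ! i = n + 1" using True by (cases h) auto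
    have ff: "f \<in> forks n u"
      using nx p e by (cases v) (auto simp: f_def forks_iff nextv_def)
    have legp: "(if u ! p = leg (hflip h) (u ! i) then Rightward else Leftward) = hflip h"
      using p by (cases h) (auto simp: leg_def)
    from turn_and_travel[OF nx[unfolded nextv_end[OF True, symmetric]], of "gen_deco n"] legp
    obtain l1 where l1: "walk (sstep u) (arrival u (i, h, v)) l1 (arrival u (p, hflip h, vflip v))" "l1 \<noteq> []"
      "concat (map (deco_out (gen_deco n) u) l1) = gen_deco n (u ! i)"
      "concat (map (fork_out n u) l1) = fork_out n u (arrival u (i, h, v))" by auto
    have legj: "(if u ! j = leg h (u ! p) then Rightward else Leftward) = hflip h"
      using p j(2) letter[OF assms(1)] by (cases h) (auto simp: leg_def)
    from turn_and_travel[of p "hflip h" "vflip v" j "gen_deco n"] j(1) legj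
    obtain l2 where l2: "walk (sstep u) (arrival u (p, hflip h, vflip v)) l2 (arrival u (j, hflip h, v))"
      "concat (map (deco_out (gen_deco n) u) l2) = gen_deco n (u ! p)"
      "concat (map (fork_out n u) l2) = fork_out n u (arrival u (p, hflip h, vflip v))" by auto
    have w: "walk (sstep u) (arrival u (i, h, v)) (l1 @ l2) (arrival u t)"
      using walk_trans[OF l1(1) l2(1)] j(3) by simp
    have fw: "fork_word f = gen_deco n (u ! i) @ gen_deco n (u ! i)"
      using fork_word_eq[of "fst f" "snd f"] ff p by (cases v) (auto simp: f_def)
    have fo: "fork_out n u (arrival u (i, h, v)) @ fork_out n u (arrival u (p, hflip h, vflip v)) = [f]"
      using ff fork_out_arrival_fork[of p i h] fork_out_arrival_fork[of i p "hflip h"] assms(1) p(1)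
      by (cases v) (simp_all add: f_def fork_out_arrival)
    have "valid t"
      using j(1-3) letter[OF assms(1)] True nextv_bounds[OF j(1)] n2 by (cases h) (auto simp: valid_def)
    then show ?thesis
      using w l1 l2 fw fo ff j(2-4) p True
      by (intro conjI exI[of _ "l1 @ l2"]) (auto simp: f_def[symmetric], auto simp: f_def)
  qed
  then show "\<exists>ls. walk (sstep u) (arrival u (i, h, v)) ls (arrival u t) \<and> ls \<noteq> [] \<and>
    concat (map (deco_out (gen_deco n) u) ls) = (case fo of None \<Rightarrow> gen_deco n (u ! i) | Some f \<Rightarrow> fork_word f) \<and>
    concat (map (fork_out n u) ls) = (case fo of None \<Rightarrow> fork_out n u (arrival u (i, h, v)) | Some f \<Rightarrow> [f])"
    and "valid t" and "fo = None \<longleftrightarrow> u ! i \<noteq> end_column n h"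
    and "fo = Some f \<Longrightarrow> f \<in> forks n u \<and> (u ! fst f = end_column n h) \<and> (u ! snd f = end_column n h)"
    and "t = (j, h', v') \<Longrightarrow> (if u ! i = end_column n h then h' = hflip h \<and> v' = v else h' = h \<and> v' = vflip v)
        \<and> u ! j = nb h' (u ! i)"
    by blast+
qed

lemma path_next_None_walk:
  assumes "i < length u" "path_next n u (i, h, v) = None"
  shows "\<exists>ls. walk (sstep u) (arrival u (i, h, v)) ls (finish u (end_node u (i, h, v))) \<and>
    concat (map (deco_out (gen_deco n) u) ls) = gen_deco n (u ! i) \<and>
    concat (map (fork_out n u) ls) = fork_out n u (arrival u (i, h, v)) \<and>
    (u ! i = end_column n h \<longrightarrow> fork_out n u (arrival u (i, h, v)) = [])"
proof -
  have "\<not> (\<exists>q. nextv u {u ! i, nb h (u ! i)} (vflip v) i q)"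
  proof (cases "u ! i = end_column n h")
    case False
    then show ?thesis using assms(2) unfolding path_next_inner[OF assms(1) False] by (auto split: if_splits)
  next
    case True
    then show ?thesis
      using path_next_end(2)[OF assms(1) True] assms(2) unfolding nextv_end[OF True] beyond_iff by fastforce
  qed
  moreover have "fork_out n u (arrival u (i, h, v)) = []" if "u ! i = end_column n h"
  proof -
    have "\<not> (v = Downward \<and> (t, i) \<in> forks n u)" for t
      using calculation that unfolding nextv_end[OF that] by (auto simp: forks_iff nextv_def)
    then show ?thesis using assms(1) by (auto simp: fork_out_arrival)
  qed
  ultimately show ?thesis using turn_and_exit[of i h v "gen_deco n"] assms(1) by blast
qed

text \<open>Moves happen in inner columns and leave no decoration, a crossing leaves a pair, and the
  final turn leaves a single decoration if the path stops in an extreme column.\<close>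

lemma path_ends_walk:
  assumes "path_ends n u s fs s'" "valid s"
  shows "valid s' \<and> path_next n u s' = None \<and> set fs \<subseteq> forks n u \<and>
    (\<exists>ls. walk (sstep u) (arrival u s) ls (finish u (end_node u s')) \<and>
      concat (map (deco_out (gen_deco n) u) ls) = concat (map fork_word fs) @ exit_word (end_node u s') \<and>
      concat (map (fork_out n u) ls) = fs)"
  using assms
proof (induction rule: path_ends.induct)
  case (stop s)
  obtain i h v where s: "s = (i, h, v)" by (cases s)
  with stop have i: "i < length u" "u ! i \<noteq> end_column n (hflip h)" by (auto simp: valid_def)
  \<comment> \<open>A path stopping in an extreme column leaves on the outermost leg, next to the
    box column 1 or \<open>n + 2\<close>; from other columns it leaves next to an inner box column,
    and both sides are empty.\<close>
  have ew: "exit_word (end_node u s) = gen_deco n (u ! i)"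
    using i letter[OF i(1)] n2 unfolding s end_node_eq by (cases h) (auto simp: exit_word_def gen_deco_def leg_def)
  have fo: "u ! i \<noteq> end_column n h \<Longrightarrow> fork_out n u (arrival u (i, h, v)) = []"
    using i fork_out_arrival_inner[OF i(1)] by (cases h) auto
  show ?case using path_next_None_walk[OF i(1), of h v] stop ew fo unfolding s by fastforce
next
  case (move s t fs s')
  obtain i h v where s: "s = (i, h, v)" by (cases s)
  with move have i: "i < length u" "u ! i \<noteq> end_column n (hflip h)" by (auto simp: valid_def)
  note pn = path_next_walk[OF i(1) move(1)[unfolded s]]
  have ne: "u ! i \<noteq> end_column n h" using pn(3) by simp
  have inner: "u ! i \<noteq> 1" "u ! i \<noteq> n + 1" using ne i(2) by (cases h; auto)+
  obtain l1 where l1: "walk (sstep u) (arrival u s) l1 (arrival u t)"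
    "concat (map (deco_out (gen_deco n) u) l1) = []" "concat (map (fork_out n u) l1) = []"
    using pn(1) inner fork_out_arrival_inner[OF i(1) inner] unfolding s by (auto simp: gen_deco_def)
  from move(3)[OF pn(2)] obtain l2 where
    l2: "walk (sstep u) (arrival u t) l2 (finish u (end_node u s'))"
      "concat (map (deco_out (gen_deco n) u) l2) = concat (map fork_word fs) @ exit_word (end_node u s')"
      "concat (map (fork_out n u) l2) = fs" by blast
  show ?case
    using move(3)[OF pn(2)] walk_trans[OF l1(1) l2(1)] l1 l2 by (intro conjI exI[of _ "l1 @ l2"]) auto
next
  case (cross s t f fs s')
  obtain i h v where s: "s = (i, h, v)" by (cases s)
  with cross have i: "i < length u" by (auto simp: valid_def)
  note pn = path_next_walk[OF i cross(1)[unfolded s]]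
  obtain l1 where l1: "walk (sstep u) (arrival u s) l1 (arrival u t)"
    "concat (map (deco_out (gen_deco n) u) l1) = fork_word f" "concat (map (fork_out n u) l1) = [f]"
    using pn(1) unfolding s by auto
  from cross(3)[OF pn(2)] obtain l2 where
    l2: "walk (sstep u) (arrival u t) l2 (finish u (end_node u s'))"
      "concat (map (deco_out (gen_deco n) u) l2) = concat (map fork_word fs) @ exit_word (end_node u s')"
      "concat (map (fork_out n u) l2) = fs" by blast
  show ?case
    using cross(3)[OF pn(2)] walk_trans[OF l1(1) l2(1)] l1 l2 pn(4)
    by (intro conjI exI[of _ "l1 @ l2"]) auto
qed

end

lemma path_crosses_unfold:
  "path_crosses n u s = (case path_next n u s of None \<Rightarrow> {} | Some (t, fo) \<Rightarrow> set_option fo \<union> path_crosses n u t)"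
proof (intro equalityI subsetI)
  let ?R = "\<lambda>s t. \<exists>g. path_next n u s = Some (t, g)"
  fix f assume "f \<in> path_crosses n u s"
  then obtain t t' where t: "?R\<^sup>*\<^sup>* s t" "path_next n u t = Some (t', Some f)"
    by (auto simp: path_crosses.simps)
  from t(1) show "f \<in> (case path_next n u s of None \<Rightarrow> {} | Some (t, fo) \<Rightarrow> set_option fo \<union> path_crosses n u t)"
  proof (cases rule: converse_rtranclpE)
    case base
    then show ?thesis using t(2) by simp
  next
    case (step y)
    then obtain g where g: "path_next n u s = Some (y, g)" by blast
    have "f \<in> path_crosses n u y" by (rule path_crosses.intros[OF step(2) t(2)])
    then show ?thesis using g by simp
  qed
next
  let ?R = "\<lambda>s t. \<exists>g. path_next n u s = Some (t, g)"
  fix f assume f: "f \<in> (case path_next n u s of None \<Rightarrow> {} | Some (t, fo) \<Rightarrow> set_option fo \<union> path_crosses n u t)"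
  then obtain t fo where t: "path_next n u s = Some (t, fo)" by (auto split: option.splits)
  with f consider "fo = Some f" | "f \<in> path_crosses n u t" by auto
  then show "f \<in> path_crosses n u s"
  proof cases
    case 1
    then show ?thesis using path_crosses.intros[of n u s s t f] t by simp
  next
    case 2
    then obtain r r' where r: "?R\<^sup>*\<^sup>* t r" "path_next n u r = Some (r', Some f)"
      by (auto simp: path_crosses.simps)
    have "?R\<^sup>*\<^sup>* s r" using t by (intro converse_rtranclp_into_rtranclp[OF _ r(1)]) blast
    then show ?thesis using r(2) by (rule path_crosses.intros)
  qed
qed

lemma path_crosses_eq: "path_ends n u s fs s' \<Longrightarrow> path_crosses n u s = set fs"
  by (induction rule: path_ends.induct) (subst path_crosses_unfold; simp)+

lemma path_ends_unique:
  assumes "path_ends n u s fs s'" "path_ends n u s gs r" shows "fs = gs \<and> s' = r"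
  using assms
proof (induction arbitrary: gs r rule: path_ends.induct)
  case (stop s)
  from stop(2,1) show ?case by (cases rule: path_ends.cases) auto
next
  case (move s t fs s')
  from move(4,1) obtain gs' where "path_ends n u t gs' r" "gs = gs'"
    by (cases rule: path_ends.cases) auto
  then show ?case using move(3) by blast
next
  case (cross s t f fs s')
  from cross(4,1) obtain gs' where "path_ends n u t gs' r" "gs = f # gs'"
    by (cases rule: path_ends.cases) auto
  then show ?case using cross(3) by blast
qed

lemma the_path_ends:
  assumes "path_ends n u s fs s'" shows "(THE (fs, s'). path_ends n u s fs s') = (fs, s')"
proof (rule the_equality)
  fix p assume "case p of (gs, r) \<Rightarrow> path_ends n u s gs r"
  then show "p = (fs, s')" using path_ends_unique[OF assms, of "fst p" "snd p"] by (cases p) simp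
qed (use assms in simp)

lemma rev_gen_deco [simp]: "rev (gen_deco n i) = gen_deco n i"
  by (simp add: gen_deco_def)

section \<open>Forks on the strands of an alternating word\<close>

sublocale alternating_word \<subseteq> reversible "sstep u" srev "points n u"
  by (rule strand_reversible) (rule gens)

context alternating_word
begin

abbreviation prod_diag :: ddiag where
  "prod_diag \<equiv> word_diag n (gen_deco n) u"

abbreviation other :: "node \<Rightarrow> node" where
  "other \<equiv> mate prod_diag"

lemma other_other [simp]: "other (other x) = x"
  using word_diag_mate(1)[OF gens] by simp

lemma other_neq: "x \<in> nodes (n + 2) \<Longrightarrow> other x \<noteq> x"
  using word_diag_mate(2)[OF gens] by simp

lemma other_nodes: "x \<in> nodes (n + 2) \<Longrightarrow> other x \<in> nodes (n + 2)"
  using word_diag_mate(3)[OF gens] by simp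

lemma no_start_pred: "sstep u a \<noteq> Some (start u x)"
  using no_pred[OF sstep_finish[of u x], of a] by (simp add: finish_def)

definition strand_forks :: "node \<Rightarrow> (nat \<times> nat) list" where
  "strand_forks x = concat (map (fork_out n u) (THE ls. walk (sstep u) (start u x) ls (finish u (other x))))"

lemma strand_walk:
  assumes "x \<in> nodes (n + 2)"
  shows "\<exists>ls. walk (sstep u) (start u x) ls (finish u (other x)) \<and>
    concat (map (deco_out (gen_deco n) u) ls) = word prod_diag x \<and>
    concat (map (fork_out n u) ls) = strand_forks x"
proof -
  obtain ls where ls: "walk (sstep u) (start u x) ls (finish u (other x))"
    "concat (map (deco_out (gen_deco n) u) ls) = word prod_diag x"
    using word_diag_strands[OF gens _ assms, of "gen_deco n"] by (auto simp: strand_of_def)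
  have "(THE ls. walk (sstep u) (start u x) ls (finish u (other x))) = ls"
  proof (rule the_equality)
    fix ls' assume "walk (sstep u) (start u x) ls' (finish u (other x))"
    from walk_end_unique[OF ls(1) this] show "ls' = ls" by simp
  qed (rule ls(1))
  then show ?thesis using ls unfolding strand_forks_def by blast
qed

lemma strand_walk_eq:
  assumes "x \<in> nodes (n + 2)" "walk (sstep u) (start u x) ls (finish u y)"
  shows "other x = y" "word prod_diag x = concat (map (deco_out (gen_deco n) u) ls)"
    "strand_forks x = concat (map (fork_out n u) ls)"
proof -
  obtain ls' where ls': "walk (sstep u) (start u x) ls' (finish u (other x))"
    "concat (map (deco_out (gen_deco n) u) ls') = word prod_diag x"
    "concat (map (fork_out n u) ls') = strand_forks x" using strand_walk[OF assms(1)] by blast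
  have "ls' = ls \<and> finish u (other x) = finish u y"
    using walk_end_unique[OF assms(2) ls'(1)] by simp
  then show "other x = y" "word prod_diag x = concat (map (deco_out (gen_deco n) u) ls)"
    "strand_forks x = concat (map (fork_out n u) ls)" using ls' by auto
qed

lemma strand_forks_other:
  assumes "x \<in> nodes (n + 2)" shows "strand_forks (other x) = rev (strand_forks x)"
proof -
  obtain ls where ls: "walk (sstep u) (start u x) ls (finish u (other x))"
    "concat (map (fork_out n u) ls) = strand_forks x" using strand_walk[OF assms] by blast
  obtain ys where ys: "walk (sstep u) (srev (finish u (other x))) ys (srev (start u x))"
    "concat (map (fork_out n u) ys) = rev (concat (map (fork_out n u) ls))"
    using walk_rev[OF ls(1), where 'b = "nat \<times> nat"] fork_out_srev by blast
  have "walk (sstep u) (start u (other x)) ys (finish u x)" using ys(1) by (simp add: finish_def)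
  from strand_walk_eq(3)[OF other_nodes[OF assms] this] show ?thesis using ys(2) ls(2) by simp
qed

lemma arrival_points: "i < length u \<Longrightarrow> arrival u (i, h, v) \<in> points n u"
  using letter[of i] by (cases h; cases v) (auto simp: arrival_def points_def arrive_def leg_def)

lemma valid_points: "valid s \<Longrightarrow> arrival u s \<in> points n u"
  by (cases s) (auto simp: valid_def intro: arrival_points)

lemma finish_points: "finish u x \<in> points n u \<Longrightarrow> x \<in> nodes (n + 2)"
  by (cases x) (auto simp: points_def)

text \<open>Each step of the path uses up a nonempty piece of the strand, so if the strand stops,
  the path stops.\<close>

lemma path_ends_exists:
  assumes "valid s" "terminating (sstep u) (arrival u s)"
  shows "\<exists>fs s'. path_ends n u s fs s'"
proof -
  obtain ls e where "walk (sstep u) (arrival u s) ls e" "sstep u e = None"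
    using assms(2) by (auto simp: terminating_def)
  then show ?thesis using assms(1)
  proof (induction "length ls" arbitrary: ls s rule: less_induct)
    case less
    show ?case
    proof (cases "path_next n u s")
      case None
      then show ?thesis using path_ends.stop by blast
    next
      case (Some a)
      obtain t fo where a: "a = (t, fo)" by (cases a)
      obtain i h v where s: "s = (i, h, v)" by (cases s)
      have i: "i < length u" using less.prems(3) s by (simp add: valid_def)
      note pn = path_next_walk[OF i Some[unfolded a s]]
      obtain l1 where l1: "walk (sstep u) (arrival u s) l1 (arrival u t)" "l1 \<noteq> []"
        using pn(1) s by auto
      obtain zs where zs: "ls = l1 @ zs" "walk (sstep u) (arrival u t) zs e"
        using walk_to_end[OF l1(1) less.prems(1,2)] by blast
      have "\<exists>fs s'. path_ends n u t fs s'"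
        by (rule less.hyps[OF _ zs(2) less.prems(2) pn(2)]) (use zs l1 in simp)
      then show ?thesis using Some a path_ends.move path_ends.cross by (cases fo) blast+
    qed
  qed
qed

lemma path_ends_terminating: "path_ends n u s fs s' \<Longrightarrow> valid s \<Longrightarrow> terminating (sstep u) (arrival u s)"
  using path_ends_walk unfolding terminating_def by (metis sstep_finish)

text \<open>The strand through the fork \<open>f\<close> passes \<open>cap f\<close> or its partner on the other leg of the
  lower extreme node of \<open>f\<close>.\<close>

definition cap :: "nat \<times> nat \<Rightarrow> point" where
  "cap f = arrival u (snd f, Rightward, Downward)"

definition cap' :: "nat \<times> nat \<Rightarrow> point" where
  "cap' f = arrival u (snd f, Leftward, Downward)"

lemma fork_length: "f \<in> forks n u \<Longrightarrow> fst f < length u \<and> snd f < length u"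
  by (cases f) (auto simp: forks_iff nextin_def)

lemma sstep_cap: "snd f < length u \<Longrightarrow> sstep u (cap f) = Some (srev (cap' f))"
  "snd f < length u \<Longrightarrow> sstep u (cap' f) = Some (srev (cap f))"
  by (auto simp: cap_def cap'_def arrival_def arrive_def leg_def)

lemma fork_out_caps: "f \<in> forks n u \<Longrightarrow> fork_out n u (cap f) = [f] \<and> fork_out n u (cap' f) = [f]"
  using fork_length[of f] fork_out_arrival_fork[of "fst f" "snd f"] by (simp add: cap_def cap'_def)

lemma same_strand_caps: "f \<in> forks n u \<Longrightarrow> same_strand (cap f) (cap' f)"
  using same_strand_step[OF sstep_cap(1)] same_strand_r same_strand_sym same_strand_trans fork_length by metis

lemma cap_points: "f \<in> forks n u \<Longrightarrow> cap f \<in> points n u"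
  unfolding cap_def using arrival_points fork_length by blast

lemma fork_out_mem:
  assumes "f \<in> set (fork_out n u s)" shows "f \<in> forks n u \<and> same_strand s (cap f)"
proof -
  obtain g x v where s: "s = (g, x, v)" by (cases s)
  have v: "v = Downward" "turn_letter u s \<noteq> None" and ex: "\<exists>t. (t, g) \<in> forks n u"
    and f: "f = (THE t. (t, g) \<in> forks n u, g)"
    using assms by (auto simp: fork_out_def s split: if_splits)
  obtain t where t: "(t, g) \<in> forks n u" using ex by blast
  then have "(THE t. (t, g) \<in> forks n u) = t" using forks_unique by blast
  then have f': "f = (t, g)" "f \<in> forks n u" using f t by auto
  have "s = cap f \<or> s = cap' f"
    using v f'(1) by (auto simp: s cap_def cap'_def arrival_def arrive_def leg_def split: if_splits)
  then show ?thesis using same_strand_sym[OF same_strand_caps[OF f'(2)]] f'(2) by auto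
qed

lemma walk_forks:
  assumes "walk (sstep u) s ls t" "f \<in> set (concat (map (fork_out n u) ls))"
  shows "f \<in> forks n u \<and> same_strand s (cap f)"
proof -
  obtain y where "y \<in> set ls" "f \<in> set (fork_out n u y)" using assms(2) by auto
  then show ?thesis using fork_out_mem same_strand_walk_mem[OF assms(1)] same_strand_trans by blast
qed

text \<open>The strand from a box node is maximal in both directions, so it contains every point
  comparable with its start. The turn at the lower node of \<open>f\<close> exchanges
  \<open>cap f\<close> and \<open>cap' f\<close> up to reversal; whichever way the strand runs, it
  leaves one of the two, and both record \<open>f\<close>.\<close>

lemma strand_forks_iff:
  assumes x: "x \<in> nodes (n + 2)"
  shows "f \<in> set (strand_forks x) \<longleftrightarrow> f \<in> forks n u \<and> same_strand (start u x) (cap f)"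
proof
  assume "f \<in> set (strand_forks x)"
  then show "f \<in> forks n u \<and> same_strand (start u x) (cap f)"
    using strand_walk[OF x] walk_forks by metis
next
  assume f: "f \<in> forks n u \<and> same_strand (start u x) (cap f)"
  then have fl: "snd f < length u" using fork_length by blast
  obtain ls where ls: "walk (sstep u) (start u x) ls (finish u (other x))"
    "concat (map (fork_out n u) ls) = strand_forks x" using strand_walk[OF x] by blast
  have mem: "s \<in> set ls" if s: "comparable (start u x) s" "sstep u s \<noteq> None" for s
  proof -
    have "\<exists>ys. walk (sstep u) (start u x) ys s"
    proof -
      have "s = start u x" if w: "walk (sstep u) s ys (start u x)" for ys
      proof (cases ys rule: rev_cases)
        case (snoc zs z)
        then have "sstep u z = Some (start u x)" using w by (simp add: walk_snoc)
        then show ?thesis using no_start_pred by blast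
      qed (use w in simp)
      then show ?thesis using s(1) unfolding comparable_def by (metis walk.simps(1))
    qed
    then obtain ys where "walk (sstep u) (start u x) ys s" by blast
    from walk_to_end[OF this ls(1) sstep_finish] obtain zs where
      zs: "ls = ys @ zs" "walk (sstep u) s zs (finish u (other x))" by blast
    moreover have "zs \<noteq> []" using zs(2) s(2) sstep_finish by auto
    ultimately show ?thesis by (cases zs) auto
  qed
  have "comparable (start u x) (cap f) \<or> comparable (start u x) (cap' f)"
    using same_strand_comparable[of "start u x" "cap f"] f comparable_unstep[OF _ sstep_cap(2)[OF fl]] by blast
  then have "cap f \<in> set ls \<or> cap' f \<in> set ls"
    using mem[of "cap f"] mem[of "cap' f"] sstep_cap[OF fl] by fastforce
  moreover have "fork_out n u (cap f) = [f]" "fork_out n u (cap' f) = [f]"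
    using fork_out_caps f by blast+
  ultimately have "\<exists>y\<in>set ls. f \<in> set (fork_out n u y)" by (metis list.set_intros(1))
  then show "f \<in> set (strand_forks x)"
    unfolding ls(2)[symmetric] by simp
qed

lemma same_strand_starts:
  assumes x: "x \<in> nodes (n + 2)" and "same_strand (start u x) (start u y)"
  shows "y = x \<or> y = other x"
proof -
  obtain ls where ls: "walk (sstep u) (start u x) ls (finish u (other x))" using strand_walk[OF x] by blast
  have st: "s = start u z" if "walk (sstep u) s ys (start u z)" for s ys z
  proof (cases ys rule: rev_cases)
    case (snoc zs a)
    then have "sstep u a = Some (start u z)" using that by (simp add: walk_snoc)
    then show ?thesis using no_start_pred by blast
  qed (use that in simp)
  have fin: "s = finish u z" if "walk (sstep u) (finish u z) ys s" for s ys z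
    using that by (cases ys) auto
  have fy: "srev (start u y) = finish u y" by (simp add: finish_def)
  from same_strand_comparable[OF assms(2)] show ?thesis
    unfolding comparable_def fy
  proof (elim disjE exE)
    fix ys assume "walk (sstep u) (start u x) ys (start u y)"
    then show ?thesis using st by fastforce
  next
    fix ys assume "walk (sstep u) (start u y) ys (start u x)"
    then show ?thesis using st by fastforce
  next
    fix ys assume "walk (sstep u) (start u x) ys (finish u y)"
    then show ?thesis using strand_walk_eq(1)[OF x] by blast
  next
    fix ys assume "walk (sstep u) (finish u y) ys (start u x)"
    then have "start u x = finish u y" using fin by blast
    then have "walk (sstep u) (start u x) [] (finish u y)" by simp
    then show ?thesis using strand_walk_eq(1)[OF x] by blast
  qed
qed

lemma strand_forks_disjoint:
  assumes "x \<in> nodes (n + 2)" "y \<in> nodes (n + 2)" "f \<in> set (strand_forks x)" "f \<in> set (strand_forks y)"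
  shows "y = x \<or> y = other x"
proof (rule same_strand_starts[OF assms(1)])
  have "same_strand (start u x) (cap f)" "same_strand (start u y) (cap f)"
    using assms strand_forks_iff by blast+
  then show "same_strand (start u x) (start u y)" using same_strand_sym same_strand_trans by blast
qed

lemma path_crosses_same_strand:
  assumes "valid s" "f \<in> path_crosses n u s"
  shows "f \<in> forks n u \<and> same_strand (arrival u s) (cap f)"
proof -
  have step: "valid t \<and> same_strand (arrival u s) (arrival u t) \<and>
      (\<forall>f. fo = Some f \<longrightarrow> f \<in> forks n u \<and> same_strand (arrival u s) (cap f))"
    if v: "valid s" and pn: "path_next n u s = Some (t, fo)" for s t fo
  proof -
    obtain i h d where s: "s = (i, h, d)" by (cases s)
    have i: "i < length u" using v s by (simp add: valid_def)
    note p = path_next_walk[OF i pn[unfolded s]]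
    obtain ls where ls: "walk (sstep u) (arrival u s) ls (arrival u t)"
      "concat (map (fork_out n u) ls) = (case fo of None \<Rightarrow> fork_out n u (arrival u (i, h, d)) | Some f \<Rightarrow> [f])"
      using p(1) s by auto
    show ?thesis using p(2) same_strand_walk[OF ls(1)] walk_forks[OF ls(1)] ls(2) by auto
  qed
  obtain t t' where t: "(\<lambda>s t. \<exists>g. path_next n u s = Some (t, g))\<^sup>*\<^sup>* s t" "path_next n u t = Some (t', Some f)"
    using assms(2) by (auto simp: path_crosses.simps)
  have "valid t \<and> same_strand (arrival u s) (arrival u t)"
    using t(1) by (induction rule: rtranclp_induct) (use assms(1) step same_strand_trans in \<open>simp, blast\<close>)
  then show ?thesis using step[OF _ t(2)] same_strand_trans by blast
qed

definition fork_nodes :: "nat \<times> nat \<Rightarrow> node \<times> node" where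
  "fork_nodes f = (end_node u (snd (top_path n u f)), end_node u (snd (bot_path n u f)))"

text \<open>The middle node of the fork, provided by \<open>between_exists\<close>, is where both
  halves of the snake path begin, with opposite vertical directions.\<close>

lemma fork_starts:
  assumes f: "f \<in> forks n u"
  shows "\<exists>k. top_start n u f = (k, start_dir n u f, Downward) \<and> bot_start n u f = (k, start_dir n u f, Upward) \<and>
    valid (top_start n u f) \<and> valid (bot_start n u f) \<and>
    nextin u {u ! fst f, nb (start_dir n u f) (u ! fst f)} (fst f) k \<and>
    nextin u {u ! snd f, nb (start_dir n u f) (u ! snd f)} k (snd f) \<and>
    u ! fst f = u ! snd f \<and> u ! fst f = end_column n (hflip (start_dir n u f)) \<and>
    u ! k = nb (start_dir n u f) (u ! fst f)"
proof -
  obtain t b where tb: "f = (t, b)" by (cases f)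
  define h where "h = start_dir n u f"
  have nx: "nextin u {u ! b} t b" and c: "u ! b = 1 \<or> u ! b = n + 1" using f tb by (auto simp: forks_iff)
  have l: "f \<in> left_forks n u \<longleftrightarrow> u ! b = 1" using nx by (auto simp: tb left_forks_iff nextin_def)
  have ce: "u ! b = end_column n (hflip h)" using l c by (auto simp: h_def start_dir_def)
  have t: "u ! t = u ! b" "t < length u" "b < length u" using nx by (auto simp: nextin_def)
  have d: "nb h (u ! b) = u ! b + 1 \<or> u ! b = nb h (u ! b) + 1" "u ! b \<in> gens n" "nb h (u ! b) \<in> gens n"
    using ce n2 by (cases h; auto simp: gens_bounds)+
  obtain k where k: "nextin u {u ! b, nb h (u ! b)} t k" "nextin u {u ! b, nb h (u ! b)} k b" "u ! k = nb h (u ! b)"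
    using between_exists[OF nx d] by blast
  have ne: "u ! t \<noteq> end_column n h" "u ! b \<noteq> end_column n h" using ce t n2 by (cases h; auto)+
  have "step_to n u h Downward t = Some k" "step_to n u h Upward b = Some k"
    using step_to_inner[OF t(2) ne(1), of Downward k] step_to_inner[OF t(3) ne(2), of Upward k] k t(1)
    by (auto simp: nextv_def)
  then have s: "top_start n u f = (k, h, Downward)" "bot_start n u f = (k, h, Upward)"
    using h_def by (simp_all add: top_start_def bot_start_def tb Let_def)
  have "k < length u" using k(1) by (simp add: nextin_def)
  then have "valid (k, h, v)" for v using k(3) ce n2 by (cases h) (auto simp: valid_def)
  then show ?thesis using s k t(1) ce unfolding h_def tb by (intro exI[of _ k]) simp
qed

text \<open>The strand is cut at \<open>A\<close>, just below the upper extreme node on its inner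
  leg. Forwards it crosses the fork and continues as the bottom path; backwards it runs straight
  into the top path.\<close>

lemma fork_through:
  assumes f: "f \<in> forks n u"
  defines "A \<equiv> arrival u (fst f, hflip (start_dir n u f), Upward)"
  shows "\<exists>ls. walk (sstep u) (srev A) ls (arrival u (top_start n u f)) \<and>
      concat (map (deco_out c u) ls) = [] \<and> concat (map (fork_out n u) ls) = []"
    and "\<exists>ls. walk (sstep u) A ls (arrival u (bot_start n u f)) \<and>
      concat (map (deco_out (gen_deco n) u) ls) = fork_word f \<and> concat (map (fork_out n u) ls) = [f]"
    and "path_next n u (fst f, hflip (start_dir n u f), Upward) = Some (bot_start n u f, Some f)"
proof -
  define h where "h = start_dir n u f"
  obtain k where k: "top_start n u f = (k, h, Downward)" "bot_start n u f = (k, h, Upward)"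
    "nextin u {u ! fst f, nb h (u ! fst f)} (fst f) k" "nextin u {u ! snd f, nb h (u ! snd f)} k (snd f)"
    "u ! fst f = u ! snd f" "u ! fst f = end_column n (hflip h)" "u ! k = nb h (u ! fst f)"
    using fork_starts[OF f] unfolding h_def by blast
  have t: "fst f < length u" using fork_length[OF f] by simp
  let ?x = "leg (hflip h) (u ! fst f)"
  have tch: "u ! j \<in> {u ! fst f, nb h (u ! fst f)}" if "?x = u ! j \<or> ?x = u ! j + 1" for j
    using touching_leg[of "u ! fst f" h "u ! j"] letter[OF t] that by blast
  obtain ls where ls: "walk (sstep u) (arrive (vflip Downward) (fst f), ?x, Downward) ls (arrive Downward k, ?x, Downward)"
    "\<forall>s\<in>set ls. turn_letter u s = None"
    using travel[of u "{u ! fst f, nb h (u ! fst f)}" Downward "fst f" k ?x] k(3) tch by (auto simp: nextv_def)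
  have "(arrive (vflip Downward) (fst f), ?x, Downward) = srev A"
    by (simp add: A_def h_def arrival_def)
  moreover have "(arrive Downward k, ?x, Downward) = arrival u (top_start n u f)"
    using k(6,7) letter[OF t] unfolding k(1) by (cases h) (auto simp: arrival_def leg_def)
  ultimately show "\<exists>ls. walk (sstep u) (srev A) ls (arrival u (top_start n u f)) \<and>
      concat (map (deco_out c u) ls) = [] \<and> concat (map (fork_out n u) ls) = []"
    using ls outputs_without_turn[OF ls(2)] by metis
  have nf: "nextin u {u ! fst f} (fst f) (snd f)" using f k(5) by (cases f) (simp add: forks_iff)
  then have b: "beyond Upward (fst f) (snd f)" by (simp add: beyond_iff nextv_def)
  from path_next_end(2)[OF t k(6) b] obtain j where
    j: "nextv u {u ! snd f, nb h (u ! snd f)} Upward (snd f) j"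
      "path_next n u (fst f, hflip h, Upward) = Some ((j, h, Upward), Some f)" by auto
  have "nextv u {u ! snd f, nb h (u ! snd f)} Upward (snd f) k" using k(4) by (simp add: nextv_def)
  then have "j = k" using j(1) nextv_unique by blast
  then show pn: "path_next n u (fst f, hflip (start_dir n u f), Upward) = Some (bot_start n u f, Some f)"
    using j(2) k(2) by (simp add: h_def)
  show "\<exists>ls. walk (sstep u) A ls (arrival u (bot_start n u f)) \<and>
      concat (map (deco_out (gen_deco n) u) ls) = fork_word f \<and> concat (map (fork_out n u) ls) = [f]"
    using path_next_walk(1)[OF t pn] unfolding A_def by auto
qed

lemma same_strand_fork_starts:
  assumes f: "f \<in> forks n u"
  shows "same_strand (cap f) (arrival u (top_start n u f))" "same_strand (cap f) (arrival u (bot_start n u f))"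
proof -
  let ?A = "arrival u (fst f, hflip (start_dir n u f), Upward)"
  obtain ls where ls: "walk (sstep u) ?A ls (arrival u (bot_start n u f))" "concat (map (fork_out n u) ls) = [f]"
    using fork_through(2)[OF f] by blast
  have A: "same_strand (cap f) ?A" using walk_forks[OF ls(1), of f] ls(2) same_strand_sym by auto
  then show "same_strand (cap f) (arrival u (bot_start n u f))"
    using same_strand_walk[OF ls(1)] same_strand_trans by blast
  obtain ls' where "walk (sstep u) (srev ?A) ls' (arrival u (top_start n u f))"
    using fork_through(1)[OF f, of "gen_deco n"] by blast
  then show "same_strand (cap f) (arrival u (top_start n u f))"
    using A same_strand_r same_strand_walk same_strand_trans by blast
qed

lemma is_cycle_iff:
  assumes f: "f \<in> forks n u" shows "is_cycle n u f \<longleftrightarrow> \<not> terminating (sstep u) (cap f)"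
proof -
  have v: "valid (top_start n u f)" using fork_starts[OF f] by blast
  have "terminating (sstep u) (cap f) \<longleftrightarrow> terminating (sstep u) (arrival u (top_start n u f))"
    using same_strand_terminating[OF same_strand_fork_starts(1)[OF f] cap_points[OF f] valid_points[OF v]] .
  then show ?thesis
    unfolding is_cycle_def using path_ends_exists[OF v] path_ends_terminating[OF _ v] by blast
qed

text \<open>The reversed top path, the fork and the bottom path join to the whole strand between two
  box nodes, so \<open>fork_seq\<close> lists the forks in the order in which the strand records
  them.\<close>

lemma fork_path:
  assumes f: "f \<in> forks n u" and nc: "\<not> is_cycle n u f"
  shows "fst (fork_nodes f) \<in> nodes (n + 2) \<and> other (fst (fork_nodes f)) = snd (fork_nodes f) \<and>
    strand_forks (fst (fork_nodes f)) = fork_seq n u f \<and> crossed_by n u f = set (fork_seq n u f)"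
proof -
  let ?A = "arrival u (fst f, hflip (start_dir n u f), Upward)"
  have v: "valid (top_start n u f)" "valid (bot_start n u f)" using fork_starts[OF f] by blast+
  have tc: "terminating (sstep u) (cap f)" using nc is_cycle_iff[OF f] by simp
  have "terminating (sstep u) (arrival u (bot_start n u f))"
    using same_strand_terminating[OF same_strand_fork_starts(2)[OF f] cap_points[OF f] valid_points[OF v(2)]] tc by simp
  then obtain bs sb where bs: "path_ends n u (bot_start n u f) bs sb" using path_ends_exists[OF v(2)] by blast
  obtain ts st where ts: "path_ends n u (top_start n u f) ts st" using nc by (auto simp: is_cycle_def)
  have tp: "top_path n u f = (ts, st)" "bot_path n u f = (bs, sb)"
    unfolding top_path_def bot_path_def using the_path_ends[OF ts] the_path_ends[OF bs] by auto
  let ?h = "end_node u st" and ?k = "end_node u sb"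
  obtain l0 where l0: "walk (sstep u) (srev ?A) l0 (arrival u (top_start n u f))" "concat (map (fork_out n u) l0) = []"
    using fork_through(1)[OF f, of "gen_deco n"] by blast
  obtain l1 where l1: "walk (sstep u) (arrival u (top_start n u f)) l1 (finish u ?h)" "concat (map (fork_out n u) l1) = ts"
    using path_ends_walk[OF ts v(1)] by blast
  obtain l2 where l2: "walk (sstep u) ?A l2 (arrival u (bot_start n u f))" "concat (map (fork_out n u) l2) = [f]"
    using fork_through(2)[OF f] by blast
  obtain l3 where l3: "walk (sstep u) (arrival u (bot_start n u f)) l3 (finish u ?k)" "concat (map (fork_out n u) l3) = bs"
    using path_ends_walk[OF bs v(2)] by blast
  have "walk (sstep u) (srev ?A) (l0 @ l1) (finish u ?h)" by (rule walk_trans[OF l0(1) l1(1)])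
  then obtain l4 where l4: "walk (sstep u) (start u ?h) l4 ?A" "concat (map (fork_out n u) l4) = rev ts"
    using walk_rev[of "srev ?A" "l0 @ l1" "finish u ?h", where 'b = "nat \<times> nat"] fork_out_srev[of u _ _ n] l0(2) l1(2)
    by (fastforce simp: finish_def)
  have w: "walk (sstep u) (start u ?h) (l4 @ l2 @ l3) (finish u ?k)"
    by (rule walk_trans[OF l4(1) walk_trans[OF l2(1) l3(1)]])
  have "finish u ?h \<in> points n u"
    using walk_in_closed(1)[OF l1(1) valid_points[OF v(1)]] f_D by blast
  then have h: "?h \<in> nodes (n + 2)" by (rule finish_points)
  have "strand_forks ?h = rev ts @ [f] @ bs" using strand_walk_eq(3)[OF h w] l4(2) l2(2) l3(2) by simp
  then show ?thesis
    using h strand_walk_eq(1)[OF h w] path_crosses_eq[OF ts] path_crosses_eq[OF bs]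
    by (auto simp: fork_nodes_def tp fork_seq_def crossed_by_def)
qed

lemma strand_forks_not_cycle:
  assumes "x \<in> nodes (n + 2)" "f \<in> set (strand_forks x)" shows "\<not> is_cycle n u f"
proof -
  have f: "f \<in> forks n u" "same_strand (start u x) (cap f)" using strand_forks_iff[OF assms(1)] assms(2) by auto
  have "terminating (sstep u) (start u x)"
    using strand_walk[OF assms(1)] sstep_finish unfolding terminating_def by blast
  then show ?thesis
    using same_strand_terminating[OF f(2) start_points[OF assms(1)] cap_points[OF f(1)]] is_cycle_iff[OF f(1)] by simp
qed

lemma oriented_start_mem:
  "oriented_start n u f \<in> set (fork_seq n u f)"
proof -
  have f: "f \<in> set (fork_seq n u f)" by (simp add: fork_seq_def)
  show ?thesis
  proof (cases "filter (\<lambda>g. g \<in> left_forks n u) (fork_seq n u f)")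
    case Nil
    then show ?thesis using f by (simp add: oriented_start_def)
  next
    case (Cons g gs)
    then have "g \<in> set (fork_seq n u f)" by (simp add: filter_eq_Cons_iff) auto
    then show ?thesis using f Cons by (simp add: oriented_start_def)
  qed
qed

text \<open>The algorithm may pass to another fork of the path in order to fix the orientation. This
  only changes the end from which the word is written, and \<open>add_word\<close> writes the
  reversed word at the other end. Emptiness is assumed because \<open>add_word\<close> appends to
  what is there.\<close>

lemma decorate_path_word:
  assumes f: "f \<in> forks n u" and nc: "\<not> is_cycle n u f"
    and empty: "\<And>x. x \<in> nodes (n + 2) \<Longrightarrow> f \<in> set (strand_forks x) \<Longrightarrow> word d x = []"
  shows "word (decorate_path n u f d) x =
      (if x \<in> nodes (n + 2) \<and> f \<in> set (strand_forks x) then map (fork_deco n u) (strand_forks x) else word d x)"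
    and "mate (decorate_path n u f d) = mate d" "loops (decorate_path n u f d) = loops d"
proof -
  define g where "g = oriented_start n u f"
  note pf = fork_path[OF f nc]
  have gf: "g \<in> set (strand_forks (fst (fork_nodes f)))" using oriented_start_mem pf unfolding g_def by simp
  have g: "g \<in> forks n u" "\<not> is_cycle n u g"
    using gf pf strand_forks_iff strand_forks_not_cycle by blast+
  note pg = fork_path[OF g]
  define h where "h = fst (fork_nodes g)"
  define k where "k = snd (fork_nodes g)"
  have hk: "h \<in> nodes (n + 2)" "other h = k" "strand_forks h = fork_seq n u g"
    using pg by (simp_all add: h_def k_def)
  have "g \<in> set (strand_forks h)" using hk(3) by (simp add: fork_seq_def)
  then have "fst (fork_nodes f) = h \<or> fst (fork_nodes f) = other h"
    using strand_forks_disjoint[OF hk(1) _ _ gf] pf by blast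
  moreover have "f \<in> set (strand_forks (fst (fork_nodes f)))" using pf by (simp add: fork_seq_def)
  ultimately have fh: "f \<in> set (strand_forks h)" using strand_forks_other[OF hk(1)] by auto
  have k: "k \<in> nodes (n + 2)" "strand_forks k = rev (strand_forks h)" "h \<noteq> k"
    using hk other_nodes[OF hk(1)] strand_forks_other[OF hk(1)] other_neq[OF hk(1)] by auto
  have only: "x \<in> nodes (n + 2) \<and> f \<in> set (strand_forks x) \<longleftrightarrow> x = h \<or> x = k" for x
    using strand_forks_disjoint[OF hk(1) _ fh, of x] hk k fh by auto
  have e: "word d h = []" "word d k = []" using empty[of h] empty[of k] only by auto
  have d: "decorate_path n u f d = add_word h k (map (fork_deco n u) (strand_forks h)) d"
    using nc hk(3) by (simp add: decorate_path_def Let_def g_def[symmetric] h_def k_def fork_nodes_def)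
  show "word (decorate_path n u f d) x =
      (if x \<in> nodes (n + 2) \<and> f \<in> set (strand_forks x) then map (fork_deco n u) (strand_forks x) else word d x)"
    unfolding only using e k by (auto simp: d add_word_def rev_map)
  show "mate (decorate_path n u f d) = mate d" "loops (decorate_path n u f d) = loops d"
    by (simp_all add: d add_word_def)
qed

end

section \<open>Words on strands and cycles\<close>

fun opposite :: "node \<Rightarrow> node" where
  "opposite (North i) = South i"
| "opposite (South i) = North i"

context alternating_word
begin

text \<open>Only the crossing of a fork changes the horizontal direction. So a strand that starts in
  an extreme column and meets no fork ends in a different box column.\<close>

lemma path_ends_straight:
  assumes "path_ends n u s fs s'" "fs = []" "valid s" shows "fst (snd s') = fst (snd s)"
  using assms
proof (induction rule: path_ends.induct)
  case (move s t fs s')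
  obtain i h v where s: "s = (i, h, v)" by (cases s)
  obtain j h' v' where t: "t = (j, h', v')" by (cases t)
  have i: "i < length u" using move.prems s by (simp add: valid_def)
  note pn = path_next_walk[OF i move.hyps(1)[unfolded s]]
  have "h' = h" using pn(3) pn(5)[OF t] by (auto split: if_splits)
  then show ?case using move.IH[OF move.prems(1) pn(2)] s t by simp
qed simp_all

lemma first_arrival:
  assumes x: "x \<in> nodes (n + 2)" and k: "k < length u" "node_index x = u ! k \<or> node_index x = u ! k + 1"
  shows "\<exists>q h v ls. walk (sstep u) (start u x) ls (arrival u (q, h, v)) \<and>
    (\<forall>s\<in>set ls. turn_letter u s = None) \<and> q < length u \<and> leg h (u ! q) = node_index x \<and>
    fork_out n u (arrival u (q, h, v)) = []"
proof (cases x)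
  case (North y)
  let ?P = "\<lambda>k. k < length u \<and> (y = u ! k \<or> y = u ! k + 1)"
  define q where "q = (LEAST k. ?P k)"
  have q: "?P q" unfolding q_def by (rule LeastI[of ?P k]) (use k North in simp)
  have lst: "\<not> ?P j" if "j < q" for j using that not_less_Least unfolding q_def by blast
  define h where "h = (if y = u ! q then Rightward else Leftward)"
  have "y \<noteq> u ! j \<and> y \<noteq> u ! j + 1" if "0 \<le> j" "j < q" for j using lst[OF that(2)] q that by auto
  then obtain ls where ls: "walk (sstep u) (0, y, Downward) ls (q, y, Downward)" "\<forall>s\<in>set ls. turn_letter u s = None"
    using travel_down[of 0 q u y] q by auto
  have e: "(q, y, Downward) = arrival u (q, h, Downward)" "leg h (u ! q) = y"
    using q by (auto simp: arrival_def arrive_def leg_def h_def)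
  \<comment> \<open>The upper extreme node of such a fork would touch the box column
    \<open>y\<close> as well, before \<open>q\<close>.\<close>
  have "(t, q) \<notin> forks n u" for t
  proof
    assume "(t, q) \<in> forks n u"
    then have "t < q" "u ! t = u ! q" by (auto simp: forks_iff nextin_def)
    then show False using lst[of t] q by auto
  qed
  then have "fork_out n u (arrival u (q, h, Downward)) = []" using fork_out_arrival q by auto
  then show ?thesis using ls q e North by (intro exI[of _ q] exI[of _ h] exI[of _ Downward] exI[of _ ls]) simp
next
  case (South y)
  let ?P = "\<lambda>k. k < length u \<and> (y = u ! k \<or> y = u ! k + 1)"
  have b: "\<And>k. ?P k \<Longrightarrow> k \<le> length u" by simp
  define q where "q = (GREATEST k. ?P k)"
  have q: "?P q" unfolding q_def by (rule GreatestI_nat[of ?P k "length u"]) (use k South in auto)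
  have gr: "\<not> ?P j" if "q < j" for j
  proof
    assume "?P j"
    from Greatest_le_nat[of ?P, OF this b] show False using that unfolding q_def by simp
  qed
  define h where "h = (if y = u ! q then Rightward else Leftward)"
  have "y \<noteq> u ! j \<and> y \<noteq> u ! j + 1" if "q + 1 \<le> j" "j < length u" for j using gr[of j] that by auto
  then obtain ls where ls: "walk (sstep u) (length u, y, Upward) ls (q + 1, y, Upward)" "\<forall>s\<in>set ls. turn_letter u s = None"
    using travel_up[of "q + 1" "length u" u y] q by auto
  have e: "(q + 1, y, Upward) = arrival u (q, h, Upward)" "leg h (u ! q) = y"
    using q by (auto simp: arrival_def arrive_def leg_def h_def)
  have "fork_out n u (arrival u (q, h, Upward)) = []" using fork_out_arrival q by auto
  then show ?thesis using ls q e South by (intro exI[of _ q] exI[of _ h] exI[of _ Upward] exI[of _ ls]) simp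
qed

text \<open>The second alternative is a vertical edge in an extreme column without nodes of the heap.\<close>

lemma strand_word:
  assumes x: "x \<in> nodes (n + 2)"
  shows "(word prod_diag x = exit_word x @ concat (map fork_word (strand_forks x)) @ exit_word (other x) \<and>
      (strand_forks x = [] \<and> exit_word x \<noteq> [] \<longrightarrow> node_index (other x) \<noteq> node_index x)) \<or>
    (word prod_diag x = [] \<and> strand_forks x = [] \<and> exit_word x \<noteq> [] \<and> other x = opposite x)"
proof (cases "\<exists>k<length u. node_index x = u ! k \<or> node_index x = u ! k + 1")
  case False
  have "\<exists>ls. walk (sstep u) (start u x) ls (finish u (opposite x)) \<and> (\<forall>s\<in>set ls. turn_letter u s = None)"
  proof (cases x)
    case (North y)
    then show ?thesis using travel_down[of 0 "length u" u y] False by auto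
  next
    case (South y)
    then show ?thesis using travel_up[of 0 "length u" u y] False by auto
  qed
  then obtain ls where ls: "walk (sstep u) (start u x) ls (finish u (opposite x))" "\<forall>s\<in>set ls. turn_letter u s = None"
    by blast
  note e = strand_walk_eq[OF x ls(1)] outputs_without_turn[OF ls(2)]
  have "exit_word (opposite x) = exit_word x" by (cases x) (auto simp: exit_word_def)
  then show ?thesis using e by auto
next
  case True
  then obtain k where k: "k < length u" "node_index x = u ! k \<or> node_index x = u ! k + 1" by blast
  from first_arrival[OF x k] obtain q h v ls where
    ls: "walk (sstep u) (start u x) ls (arrival u (q, h, v))" "\<forall>s\<in>set ls. turn_letter u s = None"
    and q: "q < length u" "leg h (u ! q) = node_index x" and fo: "fork_out n u (arrival u (q, h, v)) = []"
    by blast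
  note out = outputs_without_turn[OF ls(2)]
  have tm: "terminating (sstep u) (arrival u (q, h, v))"
    using strand_walk[OF x] walk_terminating_iff[OF ls(1)] sstep_finish unfolding terminating_def by blast
  show ?thesis
  proof (cases "valid (q, h, v)")
    case True
    obtain fs s' where p: "path_ends n u (q, h, v) fs s'" using path_ends_exists[OF True tm] by blast
    from path_ends_walk[OF p True] obtain l2 where
      l2: "walk (sstep u) (arrival u (q, h, v)) l2 (finish u (end_node u s'))"
        "concat (map (deco_out (gen_deco n) u) l2) = concat (map fork_word fs) @ exit_word (end_node u s')"
        "concat (map (fork_out n u) l2) = fs" by blast
    note e = strand_walk_eq[OF x walk_trans[OF ls(1) l2(1)]]
    have "exit_word x = []"
      using True q letter[OF q(1)] by (cases h) (auto simp: exit_word_def valid_def leg_def)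
    then show ?thesis using e out l2 by simp
  next
    case False
    \<comment> \<open>The strand enters on the outer leg of a node in an extreme column. This first
      turn yields the decoration of \<open>exit_word x\<close>, and a valid state is reached only
      with the next node.\<close>
    then have c: "u ! q = end_column n (hflip h)" using q by (simp add: valid_def)
    then have ne: "u ! q \<noteq> end_column n h" using end_column_hflip by fastforce
    have ex: "exit_word x = gen_deco n (u ! q)" "exit_word x \<noteq> []"
      using c q(2) n2 by (cases h; auto simp: exit_word_def gen_deco_def leg_def)+
    show ?thesis
    proof (cases "path_next n u (q, h, v)")
      case None
      from path_next_None_walk[OF q(1) None] obtain l2 where
        l2: "walk (sstep u) (arrival u (q, h, v)) l2 (finish u (end_node u (q, h, v)))"
          "concat (map (deco_out (gen_deco n) u) l2) = gen_deco n (u ! q)"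
          "concat (map (fork_out n u) l2) = []" using fo by auto
      note e = strand_walk_eq[OF x walk_trans[OF ls(1) l2(1)]]
      have "exit_word (end_node u (q, h, v)) = []" "node_index (end_node u (q, h, v)) \<noteq> node_index x"
        using c n2 unfolding end_node_eq q(2)[symmetric] by (cases h; auto simp: exit_word_def leg_def)+
      then show ?thesis using e out l2 ex by simp
    next
      case (Some a)
      obtain t fo' where a: "a = (t, fo')" by (cases a)
      note pn = path_next_walk[OF q(1) Some[unfolded a]]
      obtain j h' v' where t: "t = (j, h', v')" by (cases t)
      have fo': "fo' = None" using pn(3) ne by simp
      have h': "h' = h" using pn(5)[OF t] ne by simp
      obtain l2 where l2: "walk (sstep u) (arrival u (q, h, v)) l2 (arrival u t)"
        "concat (map (deco_out (gen_deco n) u) l2) = gen_deco n (u ! q)"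
        "concat (map (fork_out n u) l2) = []" using pn(1) fo fo' by auto
      have tm': "terminating (sstep u) (arrival u t)" using walk_terminating_iff[OF l2(1)] tm by simp
      obtain fs s' where p: "path_ends n u t fs s'" using path_ends_exists[OF pn(2) tm'] by blast
      from path_ends_walk[OF p pn(2)] obtain l3 where
        vs: "valid s'" and l3: "walk (sstep u) (arrival u t) l3 (finish u (end_node u s'))"
          "concat (map (deco_out (gen_deco n) u) l3) = concat (map fork_word fs) @ exit_word (end_node u s')"
          "concat (map (fork_out n u) l3) = fs" by blast
      note e = strand_walk_eq[OF x walk_trans[OF ls(1) walk_trans[OF l2(1) l3(1)]]]
      have "node_index (end_node u s') \<noteq> node_index x" if "fs = []"
      proof -
        obtain i' h'' v'' where s': "s' = (i', h'', v'')" by (cases s')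
        have "h'' = h" using path_ends_straight[OF p that pn(2)] s' t h' by simp
        moreover have "i' < length u" using vs s' by (simp add: valid_def)
        ultimately show ?thesis using letter[of i'] c unfolding s' end_node_eq q(2)[symmetric]
          by (cases h) (auto simp: leg_def)
      qed
      then show ?thesis using e out l2 l3 ex by auto
    qed
  qed
qed

section \<open>Vertical translation and the shape of cycles\<close>

definition count_before :: "nat \<Rightarrow> nat \<Rightarrow> nat" where
  "count_before c i = card {k. k < i \<and> u ! k = c}"

text \<open>The rank of a node in its own column, counted from the top starting at 0; together with
  the label it determines the node.\<close>

definition occ :: "nat \<Rightarrow> nat" where
  "occ i = count_before (u ! i) i"

lemma count_before_insert:
  assumes "{k. k < j \<and> u ! k = c} = insert p {k. k < i \<and> u ! k = c}" "i \<le> p"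
  shows "count_before c j = count_before c i + 1"
  using assms unfolding count_before_def by simp

lemma occ_less: "i < j \<Longrightarrow> u ! i = u ! j \<Longrightarrow> occ i < occ j"
  unfolding occ_def count_before_def by (intro psubset_card_mono) auto

lemma occ_inj: "u ! i = u ! j \<Longrightarrow> occ i = occ j \<Longrightarrow> i = j"
  using occ_less[of i j] occ_less[of j i] by (cases i j rule: linorder_cases) auto

lemma occ_le: "occ i \<le> i"
proof -
  have "card {k. k < i \<and> u ! k = u ! i} \<le> card {..<i}" by (intro card_mono) auto
  then show ?thesis by (simp add: occ_def count_before_def)
qed

lemma count_before_nextin:
  assumes "nextin u {c} p q" "d = c + 1 \<or> c = d + 1" "c \<in> gens n" "d \<in> gens n"
  shows "count_before c q = count_before c p + 1" "count_before d q = count_before d p + 1"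
proof -
  have nx: "p < q" "u ! p = c" "\<And>k. p < k \<Longrightarrow> k < q \<Longrightarrow> u ! k \<noteq> c" using assms(1) by (auto simp: nextin_def)
  have dc: "d \<noteq> c" using assms(2) by auto
  have "{k. k < q \<and> u ! k = c} = insert p {k. k < p \<and> u ! k = c}"
    using nx by (auto simp: not_less) (metis linorder_neqE_nat)
  then show "count_before c q = count_before c p + 1" by (rule count_before_insert) simp
  obtain k where k: "nextin u {c, d} p k" "nextin u {c, d} k q" "u ! k = d" using between_exists[OF assms] by blast
  have kk: "p < k" "k < q" "\<And>j. p < j \<Longrightarrow> j < k \<Longrightarrow> u ! j \<noteq> d" "\<And>j. k < j \<Longrightarrow> j < q \<Longrightarrow> u ! j \<noteq> d"
    using k(1,2) by (auto simp: nextin_def)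
  have "j = k" if "j < q" "u ! j = d" "\<not> j < p" for j
  proof -
    have "j \<noteq> p" using nx(2) dc that(2) by auto
    then have "p < j" using that(3) by simp
    then show ?thesis using kk(3)[of j] kk(4)[of j] that by (cases j k rule: linorder_cases) auto
  qed
  then have "{j. j < q \<and> u ! j = d} \<subseteq> insert k {j. j < p \<and> u ! j = d}" by blast
  moreover have "insert k {j. j < p \<and> u ! j = d} \<subseteq> {j. j < q \<and> u ! j = d}"
    using kk(1,2) k(3) nx(1) by auto
  ultimately have "{j. j < q \<and> u ! j = d} = insert k {j. j < p \<and> u ! j = d}" by blast
  then show "count_before d q = count_before d p + 1" by (rule count_before_insert) (use kk(1) in simp)
qed

text \<open>From one \<open>c\<close> to the next both counts grow by one, since exactly one
  \<open>d\<close> lies between. This makes \<open>offset\<close> independent of the node at which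
  it is evaluated.\<close>

lemma count_before_const:
  assumes "u ! i = c" "u ! j = c" "i < length u" "j < length u" "d = c + 1 \<or> c = d + 1" "c \<in> gens n" "d \<in> gens n"
  shows "int (count_before d i) - int (count_before c i) = int (count_before d j) - int (count_before c j)"
proof -
  have *: "int (count_before d i) - int (count_before c i) = int (count_before d j) - int (count_before c j)"
    if "i \<le> j" "u ! i = c" "u ! j = c" "j < length u" for i j
    using that
  proof (induction j rule: less_induct)
    case (less j)
    show ?case
    proof (cases "i = j")
      case False
      then obtain p where p: "nextin u {c} p j" "i \<le> p"
        using previn_exists[of i j u "{c}"] less.prems by auto
      have "p < j" "u ! p = c" using p(1) by (auto simp: nextin_def)
      then have "int (count_before d i) - int (count_before c i) = int (count_before d p) - int (count_before c p)"
        using less.IH[of p] p(2) less.prems by simp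
      then show ?thesis using count_before_nextin[OF p(1) assms(5-7)] by simp
    qed simp
  qed
  show ?thesis
  proof (cases "i \<le> j")
    case True
    show ?thesis by (rule *) (use assms True in simp_all)
  next
    case False
    show ?thesis by (rule *[symmetric]) (use assms False in simp_all)
  qed
qed

definition offset :: "nat \<Rightarrow> nat \<Rightarrow> int" where
  "offset c d = (let i = LEAST i. i < length u \<and> u ! i = c in int (count_before d i) - int (count_before c i))"

lemma offset_eq:
  assumes "i < length u" "u ! i = c" "d = c + 1 \<or> c = d + 1" "c \<in> gens n" "d \<in> gens n"
  shows "int (count_before d i) - int (count_before c i) = offset c d"
proof -
  let ?l = "LEAST i. i < length u \<and> u ! i = c"
  have l: "?l < length u \<and> u ! ?l = c" using LeastI[of "\<lambda>i. i < length u \<and> u ! i = c" i] assms by simp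
  show ?thesis unfolding offset_def Let_def
    by (rule count_before_const) (use assms l in auto)
qed

text \<open>The \<open>d\<close> following \<open>i\<close> has all the \<open>d\<close>s before
  \<open>i\<close> above it; the \<open>d\<close> preceding \<open>i\<close> has one fewer.\<close>

lemma occ_nextv:
  assumes "nextv u {c, d} v i j" "u ! i = c" "u ! j = d" "d = c + 1 \<or> c = d + 1" "c \<in> gens n" "d \<in> gens n"
  shows "int (occ j) = int (occ i) + (offset c d - (if v = Upward then 1 else 0))"
proof -
  have i: "i < length u" using nextv_bounds[OF assms(1)] by simp
  have cd: "c \<noteq> d" using assms(4) by auto
  have "int (occ i) + offset c d = int (count_before d i)"
    using offset_eq[OF i assms(2,4-6)] assms(2) by (simp add: occ_def)
  moreover have "int (occ j) = int (count_before d i) - (if v = Upward then 1 else 0)"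
  proof (cases v)
    case Downward
    then have nx: "nextin u {c, d} i j" using assms(1) by (simp add: nextv_def)
    have "k < i" if "k < j" "u ! k = d" for k
    proof (rule ccontr)
      assume "\<not> k < i"
      moreover have "k \<noteq> i" using assms(2) that(2) cd by auto
      ultimately show False using nx that by (auto simp: nextin_def)
    qed
    moreover have "i < j" using nx by (simp add: nextin_def)
    ultimately have "{k. k < j \<and> u ! k = d} = {k. k < i \<and> u ! k = d}" using less_trans by blast
    then show ?thesis using Downward assms(3) by (simp add: occ_def count_before_def)
  next
    case Upward
    then have nx: "nextin u {c, d} j i" using assms(1) by (simp add: nextv_def)
    have "k = j" if "k < i" "u ! k = d" "\<not> k < j" for k
      by (cases k j rule: linorder_cases) (use nx that in \<open>auto simp: nextin_def\<close>)
    then have "{k. k < i \<and> u ! k = d} \<subseteq> insert j {k. k < j \<and> u ! k = d}" by blast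
    moreover have "insert j {k. k < j \<and> u ! k = d} \<subseteq> {k. k < i \<and> u ! k = d}"
      using nx assms(3) by (auto simp: nextin_def)
    ultimately have "{k. k < i \<and> u ! k = d} = insert j {k. k < j \<and> u ! k = d}" by blast
    then have "count_before d i = count_before d j + 1" by (rule count_before_insert) simp
    then show ?thesis using Upward assms(3) by (simp add: occ_def)
  qed
  ultimately show ?thesis by simp
qed

text \<open>In the end column the path first passes to the other extreme node of the fork, which
  changes the rank by one, and then steps back in the vertical direction \<open>v\<close>. Elsewhere
  it steps in the direction \<open>vflip v\<close>; hence the opposite conditions in the two
  branches.\<close>

definition path_shift :: "nat \<Rightarrow> hdir \<Rightarrow> vdir \<Rightarrow> int" where
  "path_shift c h v = (if c = end_column n h
     then (if v = Downward then - 1 else 1) + (offset c (nb (hflip h) c) - (if v = Upward then 1 else 0))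
     else offset c (nb h c) - (if v = Downward then 1 else 0))"

text \<open>A step of a snake path shifts the index of the node among the nodes of its column by an amount that depends
  on column and directions only; so paths are invariant under vertical translation.\<close>

lemma path_next_occ:
  assumes i: "i < length u" and pn: "path_next n u (i, h, v) = Some ((j, h', v'), fo)"
  shows "int (occ j) = int (occ i) + path_shift (u ! i) h v"
proof (cases "u ! i = end_column n h")
  case False
  with pn obtain q where q: "nextv u {u ! i, nb h (u ! i)} (vflip v) i q"
    unfolding path_next_inner[OF i False] by (auto split: if_splits)
  then have "(THE q. nextv u {u ! i, nb h (u ! i)} (vflip v) i q) = q"
    by (intro the_equality) (auto intro: nextv_unique)
  then have "j = q" using pn q unfolding path_next_inner[OF i False] by (auto split: if_splits)
  moreover have "nb h (u ! i) = u ! i + 1 \<or> u ! i = nb h (u ! i) + 1" "u ! i \<in> gens n" "nb h (u ! i) \<in> gens n"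
    using letter[OF i] False by (cases h; auto simp: gens_bounds)+
  ultimately show ?thesis
    using occ_nextv[OF q refl nextv_letter[OF q False]] False by (simp add: path_shift_def)
next
  case True
  then have "\<exists>p. beyond v i p" using path_next_end(1)[OF i True] pn by fastforce
  then obtain p where b: "beyond v i p" by blast
  from path_next_end(2)[OF i True b] pn have
    j: "nextv u {u ! p, nb (hflip h) (u ! p)} v p j" "u ! j = nb (hflip h) (u ! i)" by auto
  have nx: "nextv u {u ! i} (vflip v) i p" using b by (simp only: beyond_iff)
  have p: "p < length u" "u ! p = u ! i" using nextv_bounds[OF nx] nextv_in[OF nx] by auto
  have g: "nb (hflip h) (u ! i) = u ! i + 1 \<or> u ! i = nb (hflip h) (u ! i) + 1" "u ! i \<in> gens n" "nb (hflip h) (u ! i) \<in> gens n"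
    using letter[OF i] True n2 by (cases h; auto simp: gens_bounds)+
  have "int (occ p) = int (occ i) + (if v = Downward then - 1 else 1)"
  proof (cases v)
    case Downward
    then have "nextin u {u ! i} p i" using nx by (simp add: nextv_def)
    from count_before_nextin(1)[OF this g] show ?thesis using Downward p(2) by (simp add: occ_def)
  next
    case Upward
    then have "nextin u {u ! i} i p" using nx by (simp add: nextv_def)
    from count_before_nextin(1)[OF this g] show ?thesis using Upward p(2) by (simp add: occ_def)
  qed
  then show ?thesis
    using occ_nextv[OF j(1)] j(2) p(2) g True by (simp add: path_shift_def)
qed

definition endless :: "state \<Rightarrow> bool" where
  "endless s \<longleftrightarrow> valid s \<and> \<not> terminating (sstep u) (arrival u s)"

lemma endless_next:
  assumes "endless s" shows "\<exists>t fo. path_next n u s = Some (t, fo) \<and> endless t"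
proof -
  obtain i h v where s: "s = (i, h, v)" by (cases s)
  have i: "i < length u" using assms s by (simp add: endless_def valid_def)
  have "path_next n u s \<noteq> None"
    using path_ends.stop[of n u s] path_ends_terminating[of s "[]" s] assms
    unfolding endless_def by blast
  then obtain a where "path_next n u s = Some a" by blast
  then obtain t fo where t: "path_next n u s = Some (t, fo)" by (cases a) auto
  note pn = path_next_walk[OF i t[unfolded s]]
  obtain ls where "walk (sstep u) (arrival u s) ls (arrival u t)" using pn(1) s by blast
  from walk_terminating_iff[OF this] have "endless t" using assms pn(2) unfolding endless_def by blast
  then show ?thesis using t by blast
qed

fun dist_end :: "hdir \<Rightarrow> nat \<Rightarrow> nat" where
  "dist_end Rightward c = n + 1 - c"
| "dist_end Leftward c = c - 1"

text \<open>The total shift of a half lap: \<open>k\<close> moves from column \<open>c\<close> to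
  the end column, followed by the crossing of the fork there.\<close>

primrec lap_shift :: "nat \<Rightarrow> nat \<Rightarrow> hdir \<Rightarrow> vdir \<Rightarrow> int" where
  "lap_shift 0 c h v = path_shift c h v"
| "lap_shift (Suc k) c h v = path_shift c h v + lap_shift k (nb h c) h (vflip v)"

text \<open>An endless path cannot stop, so it runs on to the end column and crosses a fork there.
  The moves before take place in inner columns and contribute neither decorations nor forks.\<close>

lemma endless_lap:
  assumes "endless (i, h, v)" "dist_end h (u ! i) = k"
  shows "\<exists>f j ls. walk (sstep u) (arrival u (i, h, v)) ls (arrival u (j, hflip h, (vflip ^^ k) v)) \<and>
    concat (map (deco_out (gen_deco n) u) ls) = fork_word f \<and> concat (map (fork_out n u) ls) = [f] \<and>
    ls \<noteq> [] \<and> f \<in> forks n u \<and> u ! fst f = end_column n h \<and> f \<in> path_crosses n u (i, h, v) \<and>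
    endless (j, hflip h, (vflip ^^ k) v) \<and> u ! j = nb (hflip h) (end_column n h) \<and>
    int (occ j) = int (occ i) + lap_shift k (u ! i) h v"
  using assms
proof (induction k arbitrary: i v)
  case 0
  have val: "valid (i, h, v)" using 0 by (simp add: endless_def)
  then have i: "i < length u" by (simp add: valid_def)
  obtain t fo where t: "path_next n u (i, h, v) = Some (t, fo)" "endless t" using endless_next[OF 0(1)] by blast
  obtain j h' v' where tj: "t = (j, h', v')" by (cases t)
  have e: "u ! i = end_column n h" using 0(2) letter[OF i] by (cases h) auto
  note pn = path_next_walk[OF i t(1)]
  obtain f where f: "fo = Some f" using pn(3) e by (cases fo) auto
  have tt: "t = (j, hflip h, v)" "u ! j = nb (hflip h) (u ! i)" using pn(5)[OF tj] e tj by auto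
  have "f \<in> path_crosses n u (i, h, v)" using t(1) f by (subst path_crosses_unfold) simp
  moreover have "int (occ j) = int (occ i) + path_shift (u ! i) h v"
    using path_next_occ[OF i t(1)[unfolded tt(1)]] .
  moreover obtain ls where "walk (sstep u) (arrival u (i, h, v)) ls (arrival u t)" "ls \<noteq> []"
    "concat (map (deco_out (gen_deco n) u) ls) = fork_word f" "concat (map (fork_out n u) ls) = [f]"
    using pn(1) f by auto
  ultimately show ?case using pn(4)[OF f] tt t(2) e by (intro exI[of _ f] exI[of _ j] exI[of _ ls]) auto
next
  case (Suc k)
  have val: "valid (i, h, v)" using Suc by (simp add: endless_def)
  then have i: "i < length u" by (simp add: valid_def)
  obtain t fo where t: "path_next n u (i, h, v) = Some (t, fo)" "endless t" using endless_next[OF Suc.prems(1)] by blast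
  obtain j h' v' where tj: "t = (j, h', v')" by (cases t)
  have e: "u ! i \<noteq> end_column n h" using Suc.prems(2) letter[OF i] by (cases h) auto
  note pn = path_next_walk[OF i t(1)]
  have fo: "fo = None" using pn(3) e by simp
  have tt: "t = (j, h, vflip v)" "u ! j = nb h (u ! i)" using pn(5)[OF tj] e tj by auto
  have inner: "u ! i \<noteq> 1" "u ! i \<noteq> n + 1" using e val by (cases h; auto simp: valid_def)+
  obtain l1 where l1: "walk (sstep u) (arrival u (i, h, v)) l1 (arrival u (j, h, vflip v))" "l1 \<noteq> []"
    "concat (map (deco_out (gen_deco n) u) l1) = []" "concat (map (fork_out n u) l1) = []"
    using pn(1) fo inner fork_out_arrival_inner[OF i inner] tt(1) by (auto simp: gen_deco_def)
  have d: "dist_end h (u ! j) = k" using tt(2) Suc.prems(2) by (cases h) auto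
  from Suc.IH[OF t(2)[unfolded tt(1)] d] obtain f j' l2 where
    l2: "walk (sstep u) (arrival u (j, h, vflip v)) l2 (arrival u (j', hflip h, (vflip ^^ k) (vflip v)))"
    "concat (map (deco_out (gen_deco n) u) l2) = fork_word f" "concat (map (fork_out n u) l2) = [f]"
    and f: "f \<in> forks n u" "u ! fst f = end_column n h" "f \<in> path_crosses n u (j, h, vflip v)"
    and j': "endless (j', hflip h, (vflip ^^ k) (vflip v))" "u ! j' = nb (hflip h) (end_column n h)"
      "int (occ j') = int (occ j) + lap_shift k (u ! j) h (vflip v)" by blast
  have pc: "f \<in> path_crosses n u (i, h, v)" using f(3) t(1) tt(1) by (subst path_crosses_unfold) simp
  have sh: "int (occ j') = int (occ i) + lap_shift (Suc k) (u ! i) h v"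
    using path_next_occ[OF i t(1)[unfolded tt(1)]] j'(3) tt(2) by simp
  have v: "(vflip ^^ Suc k) v = (vflip ^^ k) (vflip v)" by (simp add: funpow_swap1)
  show ?case
    unfolding v using walk_trans[OF l1(1) l2(1)] l1 l2 f pc j' sh
    by (intro exI[of _ f] exI[of _ j'] exI[of _ "l1 @ l2"]) auto
qed

lemma fork_sides:
  assumes "f \<in> forks n u"
  shows "f \<in> left_forks n u \<longleftrightarrow> u ! fst f = 1" "f \<in> right_forks n u \<longleftrightarrow> u ! fst f = n + 1"
proof -
  obtain t b where f: "f = (t, b)" by (cases f)
  have nx: "nextin u {u ! b} t b" using assms unfolding f forks_iff by blast
  then have e: "u ! t = u ! b" unfolding nextin_def by blast
  have "nextin u {c} t b \<longleftrightarrow> u ! t = c" for c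
  proof
    assume "nextin u {c} t b"
    then show "u ! t = c" unfolding nextin_def by blast
  next
    assume "u ! t = c"
    then show "nextin u {c} t b" using nx unfolding e by simp
  qed
  then show "f \<in> left_forks n u \<longleftrightarrow> u ! fst f = 1" "f \<in> right_forks n u \<longleftrightarrow> u ! fst f = n + 1"
    unfolding f left_forks_iff right_forks_iff fst_conv by blast+
qed

lemma vflip_funpow: "(vflip ^^ k) ((vflip ^^ k) v) = v"
  by (induction k arbitrary: v) (auto simp: funpow_swap1)

text \<open>On a closed walk every state has its predecessor. If the walk contains
  \<open>cap f\<close> only in reversed form, it contains the predecessor of that state, which is
  \<open>cap' f\<close> and records \<open>f\<close> as well.\<close>

lemma closed_walk_forks:
  assumes "walk (sstep u) s xs s" "xs \<noteq> []" "f \<in> forks n u" "same_strand s (cap f)"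
  shows "f \<in> set (concat (map (fork_out n u) xs))"
proof -
  have fl: "snd f < length u" using fork_length[OF assms(3)] by simp
  have "cap f \<in> set xs \<or> cap' f \<in> set xs"
  proof (rule ccontr)
    assume no: "\<not> ?thesis"
    then have m: "srev (cap f) \<in> set xs" using same_strand_in_closed[OF assms(1,2,4)] by blast
    obtain ys z where xs: "xs = ys @ [z]" using assms(2) by (cases xs rule: rev_cases) auto
    have "z \<in> set xs" "sstep u z = Some s" using assms(1) unfolding xs by (auto simp: walk_snoc)
    moreover have "srev (cap f) = s \<or> (\<exists>a\<in>set xs. sstep u a = Some (srev (cap f)))"
      using walk_predecessor[OF assms(1), of "srev (cap f)"] m by simp
    ultimately obtain a where a: "a \<in> set xs" "sstep u a = Some (srev (cap f))" by metis
    have "a = cap' f" by (rule f_inj[OF a(2) sstep_cap(2)[OF fl]])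
    then show False using a no by blast
  qed
  moreover have "fork_out n u (cap f) = [f]" "fork_out n u (cap' f) = [f]"
    using fork_out_caps assms(3) by blast+
  ultimately have "\<exists>y\<in>set xs. f \<in> set (fork_out n u y)" by (metis list.set_intros(1))
  then show ?thesis by simp
qed

text \<open>A round trip from column 2 returns to column 2 in the same directions and changes the
  rank by a constant \<open>Z\<close>. It can be repeated for ever, while ranks are bounded; so
  \<open>Z\<close> is 0 and the first round trip already returns to \<open>i\<close>. Thus the whole
  strand meets only the two forks of one round.\<close>

lemma endless_closed:
  assumes "endless (i, Rightward, v)" "u ! i = 2"
  shows "\<exists>r l ls. walk (sstep u) (arrival u (i, Rightward, v)) ls (arrival u (i, Rightward, v)) \<and> ls \<noteq> [] \<and>
    concat (map (deco_out (gen_deco n) u) ls) = [Circle, Circle, Bullet, Bullet] \<and>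
    r \<in> right_forks n u \<and> l \<in> left_forks n u \<and>
    {f \<in> forks n u. same_strand (arrival u (i, Rightward, v)) (cap f)} = {r, l}"
proof -
  define v' where "v' = (vflip ^^ (n - 1)) v"
  define Z where "Z = lap_shift (n - 1) 2 Rightward v + lap_shift (n - 1) n Leftward v'"
  have round: "\<exists>k r l ls. walk (sstep u) (arrival u (i, Rightward, v)) ls (arrival u (k, Rightward, v)) \<and> ls \<noteq> [] \<and>
      concat (map (deco_out (gen_deco n) u) ls) = fork_word r @ fork_word l \<and>
      concat (map (fork_out n u) ls) = [r, l] \<and>
      r \<in> forks n u \<and> l \<in> forks n u \<and> u ! fst r = n + 1 \<and> u ! fst l = 1 \<and>
      endless (k, Rightward, v) \<and> u ! k = 2 \<and> int (occ k) = int (occ i) + Z"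
    if en: "endless (i, Rightward, v)" "u ! i = 2" for i
  proof -
    have d: "dist_end Rightward (u ! i) = n - 1" using that(2) n2 by simp
    note lap = endless_lap[OF en(1) d, folded v'_def, unfolded en(2) hflip.simps end_column.simps nb.simps
        add_diff_cancel_right']
    from lap obtain r j l1 where
      l1: "walk (sstep u) (arrival u (i, Rightward, v)) l1 (arrival u (j, Leftward, v'))"
        "concat (map (deco_out (gen_deco n) u) l1) = fork_word r" "concat (map (fork_out n u) l1) = [r]" "l1 \<noteq> []"
      and r: "r \<in> forks n u" "u ! fst r = n + 1"
      and j: "endless (j, Leftward, v')" "u ! j = n" "int (occ j) = int (occ i) + lap_shift (n - 1) 2 Rightward v"
      by blast
    have d': "dist_end Leftward (u ! j) = n - 1" using j(2) by simp
    \<comment> \<open>Both halves flip the vertical direction \<open>n - 1\<close> times and a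
      crossing keeps it, so a round trip restores \<open>v\<close>.\<close>
    have vv: "(vflip ^^ (n - 1)) v' = v" unfolding v'_def by (rule vflip_funpow)
    note lap' = endless_lap[OF j(1) d', unfolded vv j(2) hflip.simps end_column.simps nb.simps one_add_one]
    from lap' obtain l k l2 where
      l2: "walk (sstep u) (arrival u (j, Leftward, v')) l2 (arrival u (k, Rightward, v))"
        "concat (map (deco_out (gen_deco n) u) l2) = fork_word l" "concat (map (fork_out n u) l2) = [l]"
      and l: "l \<in> forks n u" "u ! fst l = 1"
      and k: "endless (k, Rightward, v)" "u ! k = 2" "int (occ k) = int (occ j) + lap_shift (n - 1) n Leftward v'"
      by blast
    show ?thesis
      using walk_trans[OF l1(1) l2(1)] l1 l2 r l j k
      by (intro exI[of _ k] exI[of _ r] exI[of _ l] exI[of _ "l1 @ l2"]) (auto simp: Z_def)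
  qed
  have many: "\<exists>k. endless (k, Rightward, v) \<and> u ! k = 2 \<and> int (occ k) = int (occ i) + int m * Z" for m
  proof (induction m)
    case 0
    show ?case using assms by auto
  next
    case (Suc m)
    then obtain k where k: "endless (k, Rightward, v)" "u ! k = 2" "int (occ k) = int (occ i) + int m * Z" by blast
    from round[OF k(1,2)] obtain k' where "endless (k', Rightward, v)" "u ! k' = 2" "int (occ k') = int (occ k) + Z" by blast
    then show ?case using k(3) by (intro exI[of _ k']) (simp add: algebra_simps)
  qed
  \<comment> \<open>This holds for every number \<open>m\<close> of laps; a nonzero \<open>Z\<close>
    violates it after \<open>length u\<close> laps.\<close>
  have bound: "0 \<le> int (occ i) + int m * Z \<and> int (occ i) + int m * Z < int (length u)" for m
  proof -
    obtain k where k: "endless (k, Rightward, v)" "int (occ k) = int (occ i) + int m * Z" using many by blast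
    have "occ k < length u" using occ_le[of k] k(1) by (simp add: endless_def valid_def)
    then show ?thesis using k(2) by linarith
  qed
  have "Z = 0"
  proof (rule ccontr)
    assume "Z \<noteq> 0"
    then consider "Z \<ge> 1" | "Z \<le> - 1" by linarith
    then show False
    proof cases
      case 1
      then have "int (length u) * 1 \<le> int (length u) * Z" by (intro mult_left_mono) auto
      then show False using bound[of "length u"] by simp
    next
      case 2
      then have "int (length u) * Z \<le> int (length u) * (- 1)" by (intro mult_left_mono) auto
      moreover have "occ i < length u" using occ_le[of i] assms(1) by (simp add: endless_def valid_def)
      ultimately show False using bound[of "length u"] by simp
    qed
  qed
  from round[OF assms] obtain k r l ls where
    ls: "walk (sstep u) (arrival u (i, Rightward, v)) ls (arrival u (k, Rightward, v))" "ls \<noteq> []"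
      "concat (map (deco_out (gen_deco n) u) ls) = fork_word r @ fork_word l" "concat (map (fork_out n u) ls) = [r, l]"
    and rl: "r \<in> forks n u" "l \<in> forks n u" "u ! fst r = n + 1" "u ! fst l = 1"
    and k: "u ! k = 2" "int (occ k) = int (occ i) + Z" by blast
  have "k = i" using occ_inj[of k i] k \<open>Z = 0\<close> assms(2) by simp
  have side: "r \<in> right_forks n u" "l \<in> left_forks n u"
    using rl fork_sides by blast+
  have nl: "r \<notin> left_forks n u" using side left_not_right by blast
  have "{f \<in> forks n u. same_strand (arrival u (i, Rightward, v)) (cap f)} = {r, l}"
  proof -
    have "set (concat (map (fork_out n u) ls)) = {r, l}" unfolding ls(4) by simp
    then show ?thesis
      using walk_forks[OF ls(1)] closed_walk_forks[OF ls(1)[unfolded \<open>k = i\<close>] ls(2)] by blast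
  qed
  moreover have "fork_word r = [Circle, Circle]" "fork_word l = [Bullet, Bullet]"
    using nl side(2) by (simp_all add: fork_word_def)
  then have "concat (map (deco_out (gen_deco n) u) ls) = [Circle, Circle, Bullet, Bullet]"
    using ls(3) by simp
  ultimately show ?thesis using ls(1)[unfolded \<open>k = i\<close>] ls(2) side by blast
qed

text \<open>After at most two half laps an endless path leaves column 1 to the right, and its next
  node is in column 2.\<close>

lemma endless_column_2:
  assumes "endless s"
  shows "\<exists>k v. endless (k, Rightward, v) \<and> u ! k = 2 \<and> same_strand (arrival u s) (arrival u (k, Rightward, v))"
proof -
  have left: "\<exists>k v. endless (k, Rightward, v) \<and> u ! k = 2 \<and> same_strand (arrival u s) (arrival u (k, Rightward, v))"
    if s: "s = (i, Leftward, v)" "endless s" for s i v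
  proof -
    note lap = endless_lap[OF s(2)[unfolded s(1)] refl, unfolded hflip.simps end_column.simps nb.simps one_add_one]
    from lap obtain k v' ls where "walk (sstep u) (arrival u s) ls (arrival u (k, Rightward, v'))"
      "endless (k, Rightward, v')" "u ! k = 2" unfolding s(1) by blast
    then show ?thesis using same_strand_walk by blast
  qed
  obtain i h v where s: "s = (i, h, v)" by (cases s)
  show ?thesis
  proof (cases h)
    case Leftward
    then show ?thesis using left s assms by blast
  next
    case Rightward
    note lap = endless_lap[OF assms[unfolded s Rightward] refl, unfolded hflip.simps]
    from lap obtain j v' ls where w: "walk (sstep u) (arrival u s) ls (arrival u (j, Leftward, v'))"
      and e: "endless (j, Leftward, v')" unfolding s Rightward by blast
    from left[OF refl e] obtain k v'' where "endless (k, Rightward, v'')" "u ! k = 2"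
      "same_strand (arrival u (j, Leftward, v')) (arrival u (k, Rightward, v''))" by blast
    then show ?thesis using same_strand_trans[OF same_strand_walk[OF w]] by blast
  qed
qed

text \<open>The strand contains just the two forks of \<open>endless_closed\<close>, which bounds
  the crossed forks from above. Conversely, the top path of \<open>f\<close> reaches the opposite
  extreme column and crosses the other fork there.\<close>

lemma cycle_class:
  assumes f: "f \<in> forks n u" and c: "is_cycle n u f"
  shows "\<exists>r l. r \<in> right_forks n u \<and> l \<in> left_forks n u \<and> f \<in> {r, l} \<and>
    {g \<in> forks n u. same_strand (cap f) (cap g)} = {r, l} \<and> crossed_by n u f = {r, l}"
proof -
  have v: "valid (top_start n u f)" "valid (bot_start n u f)" using fork_starts[OF f] by blast+
  note ss = same_strand_fork_starts[OF f]
  have en: "endless (top_start n u f)"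
    using c is_cycle_iff[OF f] same_strand_terminating[OF ss(1) cap_points[OF f] valid_points[OF v(1)]] v(1)
    by (simp add: endless_def)
  obtain i w where i: "endless (i, Rightward, w)" "u ! i = 2" "same_strand (arrival u (top_start n u f)) (arrival u (i, Rightward, w))"
    using endless_column_2[OF en] by blast
  have s: "same_strand (cap f) (arrival u (i, Rightward, w))" using ss(1) i(3) same_strand_trans by blast
  obtain r l where rl: "r \<in> right_forks n u" "l \<in> left_forks n u"
    "{g \<in> forks n u. same_strand (arrival u (i, Rightward, w)) (cap g)} = {r, l}"
    using endless_closed[OF i(1,2)] by blast
  have "same_strand (cap f) x \<longleftrightarrow> same_strand (arrival u (i, Rightward, w)) x" for x
    using same_strand_trans[OF s] same_strand_trans[OF same_strand_sym[OF s]] by blast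
  then have cl: "{g \<in> forks n u. same_strand (cap f) (cap g)} = {r, l}" unfolding rl(3)[symmetric] by blast
  have "f \<in> {g \<in> forks n u. same_strand (cap f) (cap g)}" using f by simp
  then have fm: "f \<in> {r, l}" unfolding cl .
  have "crossed_by n u f \<subseteq> {r, l}"
  proof
    fix g assume "g \<in> crossed_by n u f"
    then consider "g = f" | "g \<in> path_crosses n u (top_start n u f)" | "g \<in> path_crosses n u (bot_start n u f)"
      by (auto simp: crossed_by_def)
    then have "g \<in> forks n u \<and> same_strand (cap f) (cap g)"
    proof cases
      case 1
      then show ?thesis using f by simp
    next
      case 2
      then show ?thesis using path_crosses_same_strand[OF v(1)] same_strand_trans[OF ss(1)] by blast
    next
      case 3
      then show ?thesis using path_crosses_same_strand[OF v(2)] same_strand_trans[OF ss(2)] by blast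
    qed
    then show "g \<in> {r, l}" using cl by blast
  qed
  moreover have "{r, l} \<subseteq> crossed_by n u f"
  proof -
    obtain k where k: "top_start n u f = (k, start_dir n u f, Downward)" using fork_starts[OF f] by blast
    from endless_lap[OF en[unfolded k] refl] obtain g where
      g: "g \<in> forks n u" "u ! fst g = end_column n (start_dir n u f)" "g \<in> path_crosses n u (top_start n u f)"
      using k by metis
    have gc: "g \<in> crossed_by n u f" using g(3) by (simp add: crossed_by_def)
    then have "g \<in> {r, l}" using calculation by blast
    moreover have "g \<noteq> f"
    proof
      assume "g = f"
      moreover have "u ! fst f = end_column n (hflip (start_dir n u f))" using fork_starts[OF f] by blast
      ultimately show False using g(2) n2 by (cases "start_dir n u f") auto
    qed
    moreover have "f \<in> crossed_by n u f" by (simp add: crossed_by_def)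
    ultimately show ?thesis using gc fm by auto
  qed
  ultimately have "crossed_by n u f = {r, l}" by blast
  then show ?thesis using rl(1,2) fm cl by blast
qed

end

section \<open>Loops of the product\<close>

lemma alternating_tl: "alternating n (i # u) \<Longrightarrow> alternating n u"
  unfolding alternating_def by (auto split: if_splits dest: distinct_adj_ConsD)

lemma cyc_append: "cyc (x @ y) = cyc (y @ x)"
proof -
  have r: "{rotate k (x @ y) | k. True} \<subseteq> {rotate k (y @ x) | k. True}" for x y :: "deco list"
  proof -
    have "rotate k (x @ y) = rotate (k + length y) (y @ x)" for k
      by (simp add: rotate_rotate[symmetric] rotate_append)
    then show ?thesis by blast
  qed
  have e: "{rotate k (x @ y) | k. True} = {rotate k (y @ x) | k. True}" for x y :: "deco list"
    by (rule equalityI) (rule r)+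
  show ?thesis unfolding cyc_def rev_append e[of x y] e[of "rev y" "rev x"] ..
qed

text \<open>A closed walk either begins with the full lap \<open>m\<close> or is a part of it; a
  proper part would bring \<open>m\<close> back to \<open>s\<close> too early.\<close>

lemma closed_walk_power:
  assumes m: "walk f s m s" "m \<noteq> []" "distinct m" and "walk f s xs s"
  shows "\<exists>e. xs = concat (replicate e m)"
  using assms(4)
proof (induction "length xs" arbitrary: xs rule: less_induct)
  case less
  from walk_compare[OF m(1) less.prems] show ?case
  proof (elim disjE exE conjE)
    fix zs assume zs: "xs = m @ zs" "walk f s zs s"
    then obtain e where "zs = concat (replicate e m)" using less.hyps[of zs] m(2) by auto
    then have "xs = concat (replicate (Suc e) m)" using zs(1) by simp
    then show ?thesis by blast
  next
    fix zs assume zs: "m = xs @ zs" "walk f s zs s"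
    show ?thesis
    proof (cases "xs = [] \<or> zs = []")
      case True
      then show ?thesis using zs(1) by (auto intro: exI[of _ "0::nat"] exI[of _ "1::nat"])
    next
      case False
      then have "hd xs = s" "hd zs = s" using less.prems zs(2) by (cases xs; cases zs; auto)+
      then have "s \<in> set xs" "s \<in> set zs" using False hd_in_set by metis+
      then show ?thesis using m(3) zs(1) by auto
    qed
  qed
qed

lemma concat_map_replicate:
  "concat (map f (concat (replicate e m))) = concat (replicate e (concat (map f m)))"
  by (induction e) simp_all

text \<open>\<open>e\<close> divides 4, and a root of length 1 or 2 is excluded because
  \<open>a\<close> and \<open>b\<close> differ. So a closed walk with this word goes round its loop
  only once.\<close>

lemma root_of_cycle_word:
  assumes "concat (replicate e x) = [a, a, b, b]" "a \<noteq> b" shows "x = [a, a, b, b]"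
proof -
  have "e * length x = 4" using arg_cong[OF assms(1), of length] by (simp add: length_concat sum_list_replicate)
  then have "e dvd 4" by (metis dvd_triv_left)
  then have "e \<le> 4" by (auto dest: dvd_imp_le)
  then consider "e = 0" | "e = 1" | "e = 2" | "e = 3" | "e = 4" by linarith
  then show ?thesis
  proof cases
    case 3
    then have "length x = 2" using \<open>e * length x = 4\<close> by simp
    then obtain y z where "x = [y, z]" by (auto simp: numeral_2_eq_2 length_Suc_conv)
    then show ?thesis using assms 3 by (auto simp: numeral_2_eq_2)
  next
    case 5
    then have "length x = 1" using \<open>e * length x = 4\<close> by simp
    then obtain y where "x = [y]" by (auto simp: length_Suc_conv)
    then show ?thesis using assms 5 by (auto simp: eval_nat_numeral)
  next
    case 4
    then show ?thesis using \<open>e * length x = 4\<close> by arith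
  qed (use assms in auto)
qed

definition cycle_word :: "deco list" where
  "cycle_word = [Bullet, Bullet, Circle, Circle]"

text \<open>Every loop crosses exactly one left fork, and \<open>(b, 1, Downward)\<close> is the
  \<open>cap\<close> of the left fork with lower node \<open>b\<close>; so these letters count the
  loops. Positions are used instead of forks because they behave well when a letter is put in front
  of the word.\<close>

definition endless_ones :: "nat list \<Rightarrow> nat set" where
  "endless_ones u = {b. b < length u \<and> u ! b = 1 \<and> \<not> terminating (sstep u) (b, 1, Downward)}"

lemma finite_endless_ones [simp]: "finite (endless_ones u)"
  by (rule finite_subset[of _ "{..<length u}"]) (auto simp: endless_ones_def)

lemma shift_inj [simp]: "shift s = shift t \<longleftrightarrow> s = t"
  by (cases s; cases t) auto

lemma srev_shift [simp]: "srev (shift s) = shift (srev s)"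
  by (cases s) auto

text \<open>An endless strand never reaches an end of \<open>u\<close>, so it does not meet the new
  letter.\<close>

lemma endless_shift:
  assumes "\<not> terminating (sstep u) s" shows "\<not> terminating (sstep (i # u)) (shift s)"
proof
  assume "terminating (sstep (i # u)) (shift s)"
  then obtain xs e where "walk (sstep (i # u)) (shift s) xs e" "sstep (i # u) e = None" by (auto simp: terminating_def)
  then show False using assms
  proof (induction xs arbitrary: s)
    case Nil
    then have "sstep u s \<noteq> None" by (metis terminating_def walk.simps(1))
    then obtain t where "sstep u s = Some t" by blast
    from sstep_shift[OF this, of i] show False using Nil by simp
  next
    case (Cons x xs)
    then have "sstep u s \<noteq> None" by (metis terminating_def walk.simps(1))
    then obtain t where t: "sstep u s = Some t" by blast
    have "walk (sstep u) s [s] t" using t by simp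
    from walk_terminating_iff[OF this] have "\<not> terminating (sstep u) t" using Cons.prems(3) by simp
    moreover have "walk (sstep (i # u)) (shift t) xs e" using Cons.prems(1) sstep_shift[OF t, of i] by simp
    ultimately show False using Cons.IH Cons.prems(2) by blast
  qed
qed

lemma endless_ones_shift: "Suc ` endless_ones u \<subseteq> endless_ones (i # u)"
proof
  fix c assume "c \<in> Suc ` endless_ones u"
  then obtain c' where "c = Suc c'" "c' < length u" "u ! c' = 1" "\<not> terminating (sstep u) (c', 1, Downward)"
    by (auto simp: endless_ones_def)
  then show "c \<in> endless_ones (i # u)"
    using endless_shift[of u "(c', 1, Downward)" i] by (simp add: endless_ones_def)
qed

context alternating_word
begin

text \<open>If \<open>b\<close> were the uppermost letter 1, the strand would go up along the box
  column 1, which no other letter touches, and leave at \<open>North 1\<close>.\<close>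

lemma endless_one_fork:
  assumes "b \<in> endless_ones u"
  shows "\<exists>t. (t, b) \<in> left_forks n u \<and> cap (t, b) = (b, 1, Downward) \<and> is_cycle n u (t, b)"
proof -
  have b: "b < length u" "u ! b = 1" "\<not> terminating (sstep u) (b, 1, Downward)"
    using assms by (auto simp: endless_ones_def)
  have pt: "(b, 1, Downward) \<in> points n u" using b by (auto simp: points_def)
  have up: "\<not> terminating (sstep u) (b, 1, Upward)"
    using terminating_r[of "(b, 1, Upward)"] b(3) r_D[OF pt] by auto
  have "\<exists>t. nextv u {1} Upward b t"
  proof (rule ccontr)
    assume no: "\<not> ?thesis"
    have "u ! k \<in> {1}" if "k < length u" "1 = u ! k \<or> 1 = u ! k + 1" for k
      using letter[OF that(1)] that(2) by auto
    from travel_out[where x = 1, OF no b(1) _ this] b(2) obtain ls where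
      "walk (sstep u) (arrive (vflip Upward) b, 1, Upward) ls (finish u (North 1))" by auto
    then have "walk (sstep u) (b, 1, Upward) ls (finish u (North 1))" by (simp add: arrive_def)
    then show False using up sstep_finish unfolding terminating_def by blast
  qed
  then obtain t where t: "nextin u {1} t b" by (auto simp: nextv_def)
  then have l: "(t, b) \<in> left_forks n u" by (simp add: left_forks_iff)
  then have f: "(t, b) \<in> forks n u" by (simp add: forks_def)
  have c: "cap (t, b) = (b, 1, Downward)" using b by (simp add: cap_def arrival_def arrive_def leg_def)
  then show ?thesis using l is_cycle_iff[OF f] b(3) by auto
qed

lemma card_endless_ones: "card (endless_ones u) = card {f \<in> left_forks n u. is_cycle n u f}"
proof -
  have lf: "left_forks n u \<subseteq> forks n u" by (simp add: forks_def)
  have "snd ` {f \<in> left_forks n u. is_cycle n u f} = endless_ones u"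
  proof (intro equalityI subsetI)
    fix b assume "b \<in> endless_ones u"
    then show "b \<in> snd ` {f \<in> left_forks n u. is_cycle n u f}" using endless_one_fork[of b] by force
  next
    fix b assume "b \<in> snd ` {f \<in> left_forks n u. is_cycle n u f}"
    then obtain t where f: "(t, b) \<in> left_forks n u" "is_cycle n u (t, b)" by auto
    then have "nextin u {1} t b" by (simp add: left_forks_iff)
    then have "b < length u" "u ! b = 1" unfolding nextin_def by blast+
    moreover have "\<not> terminating (sstep u) (cap (t, b))" using is_cycle_iff[of "(t, b)"] f lf by blast
    ultimately show "b \<in> endless_ones u"
      by (simp add: endless_ones_def cap_def arrival_def arrive_def leg_def)
  qed
  moreover have "inj_on snd {f \<in> left_forks n u. is_cycle n u f}"
    using forks_unique lf by (fastforce intro: inj_onI)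
  ultimately show ?thesis using card_image by metis
qed

end

text \<open>The new letter closes an edge of the old diagram to a loop, whose strand is endless. By
  \<open>endless_closed\<close> this strand has exactly one left fork, which gives the one new
  element, and its word is that of a round trip. The loop read off from the gluing may start
  elsewhere and run the other way, which \<open>cyc\<close> forgets.\<close>

lemma new_cycle:
  assumes A: "alternating_word n (i # w)"
    and closed: "mate (word_diag n (gen_deco n) w) (North i) = North (i + 1)"
  shows "\<exists>b. endless_ones (i # w) = insert b (Suc ` endless_ones w) \<and> b \<notin> Suc ` endless_ones w"
    and "cyc (word (word_diag n (gen_deco n) w) (North i) @ gen_deco n i) = cyc cycle_word"
proof -
  interpret A: alternating_word n "i # w" by fact
  interpret W: alternating_word n w
    using A.n2 A.gens alternating_tl[OF A.alternating] by unfold_locales auto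
  let ?f = "sstep (i # w)"
  have i: "1 \<le> i" "i \<le> n + 1" using A.letter[of 0] by auto
  have Ni: "North i \<in> nodes (n + 2)" "North (i + 1) \<in> nodes (n + 2)" using i by auto
  have closed': "W.other (North (i + 1)) = North i" using W.other_other[of "North i"] closed by simp
  \<comment> \<open>The point just below the new letter, where the loop enters the old word.\<close>
  define a where "a = shift (start w (North i))"
  have a: "a = (1, i, Downward)" by (simp add: a_def)
  obtain ls where ls: "walk (sstep w) (start w (North i)) ls (finish w (North (i + 1)))"
    "concat (map (deco_out (gen_deco n) w) ls) = word W.prod_diag (North i)"
    using W.strand_walk[OF Ni(1)] closed by metis
  define cs where "cs = map shift (ls @ [finish w (North (i + 1))])"
  have last: "?f (shift (finish w (North (i + 1)))) = Some a" by (simp add: a)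
  have cs: "walk ?f a cs a"
    using walk_shift[OF ls(1), of i] last unfolding cs_def a_def by (simp add: walk_snoc)
  have csne: "cs \<noteq> []" by (simp add: cs_def)
  have "distinct (ls @ [finish w (North (i + 1))])"
    by (rule walk_distinct[OF _ _ ls(1)]) (use W.f_inj W.no_start_pred in blast)+
  then have dcs: "distinct cs" unfolding cs_def by (subst distinct_map) (auto simp: inj_on_def)
  have ocs: "concat (map (deco_out (gen_deco n) (i # w)) cs) = word W.prod_diag (North i) @ gen_deco n i"
    using deco_out_shift[OF ls(1), of "gen_deco n" i] ls(2) by (simp add: cs_def deco_out_def)
  have ap: "a \<in> points n (i # w)" using i by (auto simp: a points_def)
  have nt: "\<not> terminating ?f a"
  proof
    assume "terminating ?f a"
    then obtain xs e where e: "walk ?f a xs e" "?f e = None" by (auto simp: terminating_def)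
    have "e \<in> set cs" by (rule A.walk_from_closed[OF cs csne e(1)])
    then obtain bs where "walk ?f e bs a" "bs \<noteq> []" using walk_split[OF cs] by metis
    then show False using e(2) by (cases bs) auto
  qed
  have tls: "terminating (sstep w) s" if "s \<in> set (ls @ [finish w (North (i + 1))])" for s
  proof -
    have "\<exists>xs. walk (sstep w) s xs (finish w (North (i + 1)))"
      using that walk_split[OF ls(1), of s] by (auto intro: exI[of _ "[]"])
    then show ?thesis using sstep_finish unfolding terminating_def by blast
  qed
  \<comment> \<open>The new letter, at position 0, is reached from below. For \<open>i = 1\<close>
    the right leg is taken, otherwise the left one, so that the state is valid; both legs belong to
    the new loop.\<close>
  define s0 where "s0 = (0::nat, if i = 1 then Leftward else Rightward, Upward)"
  have v0: "A.valid s0" using i A.n2 by (auto simp: s0_def A.valid_def)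
  have arr: "arrival (i # w) s0 = (if i = 1 then shift (finish w (North (i + 1))) else srev a)"
    by (simp add: s0_def arrival_def arrive_def leg_def a)
  have "A.same_strand (shift (finish w (North (i + 1)))) a" by (rule A.same_strand_step[OF last])
  then have as0: "A.same_strand a (arrival (i # w) s0)"
  proof -
    assume *: "A.same_strand (shift (finish w (North (i + 1)))) a"
    consider "arrival (i # w) s0 = shift (finish w (North (i + 1)))" | "arrival (i # w) s0 = srev a"
      using arr by metis
    then show ?thesis
    proof cases
      case 1
      then show ?thesis using A.same_strand_sym[OF *] by metis
    next
      case 2
      then show ?thesis using A.same_strand_r[of a] by metis
    qed
  qed
  have "\<not> terminating ?f (arrival (i # w) s0)"
    using A.same_strand_terminating[OF as0 ap A.valid_points[OF v0]] nt by simp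
  then have "A.endless s0" using v0 by (simp add: A.endless_def)
  from A.endless_column_2[OF this] obtain k v where
    k: "A.endless (k, Rightward, v)" "(i # w) ! k = 2"
      "A.same_strand (arrival (i # w) s0) (arrival (i # w) (k, Rightward, v))" by blast
  define s1 where "s1 = arrival (i # w) (k, Rightward, v)"
  have as1: "A.same_strand a s1" using A.same_strand_trans[OF as0 k(3)] by (simp add: s1_def)
  from A.endless_closed[OF k(1,2)] obtain r l ms where
    ms: "walk ?f s1 ms s1" "ms \<noteq> []" "concat (map (deco_out (gen_deco n) (i # w)) ms) = [Circle, Circle, Bullet, Bullet]"
    and rl: "r \<in> right_forks n (i # w)" "l \<in> left_forks n (i # w)"
      "{f \<in> forks n (i # w). A.same_strand s1 (A.cap f)} = {r, l}" unfolding s1_def by blast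
  have cls: "A.same_strand a x \<longleftrightarrow> A.same_strand s1 x" for x
    using A.same_strand_trans[OF as1] A.same_strand_trans[OF A.same_strand_sym[OF as1]] by blast
  have lf: "l \<in> forks n (i # w)" using rl(2) by (simp add: forks_def)
  have lc: "A.same_strand a (A.cap l)" using rl(3) lf cls by blast
  define b where "b = snd l"
  have lb: "b < length (i # w)" "(i # w) ! b = 1" "A.cap l = (b, 1, Downward)"
  proof -
    have "nextin (i # w) {1} (fst l) b" using rl(2) A.left_forks_iff[of "fst l" "snd l"] by (simp add: b_def)
    then show bl: "b < length (i # w)" "(i # w) ! b = 1" unfolding nextin_def by blast+
    show "A.cap l = (b, 1, Downward)"
      unfolding A.cap_def b_def[symmetric] using bl by (simp add: arrival_def arrive_def leg_def)
  qed
  have only: "b' = b" if b': "b' \<in> endless_ones (i # w)" "A.same_strand a (b', 1, Downward)" for b'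
  proof -
    obtain t where t: "(t, b') \<in> left_forks n (i # w)" "A.cap (t, b') = (b', 1, Downward)"
      using A.endless_one_fork[OF b'(1)] by blast
    then have "(t, b') \<in> {f \<in> forks n (i # w). A.same_strand s1 (A.cap f)}"
      using b'(2) cls by (simp add: forks_def)
    then have "(t, b') \<in> {r, l}" using rl(3) by blast
    moreover have "(t, b') \<noteq> r" using t(1) rl(1) A.left_not_right by blast
    ultimately have "(t, b') = l" by blast
    then show ?thesis by (auto simp: b_def)
  qed
  have bX: "b \<in> endless_ones (i # w)"
  proof -
    have "A.cap l \<in> points n (i # w)" by (rule A.cap_points[OF lf])
    then have "\<not> terminating ?f (A.cap l)" using A.same_strand_terminating[OF lc ap] nt by blast
    then show ?thesis using lb by (simp add: endless_ones_def)
  qed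
  have notSuc: "b \<notin> Suc ` endless_ones w"
  proof
    assume "b \<in> Suc ` endless_ones w"
    then obtain b' where b': "b = Suc b'" "\<not> terminating (sstep w) (b', 1, Downward)" "b' < length w"
      by (auto simp: endless_ones_def)
    have pt: "(b', 1, Upward) \<in> points n w" using b'(3) by (auto simp: points_def)
    have nt': "\<not> terminating (sstep w) (b', 1, Upward)"
      using W.terminating_r[OF _ pt] b'(2) by auto
    have "shift (b', 1, Downward) \<in> set cs \<or> srev (shift (b', 1, Downward)) \<in> set cs"
      using A.same_strand_in_closed[OF cs csne, of "(b, 1, Downward)"] lc lb(3) b'(1) by simp
    moreover have "srev (shift (b', 1, Downward)) = shift (b', 1, Upward)" by simp
    moreover have "shift s \<in> set cs \<longleftrightarrow> s \<in> set (ls @ [finish w (North (i + 1))])" for s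
      unfolding cs_def set_map by (rule inj_image_mem_iff) (simp add: inj_def)
    ultimately have "(b', 1, Downward) \<in> set (ls @ [finish w (North (i + 1))]) \<or> (b', 1, Upward) \<in> set (ls @ [finish w (North (i + 1))])"
      by metis
    then show False using tls b'(2) nt' by blast
  qed
  have "endless_ones (i # w) = insert b (Suc ` endless_ones w)"
  proof (intro equalityI subsetI)
    fix c assume "c \<in> insert b (Suc ` endless_ones w)"
    then show "c \<in> endless_ones (i # w)"
      using bX endless_ones_shift by blast
  next
    fix c assume c: "c \<in> endless_ones (i # w)"
    show "c \<in> insert b (Suc ` endless_ones w)"
    proof (cases "A.same_strand a (c, 1, Downward)")
      case True
      then show ?thesis using only[OF c] by simp
    next
      case False
      have "c \<noteq> 0"
      proof
        assume "c = 0"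
        then have "i = 1" using c by (simp add: endless_ones_def)
        then have "?f (0, 1, Downward) = Some (finish (i # w) (North 2))" by simp
        then have "walk ?f (0, 1, Downward) [(0, 1, Downward)] (finish (i # w) (North 2))" by simp
        then have "terminating ?f (0, 1, Downward)" using sstep_finish unfolding terminating_def by blast
        then show False using c \<open>c = 0\<close> by (simp add: endless_ones_def)
      qed
      then obtain c' where c': "c = Suc c'" by (cases c) auto
      have cw: "c' < length w" "w ! c' = 1" using c c' by (auto simp: endless_ones_def)
      \<comment> \<open>A strand that stops in the old word does so at a node of the old box. With
        the new letter it leaves the box from there, unless the node is the north node
        \<open>i\<close> or \<open>i + 1\<close>; but then it lies on the new loop, which this case
        excludes.\<close>
      have "\<not> terminating (sstep w) (c', 1, Downward)"
      proof
        assume "terminating (sstep w) (c', 1, Downward)"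
        then obtain xs e where e: "walk (sstep w) (c', 1, Downward) xs e" "sstep w e = None" by (auto simp: terminating_def)
        have "(c', 1, Downward) \<in> points n w" using cw by (auto simp: points_def)
        then have "e \<in> points n w" using walk_in_closed(1)[OF e(1)] W.f_D by blast
        then obtain y where y: "y \<in> nodes (n + 2)" "e = finish w y" using sstep_NoneE[OF e(2)] by blast
        have w': "walk ?f (c, 1, Downward) (map shift xs) (shift (finish w y))"
          using walk_shift[OF e(1), of i] c' y(2) by simp
        then have nty: "\<not> terminating ?f (shift (finish w y))"
          using walk_terminating_iff[OF w'] c by (simp add: endless_ones_def)
        have ss: "A.same_strand (c, 1, Downward) (shift (finish w y))" by (rule A.same_strand_walk[OF w'])
        show False
        proof (cases y)
          case (South j)
          then have "shift (finish w y) = finish (i # w) y" by simp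
          then have "walk ?f (shift (finish w y)) [] (finish (i # w) y)" by simp
          then show False using nty sstep_finish unfolding terminating_def by blast
        next
          case (North j)
          consider "j = i" | "j = i + 1" | "j \<noteq> i" "j \<noteq> i + 1" by blast
          then show False
          proof cases
            case 1
            then have "shift (finish w y) = srev a" using North by (simp add: a)
            then show False using ss False A.same_strand_r A.same_strand_sym A.same_strand_trans by metis
          next
            case 2
            then have "A.same_strand (shift (finish w y)) a" using North A.same_strand_step[OF last] by simp
            then show False using ss False A.same_strand_sym A.same_strand_trans by blast
          next
            case 3
            then have "?f (shift (finish w y)) = Some (finish (i # w) y)" using North by simp
            then have "walk ?f (shift (finish w y)) [shift (finish w y)] (finish (i # w) y)" by simp
            then show False using nty sstep_finish unfolding terminating_def by blast
          qed
        qed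
      qed
      then show ?thesis using cw c' by (simp add: endless_ones_def)
    qed
  qed
  then show "\<exists>b. endless_ones (i # w) = insert b (Suc ` endless_ones w) \<and> b \<notin> Suc ` endless_ones w"
    using notSuc by blast
  show "cyc (word W.prod_diag (North i) @ gen_deco n i) = cyc cycle_word"
  proof -
    \<comment> \<open>\<open>zs\<close> runs some number of times through the loop rotated to begin
      at \<open>s\<close>. Since its word is no proper power, this is a single lap, and undoing the
      rotation does not change \<open>cyc\<close>.\<close>
    have root: "cyc (concat (map (deco_out (gen_deco n) (i # w)) cs)) = cyc [x, x, y, y]"
      if s: "s \<in> set cs" "walk ?f s zs s" "concat (map (deco_out (gen_deco n) (i # w)) zs) = [x, x, y, y]" "x \<noteq> y"
      for s zs x y
    proof -
      obtain as bs where ab: "cs = as @ bs" "bs \<noteq> []" "walk ?f a as s" "walk ?f s bs a" using walk_split[OF cs s(1)] by blast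
      have m: "walk ?f s (bs @ as) s" by (rule walk_trans[OF ab(4,3)])
      have "bs @ as \<noteq> []" "distinct (bs @ as)" using ab(1,2) dcs by auto
      from closed_walk_power[OF m this s(2)] obtain e where zs: "zs = concat (replicate e (bs @ as))" by blast
      have "concat (replicate e (concat (map (deco_out (gen_deco n) (i # w)) (bs @ as)))) = [x, x, y, y]"
        using s(3) unfolding zs concat_map_replicate .
      from root_of_cycle_word[OF this s(4)]
      have "concat (map (deco_out (gen_deco n) (i # w)) bs) @ concat (map (deco_out (gen_deco n) (i # w)) as) = [x, x, y, y]" by simp
      then show ?thesis unfolding ab(1) map_append concat_append by (metis cyc_append)
    qed
    have "cyc (concat (map (deco_out (gen_deco n) (i # w)) cs)) = cyc cycle_word"
    proof (cases "s1 \<in> set cs")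
      case True
      from root[OF True ms(1,3)] show ?thesis
        using cyc_append[of "[Circle, Circle]" "[Bullet, Bullet]"] by (simp add: cycle_word_def)
    next
      case False
      then have "srev s1 \<in> set cs" using A.same_strand_in_closed[OF cs csne as1] by blast
      obtain ms' where "walk ?f (srev s1) ms' (srev s1)"
        "concat (map (deco_out (gen_deco n) (i # w)) ms') = rev [Circle, Circle, Bullet, Bullet]"
        using A.walk_rev[OF ms(1), where 'b = deco] deco_out_srev[of "i # w" _ _ "gen_deco n"] ms(3) by fastforce
      with root[OF \<open>srev s1 \<in> set cs\<close>] show ?thesis by (simp add: cycle_word_def)
    qed
    then show ?thesis unfolding ocs .
  qed
qed

text \<open>A strand arriving from below at one leg of the new letter turns and enters the old word
  at the other leg. By assumption it does not come back to the new letter, so it leaves the box.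
  Hence strands that stop in the old word still stop.\<close>

lemma no_new_cycle:
  assumes A: "alternating_word n (i # w)"
    and no: "mate (word_diag n (gen_deco n) w) (North i) \<noteq> North (i + 1)"
  shows "endless_ones (i # w) = Suc ` endless_ones w"
proof -
  interpret A: alternating_word n "i # w" by fact
  interpret W: alternating_word n w
    using A.n2 A.gens alternating_tl[OF A.alternating] by unfold_locales auto
  let ?f = "sstep (i # w)"
  have i: "1 \<le> i" "i \<le> n + 1" using A.letter[of 0] by auto
  have Ni: "North i \<in> nodes (n + 2)" "North (i + 1) \<in> nodes (n + 2)" using i by auto
  have out: "terminating ?f (shift (finish w y))" if "y \<noteq> North i" "y \<noteq> North (i + 1)" for y
  proof (cases y)
    case (South j)
    then have "walk ?f (shift (finish w y)) [] (finish (i # w) y)" by simp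
    then show ?thesis using sstep_finish unfolding terminating_def by blast
  next
    case (North j)
    then have "?f (shift (finish w y)) = Some (finish (i # w) y)" using that by simp
    then have "walk ?f (shift (finish w y)) [shift (finish w y)] (finish (i # w) y)" by simp
    then show ?thesis using sstep_finish unfolding terminating_def by blast
  qed
  have turn: "terminating ?f (shift (finish w (North j)))"
    if j: "j = i \<and> j' = i + 1 \<or> j = i + 1 \<and> j' = i" for j j'
  proof -
    have st: "?f (shift (finish w (North j))) = Some (shift (start w (North j')))" using j by auto
    have nj: "North j' \<in> nodes (n + 2)" using j Ni by auto
    obtain ls where ls: "walk (sstep w) (start w (North j')) ls (finish w (W.other (North j')))"
      using W.strand_walk[OF nj] by blast
    have "W.other (North j') \<noteq> North j'" using W.other_neq[OF nj] .
    moreover have "W.other (North j') \<noteq> North j"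
      using j no W.other_other by metis
    ultimately have tm: "terminating ?f (shift (finish w (W.other (North j'))))"
      using out[of "W.other (North j')"] j by auto
    have w': "walk ?f (shift (finish w (North j))) (shift (finish w (North j)) # map shift ls) (shift (finish w (W.other (North j'))))"
      using walk_shift[OF ls, of i] st by simp
    show ?thesis using walk_terminating_iff[OF w'] tm by simp
  qed
  have all: "terminating ?f (shift (finish w y))" for y
  proof (cases "y = North i \<or> y = North (i + 1)")
    case True
    then show ?thesis using turn[of i "i + 1"] turn[of "i + 1" i] by blast
  qed (use out in blast)
  show ?thesis
  proof (intro equalityI subsetI)
    fix c assume "c \<in> Suc ` endless_ones w"
    then show "c \<in> endless_ones (i # w)" using endless_ones_shift by blast
  next
    fix c assume c: "c \<in> endless_ones (i # w)"
    have "c \<noteq> 0"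
    proof
      assume "c = 0"
      then have "i = 1" using c by (simp add: endless_ones_def)
      then have "?f (0, 1, Downward) = Some (finish (i # w) (North 2))" by simp
      then have "walk ?f (0, 1, Downward) [(0, 1, Downward)] (finish (i # w) (North 2))" by simp
      then have "terminating ?f (0, 1, Downward)" using sstep_finish unfolding terminating_def by blast
      then show False using c \<open>c = 0\<close> by (simp add: endless_ones_def)
    qed
    then obtain c' where c': "c = Suc c'" by (cases c) auto
    have cw: "c' < length w" "w ! c' = 1" using c c' by (auto simp: endless_ones_def)
    have "\<not> terminating (sstep w) (c', 1, Downward)"
    proof
      assume "terminating (sstep w) (c', 1, Downward)"
      then obtain xs e where e: "walk (sstep w) (c', 1, Downward) xs e" "sstep w e = None" by (auto simp: terminating_def)
      have "(c', 1, Downward) \<in> points n w" using cw by (auto simp: points_def)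
      then have "e \<in> points n w" using walk_in_closed(1)[OF e(1)] W.f_D by blast
      then obtain y where y: "y \<in> nodes (n + 2)" "e = finish w y" using sstep_NoneE[OF e(2)] by blast
      have w': "walk ?f (c, 1, Downward) (map shift xs) (shift (finish w y))"
        using walk_shift[OF e(1), of i] c' y(2) by simp
      then show False using walk_terminating_iff[OF w'] c all by (simp add: endless_ones_def)
    qed
    then show "c \<in> Suc ` endless_ones w" using cw c' by (simp add: endless_ones_def)
  qed
qed

lemma loops_word_diag:
  assumes "alternating_word n u"
  shows "loops (word_diag n (gen_deco n) u) = replicate_mset (card (endless_ones u)) (cyc cycle_word)"
  using assms
proof (induction u)
  case Nil
  then show ?case by (simp add: endless_ones_def id_diag_def)
next
  case (Cons i w)
  interpret A: alternating_word n "i # w" by fact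
  have W: "alternating_word n w"
    using A.n2 A.gens alternating_tl[OF A.alternating] by unfold_locales auto
  note L = loops_word_diag_Cons[OF A.gens, of "gen_deco n"]
  show ?case
  proof (cases "mate (word_diag n (gen_deco n) w) (North i) = North (i + 1)")
    case True
    obtain b where "endless_ones (i # w) = insert b (Suc ` endless_ones w)" "b \<notin> Suc ` endless_ones w"
      using new_cycle(1)[OF Cons.prems True] by blast
    then have "card (endless_ones (i # w)) = Suc (card (endless_ones w))" by (simp add: card_image)
    then show ?thesis using L Cons.IH[OF W] True new_cycle(2)[OF Cons.prems True] by simp
  next
    case False
    then have "card (endless_ones (i # w)) = card (endless_ones w)"
      using no_new_cycle[OF Cons.prems False] by (simp add: card_image)
    then show ?thesis using L Cons.IH[OF W] False by simp
  qed
qed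

text \<open>Without decorations the same curves are glued, so loops arise at the same letters; only
  their words differ.\<close>

lemma loops_concrete_diag:
  assumes "alternating_word n u"
  shows "loops (concrete_diag n u) = replicate_mset (card (endless_ones u)) (cyc [])"
proof -
  have "size (loops (word_diag n (\<lambda>_. []) w)) = size (loops (word_diag n (gen_deco n) w)) \<and>
      set_mset (loops (word_diag n (\<lambda>_. []) w)) \<subseteq> {cyc []}" if "set w \<subseteq> gens n" for w
    using that
  proof (induction w)
    case (Cons i w)
    then have w: "set w \<subseteq> gens n" by simp
    have m: "mate (word_diag n (\<lambda>_. []) w) = mate (word_diag n (gen_deco n) w)"
      by (rule mate_word_diag_cong[OF w]) simp_all
    have wd: "word (word_diag n (\<lambda>_. []) w) x = []" for x
    proof (cases "x \<in> nodes (n + 2)")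
      case True
      obtain ls where "strand_of n (\<lambda>_. []) w x ls" using word_diag_strands[where c = "\<lambda>_. []", OF w _ True] by auto
      moreover have "deco_out (\<lambda>_. []) w = (\<lambda>_. [])"
        by (rule ext) (simp add: deco_out_def split: option.split)
      moreover have "concat (map (\<lambda>_. []) ls) = ([] :: deco list)" by (simp add: concat_eq_Nil_conv)
      ultimately show ?thesis by (metis strand_of_def)
    qed (use mate_outside in blast)
    show ?case
      using loops_word_diag_Cons[OF Cons.prems, of "\<lambda>_. []"] loops_word_diag_Cons[OF Cons.prems, of "gen_deco n"]
        Cons.IH[OF w] m wd by auto
  qed (simp add: id_diag_def)
  from this[of u] have *: "size (loops (concrete_diag n u)) = card (endless_ones u)"
      "set_mset (loops (concrete_diag n u)) \<subseteq> {cyc []}"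
    using loops_word_diag[OF assms] alternating_word.gens[OF assms] by (auto simp: concrete_diag_eq)
  then show ?thesis using set_mset_subset_singletonD[OF *(2)] by simp
qed

section \<open>Contracting pairs of equal decorations\<close>

text \<open>A chord that crosses the third side of the triangle \<open>s\<close>, \<open>t\<close>,
  \<open>r\<close> also crosses one of the other two sides, unless it ends in
  \<open>t\<close>.\<close>

lemma noncrossing_shortcut:
  assumes S: "noncrossing S" "(s, t) \<in> S" "(t, r) \<in> S"
    and S': "S' \<subseteq> {p \<in> S. fst p \<noteq> t \<and> snd p \<noteq> t} \<union> {(s, r)}"
  shows "noncrossing S'"
proof -
  have key: "\<not> crosses (s, r) (c, e) \<and> \<not> crosses (c, e) (s, r)" if "(c, e) \<in> S" "c \<noteq> t" "e \<noteq> t" for c e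
  proof -
    have "\<not> crosses (s, t) (c, e)" "\<not> crosses (c, e) (s, t)" "\<not> crosses (t, r) (c, e)" "\<not> crosses (c, e) (t, r)"
      using S that(1) unfolding noncrossing_alt by blast+
    then show ?thesis using that(2,3) unfolding crosses_def by (auto simp: min_def max_def split: if_splits)
  qed
  have self: "\<not> crosses (s, r) (s, r)" by (auto simp: crosses_def)
  show ?thesis
    unfolding noncrossing_alt
  proof (intro ballI)
    fix p q assume pq: "p \<in> S'" "q \<in> S'"
    obtain c e c' e' where e: "p = (c, e)" "q = (c', e')" by (cases p; cases q)
    have "p \<in> S \<and> c \<noteq> t \<and> e \<noteq> t \<or> p = (s, r)" "q \<in> S \<and> c' \<noteq> t \<and> e' \<noteq> t \<or> q = (s, r)"
      using pq S' e by auto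
    then show "\<not> crosses p q"
      using S(1) key[of c e] key[of c' e'] self unfolding noncrossing_alt e by blast
  qed
qed

lemma chords_simps [simp]: "chords [] = {}" "chords [a] = {}" "chords (a # b # xs) = insert (a, b) (chords (b # xs))"
  by (simp_all add: chords_def)

lemma chords_append: "chords (xs @ a # ys) = chords (xs @ [a]) \<union> chords (a # ys)"
proof (induction xs)
  case (Cons x xs)
  then show ?case by (cases xs) auto
qed simp

lemma chords_subset: "chords xs \<subseteq> set xs \<times> set xs"
  unfolding chords_def by (cases xs) (auto dest: set_zip_leftD set_zip_rightD)

lemma chords_avoid: "p \<in> chords zs \<Longrightarrow> t \<notin> set zs \<Longrightarrow> fst p \<noteq> t \<and> snd p \<noteq> t"
  using chords_subset[of zs] by (cases p) auto

definition edge_reps :: "nat \<Rightarrow> ddiag \<Rightarrow> node list" where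
  "edge_reps m d = filter (\<lambda>x. pos m x < pos m (mate d x)) (node_list m)"

definition deformation :: "nat \<Rightarrow> ddiag \<Rightarrow> (node \<Rightarrow> real list) \<Rightarrow> (deco list \<times> real list) list \<Rightarrow> bool" where
  "deformation m d T ls \<longleftrightarrow>
     loops d = mset (map (\<lambda>(w, ts). cyc w) ls) \<and>
     (\<forall>x\<in>set (edge_reps m d). list_all2 (on_wall m) (word d x) (T x)) \<and>
     (\<forall>(w, ts)\<in>set ls. list_all2 (on_wall m) w ts) \<and>
     distinct (concat (map T (edge_reps m d)) @ concat (map snd ls)) \<and>
     noncrossing ((\<Union>x\<in>set (edge_reps m d). chords (pos m x # T x @ [pos m (mate d x)]))
                  \<union> (\<Union>(w, ts)\<in>set ls. chords (ts @ [hd ts])))"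

lemma deformable_iff: "deformable m d \<longleftrightarrow> (\<exists>T ls. deformation m d T ls)"
  unfolding deformable_def deformation_def edge_reps_def Let_def ..

lemma pos_not_on_wall: "x \<in> nodes m \<Longrightarrow> on_wall m c t \<Longrightarrow> pos m x \<noteq> t"
  by (cases x rule: node.exhaust) (auto simp: on_wall_def split: if_splits)

lemma list_all2_on_wall_pos:
  assumes "list_all2 (on_wall m) w ts" "t \<in> set ts" "x \<in> nodes m" shows "pos m x \<noteq> t"
proof -
  obtain i where "i < length ts" "ts ! i = t" using assms(2) by (auto simp: in_set_conv_nth)
  then have "on_wall m (w ! i) t" using assms(1) by (auto simp: list_all2_conv_all_nth)
  then show ?thesis using pos_not_on_wall[OF assms(3)] by blast
qed

lemma distinct_edge_reps: "distinct (edge_reps m d)"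
  unfolding edge_reps_def node_list_def by (auto simp: distinct_map inj_on_def)

lemma edge_reps_nodes: "x \<in> set (edge_reps m d) \<Longrightarrow> x \<in> nodes m"
  by (simp add: edge_reps_def)

text \<open>The relations between decorations that have coefficient 1.\<close>

inductive contraction :: "deco list \<Rightarrow> deco list \<Rightarrow> bool" where
  "(c, c') \<in> {(Bullet, BTriangle), (Circle, WTriangle)} \<Longrightarrow> contraction (p @ [c, c] @ q) (p @ [c'] @ q)"

lemma contraction_rev: "contraction w w' \<Longrightarrow> contraction (rev w) (rev w')"
proof (induction rule: contraction.induct)
  case (1 c c' p q)
  from contraction.intros[OF 1, of "rev q" "rev p"] show ?case by simp
qed

text \<open>A triangle may be taken to any wall point of the bullet or circle it replaces. Of the
  two points one is kept, and skipping the other is a shortcut in the sense of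
  \<open>noncrossing_shortcut\<close>.\<close>

lemma deformable_edge:
  assumes "deformable m d" and x0: "x0 \<in> set (edge_reps m d)"
    and nod: "\<And>x. x \<in> nodes m \<Longrightarrow> mate d x \<in> nodes m"
    and con: "contraction (word d x0) (word d' x0)"
    and same: "mate d' = mate d" "loops d' = loops d" "\<And>x. x \<in> set (edge_reps m d) \<Longrightarrow> x \<noteq> x0 \<Longrightarrow> word d' x = word d x"
  shows "deformable m d'"
proof -
  obtain T ls where T: "deformation m d T ls" using assms(1) by (auto simp: deformable_iff)
  note T' = T[unfolded deformation_def]
  obtain c c' p q where w: "(c, c') \<in> {(Bullet, BTriangle), (Circle, WTriangle)}" "word d x0 = p @ [c, c] @ q" "word d' x0 = p @ [c'] @ q"
    using con by (cases rule: contraction.cases) auto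
  have "list_all2 (on_wall m) (p @ [c, c] @ q) (T x0)" using T' x0 w(2) by metis
  then obtain tp t1 t2 tq where t: "T x0 = tp @ t1 # t2 # tq" "list_all2 (on_wall m) p tp" "on_wall m c t1" "on_wall m c t2" "list_all2 (on_wall m) q tq"
    by (auto simp: list_all2_append1 list_all2_Cons1)
  \<comment> \<open>The triangle stays at \<open>t1\<close>, and \<open>t2\<close> is
    dropped.\<close>
  define U where "U = T(x0 := tp @ t1 # tq)"
  let ?E = "edge_reps m d"
  have Er: "edge_reps m d' = ?E" by (simp add: edge_reps_def same)
  obtain E1 E2 where E: "?E = E1 @ x0 # E2" using x0 split_list by metis
  have x12: "x0 \<notin> set E1" "x0 \<notin> set E2" using distinct_edge_reps[of m d] E by auto
  have U12: "map U E1 = map T E1" "map U E2 = map T E2" using x12 by (auto simp: U_def)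
  have d: "distinct (concat (map T ?E) @ concat (map snd ls))" using T' by blast
  have dU: "distinct (concat (map U ?E) @ concat (map snd ls))"
    using d unfolding E map_append concat_append list.map concat.simps U12
    by (simp add: U_def t(1) Int_Un_distrib Int_Un_distrib2)
  have t2: "t2 \<notin> set (T x)" if "x \<in> set ?E" "x \<noteq> x0" for x
    using d that unfolding E by (auto simp: t(1))
  have t2l: "t2 \<notin> set ts" if "(w, ts) \<in> set ls" for w ts
    using d that unfolding E by (force simp: t(1))
  have t2x: "t2 \<notin> set tp" "t2 \<noteq> t1" "t2 \<notin> set tq" using d unfolding E by (auto simp: t(1))
  have t2p: "pos m x \<noteq> t2" if "x \<in> nodes m" for x using pos_not_on_wall[OF that t(4)] .
  let ?C = "\<lambda>T x. chords (pos m x # T x @ [pos m (mate d x)])"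
  let ?L = "\<Union>(w, ts)\<in>set ls. chords (ts @ [hd ts])"
  let ?S = "(\<Union>x\<in>set ?E. ?C T x) \<union> ?L"
  \<comment> \<open>\<open>r\<close> is what follows \<open>t2\<close>: the next wall point or the
    end of the edge.\<close>
  obtain r rs where r: "tq @ [pos m (mate d x0)] = r # rs" by (cases "tq @ [pos m (mate d x0)]") auto
  have xn: "x0 \<in> nodes m" "mate d x0 \<in> nodes m" using edge_reps_nodes[OF x0] nod by auto
  have rr: "t2 \<notin> set (r # rs)" unfolding r[symmetric] using t2x(3) t2p[OF xn(2)] by auto
  have C0: "?C T x0 = chords (pos m x0 # tp @ [t1]) \<union> {(t1, t2), (t2, r)} \<union> chords (r # rs)"
    using chords_append[of "pos m x0 # tp" t1 "t2 # tq @ [pos m (mate d x0)]"] by (simp add: t(1) r)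
  have C1: "?C U x0 = chords (pos m x0 # tp @ [t1]) \<union> {(t1, r)} \<union> chords (r # rs)"
    using chords_append[of "pos m x0 # tp" t1 "tq @ [pos m (mate d x0)]"] by (simp add: U_def r)
  have "t2 \<notin> set (pos m x0 # tp @ [t1])" using t2x t2p[OF xn(1)] by auto
  then have a: "p \<in> chords (pos m x0 # tp @ [t1]) \<Longrightarrow> fst p \<noteq> t2 \<and> snd p \<noteq> t2" for p
    using chords_avoid by blast
  have b: "p \<in> chords (r # rs) \<Longrightarrow> fst p \<noteq> t2 \<and> snd p \<noteq> t2" for p
    using chords_avoid rr by blast
  have c: "p \<in> ?C T x \<Longrightarrow> fst p \<noteq> t2 \<and> snd p \<noteq> t2" if "x \<in> set ?E" "x \<noteq> x0" for p x
  proof -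
    have "x \<in> nodes m" "mate d x \<in> nodes m" using edge_reps_nodes[OF that(1)] nod by auto
    then have "t2 \<notin> set (pos m x # T x @ [pos m (mate d x)])" using t2[OF that] t2p[of x] t2p[of "mate d x"] by auto
    moreover assume "p \<in> ?C T x"
    ultimately show ?thesis using chords_avoid by blast
  qed
  have l: "p \<in> chords (ts @ [hd ts]) \<Longrightarrow> fst p \<noteq> t2 \<and> snd p \<noteq> t2" if "(w, ts) \<in> set ls" for p w ts
  proof (cases ts)
    case (Cons y ys)
    then have "t2 \<notin> set (ts @ [hd ts])" using t2l[OF that] by auto
    moreover assume "p \<in> chords (ts @ [hd ts])"
    ultimately show ?thesis using chords_avoid by blast
  qed simp
  have "noncrossing ((\<Union>x\<in>set ?E. ?C U x) \<union> ?L)"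
  proof (rule noncrossing_shortcut[where S = ?S and s = t1 and t = t2 and r = r])
    show "noncrossing ?S" using T' by blast
    show "(t1, t2) \<in> ?S" "(t2, r) \<in> ?S" using C0 x0 by blast+
    show "(\<Union>x\<in>set ?E. ?C U x) \<union> ?L \<subseteq> {p \<in> ?S. fst p \<noteq> t2 \<and> snd p \<noteq> t2} \<union> {(t1, r)}"
    proof
      fix p assume "p \<in> (\<Union>x\<in>set ?E. ?C U x) \<union> ?L"
      then consider "p \<in> ?C U x0" | x where "x \<in> set ?E" "x \<noteq> x0" "p \<in> ?C U x" | "p \<in> ?L" by blast
      then show "p \<in> {p \<in> ?S. fst p \<noteq> t2 \<and> snd p \<noteq> t2} \<union> {(t1, r)}"
      proof cases
        case 1
        then show ?thesis unfolding C1 using a[of p] b[of p] C0 x0 by blast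
      next
        case 2
        then have "p \<in> ?C T x" by (simp add: U_def)
        then show ?thesis using c[OF 2(1,2)] 2(1) by blast
      next
        case 3
        then show ?thesis using l by blast
      qed
    qed
  qed
  moreover have "list_all2 (on_wall m) (word d' x) (U x)" if "x \<in> set ?E" for x
  proof (cases "x = x0")
    case True
    have "on_wall m c' t1" using t(3) w(1) by (auto simp: on_wall_def black_def)
    then have "list_all2 (on_wall m) (p @ [c'] @ q) (tp @ t1 # tq)"
      using t by (simp add: list_all2_appendI)
    then show ?thesis using True w(3) by (simp add: U_def)
  next
    case False
    then show ?thesis using same(3)[OF that False] T' that by (simp add: U_def)
  qed
  ultimately have "deformation m d' U ls"
    using T' dU unfolding deformation_def Er same(1,2) by blast
  then show ?thesis using deformable_iff by blast
qed

text \<open>Loop words are known only up to rotation and reversal, so the pair may sit anywhere,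
  even across the ends of the list. The lemma therefore only asks for a point \<open>t\<close> and
  its two neighbours \<open>s\<close> and \<open>r\<close> on the loop.\<close>

lemma deformable_loop:
  assumes T: "deformation m d T (l1 @ (v, ts) # l2)" and nod: "\<And>x. x \<in> nodes m \<Longrightarrow> mate d x \<in> nodes m"
    and v': "list_all2 (on_wall m) v' ts'" "set ts' \<subseteq> set ts - {t}" "distinct ts'" "t \<in> set ts" "ts' \<noteq> []"
    and ch: "chords (ts' @ [hd ts']) \<subseteq> chords (ts @ [hd ts]) \<union> {(s, r)}"
      "(s, t) \<in> chords (ts @ [hd ts])" "(t, r) \<in> chords (ts @ [hd ts])"
    and same: "mate d' = mate d" "word d' = word d" "loops d' = mset (map (\<lambda>(w, ts). cyc w) (l1 @ (v', ts') # l2))"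
  shows "deformable m d'"
proof -
  note T' = T[unfolded deformation_def]
  let ?E = "edge_reps m d"
  have Er: "edge_reps m d' = ?E" by (simp add: edge_reps_def same)
  have d: "distinct (concat (map T ?E) @ concat (map snd (l1 @ (v, ts) # l2)))" using T' by blast
  have dU: "distinct (concat (map T ?E) @ concat (map snd (l1 @ (v', ts') # l2)))"
    using d v'(2,3) by auto
  have lw: "list_all2 (on_wall m) v ts" using T' by auto
  have tT: "t \<notin> set (T x)" if "x \<in> set ?E" for x using d that v'(4) by auto
  have tl: "t \<notin> set us" if "(w, us) \<in> set (l1 @ l2)" for w us
    using d that v'(4) by (auto; force)
  let ?C = "\<lambda>x. chords (pos m x # T x @ [pos m (mate d x)])"
  let ?K = "\<lambda>ts. chords (ts @ [hd ts])"
  let ?S = "(\<Union>x\<in>set ?E. ?C x) \<union> (\<Union>(w, ts)\<in>set (l1 @ (v, ts) # l2). ?K ts)"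
  have c: "p \<in> ?C x \<Longrightarrow> fst p \<noteq> t \<and> snd p \<noteq> t" if "x \<in> set ?E" for p x
  proof -
    have xn: "x \<in> nodes m" "mate d x \<in> nodes m" using edge_reps_nodes[OF that] nod by auto
    then have "t \<notin> set (pos m x # T x @ [pos m (mate d x)])"
      using tT[OF that] list_all2_on_wall_pos[OF lw v'(4)] by fastforce
    moreover assume "p \<in> ?C x"
    ultimately show ?thesis using chords_avoid by blast
  qed
  have l: "p \<in> ?K us \<Longrightarrow> fst p \<noteq> t \<and> snd p \<noteq> t" if "t \<notin> set us" for p us
  proof (cases us)
    case (Cons y ys)
    then have "t \<notin> set (us @ [hd us])" using that by auto
    moreover assume "p \<in> ?K us"
    ultimately show ?thesis using chords_avoid by blast
  qed simp
  have tts: "t \<notin> set ts'" using v'(2) by blast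
  have "noncrossing ((\<Union>x\<in>set ?E. ?C x) \<union> (\<Union>(w, ts)\<in>set (l1 @ (v', ts') # l2). ?K ts))"
  proof (rule noncrossing_shortcut[where S = ?S and s = s and t = t and r = r])
    show "noncrossing ?S" using T' by blast
    show "(s, t) \<in> ?S" "(t, r) \<in> ?S" using ch(2,3) by auto
    show "(\<Union>x\<in>set ?E. ?C x) \<union> (\<Union>(w, ts)\<in>set (l1 @ (v', ts') # l2). ?K ts)
        \<subseteq> {p \<in> ?S. fst p \<noteq> t \<and> snd p \<noteq> t} \<union> {(s, r)}"
    proof
      fix p assume "p \<in> (\<Union>x\<in>set ?E. ?C x) \<union> (\<Union>(w, ts)\<in>set (l1 @ (v', ts') # l2). ?K ts)"
      then consider x where "x \<in> set ?E" "p \<in> ?C x" | w us where "(w, us) \<in> set (l1 @ l2)" "p \<in> ?K us" | "p \<in> ?K ts'"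
        by auto
      then show "p \<in> {p \<in> ?S. fst p \<noteq> t \<and> snd p \<noteq> t} \<union> {(s, r)}"
      proof cases
        case 1
        then show ?thesis using c by blast
      next
        case 2
        then have "p \<in> ?S" by auto
        then show ?thesis using l[OF tl[OF 2(1)] 2(2)] by blast
      next
        case 3
        then have "p \<in> ?K ts \<or> p = (s, r)" using ch(1) by blast
        then show ?thesis using l[OF tts 3] by auto
      qed
    qed
  qed
  then have "deformation m d' T (l1 @ (v', ts') # l2)"
    using T' dU v'(1) unfolding deformation_def Er same by auto
  then show ?thesis using deformable_iff by blast
qed

lemma cyc_cases:
  assumes "cyc v = cyc w" shows "\<exists>k<Suc (length w). v = rotate k w \<or> v = rotate k (rev w)"
proof -
  have "v = rotate 0 v" by simp
  then have "v \<in> cyc v" unfolding cyc_def by blast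
  then have "v \<in> cyc w" using assms by simp
  then obtain k where "v = rotate k w \<or> v = rotate k (rev w)" unfolding cyc_def by blast
  then have "v = rotate (k mod length w) w \<or> v = rotate (k mod length w) (rev w)"
    using rotate_conv_mod[of k w] rotate_conv_mod[of k "rev w"] by simp
  moreover have "k mod length w < Suc (length w)" if "w \<noteq> []"
    using that by (simp add: less_Suc_eq)
  ultimately show ?thesis by (cases "w = []") auto
qed

lemma cyc_mem_self: "w \<in> cyc w"
proof -
  have "w = rotate 0 w" by simp
  then show ?thesis unfolding cyc_def by blast
qed

lemma deformation_loopE:
  assumes "deformable m d" "loops d = L + {#cyc w#}"
  obtains T l1 v ts l2 where "deformation m d T (l1 @ (v, ts) # l2)" "cyc v = cyc w"
    "L = mset (map (\<lambda>(w, ts). cyc w) (l1 @ l2))"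
proof -
  obtain T ls where T: "deformation m d T ls" using assms(1) by (auto simp: deformable_iff)
  then have m: "mset (map (\<lambda>(w, ts). cyc w) ls) = L + {#cyc w#}" using assms(2) by (auto simp: deformation_def)
  have "cyc w \<in># mset (map (\<lambda>(w, ts). cyc w) ls)" unfolding m by simp
  then have "cyc w \<in> set (map (\<lambda>(w, ts). cyc w) ls)" by (simp only: set_mset_mset)
  then obtain v ts where v: "(v, ts) \<in> set ls" "cyc v = cyc w" by auto
  then obtain l1 l2 where l: "ls = l1 @ (v, ts) # l2" using split_list by metis
  have "L = mset (map (\<lambda>(w, ts). cyc w) (l1 @ l2))" using m v(2) unfolding l by simp
  then show ?thesis using that T v(2) l by blast
qed

lemma deformable_cycle_1:
  assumes "deformable m d" "loops d = L + {#cyc [Bullet, Bullet, Circle, Circle]#}"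
    and nod: "\<And>x. x \<in> nodes m \<Longrightarrow> mate d x \<in> nodes m"
  shows "deformable m (d\<lparr>loops := L + {#cyc [BTriangle, Circle, Circle]#}\<rparr>)"
proof -
  obtain T l1 v ts l2 where T: "deformation m d T (l1 @ (v, ts) # l2)"
    "cyc v = cyc [Bullet, Bullet, Circle, Circle]" "L = mset (map (\<lambda>(w, ts). cyc w) (l1 @ l2))"
    using deformation_loopE[OF assms(1,2)] by metis
  have lw: "list_all2 (on_wall m) v ts" "distinct ts" using T(1) unfolding deformation_def by auto
  have w: "on_wall m BTriangle x \<longleftrightarrow> on_wall m Bullet x" for x by (simp add: on_wall_def black_def)
  note D = deformable_loop[OF T(1) nod]
  \<comment> \<open>Reversal adds no further words. In each rotation one of the two bullets is
    dropped; in the second one they are the last and the first letter, so the dropped point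
    \<open>e\<close> has the neighbours \<open>c\<close> and \<open>a\<close>.\<close>
  have v: "v = [Bullet, Bullet, Circle, Circle] \<or> v = [Bullet, Circle, Circle, Bullet] \<or>
      v = [Circle, Circle, Bullet, Bullet] \<or> v = [Circle, Bullet, Bullet, Circle]"
    using cyc_cases[OF T(2)] by (auto simp: less_Suc_eq)
  then have "length ts = 4" using list_all2_lengthD[OF lw(1)] by auto
  then obtain a b c e where ts: "ts = [a, b, c, e]" by (auto simp: eval_nat_numeral length_Suc_conv)
  have "cyc [Circle, Circle, BTriangle] = cyc [BTriangle, Circle, Circle]"
    using cyc_append[of "[Circle, Circle]" "[BTriangle]"] by simp
  moreover have "cyc [Circle, BTriangle, Circle] = cyc [BTriangle, Circle, Circle]"
    using cyc_append[of "[Circle]" "[BTriangle, Circle]"] by simp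
  ultimately show ?thesis
    using v lw unfolding ts
    apply (elim disjE)
       apply (rule D[of "[BTriangle, Circle, Circle]" "[a, c, e]" b a c]; auto simp: ts w T(3))
      apply (rule D[of "[BTriangle, Circle, Circle]" "[a, b, c]" e c a]; auto simp: ts w T(3))
     apply (rule D[of "[Circle, Circle, BTriangle]" "[a, b, c]" e c a]; auto simp: ts w T(3))
    apply (rule D[of "[Circle, BTriangle, Circle]" "[a, b, e]" c b e]; auto simp: ts w T(3))
    done
qed

lemma deformable_cycle_2:
  assumes "deformable m d" "loops d = L + {#cyc [BTriangle, Circle, Circle]#}"
    and nod: "\<And>x. x \<in> nodes m \<Longrightarrow> mate d x \<in> nodes m"
  shows "deformable m (d\<lparr>loops := L + {#cyc [BTriangle, WTriangle]#}\<rparr>)"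
proof -
  obtain T l1 v ts l2 where T: "deformation m d T (l1 @ (v, ts) # l2)"
    "cyc v = cyc [BTriangle, Circle, Circle]" "L = mset (map (\<lambda>(w, ts). cyc w) (l1 @ l2))"
    using deformation_loopE[OF assms(1,2)] by metis
  have lw: "list_all2 (on_wall m) v ts" "distinct ts" using T(1) unfolding deformation_def by auto
  have w: "on_wall m WTriangle x \<longleftrightarrow> on_wall m Circle x" for x by (simp add: on_wall_def black_def)
  note D = deformable_loop[OF T(1) nod]
  have v: "v = [BTriangle, Circle, Circle] \<or> v = [Circle, Circle, BTriangle] \<or> v = [Circle, BTriangle, Circle]"
    using cyc_cases[OF T(2)] by (auto simp: less_Suc_eq)
  then have "length ts = 3" using list_all2_lengthD[OF lw(1)] by auto
  then obtain a b c where ts: "ts = [a, b, c]" by (auto simp: eval_nat_numeral length_Suc_conv)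
  have "cyc [WTriangle, BTriangle] = cyc [BTriangle, WTriangle]"
    using cyc_append[of "[WTriangle]" "[BTriangle]"] by simp
  then show ?thesis
    using v lw unfolding ts
    apply (elim disjE)
      apply (rule D[of "[BTriangle, WTriangle]" "[a, b]" c b a]; auto simp: ts w T(3))
     apply (rule D[of "[WTriangle, BTriangle]" "[a, c]" b a c]; auto simp: ts w T(3))
    apply (rule D[of "[WTriangle, BTriangle]" "[a, b]" c b a]; auto simp: ts w T(3))
    done
qed

section \<open>Rewriting diagrams in the quotient\<close>

lemma diag_class_rel:
  assumes "diag_ideal n \<noteq> UNIV" "diag_rel n d 1 d'" shows "diag_class n d = diag_class n d'"
proof (rule diag_class_eqI)
  show "ring (diag_alg n)" "ideal (diag_ideal n) (diag_alg n)" "diag_rel n d 1 d'"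
    using diag_ideal_cases[of n] assms by blast+
  show "Poly_Mapping.single d 1 - Poly_Mapping.single d' c \<in> diag_ideal n" if "diag_rel n d c d'" for d c d'
    using diag_ideal_cases[of n] assms(1) that by blast
qed

lemma pos_inj: "x \<in> nodes m \<Longrightarrow> y \<in> nodes m \<Longrightarrow> pos m x = pos m y \<Longrightarrow> x = y"
  by (cases x rule: node.exhaust; cases y rule: node.exhaust) auto

lemma decorated_nodes:
  assumes "decorated_diagram n d" "x \<in> nodes (n + 2)"
  shows "mate d x \<in> nodes (n + 2)" "mate d x \<noteq> x" "mate d (mate d x) = x" "word d (mate d x) = rev (word d x)"
  using assms unfolding decorated_diagram_def Let_def by blast+

lemma decorated_outside:
  assumes "decorated_diagram n d" "x \<notin> nodes (n + 2)" shows "mate d x = x" "word d x = []"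
  using assms unfolding decorated_diagram_def Let_def by blast+

text \<open>The decorations of the propagating edges, edge by edge from left to right. If they all
  have one colour, a decorated diagram with \<open>a_val\<close> equal to 1 has no other choice for
  \<open>vert\<close>.\<close>

definition prop_vert :: "nat \<Rightarrow> ddiag \<Rightarrow> deco list" where
  "prop_vert n d = (if a_val (mate d) = 1 then concat (map (word d) (prop_list (n + 2) (mate d))) else [])"

definition set_word :: "nat \<Rightarrow> ddiag \<Rightarrow> node \<Rightarrow> deco list \<Rightarrow> ddiag" where
  "set_word n d x w = (let e = d\<lparr>word := (word d)(x := w, mate d x := rev w)\<rparr> in e\<lparr>vert := prop_vert n e\<rparr>)"

lemma set_word_simps [simp]:
  "mate (set_word n d x w) = mate d" "loops (set_word n d x w) = loops d"
  "word (set_word n d x w) = (word d)(x := w, mate d x := rev w)"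
  "vert (set_word n d x w) = prop_vert n (set_word n d x w)"
  by (simp_all add: set_word_def Let_def prop_vert_def)

lemma prop_vert_update [simp]: "prop_vert n (d\<lparr>vert := v, word := w\<rparr>) = prop_vert n (d\<lparr>word := w\<rparr>)"
  by (simp add: prop_vert_def)

lemma contraction_rule:
  assumes "contraction w w'"
  shows "\<exists>p r q r'. w = p @ r @ q \<and> w' = p @ r' @ q \<and> deco_rule r 1 r'"
  using assms
proof (cases rule: contraction.cases)
  case (1 c c' p q)
  then have "deco_rule [c, c] 1 [c']" by (auto intro: deco_rule.intros)
  then show ?thesis using 1 by blast
qed

lemma contraction_Nil: "contraction w w' \<Longrightarrow> w \<noteq> []"
  by (cases rule: contraction.cases) auto

lemma prop_list_facts:
  shows "distinct (prop_list m f)" "x \<in> set (prop_list m f) \<Longrightarrow> x \<in> nodes m \<and> (\<exists>i j. x = North i \<and> f x = South j)"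
  by (auto simp: prop_list_def distinct_map inj_on_def)

text \<open>If \<open>a_val\<close> is 1 and the contracted edge is propagating, the list
  \<open>vert\<close> changes and the relation \<open>block\<close> applies; otherwise
  \<open>vert\<close> stays the same and \<open>edge\<close> applies. Both demand that the result is
  a decorated diagram.\<close>

lemma edge_step:
  assumes proper: "diag_ideal n \<noteq> UNIV" and d: "decorated_diagram n d" "vert d = prop_vert n d"
    and x: "x \<in> nodes (n + 2)" and con: "contraction (word d x) w"
  shows "decorated_diagram n (set_word n d x w) \<and> diag_class n d = diag_class n (set_word n d x w)"
proof -
  define e where "e = set_word n d x w"
  define y where "y = mate d x"
  note nd = decorated_nodes[OF d(1)]
  have y: "y \<in> nodes (n + 2)" "y \<noteq> x" "mate d y = x" "word d y = rev (word d x)"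
    using nd[OF x] by (simp_all add: y_def)
  have we: "word e z = (if z = y then rev w else if z = x then w else word d z)" for z
    by (simp add: e_def y_def)
  have em: "mate e = mate d" "loops e = loops d" "vert e = prop_vert n e" by (simp_all add: e_def)
  have "a_val (mate d) \<noteq> 0"
  proof
    assume "a_val (mate d) = 0"
    then have "word d x = []" using d(1) unfolding decorated_diagram_def Let_def by blast
    then show False using contraction_Nil[OF con] by blast
  qed
  have cony: "contraction (word d y) (rev w)" using contraction_rev[OF con] y(4) by simp
  have def: "deformable (n + 2) e"
  proof -
    have D: "deformable (n + 2) d" using d(1) unfolding decorated_diagram_def Let_def by blast
    \<comment> \<open>Deformability looks at an edge from its clockwise first end; a contraction of
      the word is one from either end.\<close>
    define x0 where "x0 = (if pos (n + 2) x < pos (n + 2) y then x else y)"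
    have "pos (n + 2) x \<noteq> pos (n + 2) y" using pos_inj[OF x y(1)] y(2) by blast
    then have x0: "x0 \<in> set (edge_reps (n + 2) d)"
      using x y(1,3) y_def by (auto simp: edge_reps_def x0_def)
    have "z \<notin> set (edge_reps (n + 2) d)" if "z = x \<or> z = y" "z \<noteq> x0" for z
      using that y(3) y_def by (auto simp: edge_reps_def x0_def split: if_splits)
    then show ?thesis
      by (intro deformable_edge[OF D x0]) (use nd con cony y in \<open>auto simp: em we x0_def\<close>)
  qed
  have dec: "decorated_diagram n e"
  proof -
    have 1: "mate e z \<in> nodes (n + 2) \<and> mate e z \<noteq> z \<and> mate e (mate e z) = z \<and> word e (mate e z) = rev (word e z)"
      if z: "z \<in> nodes (n + 2)" for z
    proof -
      have "mate d z = y \<longleftrightarrow> z = x" "mate d z = x \<longleftrightarrow> z = y" using nd(3)[OF z] y(3) y_def by metis+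
      then show ?thesis using nd[OF z] y unfolding em we by auto
    qed
    have 2: "mate e z = z \<and> word e z = []" if "z \<notin> nodes (n + 2)" for z
      using decorated_outside[OF d(1) that] that x y(1) unfolding em we by auto
    have 3: "if a_val (mate e) = 1
      then (let ws = concat (map (word e) (prop_list (n + 2) (mate e))) in
              filter black (vert e) = filter black ws \<and>
              filter (\<lambda>c. \<not> black c) (vert e) = filter (\<lambda>c. \<not> black c) ws)
      else vert e = []"
      unfolding em(3) by (simp add: prop_vert_def Let_def)
    show ?thesis
      unfolding decorated_diagram_def Let_def
      using 1 2 def 3[unfolded Let_def] \<open>a_val (mate d) \<noteq> 0\<close> em(1) by simp
  qed
  have edge: "diag_rel n d 1 e" if "vert e = vert d"
  proof -
    obtain p r q r' where r: "word d x = p @ r @ q" "w = p @ r' @ q" "deco_rule r 1 r'" using contraction_rule[OF con] by blast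
    show ?thesis
      by (rule diag_rel.edge[OF d(1) dec r(3) x r(1)]) (use r y em that in \<open>auto simp: we y_def[symmetric]\<close>)
  qed
  have block: "diag_rel n d 1 e" if z: "z \<in> set (prop_list (n + 2) (mate d))" "a_val (mate d) = 1"
      "contraction (word d z) (word e z)" "z = x \<or> z = y" for z
  proof -
    let ?l = "prop_list (n + 2) (mate d)"
    obtain p r q r' where r: "word d z = p @ r @ q" "word e z = p @ r' @ q" "deco_rule r 1 r'"
      using contraction_rule[OF z(3)] by blast
    obtain l1 l2 where l: "?l = l1 @ z # l2" using z(1) split_list by metis
    have zm: "mate d z \<notin> set ?l" using prop_list_facts(2)[OF z(1)] prop_list_facts(2)[of "mate d z" "n + 2" "mate d"] by auto
    have other: "word e v = word d v" if "v \<in> set (l1 @ l2)" for v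
    proof -
      have "v \<in> set ?l" "v \<noteq> z" using that prop_list_facts(1)[of "n + 2" "mate d"] unfolding l by auto
      then have "v \<noteq> mate d z" using zm by blast
      then have "v \<noteq> x \<and> v \<noteq> y" using z(4) \<open>v \<noteq> z\<close> y(3) y_def by auto
      then show ?thesis by (simp add: we)
    qed
    then have m: "map (word e) l1 = map (word d) l1" "map (word e) l2 = map (word d) l2" by auto
    have v: "vert d = (concat (map (word d) l1) @ p) @ r @ (q @ concat (map (word d) l2))"
      "vert e = (concat (map (word d) l1) @ p) @ r' @ (q @ concat (map (word d) l2))"
      unfolding d(2) em(3) prop_vert_def em(1) using z(2) r unfolding l map_append concat_append list.map concat.simps m by simp_all
    have "\<forall>v\<in>nodes (n + 2). v \<notin> set ?l \<and> mate d v \<notin> set ?l \<longrightarrow> word e v = word d v"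
      using z(1,4) y(3) y_def by (auto simp: we)
    then show ?thesis
      using diag_rel.block[OF d(1) dec r(3) v] em by simp
  qed
  have "diag_rel n d 1 e"
  proof (cases "a_val (mate d) = 1 \<and> (x \<in> set (prop_list (n + 2) (mate d)) \<or> y \<in> set (prop_list (n + 2) (mate d)))")
    case True
    then show ?thesis using block[of x] block[of y] con cony y(2) by (auto simp: we)
  next
    case False
    have "vert e = vert d"
    proof (cases "a_val (mate d) = 1")
      case True
      then have "map (word e) (prop_list (n + 2) (mate d)) = map (word d) (prop_list (n + 2) (mate d))"
        using False by (intro map_cong) (auto simp: we)
      then show ?thesis unfolding d(2) em(3) prop_vert_def em(1) by (simp only:)
    qed (simp add: d(2) em prop_vert_def)
    then show ?thesis by (rule edge)
  qed
  then show ?thesis using dec diag_class_rel[OF proper] unfolding e_def by blast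
qed

lemma edge_steps:
  assumes proper: "diag_ideal n \<noteq> UNIV" and d: "decorated_diagram n d" "vert d = prop_vert n d"
    and x: "x \<in> nodes (n + 2)" and con: "contraction\<^sup>*\<^sup>* (word d x) w"
  shows "decorated_diagram n (set_word n d x w) \<and> diag_class n d = diag_class n (set_word n d x w)"
  using con
proof (induction rule: rtranclp_induct)
  case base
  have "(word d)(x := word d x, mate d x := rev (word d x)) = word d"
    using decorated_nodes(4)[OF d(1) x] by (auto simp: fun_eq_iff)
  then have "set_word n d x (word d x) = d" using d(2) by (simp add: set_word_def Let_def)
  then show ?case using d(1) by simp
next
  case (step w w')
  let ?e = "set_word n d x w"
  have xm: "mate d x \<noteq> x" using decorated_nodes(2)[OF d(1) x] .
  then have "contraction (word ?e x) w'" using step(2) by simp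
  moreover have "set_word n ?e x w' = set_word n d x w'"
    using xm by (simp add: set_word_def Let_def fun_upd_twist[OF xm])
  ultimately show ?case using edge_step[OF proper _ _ x, of ?e w'] step.IH by simp
qed

text \<open>\<open>F xs\<close> has the final words on all edges with an end in \<open>xs\<close>.
  The word of an edge is stored at both ends, so both are changed together, and when the second end
  is reached nothing is left to do.\<close>

lemma rewrite_words:
  assumes proper: "diag_ideal n \<noteq> UNIV" and d: "decorated_diagram n d" "vert d = prop_vert n d"
    and g: "\<And>x. x \<in> nodes (n + 2) \<Longrightarrow> contraction\<^sup>*\<^sup>* (word d x) (g x)"
      "\<And>x. x \<in> nodes (n + 2) \<Longrightarrow> g (mate d x) = rev (g x)" "\<And>x. x \<notin> nodes (n + 2) \<Longrightarrow> g x = []"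
    and e: "e = d\<lparr>word := g\<rparr>\<lparr>vert := prop_vert n (d\<lparr>word := g\<rparr>)\<rparr>"
  shows "decorated_diagram n e \<and> diag_class n d = diag_class n e"
proof -
  define G where "G xs x = (if x \<in> nodes (n + 2) \<and> (x \<in> set xs \<or> mate d x \<in> set xs) then g x else word d x)" for xs x
  define F where "F xs = d\<lparr>word := G xs\<rparr>\<lparr>vert := prop_vert n (d\<lparr>word := G xs\<rparr>)\<rparr>" for xs
  have Fs: "mate (F xs) = mate d" "word (F xs) = G xs" "vert (F xs) = prop_vert n (F xs)" for xs
    by (simp_all add: F_def prop_vert_def)
  have main: "decorated_diagram n (F xs) \<and> diag_class n d = diag_class n (F xs)" if "set xs \<subseteq> nodes (n + 2)" for xs
    using that
  proof (induction xs)
    case Nil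
    have "G [] = word d" by (auto simp: G_def fun_eq_iff)
    then have "F [] = d" using d(2) by (simp add: F_def)
    then show ?case using d(1) by simp
  next
    case (Cons x xs)
    then have x: "x \<in> nodes (n + 2)" and IH: "decorated_diagram n (F xs)" "diag_class n d = diag_class n (F xs)" by auto
    note nx = decorated_nodes[OF d(1) x]
    have c: "contraction\<^sup>*\<^sup>* (word (F xs) x) (g x)" using g(1)[OF x] by (simp add: Fs G_def)
    have "(G xs)(x := g x, mate d x := rev (g x)) = G (x # xs)"
    proof
      fix z
      show "((G xs)(x := g x, mate d x := rev (g x))) z = G (x # xs) z"
      proof (cases "z = x \<or> z = mate d x")
        case True
        then show ?thesis using x nx g(2)[OF x] by (auto simp: G_def)
      next
        case False
        then have "z \<in> nodes (n + 2) \<Longrightarrow> mate d z \<noteq> x" using decorated_nodes(3)[OF d(1), of z] by auto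
        then show ?thesis using False by (auto simp: G_def)
      qed
    qed
    then have "set_word n (F xs) x (g x) = F (x # xs)"
      by (simp add: set_word_def Let_def Fs) (simp add: F_def)
    then show ?case using edge_steps[OF proper IH(1) Fs(3) x c] IH(2) by simp
  qed
  have "G (node_list (n + 2)) = g" using g(3) decorated_outside[OF d(1)] by (auto simp: G_def fun_eq_iff)
  then have "F (node_list (n + 2)) = e" by (simp add: F_def e)
  then show ?thesis using main[of "node_list (n + 2)"] by simp
qed

lemma decorated_set_loops:
  assumes "decorated_diagram n d" "deformable (n + 2) (d\<lparr>loops := L\<rparr>)" "a_val (mate d) \<noteq> 0"
  shows "decorated_diagram n (d\<lparr>loops := L\<rparr>)"
  using assms unfolding decorated_diagram_def Let_def by simp

lemma rewrite_cycle:
  assumes proper: "diag_ideal n \<noteq> UNIV" and d: "decorated_diagram n d" "loops d = L + {#cyc cycle_word#}"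
  shows "decorated_diagram n (d\<lparr>loops := L + {#cyc [BTriangle, WTriangle]#}\<rparr>) \<and>
    diag_class n d = diag_class n (d\<lparr>loops := L + {#cyc [BTriangle, WTriangle]#}\<rparr>)"
proof -
  have nod: "\<And>x. x \<in> nodes (n + 2) \<Longrightarrow> mate d x \<in> nodes (n + 2)" using decorated_nodes(1)[OF d(1)] .
  have D: "deformable (n + 2) d" using d(1) unfolding decorated_diagram_def Let_def by blast
  have a: "a_val (mate d) \<noteq> 0"
  proof
    assume "a_val (mate d) = 0"
    then have "cyc cycle_word = cyc []" using d unfolding decorated_diagram_def Let_def by (metis union_iff union_single_eq_member add_mset_add_single)
    then have "cycle_word \<in> cyc []" using cyc_mem_self[of cycle_word] by simp
    then show False by (auto simp: cyc_def cycle_word_def)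
  qed
  let ?d1 = "d\<lparr>loops := L + {#cyc [BTriangle, Circle, Circle]#}\<rparr>"
  let ?d2 = "d\<lparr>loops := L + {#cyc [BTriangle, WTriangle]#}\<rparr>"
  have 1: "decorated_diagram n ?d1"
    using deformable_cycle_1[OF D d(2)[unfolded cycle_word_def] nod] by (rule decorated_set_loops[OF d(1) _ a])
  have "deformable (n + 2) ?d1" using 1 unfolding decorated_diagram_def Let_def by blast
  from deformable_cycle_2[OF this, of L] nod have "deformable (n + 2) ?d2" by simp
  then have 2: "decorated_diagram n ?d2" by (rule decorated_set_loops[OF d(1) _ a])
  have "diag_rel n d 1 ?d1"
    by (rule diag_rel.loop[OF d(1) 1, of "[Bullet, Bullet]" 1 "[BTriangle]" L "[Circle, Circle]"])
      (use d(2) in \<open>auto simp: cycle_word_def intro: deco_rule.intros\<close>)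
  \<comment> \<open>The loop relation rewrites the beginning of a word, so the circles are rotated
    to the front.\<close>
  moreover have "diag_rel n ?d1 1 ?d2"
    by (rule diag_rel.loop[OF 1 2, of "[Circle, Circle]" 1 "[WTriangle]" L "[BTriangle]"])
      (use cyc_append[of "[Circle, Circle]" "[BTriangle]"] cyc_append[of "[WTriangle]" "[BTriangle]"]
        in \<open>auto intro: deco_rule.intros\<close>)
  ultimately show ?thesis using 2 diag_class_rel[OF proper] by metis
qed

lemma rewrite_cycles:
  assumes proper: "diag_ideal n \<noteq> UNIV" and d: "decorated_diagram n d" "loops d = L + replicate_mset k (cyc cycle_word)"
  shows "decorated_diagram n (d\<lparr>loops := L + replicate_mset k (cyc [BTriangle, WTriangle])\<rparr>) \<and>
    diag_class n d = diag_class n (d\<lparr>loops := L + replicate_mset k (cyc [BTriangle, WTriangle])\<rparr>)"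
  using d
proof (induction k arbitrary: d L)
  case 0
  then have L: "L = loops d" by simp
  show ?case unfolding L using 0(1) by simp
next
  case (Suc k)
  have "loops d = (L + replicate_mset k (cyc cycle_word)) + {#cyc cycle_word#}" using Suc.prems(2) by simp
  note R = rewrite_cycle[OF proper Suc.prems(1) this]
  let ?e = "d\<lparr>loops := (L + replicate_mset k (cyc cycle_word)) + {#cyc [BTriangle, WTriangle]#}\<rparr>"
  have "loops ?e = (L + {#cyc [BTriangle, WTriangle]#}) + replicate_mset k (cyc cycle_word)" by simp
  from Suc.IH[OF _ this] R show ?case by simp
qed

section \<open>The decoration algorithm\<close>

lemma mate_add_first [simp]: "mate (add_first c x d) = mate d" "loops (add_first c x d) = loops d" "vert (add_first c x d) = vert d"
  by (simp_all add: add_first_def)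

lemma word_add_first: "word (add_first c x d) z =
    (if z = mate d x then word d z @ [c] else if z = x then c # word d z else word d z)"
  by (simp add: add_first_def)

lemma word_add_first_twice:
  assumes f: "\<And>z. mate d (mate d z) = z" "mate d (North i) \<noteq> North i" "mate d (South i) \<noteq> South i"
  shows "word (add_first c (South i) (add_first c (North i) d)) z =
    (if node_index z = i then [c] else []) @ word d z @ (if node_index (mate d z) = i then [c] else [])"
proof -
  have idx: "node_index y = i \<longleftrightarrow> y = North i \<or> y = South i" for y by (cases y) auto
  have m: "mate d z = y \<longleftrightarrow> z = mate d y" for y using f(1) by metis
  have "mate d (North i) \<noteq> mate d (South i)" using f(1) by (metis node.distinct(1))
  then show ?thesis
    unfolding word_add_first mate_add_first idx m
    using f by (cases "z = mate d (South i)"; cases "z = mate d (North i)"; cases "z = South i"; cases "z = North i") (auto simp: m)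
qed

context alternating_word
begin

lemma contraction_forks: "contraction\<^sup>*\<^sup>* (a @ concat (map fork_word F) @ b) (a @ map (fork_deco n u) F @ b)"
proof (induction F arbitrary: a)
  case (Cons f F)
  have "contraction (a @ fork_word f @ concat (map fork_word F) @ b) (a @ [fork_deco n u f] @ concat (map fork_word F) @ b)"
    using contraction.intros[of Bullet BTriangle a "concat (map fork_word F) @ b"]
      contraction.intros[of Circle WTriangle a "concat (map fork_word F) @ b"]
    by (auto simp: fork_word_def fork_deco_def)
  moreover have "contraction\<^sup>*\<^sup>* (a @ [fork_deco n u f] @ concat (map fork_word F) @ b) (a @ map (fork_deco n u) (f # F) @ b)"
    using Cons[of "a @ [fork_deco n u f]"] by simp
  ultimately show ?case by (simp add: converse_rtranclp_into_rtranclp)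
qed simp

definition strand_class :: "nat \<times> nat \<Rightarrow> (nat \<times> nat) set" where
  "strand_class f = {g \<in> forks n u. same_strand (cap f) (cap g)}"

lemma strand_class_mem: "f \<in> forks n u \<Longrightarrow> f \<in> strand_class f"
  by (simp add: strand_class_def)

lemma strand_class_sym: "f \<in> forks n u \<Longrightarrow> g \<in> strand_class f \<Longrightarrow> f \<in> strand_class g"
  using same_strand_sym by (auto simp: strand_class_def)

lemma strand_class_subset:
  assumes "g \<in> strand_class f" shows "strand_class g \<subseteq> strand_class f"
proof
  fix e assume "e \<in> strand_class g"
  then show "e \<in> strand_class f"
    using assms same_strand_trans[of "cap f" "cap g" "cap e"] by (simp add: strand_class_def)
qed

lemma strand_forks_class:
  assumes "x \<in> nodes (n + 2)" "f \<in> set (strand_forks x)" "g \<in> strand_class f"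
  shows "g \<in> set (strand_forks x)"
  using assms strand_forks_iff[OF assms(1)] same_strand_trans[of "start u x" "cap f" "cap g"]
  by (simp add: strand_class_def)

lemma strand_forks_subset_class:
  assumes "x \<in> nodes (n + 2)" "f \<in> set (strand_forks x)"
  shows "set (strand_forks x) \<subseteq> strand_class f"
proof
  fix g assume "g \<in> set (strand_forks x)"
  then have "g \<in> forks n u" "same_strand (start u x) (cap g)" using strand_forks_iff[OF assms(1)] by auto
  moreover have "same_strand (start u x) (cap f)" using strand_forks_iff[OF assms(1)] assms(2) by auto
  ultimately show "g \<in> strand_class f"
    using same_strand_trans[OF same_strand_sym[of "start u x" "cap f"]] by (simp add: strand_class_def)
qed

lemma is_cycle_class:
  assumes "f \<in> forks n u" "g \<in> strand_class f" shows "is_cycle n u g \<longleftrightarrow> is_cycle n u f"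
proof -
  have g: "g \<in> forks n u" "same_strand (cap f) (cap g)" using assms(2) by (auto simp: strand_class_def)
  show ?thesis
    using same_strand_terminating[OF g(2) cap_points[OF assms(1)] cap_points[OF g(1)]]
      is_cycle_iff[OF assms(1)] is_cycle_iff[OF g(1)] by simp
qed

text \<open>For edges and cycles alike, the forks crossed by a path are all the forks of its strand.
  So the algorithm handles whole strand classes, and its result does not depend on the order of the
  forks.\<close>

lemma crossed_by_eq:
  assumes f: "f \<in> forks n u" shows "crossed_by n u f = strand_class f"
proof (cases "is_cycle n u f")
  case True
  then show ?thesis using cycle_class[OF f] unfolding strand_class_def by metis
next
  case False
  let ?h = "fst (fork_nodes f)"
  have h: "?h \<in> nodes (n + 2)" "crossed_by n u f = set (strand_forks ?h)" "f \<in> set (strand_forks ?h)"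
    using fork_path[OF f False] by (simp_all add: fork_seq_def)
  then show ?thesis using strand_forks_subset_class[OF h(1,3)] strand_forks_class[OF h(1,3)] by blast
qed

definition cycles :: "(nat \<times> nat) set" where
  "cycles = {f \<in> left_forks n u. is_cycle n u f}"

lemma finite_forks: "finite (forks n u)"
proof (rule finite_subset)
  show "forks n u \<subseteq> {..<length u} \<times> {..<length u}" using fork_length by fastforce
qed simp

lemma finite_cycles: "finite cycles"
  by (rule finite_subset[OF _ finite_forks]) (auto simp: cycles_def forks_def)

text \<open>\<open>X\<close> contains the forks crossed so far and is closed under strand classes. A
  cycle has exactly one left fork, so the loops are counted by \<open>cycles\<close>: the
  undecorated ones by its part outside \<open>X\<close>, the decorated ones by its part in
  \<open>X\<close>.\<close>

definition phase_inv :: "(nat \<times> nat) set \<Rightarrow> ddiag \<Rightarrow> bool" where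
  "phase_inv X d \<longleftrightarrow> X \<subseteq> forks n u \<and> (\<forall>f\<in>X. strand_class f \<subseteq> X) \<and> mate d = other \<and>
     (\<forall>x\<in>nodes (n + 2). word d x = (if set (strand_forks x) \<inter> X \<noteq> {} then map (fork_deco n u) (strand_forks x) else [])) \<and>
     (\<forall>x. x \<notin> nodes (n + 2) \<longrightarrow> word d x = []) \<and>
     loops d = replicate_mset (card (cycles - X)) (cyc []) + replicate_mset (card (cycles \<inter> X)) (cyc [BTriangle, WTriangle])"

lemma phase_inv_step:
  assumes inv: "phase_inv X d" and f: "f \<in> forks n u" "f \<notin> X"
  shows "phase_inv (X \<union> crossed_by n u f) (decorate_path n u f d)"
proof -
  have cl: "crossed_by n u f = strand_class f" by (rule crossed_by_eq[OF f(1)])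
  have X: "X \<subseteq> forks n u" "\<And>g. g \<in> X \<Longrightarrow> strand_class g \<subseteq> X" using inv by (auto simp: phase_inv_def)
  have dj: "strand_class f \<inter> X = {}"
    using X(2) strand_class_sym[OF f(1)] f(2) by blast
  let ?Y = "X \<union> strand_class f"
  have "strand_class f \<subseteq> forks n u" by (auto simp: strand_class_def)
  then have Y: "?Y \<subseteq> forks n u" "\<forall>g\<in>?Y. strand_class g \<subseteq> ?Y"
    using X strand_class_subset by blast+
  show ?thesis
  proof (cases "is_cycle n u f")
    case False
    have ef: "word d x = []" if x: "x \<in> nodes (n + 2)" "f \<in> set (strand_forks x)" for x
    proof -
      have "set (strand_forks x) \<inter> X = {}" using strand_forks_subset_class[OF x] dj by blast
      then show ?thesis using inv x(1) by (auto simp: phase_inv_def)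
    qed
    note D = decorate_path_word[OF f(1) False ef]
    have "cycles \<inter> strand_class f = {}" using is_cycle_class[OF f(1)] False by (auto simp: cycles_def)
    then have c: "cycles - ?Y = cycles - X" "cycles \<inter> ?Y = cycles \<inter> X" by auto
    have "word (decorate_path n u f d) x = (if set (strand_forks x) \<inter> ?Y \<noteq> {} then map (fork_deco n u) (strand_forks x) else [])"
      if x: "x \<in> nodes (n + 2)" for x
    proof (cases "f \<in> set (strand_forks x)")
      case True
      then show ?thesis using D(1) x strand_class_mem[OF f(1)] by auto
    next
      case F: False
      have "set (strand_forks x) \<inter> strand_class f = {}"
      proof (rule ccontr)
        assume "\<not> ?thesis"
        then obtain g where "g \<in> set (strand_forks x)" "g \<in> strand_class f" by blast
        then have "f \<in> set (strand_forks x)" using strand_forks_class[OF x] strand_class_sym[OF f(1)] by blast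
        then show False using F by blast
      qed
      then have "set (strand_forks x) \<inter> ?Y = set (strand_forks x) \<inter> X" by blast
      then show ?thesis using D(1)[of x] F inv x by (simp add: phase_inv_def)
    qed
    then show ?thesis
      using Y D inv c unfolding phase_inv_def cl by simp
  next
    case True
    obtain r l where rl: "r \<in> right_forks n u" "l \<in> left_forks n u" "strand_class f = {r, l}"
      using cycle_class[OF f(1) True] unfolding strand_class_def by metis
    have lc: "l \<in> cycles" using is_cycle_class[OF f(1), of l] True rl by (simp add: cycles_def)
    have "r \<notin> cycles" using left_not_right[of r] rl(1) by (auto simp: cycles_def)
    have lX: "l \<notin> X" using dj rl(3) by blast
    have "cycles \<inter> ?Y = insert l (cycles \<inter> X)" "cycles - ?Y = cycles - X - {l}"
      using rl(3) lc \<open>r \<notin> cycles\<close> by auto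
    \<comment> \<open>The left fork of this cycle is not yet in \<open>X\<close>, so there is still
      an undecorated loop for the multiset subtraction to remove.\<close>
    moreover have "card (cycles - X) = Suc (card (cycles - X - {l}))"
      using lc lX finite_cycles by (intro card.remove) auto
    moreover have "card (insert l (cycles \<inter> X)) = Suc (card (cycles \<inter> X))" using lX finite_cycles by simp
    ultimately have c: "card (cycles - X) = Suc (card (cycles - ?Y))" "card (cycles \<inter> ?Y) = Suc (card (cycles \<inter> X))" by simp_all
    have "set (strand_forks x) \<inter> ?Y = set (strand_forks x) \<inter> X" if "x \<in> nodes (n + 2)" for x
      using strand_forks_not_cycle[OF that] is_cycle_class[OF f(1)] True by blast
    then have w: "word d x = (if set (strand_forks x) \<inter> ?Y \<noteq> {} then map (fork_deco n u) (strand_forks x) else [])"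
      if "x \<in> nodes (n + 2)" for x using inv that by (simp add: phase_inv_def)
    have "loops (decorate_path n u f d) = replicate_mset (card (cycles - ?Y)) (cyc []) + replicate_mset (card (cycles \<inter> ?Y)) (cyc [BTriangle, WTriangle])"
      using inv c True by (simp add: phase_inv_def decorate_path_def)
    moreover have "word (decorate_path n u f d) = word d" "mate (decorate_path n u f d) = mate d"
      using True by (simp_all add: decorate_path_def)
    ultimately show ?thesis
      using Y inv w unfolding phase_inv_def cl by simp
  qed
qed

lemma fork_phase_inv:
  assumes "phase_inv X d" "set fs \<subseteq> forks n u"
  shows "\<exists>Y. phase_inv Y (fork_phase n u fs X d) \<and> X \<union> set fs \<subseteq> Y"
  using assms
proof (induction fs arbitrary: X d)
  case (Cons f fs)
  show ?case
  proof (cases "f \<in> X")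
    case True
    then show ?thesis using Cons.IH[of X d] Cons.prems by auto
  next
    case False
    then have inv: "phase_inv (X \<union> crossed_by n u f) (decorate_path n u f d)"
      using phase_inv_step[OF Cons.prems(1)] Cons.prems(2) by simp
    have "f \<in> crossed_by n u f" by (simp add: crossed_by_def)
    then show ?thesis using Cons.IH[OF inv] Cons.prems(2) False by auto
  qed
qed auto

lemma phase_inv_concrete: "phase_inv {} (concrete_diag n u)"
proof -
  have m: "mate (concrete_diag n u) = other"
    unfolding concrete_diag_eq by (rule mate_word_diag_cong[OF gens]) simp_all
  have "word (concrete_diag n u) x = []" for x
  proof (cases "x \<in> nodes (n + 2)")
    case True
    obtain ls where "strand_of n (\<lambda>_. []) u x ls"
      using word_diag_strands[where c = "\<lambda>_. []", OF gens _ True] by auto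
    moreover have "deco_out (\<lambda>_. []) u = (\<lambda>_. [])"
      by (rule ext) (simp add: deco_out_def split: option.split)
    moreover have "concat (map (\<lambda>_. []) ls) = ([] :: deco list)" by (simp add: concat_eq_Nil_conv)
    ultimately show ?thesis by (metis strand_of_def concrete_diag_eq)
  next
    case False
    then show ?thesis using mate_outside unfolding concrete_diag_eq by blast
  qed
  moreover have "loops (concrete_diag n u) = replicate_mset (card cycles) (cyc [])"
    using loops_concrete_diag[OF alternating_word_axioms] card_endless_ones by (simp add: cycles_def)
  ultimately show ?thesis using m by (simp add: phase_inv_def)
qed

text \<open>The exception of the final step in terms of strands: after the fork phase an edge is
  undecorated exactly if its strand has no forks.\<close>

definition straight :: "nat \<Rightarrow> bool" where
  "straight i \<longleftrightarrow> other (North i) = South i \<and> strand_forks (North i) = []"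

definition end_word :: "deco \<Rightarrow> nat \<Rightarrow> node \<Rightarrow> deco list" where
  "end_word c i x = (if node_index x = i \<and> \<not> straight i then [c] else [])"

definition final_word :: "node \<Rightarrow> deco list" where
  "final_word x = (if x \<in> nodes (n + 2) then
     (end_word Circle (n + 2) x @ end_word Bullet 1 x) @ map (fork_deco n u) (strand_forks x) @
     (end_word Bullet 1 (other x) @ end_word Circle (n + 2) (other x)) else [])"

lemma end_decorations_word:
  assumes "mate d = other" "straight i \<longleftrightarrow> other (North i) = South i \<and> word d (North i) = []"
    "1 \<le> i" "i \<le> n + 2"
  shows "word (end_decorations c i d) x = end_word c i x @ word d x @ end_word c i (other x)"
    "mate (end_decorations c i d) = mate d" "loops (end_decorations c i d) = loops d"
proof -
  have ns: "mate d (North i) \<noteq> North i" "mate d (South i) \<noteq> South i"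
    using other_neq[of "North i"] other_neq[of "South i"] assms by auto
  have inv: "\<And>z. mate d (mate d z) = z" using assms(1) by simp
  show "word (end_decorations c i d) x = end_word c i x @ word d x @ end_word c i (other x)"
    using word_add_first_twice[OF inv ns, of c x] assms(1,2) unfolding end_decorations_def end_word_def by auto
  show "mate (end_decorations c i d) = mate d" "loops (end_decorations c i d) = loops d"
    by (simp_all add: end_decorations_def)
qed

lemma dec_A_fields:
  assumes "set fs = forks n u"
  defines "d \<equiv> end_decorations Circle (n + 2) (end_decorations Bullet 1 (fork_phase n u fs {} (concrete_diag n u)))"
  shows "mate d = other" "word d = final_word" "loops d = replicate_mset (card cycles) (cyc [BTriangle, WTriangle])"
proof -
  let ?d0 = "fork_phase n u fs {} (concrete_diag n u)"
  obtain Y where Y: "phase_inv Y ?d0" "set fs \<subseteq> Y" using fork_phase_inv[OF phase_inv_concrete, of fs] assms(1) by auto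
  have YF: "Y = forks n u" using Y assms(1) by (auto simp: phase_inv_def)
  have m: "mate ?d0 = other" using Y(1) by (simp add: phase_inv_def)
  have w0: "word ?d0 x = (if x \<in> nodes (n + 2) then map (fork_deco n u) (strand_forks x) else [])" for x
  proof (cases "x \<in> nodes (n + 2)")
    case True
    have "set (strand_forks x) \<subseteq> Y" using strand_forks_iff[OF True] YF by blast
    then have "set (strand_forks x) \<inter> Y = set (strand_forks x)" by blast
    then show ?thesis using Y(1) True by (auto simp: phase_inv_def)
  next
    case False
    then show ?thesis using Y(1) by (simp add: phase_inv_def)
  qed
  have lp: "cycles - Y = {}" "cycles \<inter> Y = cycles" using YF by (auto simp: cycles_def forks_def)
  then have l0: "loops ?d0 = replicate_mset (card cycles) (cyc [BTriangle, WTriangle])"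
    using Y(1)[unfolded phase_inv_def lp] by simp
  let ?d1 = "end_decorations Bullet 1 ?d0"
  have s1: "straight 1 \<longleftrightarrow> other (North 1) = South 1 \<and> word ?d0 (North 1) = []"
    by (simp add: straight_def w0)
  note E1 = end_decorations_word[OF m s1, of Bullet]
  \<comment> \<open>The bullets already added do not interfere: they are on this edge only if it
    ends in the box column 1, and then it does not end at \<open>South (n + 2)\<close>.\<close>
  have s2: "straight (n + 2) \<longleftrightarrow> other (North (n + 2)) = South (n + 2) \<and> word ?d1 (North (n + 2)) = []"
    using E1(1)[of "North (n + 2)"] by (auto simp: straight_def w0 end_word_def)
  note E2 = end_decorations_word[of ?d1 "n + 2" Circle, OF _ s2]
  show "mate d = other" "loops d = replicate_mset (card cycles) (cyc [BTriangle, WTriangle])"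
    using E1 E2 m l0 by (simp_all add: d_def)
  show "word d = final_word"
  proof
    fix x
    have "word d x = end_word Circle (n + 2) x @ (end_word Bullet 1 x @ word ?d0 x @ end_word Bullet 1 (other x)) @ end_word Circle (n + 2) (other x)"
      using E1 E2(1)[of x] m by (simp add: d_def)
    moreover have "other x = x" "end_word Circle (n + 2) x = []" "end_word Bullet 1 x = []" if "x \<notin> nodes (n + 2)"
      using that mate_outside[OF that, of "gen_deco n" u] by (cases x; auto simp: end_word_def)+
    ultimately show "word d x = final_word x" using w0[of x] by (auto simp: final_word_def)
  qed
qed

text \<open>In the first case of \<open>strand_word\<close> the exception of the final step does not
  apply, so the end decorations agree with \<open>exit_word\<close> and only the pairs from forks
  contract. In the second case the exception applies and both words are empty.\<close>

lemma final_word_contraction: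
  assumes x: "x \<in> nodes (n + 2)" shows "contraction\<^sup>*\<^sup>* (word prod_diag x) (final_word x)"
proof -
  have str: "straight i \<Longrightarrow> node_index z = i \<Longrightarrow> strand_forks z = [] \<and> other z = opposite z" if "1 \<le> i" "i \<le> n + 2" for i z
  proof -
    assume s: "straight i" "node_index z = i"
    have N: "North i \<in> nodes (n + 2)" using that by simp
    have "other (South i) = North i" "strand_forks (South i) = []"
      using s(1) other_other[of "North i"] strand_forks_other[OF N] by (auto simp: straight_def)
    then show ?thesis using s by (cases z) (auto simp: straight_def)
  qed
  have opp: "node_index (opposite z) = node_index z" for z by (cases z) auto
  from strand_word[OF x] show ?thesis
  proof (elim disjE conjE)
    assume w: "word prod_diag x = exit_word x @ concat (map fork_word (strand_forks x)) @ exit_word (other x)"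
      and ne: "strand_forks x = [] \<and> exit_word x \<noteq> [] \<longrightarrow> node_index (other x) \<noteq> node_index x"
    have ew: "\<not> straight i" if i: "i = 1 \<or> i = n + 2" "node_index z = i" "z = x \<or> z = other x" for i z
    proof
      assume "straight i"
      then have s: "strand_forks z = []" "other z = opposite z" using str[of i z] i by auto
      have "strand_forks x = [] \<and> node_index (other x) = node_index x \<and> node_index x = i"
        using i(3)
      proof
        assume "z = x"
        then show ?thesis using s opp[of x] i(2) by simp
      next
        assume z: "z = other x"
        then have "x = opposite z" using s(2) by simp
        moreover have "strand_forks x = []" using s(1) strand_forks_other[OF x] z by simp
        ultimately show ?thesis using opp[of z] i(2) z by simp
      qed
      moreover have "exit_word x \<noteq> []" using calculation i(1) by (auto simp: exit_word_def)
      ultimately show False using ne by blast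
    qed
    have e: "end_word Circle (n + 2) z @ end_word Bullet 1 z = exit_word z" "end_word Bullet 1 z @ end_word Circle (n + 2) z = exit_word z"
      if "z = x \<or> z = other x" for z
      using ew[OF _ _ that] by (auto simp: end_word_def exit_word_def)
    have "final_word x = exit_word x @ map (fork_deco n u) (strand_forks x) @ exit_word (other x)"
      using x e(1)[of x] e(2)[of "other x"] by (simp add: final_word_def del: add_2_eq_Suc')
    then show ?thesis unfolding w using contraction_forks by simp
  next
    assume w: "word prod_diag x = []" "strand_forks x = []" "exit_word x \<noteq> []" "other x = opposite x"
    define i where "i = node_index x"
    have i: "i = 1 \<or> i = n + 2" using w(3) by (auto simp: exit_word_def i_def split: if_splits)
    have N: "North i \<in> nodes (n + 2)" using i by auto
    have "straight i"
    proof (cases x)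
      case (North j)
      then show ?thesis using w i_def by (simp add: straight_def)
    next
      case (South j)
      then have "other (South i) = North i" using w(4) i_def by simp
      then have "other (North i) = South i" using other_other[of "South i"] by simp
      moreover have "strand_forks (North i) = []" using w(2) strand_forks_other[OF N] South i_def calculation by simp
      ultimately show ?thesis by (simp add: straight_def)
    qed
    then have "end_word c j z = []" if "node_index z = i" for c j z
      using that by (auto simp: end_word_def)
    then have "final_word x = []" using w(2) opp[of x] i_def by (simp add: final_word_def w(4))
    then show ?thesis using w(1) by simp
  qed
qed

lemma final_word_other:
  assumes "x \<in> nodes (n + 2)" shows "final_word (other x) = rev (final_word x)"
  using assms other_nodes[OF assms] strand_forks_other[OF assms]
  by (auto simp: final_word_def end_word_def rev_map simp del: add_2_eq_Suc')

end

section \<open>Heights of the decorations\<close>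

text \<open>The points of the face that lie on non-propagating edges, two for each edge counted by
  \<open>a_val\<close>. Sets of points are easy to compare between the two faces, and between a word
  and its tails.\<close>

definition turned_north :: "nat \<Rightarrow> nat list \<Rightarrow> nat set" where
  "turned_north n u = {i. 1 \<le> i \<and> i \<le> n + 2 \<and> (\<exists>j. mate (word_diag n (gen_deco n) u) (North i) = North j)}"

definition turned_south :: "nat \<Rightarrow> nat list \<Rightarrow> nat set" where
  "turned_south n u = {i. 1 \<le> i \<and> i \<le> n + 2 \<and> (\<exists>j. mate (word_diag n (gen_deco n) u) (South i) = South j)}"

lemma finite_turned [simp]: "finite (turned_north n u)" "finite (turned_south n u)"
  by (rule finite_subset[of _ "{1..n+2}"]; auto simp: turned_north_def turned_south_def)+

lemma alternating_word_append: "alternating_word n (p @ v) \<Longrightarrow> alternating_word n v"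
proof (induction p)
  case (Cons i p)
  interpret A: alternating_word n "i # p @ v" using Cons.prems by simp
  have "alternating_word n (p @ v)"
    using A.n2 A.gens alternating_tl[OF A.alternating] by unfold_locales auto
  then show ?case by (rule Cons.IH)
qed simp

lemma decorated_word_diag:
  assumes "ring (diag_alg n)" "set u \<subseteq> gens n"
  shows "decorated_diagram n (word_diag n (gen_deco n) u)"
  using assms(2)
proof (induction u)
  case (Cons i u)
  then show ?case
    using decorated_dmul[OF assms(1)] decorated_d_gen[of i n] by (simp add: d_gen_eq)
qed (simp add: decorated_id_diag[OF assms(1)])

context alternating_word
begin

text \<open>The propagating edges match the remaining points of the two faces.\<close>

lemma card_turned: "card (turned_north n u) = card (turned_south n u)"
proof -
  let ?P = "{i. 1 \<le> i \<and> i \<le> n + 2 \<and> (\<exists>j. other (North i) = South j)}"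
  let ?Q = "{i. 1 \<le> i \<and> i \<le> n + 2 \<and> (\<exists>j. other (South i) = North j)}"
  have PQ: "bij_betw (\<lambda>i. node_index (other (North i))) ?P ?Q"
  proof (rule bij_betw_byWitness[where f' = "\<lambda>i. node_index (other (South i))"])
    show "\<forall>i\<in>?P. node_index (other (South (node_index (other (North i))))) = i"
    proof
      fix i assume "i \<in> ?P"
      then obtain j where "other (North i) = South j" by blast
      then show "node_index (other (South (node_index (other (North i))))) = i"
        using other_other[of "North i"] by simp
    qed
    show "\<forall>i\<in>?Q. node_index (other (North (node_index (other (South i))))) = i"
    proof
      fix i assume "i \<in> ?Q"
      then obtain j where "other (South i) = North j" by blast
      then show "node_index (other (North (node_index (other (South i))))) = i"
        using other_other[of "South i"] by simp
    qed
    show "(\<lambda>i. node_index (other (North i))) ` ?P \<subseteq> ?Q"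
    proof
      fix k assume "k \<in> (\<lambda>i. node_index (other (North i))) ` ?P"
      then obtain i j where i: "1 \<le> i" "i \<le> n + 2" "other (North i) = South j" "k = j" by auto
      then have "South k \<in> nodes (n + 2)" "other (South k) = North i"
        using other_nodes[of "North i"] other_other[of "North i"] by simp_all
      then show "k \<in> ?Q" by simp
    qed
    show "(\<lambda>i. node_index (other (South i))) ` ?Q \<subseteq> ?P"
    proof
      fix k assume "k \<in> (\<lambda>i. node_index (other (South i))) ` ?Q"
      then obtain i j where i: "1 \<le> i" "i \<le> n + 2" "other (South i) = North j" "k = j" by auto
      then have "North k \<in> nodes (n + 2)" "other (North k) = South i"
        using other_nodes[of "South i"] other_other[of "South i"] by simp_all
      then show "k \<in> ?P" by simp
    qed
  qed
  have "turned_north n u = {1..n+2} - ?P"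
  proof -
    have "(\<exists>j. other (North i) = North j) \<longleftrightarrow> \<not> (\<exists>j. other (North i) = South j)" for i
      by (cases "other (North i)") auto
    then show ?thesis by (auto simp: turned_north_def)
  qed
  moreover have "turned_south n u = {1..n+2} - ?Q"
  proof -
    have "(\<exists>j. other (South i) = South j) \<longleftrightarrow> \<not> (\<exists>j. other (South i) = North j)" for i
      by (cases "other (South i)") auto
    then show ?thesis by (auto simp: turned_south_def)
  qed
  moreover have "card ({1..n+2} - ?P) = card {1..n+2} - card ?P" "card ({1..n+2} - ?Q) = card {1..n+2} - card ?Q"
    by (rule card_Diff_subset; auto)+
  ultimately show ?thesis using bij_betw_same_card[OF PQ] by simp
qed

lemma card_turned_north:
  assumes "a_val other = 1" shows "card (turned_north n u) = 2"
proof -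
  obtain i where L: "{i. \<exists>j. other (North i) = North j \<and> i < j} = {i}"
    using assms unfolding a_val_def by (elim card_1_singletonE) blast
  then have "\<exists>j. other (North i) = North j \<and> i < j" by blast
  then obtain j where j: "other (North i) = North j" "i < j" by blast
  have ij: "other (North j) = North i" using other_other[of "North i"] j(1) by simp
  have nod: "North i \<in> nodes (n + 2)" "North j \<in> nodes (n + 2)"
  proof -
    have "other (North i) \<noteq> North i" "other (North j) \<noteq> North j" using j ij by auto
    then show "North i \<in> nodes (n + 2)" "North j \<in> nodes (n + 2)" using mate_outside by blast+
  qed
  have "k = i \<or> k = j" if k: "k \<in> turned_north n u" for k
  proof -
    obtain l where l: "North k \<in> nodes (n + 2)" "other (North k) = North l" using k by (auto simp: turned_north_def)
    have "l \<noteq> k" using other_neq[OF l(1)] l(2) by auto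
    then consider "k < l" | "l < k" by linarith
    then show ?thesis
    proof cases
      case 1
      then have "k \<in> {i. \<exists>j. other (North i) = North j \<and> i < j}" using l(2) by blast
      then show ?thesis unfolding L by blast
    next
      case 2
      have "other (North l) = North k" using other_other[of "North k"] l(2) by simp
      then have "l \<in> {i. \<exists>j. other (North i) = North j \<and> i < j}" using 2 by blast
      then have "l = i" unfolding L by blast
      then show ?thesis using \<open>other (North l) = North k\<close> j(1) by simp
    qed
  qed
  moreover have "i \<in> turned_north n u" "j \<in> turned_north n u" using nod j(1) ij by (auto simp: turned_north_def)
  ultimately have "turned_north n u = {i, j}" by blast
  then show ?thesis using j(2) by simp
qed

end

text \<open>A strand that returns to the south face never passes the top of \<open>v\<close>, so
  letters added above do not affect it.\<close>

lemma turned_south_mono: "alternating_word n (p @ v) \<Longrightarrow> turned_south n v \<subseteq> turned_south n (p @ v)"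
proof (induction p)
  case (Cons i p)
  interpret A: alternating_word n "i # (p @ v)" using Cons.prems by simp
  have W: "alternating_word n (p @ v)" using alternating_word_append[of n "[i]" "p @ v"] Cons.prems by simp
  interpret W: alternating_word n "p @ v" by (rule W)
  have "turned_south n (p @ v) \<subseteq> turned_south n (i # (p @ v))"
  proof
    fix k assume "k \<in> turned_south n (p @ v)"
    then obtain j where k: "South k \<in> nodes (n + 2)" "W.other (South k) = South j" by (auto simp: turned_south_def)
    obtain ls where "walk (sstep (p @ v)) (start (p @ v) (South k)) ls (finish (p @ v) (South j))"
      using W.strand_walk[OF k(1)] k(2) by metis
    from walk_shift[OF this, of i] have "walk (sstep (i # (p @ v))) (start (i # (p @ v)) (South k)) (map shift ls) (finish (i # (p @ v)) (South j))"
      by simp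
    from A.strand_walk_eq(1)[OF k(1) this] k(1) show "k \<in> turned_south n (i # (p @ v))" by (auto simp: turned_south_def)
  qed
  then show ?case using Cons.IH[OF W] by simp
qed simp

context alternating_word
begin

text \<open>Two consecutive distant letters would give two separate caps on the north face of the
  tail beginning with them, hence four turned points there. The same number occurs on the south face
  of the tail and persists in \<open>u\<close>, where \<open>a_val\<close> allows only two.\<close>

lemma adjacent_letters:
  assumes a: "a_val other = 1" and k: "k + 1 < length u"
  shows "u ! (k + 1) = u ! k + 1 \<or> u ! k = u ! (k + 1) + 1"
proof (rule ccontr)
  assume no: "\<not> ?thesis"
  define i where "i = u ! k"
  define j where "j = u ! (k + 1)"
  have ij: "1 \<le> i" "i \<le> n + 1" "1 \<le> j" "j \<le> n + 1" using letter[of k] letter[of "k + 1"] k by (auto simp: i_def j_def)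
  have "i \<noteq> j"
  proof
    assume "i = j"
    then have nx: "nextin u {i} k (k + 1)" using k by (auto simp: nextin_def i_def j_def)
    have "i \<in> gens n" using ij by (simp add: gens_bounds)
    moreover obtain d where d: "d \<in> gens n" "d = i + 1 \<or> i = d + 1" using neighbour[OF \<open>i \<in> gens n\<close>] by blast
    ultimately obtain l where "nextin u {i, d} k l" "nextin u {i, d} l (k + 1)"
      using between_exists[OF nx d(2) _ d(1)] by blast
    then show False by (auto simp: nextin_def)
  qed
  then have far: "i + 1 < j \<or> j + 1 < i" using no i_def j_def by auto
  define v where "v = drop k u"
  have v: "v = i # j # drop (k + 2) u"
    using k by (simp add: v_def i_def j_def Cons_nth_drop_Suc)
  have app: "take k u @ v = u" by (simp add: v_def)
  have W: "alternating_word n (take k u @ v)" unfolding app by (rule alternating_word_axioms)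
  then have V: "alternating_word n v" by (rule alternating_word_append)
  interpret V: alternating_word n v by (rule V)
  have 1: "V.other (North i) = North (i + 1)"
    by (rule V.strand_walk_eq(1)[of _ "[(0, i, Downward)]"]) (use ij in \<open>auto simp: v\<close>)
  have 2: "V.other (North j) = North (j + 1)"
    by (rule V.strand_walk_eq(1)[of _ "[(0, j, Downward), (1, j, Downward), (1, j + 1, Upward)]"]) (use ij far in \<open>auto simp: v\<close>)
  have "V.other (North (i + 1)) = North i" "V.other (North (j + 1)) = North j"
    using V.other_other[of "North i"] V.other_other[of "North j"] 1 2 by simp_all
  then have "{i, i + 1, j, j + 1} \<subseteq> turned_north n v" using 1 2 ij by (auto simp: turned_north_def)
  then have "card {i, i + 1, j, j + 1} \<le> card (turned_north n v)" by (intro card_mono) simp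
  moreover have "card {i, i + 1, j, j + 1} = 4" using far by auto
  ultimately have "4 \<le> card (turned_north n v)" by simp
  also have "\<dots> = card (turned_south n v)" by (rule V.card_turned)
  also have "\<dots> \<le> card (turned_south n u)"
    using turned_south_mono[OF W] unfolding app by (intro card_mono) simp_all
  also have "\<dots> = 2" by (rule card_turned[symmetric, THEN trans, OF card_turned_north[OF a]])
  finally show False by simp
qed

text \<open>An inner column has two neighbours, and between the two equal letters only one of them
  is visited; for the other one alternation fails.\<close>

lemma no_inner_return:
  assumes "k + 2 < length u" "u ! (k + 2) = u ! k" "u ! (k + 1) = u ! k + 1 \<or> u ! k = u ! (k + 1) + 1"
  shows "u ! k = 1 \<or> u ! k = n + 1"
proof (rule ccontr)
  assume no: "\<not> ?thesis"
  define x where "x = u ! k"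
  define y where "y = u ! (k + 1)"
  have x: "1 < x" "x < n + 1" using letter[of k] assms(1) no unfolding x_def by linarith+
  obtain z where z: "z = x + 1 \<or> x = z + 1" "1 \<le> z" "z \<le> n + 1" "y \<noteq> z" "y \<noteq> x"
  proof (cases "y = x + 1")
    case True
    then show ?thesis using x that[of "x - 1"] by simp
  next
    case False
    then have "x = y + 1" using assms(3) by (simp add: x_def y_def)
    then show ?thesis using x that[of "x + 1"] by simp
  qed
  have g: "x \<in> gens n" "z \<in> gens n" using x z by (simp_all add: gens_bounds)
  have "nextin u {x, z} k (k + 2)"
    unfolding nextin_def
  proof (intro conjI allI impI)
    fix l assume "k < l \<and> l < k + 2"
    then have "l = k + 1" by simp
    then show "u ! l \<notin> {x, z}" using z(4,5) by (simp add: y_def)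
  qed (use assms(1,2) in \<open>simp_all add: x_def\<close>)
  from nextin_neq[OF this z(1) g] show False using assms(2) by simp
qed

text \<open>The returning letter lies in an extreme column, so any letter before or after the three
  is again the middle one, \<open>y\<close>. That would be a return in the inner column of
  \<open>y\<close>. So the word consists of three letters from two columns and cannot contain both
  \<open>1\<close> and \<open>n + 1\<close>.\<close>

lemma no_return:
  assumes a: "a_val other = 1" and ends: "1 \<in> set u" "n + 1 \<in> set u"
    and k: "k + 2 < length u" "u ! (k + 2) = u ! k"
  shows False
proof -
  note adj = adjacent_letters[OF a]
  define y where "y = u ! (k + 1)"
  have e: "u ! k = 1 \<or> u ! k = n + 1" using no_inner_return[OF k adj] k(1) by simp
  have yk: "y = u ! k + 1 \<or> u ! k = y + 1" using adj[of k] k(1) by (simp add: y_def)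
  have yb: "1 \<le> y" "y \<le> n + 1" using letter[of "k + 1"] k(1) by (simp_all add: y_def)
  have y: "y \<noteq> 1" "y \<noteq> n + 1" using e yk yb n2 by linarith+
  have ynb: "u ! j = y" if "j < length u" "u ! j = u ! k + 1 \<or> u ! k = u ! j + 1" for j
    using letter[OF that(1)] that(2) e yk yb by linarith
  have "\<not> k + 3 < length u"
  proof
    assume l: "k + 3 < length u"
    have i: "k + 1 + 2 = k + 3" "k + 2 + 1 = k + 3" "k + 1 + 1 = k + 2" by simp_all
    have "u ! (k + 3) = u ! (k + 2) + 1 \<or> u ! (k + 2) = u ! (k + 3) + 1"
      using adj[of "k + 2"] l unfolding i by blast
    then have "u ! (k + 3) = y" using ynb[OF l] k(2) by simp
    moreover have "u ! (k + 2) = u ! (k + 1) + 1 \<or> u ! (k + 1) = u ! (k + 2) + 1"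
      using yk k(2) unfolding y_def by linarith
    ultimately have "y = 1 \<or> y = n + 1"
      using no_inner_return[of "k + 1"] l unfolding i y_def by blast
    then show False using y by blast
  qed
  moreover have "k = 0"
  proof (rule ccontr)
    assume "k \<noteq> 0"
    then obtain l where l: "k = Suc l" by (cases k) auto
    have i: "l + 1 = k" "l + 2 = k + 1" using l by simp_all
    have ll: "l < length u" using l k(1) by simp
    have lk: "u ! k = u ! l + 1 \<or> u ! l = u ! k + 1" using adj[of l] k(1) unfolding i by linarith
    then have "u ! l = y" using ynb[OF ll] by blast
    then have "y = 1 \<or> y = n + 1"
      using no_inner_return[of l] lk k(1) unfolding i y_def by simp
    then show False using y by blast
  qed
  ultimately have len: "length u = 3" using k(1) by simp
  have "c \<in> {u ! 0, y}" if c: "c \<in> set u" for c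
  proof -
    obtain j where "j < 3" "u ! j = c" using c len by (metis in_set_conv_nth)
    then consider "j = 0" | "j = 1" | "j = 2" by linarith
    then show ?thesis
      using \<open>u ! j = c\<close> k(2) \<open>k = 0\<close> by cases (auto simp: y_def numeral_2_eq_2)
  qed
  from this[OF ends(1)] this[OF ends(2)] show False using y n2 by simp
qed

text \<open>Consecutive letters differ by one and the word never turns back, so it is monotone; as
  it contains both extreme letters, it is the complete run.\<close>

lemma single_run:
  assumes a: "a_val other = 1" and ends: "1 \<in> set u" "n + 1 \<in> set u"
  shows "u = [1..<n + 2] \<or> u = rev [1..<n + 2]"
proof -
  note adj = adjacent_letters[OF a]
  note none = no_return[OF a ends]
  obtain p q where pq: "p < length u" "u ! p = 1" "q < length u" "u ! q = n + 1"
    using ends by (metis in_set_conv_nth)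
  then have "p \<noteq> q" using n2 by auto
  then have len: "1 < length u" using pq by linarith
  from adj[of 0] len consider "u ! 1 = u ! 0 + 1" | "u ! 0 = u ! 1 + 1" by auto
  then show ?thesis
  proof cases
    case 1
    have up: "k + 1 < length u \<Longrightarrow> u ! (k + 1) = u ! k + 1" for k
    proof (induction k)
      case (Suc k)
      then show ?case using adj[of "Suc k"] none[of k] by auto
    qed (use 1 in simp)
    have all: "k < length u \<Longrightarrow> u ! k = u ! 0 + k" for k
    proof (induction k)
      case (Suc k)
      then show ?case using up[of k] by simp
    qed simp
    have u0: "u ! 0 = 1" using all[OF pq(1)] pq(2) letter[of 0] len by linarith
    have "q = n" using all[OF pq(3)] pq(4) u0 by simp
    moreover have "length u - 1 < length u" using len by simp
    from all[OF this] letter[OF this] have "length u \<le> n + 1" using u0 len by linarith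
    ultimately have "length u = n + 1" using pq(3) by simp
    then have "u = [1..<n + 2]" using all u0 by (intro nth_equalityI) (simp_all del: upt_Suc)
    then show ?thesis ..
  next
    case 2
    have dn: "k + 1 < length u \<Longrightarrow> u ! k = u ! (k + 1) + 1" for k
    proof (induction k)
      case (Suc k)
      then show ?case using adj[of "Suc k"] none[of k] by auto
    qed (use 2 in simp)
    have all: "k < length u \<Longrightarrow> u ! k + k = u ! 0" for k
    proof (induction k)
      case (Suc k)
      then show ?case using dn[of k] by simp
    qed simp
    have u0: "u ! 0 = n + 1" using all[OF pq(3)] pq(4) letter[of 0] len by linarith
    have "p = n" using all[OF pq(1)] pq(2) u0 by simp
    moreover have "length u - 1 < length u" using len by simp
    from all[OF this] letter[OF this] have "length u \<le> n + 1" using u0 len by linarith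
    ultimately have l: "length u = n + 1" using pq(1) by simp
    have "u ! k = n + 1 - k" if "k < length u" for k using all[OF that] u0 by simp
    then have "u = rev [1..<n + 2]" using l by (intro nth_equalityI) (simp_all add: rev_nth del: upt_Suc)
    then show ?thesis ..
  qed
qed

end

lemma word_diag_letters:
  "c \<in> set (word (word_diag n (gen_deco n) u) x) \<Longrightarrow> \<exists>i\<in>set u. c \<in> set (gen_deco n i)"
proof (induction u arbitrary: x)
  case (Cons i u)
  then obtain s where s: "c \<in> set (seg_word (simple_diag n i (gen_deco n i)) (word_diag n (gen_deco n) u) s)"
    by (auto simp: dmul_def Let_def split: if_splits)
  obtain b y where "s = (b, y)" by (cases s)
  then show ?case
    using s Cons.IH[of y] by (cases b) (auto simp: word_simple_diag split: if_splits)
qed (simp add: id_diag_def)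

lemma decorated_vert:
  assumes "decorated_diagram n d"
  defines "ws \<equiv> concat (map (word d) (prop_list (n + 2) (mate d)))"
  shows "a_val (mate d) = 1 \<Longrightarrow> filter black (vert d) = filter black ws"
    "a_val (mate d) = 1 \<Longrightarrow> filter (\<lambda>c. \<not> black c) (vert d) = filter (\<lambda>c. \<not> black c) ws"
    "a_val (mate d) \<noteq> 1 \<Longrightarrow> vert d = []"
proof -
  have "if a_val (mate d) = 1 then filter black (vert d) = filter black ws \<and>
      filter (\<lambda>c. \<not> black c) (vert d) = filter (\<lambda>c. \<not> black c) ws else vert d = []"
    using assms(1) unfolding decorated_diagram_def Let_def ws_def by blast
  then show "a_val (mate d) = 1 \<Longrightarrow> filter black (vert d) = filter black ws"
    "a_val (mate d) = 1 \<Longrightarrow> filter (\<lambda>c. \<not> black c) (vert d) = filter (\<lambda>c. \<not> black c) ws"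
    "a_val (mate d) \<noteq> 1 \<Longrightarrow> vert d = []" by presburger+
qed

lemma vert_letters:
  assumes "decorated_diagram n d" "c \<in> set (vert d)" shows "\<exists>x. c \<in> set (word d x)"
proof -
  let ?ws = "concat (map (word d) (prop_list (n + 2) (mate d)))"
  have a: "a_val (mate d) = 1"
    using decorated_vert(3)[OF assms(1)] assms(2) by (metis empty_iff list.set(1))
  then have "filter black (vert d) = filter black ?ws" "filter (\<lambda>c. \<not> black c) (vert d) = filter (\<lambda>c. \<not> black c) ?ws"
    using decorated_vert(1,2)[OF assms(1) a] by blast+
  then have "c \<in> set ?ws" using assms(2) by (metis (mono_tags, lifting) mem_Collect_eq set_filter)
  then show ?thesis by auto
qed

lemma trail_inner:
  assumes "t \<in> set (butlast (tl (trail k d1 d2 s)))"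
  shows "glue_next d1 d2 t \<noteq> None \<and> (\<exists>r. glue_next d1 d2 r = Some t)"
proof -
  have nonempty: "trail k d1 d2 s \<noteq> []" for k s by (cases k) auto
  have 1: "t \<in> set (butlast (trail k d1 d2 s)) \<Longrightarrow> glue_next d1 d2 t \<noteq> None" for k s
    by (induction k arbitrary: s) (auto split: option.splits if_splits simp: nonempty)
  have hd: "set (trail k d1 d2 s) = insert s (set (tl (trail k d1 d2 s)))" for k s by (cases k) auto
  have 2: "t \<in> set (tl (trail k d1 d2 s)) \<Longrightarrow> \<exists>r. glue_next d1 d2 r = Some t" for k s
  proof (induction k arbitrary: s)
    case (Suc k)
    then obtain s' where s': "glue_next d1 d2 s = Some s'" "t \<in> set (trail k d1 d2 s')"
      by (cases "glue_next d1 d2 s") auto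
    show ?case
    proof (cases "t = s'")
      case True
      then show ?thesis using s'(1) by blast
    next
      case False
      then have "t \<in> set (tl (trail k d1 d2 s'))" using s'(2) hd[of k s'] by blast
      then show ?thesis by (rule Suc.IH)
    qed
  qed simp
  have "t \<in> set (butlast (trail k d1 d2 s))" using assms by (metis butlast_tl list.sel(2) list.set_sel(2))
  moreover have "t \<in> set (tl (trail k d1 d2 s))" using assms in_set_butlastD by fast
  ultimately show ?thesis using 1 2 by blast
qed

text \<open>If the product has only one non-propagating edge on each face, the gluing adds to the list of heights only
  decorations of the top generator: the inner segments in the lower diagram are all the cap of its first letter.\<close>

lemma vert_first_letter:
  assumes W: "alternating_word n (h # h' # v)" and a: "a_val (mate (word_diag n (gen_deco n) (h # h' # v))) = 1"
    and h': "gen_deco n h' = []"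
  shows "\<exists>mid. vert (word_diag n (gen_deco n) (h # h' # v)) = mid @ vert (word_diag n (gen_deco n) (h' # v)) \<and>
    set mid \<subseteq> set (gen_deco n h)"
proof -
  let ?w = "h' # v"
  interpret W: alternating_word n "h # h' # v" by (rule W)
  interpret V: alternating_word n "h' # v" using alternating_word_append[of n "[h]" "h' # v"] W by simp
  have ih: "1 \<le> h'" "h' \<le> n + 1" using V.letter[of 0] by auto
  have wk: "walk (sstep ?w) (start ?w (North h')) [(0, h', Downward)] (finish ?w (North (h' + 1)))" by simp
  have "North h' \<in> nodes (n + 2)" using ih by simp
  note N = V.strand_walk_eq[OF this wk]
  have N2: "V.other (North (h' + 1)) = North h'" using V.other_other[of "North h'"] N(1) by simp
  have w: "word V.prod_diag (North h') = []" using N(2) h' by (simp add: deco_out_def)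
  have wk': "walk (sstep ?w) (start ?w (North (h' + 1))) [(0, h' + 1, Downward)] (finish ?w (North h'))" by simp
  have "North (h' + 1) \<in> nodes (n + 2)" using ih by simp
  from V.strand_walk_eq(2)[OF this wk'] have w2: "word V.prod_diag (North (h' + 1)) = []"
    using h' by (simp add: deco_out_def)
  have "turned_north n ?w = {h', h' + 1}"
  proof (rule sym, rule card_seteq)
    show "{h', h' + 1} \<subseteq> turned_north n ?w" using N(1) N2 ih by (auto simp: turned_north_def)
    have "card (turned_south n ?w) \<le> card (turned_south n (h # ?w))"
      using turned_south_mono[of n "[h]" ?w] W by (intro card_mono) simp_all
    then show "card (turned_north n ?w) \<le> card {h', h' + 1}"
      using V.card_turned W.card_turned W.card_turned_north[OF a] by simp
  qed simp
  then have lower: "word V.prod_diag (North k) = []" if "V.other (North k) = North j" for k j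
  proof (cases "1 \<le> k \<and> k \<le> n + 2")
    case True
    then have "k \<in> {h', h' + 1}" using that \<open>turned_north n ?w = {h', h' + 1}\<close> by (auto simp: turned_north_def)
    then show ?thesis using w w2 by blast
  next
    case False
    then show ?thesis using mate_outside[of "North k" n "gen_deco n" ?w] by simp
  qed
  let ?d1 = "simple_diag n h (gen_deco n h)"
  let ?mid = "concat (map (\<lambda>x. concat (map (seg_word ?d1 V.prod_diag) (butlast (tl (curve (n + 2) ?d1 V.prod_diag x)))))
      (prop_list (n + 2) W.other))"
  have "c \<in> set (gen_deco n h)" if c: "c \<in> set ?mid" for c
  proof -
    obtain x t where t: "t \<in> set (butlast (tl (curve (n + 2) ?d1 V.prod_diag x)))" "c \<in> set (seg_word ?d1 V.prod_diag t)"
      using c by (auto simp del: word_diag_simps add_2_eq_Suc' simp flip: seg_word.simps)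
    obtain b y where b: "t = (b, y)" by (cases t)
    obtain r where r: "glue_next ?d1 V.prod_diag t \<noteq> None" "glue_next ?d1 V.prod_diag r = Some t"
      using trail_inner[OF t(1)[unfolded curve_def]] by blast
    show ?thesis
    proof (cases b)
      case True
      then show ?thesis using t(2) b by (auto simp: word_simple_diag split: if_splits)
    next
      case False
      obtain b' y' where "r = (b', y')" by (cases r)
      with r(2) b False obtain k where k: "y = North k" by (cases b') (auto split: node.splits simp del: word_diag_simps)
      with r(1) b False obtain j where "V.other (North k) = North j"
        by (auto split: node.splits simp del: word_diag_simps)
      then show ?thesis using lower t(2) b False k by simp
    qed
  qed
  moreover have "W.other = prod_mate (n + 2) ?d1 V.prod_diag"
    by (subst word_diag_simps) (simp add: dmul_def Let_def del: word_diag_simps)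
  then have "vert W.prod_diag = ?mid @ vert V.prod_diag"
    using a by (subst word_diag_simps) (simp add: dmul_def Let_def simple_diag_def id_diag_def del: word_diag_simps)
  ultimately show ?thesis by blast
qed

lemma contraction_black: "contraction\<^sup>*\<^sup>* w w' \<Longrightarrow> black ` set w' = black ` set w"
proof (induction rule: rtranclp_induct)
  case (step w' w'')
  from step.hyps(2) have "black ` set w'' = black ` set w'"
    by (cases rule: contraction.cases) (auto simp: black_def)
  then show ?case using step.IH by simp
qed simp

lemma contraction_not_distinct: "contraction w w' \<Longrightarrow> \<not> distinct w"
  by (cases rule: contraction.cases) auto

lemma filter_one_colour:
  assumes "\<And>c. c \<in> set ws \<Longrightarrow> P c = b"
  shows "filter P ws @ filter (\<lambda>c. \<not> P c) ws = ws" "filter (\<lambda>c. \<not> P c) ws @ filter P ws = ws"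
proof -
  have "filter P ws = (if b then ws else [])" "filter (\<lambda>c. \<not> P c) ws = (if b then [] else ws)"
    using assms by (auto simp: filter_id_conv filter_empty_conv)
  then show "filter P ws @ filter (\<lambda>c. \<not> P c) ws = ws" "filter (\<lambda>c. \<not> P c) ws @ filter P ws = ws" by auto
qed

context alternating_word
begin

lemma gen_deco_colour: "c \<in> set (gen_deco n i) \<Longrightarrow> if black c then i = 1 else i = n + 1"
  by (auto simp: gen_deco_def black_def split: if_splits)

lemma word_colour:
  assumes "c \<in> set (word prod_diag x)" shows "if black c then 1 \<in> set u else n + 1 \<in> set u"
  using word_diag_letters[OF assms] gen_deco_colour by (metis (full_types))

definition height_word :: "(node \<Rightarrow> deco list) \<Rightarrow> deco list" where
  "height_word f = (if a_val other = 1
      then (let ws = concat (map f (prop_list (n + 2) other));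
                bs = filter black ws; cs = filter (\<lambda>c. \<not> black c) ws in
            if \<exists>i j. u ! i = 1 \<and> u ! j = n + 1 \<and> heap_less n u i j then bs @ cs else cs @ bs)
      else [])"

lemma dec_A_eq:
  assumes "set fs = forks n u"
  shows "dec_A n u fs = \<lparr>mate = other, word = final_word,
    loops = replicate_mset (card cycles) (cyc [BTriangle, WTriangle]), vert = height_word final_word\<rparr>"
  using dec_A_fields[OF assms]
  unfolding dec_A_def set_heights_def height_word_def Let_def by (intro ddiag.equality) (simp_all add: prod_eqI del: add_2_eq_Suc' One_nat_def cong: if_cong)

lemma loops_prod: "loops prod_diag = replicate_mset (card cycles) (cyc cycle_word)"
  using loops_word_diag[OF alternating_word_axioms] card_endless_ones by (simp add: cycles_def)

text \<open>With a single colour one of \<open>bs\<close> and \<open>cs\<close> is empty, and their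
  order is immaterial.\<close>

lemma height_word_one_colour:
  assumes "\<not> (a_val other = 1 \<and> 1 \<in> set u \<and> n + 1 \<in> set u)" "\<And>x. black ` set (f x) \<subseteq> black ` set (word prod_diag x)"
  shows "height_word f = (if a_val other = 1 then concat (map f (prop_list (n + 2) other)) else [])"
proof (cases "a_val other = 1")
  case True
  let ?ws = "concat (map f (prop_list (n + 2) other))"
  have "black c = (1 \<in> set u)" if c: "c \<in> set ?ws" for c
  proof -
    obtain x where "c \<in> set (f x)" using c by (auto simp del: add_2_eq_Suc')
    then have "black c \<in> black ` set (word prod_diag x)" using assms(2)[of x] by blast
    then obtain c' where "c' \<in> set (word prod_diag x)" "black c' = black c" by (metis imageE)
    then show ?thesis using word_colour[of c' x] assms(1) True by (auto split: if_splits)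
  qed
  from filter_one_colour[of ?ws black, OF this] show ?thesis using True by (simp add: height_word_def Let_def)
qed (simp add: height_word_def)

lemma prop_vert_one_colour:
  assumes "decorated_diagram n prod_diag" "\<not> (a_val other = 1 \<and> 1 \<in> set u \<and> n + 1 \<in> set u)"
  shows "vert prod_diag = prop_vert n prod_diag"
proof (cases "a_val other = 1")
  case True
  let ?ws = "concat (map (word prod_diag) (prop_list (n + 2) other))"
  have f: "filter black (vert prod_diag) = filter black ?ws"
    "filter (\<lambda>c. \<not> black c) (vert prod_diag) = filter (\<lambda>c. \<not> black c) ?ws"
    by (rule decorated_vert(1,2)[OF assms(1) True])+
  have "black c = (1 \<in> set u)" if c: "c \<in> set (vert prod_diag)" for c
  proof -
    obtain x where "c \<in> set (word prod_diag x)" using vert_letters[OF assms(1) c] by blast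
    then show ?thesis using word_colour[of c x] assms(2) True by (auto split: if_splits simp del: word_diag_simps)
  qed
  from filter_one_colour(1)[of "vert prod_diag" black, OF this]
  have "vert prod_diag = filter black ?ws @ filter (\<lambda>c. \<not> black c) ?ws" using f by simp
  moreover have "black c = (1 \<in> set u)" if c: "c \<in> set ?ws" for c
  proof -
    obtain x where "c \<in> set (word prod_diag x)" using c by auto
    then show ?thesis using word_colour[of c x] assms(2) True by (auto split: if_splits simp del: word_diag_simps)
  qed
  from filter_one_colour(1)[of ?ws black, OF this] have "filter black ?ws @ filter (\<lambda>c. \<not> black c) ?ws = ?ws" .
  ultimately show ?thesis using True by (simp add: prop_vert_def)
next
  case False
  then show ?thesis using decorated_vert(3)[OF assms(1)] by (simp add: prop_vert_def)
qed

text \<open>Unless \<open>a_val\<close> is 1 and both extreme letters occur, \<open>vert\<close> is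
  determined by the words on the edges. So edges and loops can be contracted independently of each
  other.\<close>

lemma dec_A_class_one_colour:
  assumes proper: "diag_ideal n \<noteq> UNIV" and d: "decorated_diagram n prod_diag" and fs: "set fs = forks n u"
    and one: "\<not> (a_val other = 1 \<and> 1 \<in> set u \<and> n + 1 \<in> set u)"
  shows "diag_class n (dec_A n u fs) = diag_class n prod_diag"
proof -
  define e where "e = prod_diag\<lparr>word := final_word\<rparr>\<lparr>vert := prop_vert n (prod_diag\<lparr>word := final_word\<rparr>)\<rparr>"
  have out: "final_word x = []" if "x \<notin> nodes (n + 2)" for x using that by (simp add: final_word_def)
  have e: "decorated_diagram n e \<and> diag_class n prod_diag = diag_class n e"
    by (rule rewrite_words[OF proper d prop_vert_one_colour[OF d one] final_word_contraction final_word_other out e_def])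
  have "black ` set (final_word x) \<subseteq> black ` set (word prod_diag x)" for x
    using contraction_black[OF final_word_contraction] out by (cases "x \<in> nodes (n + 2)") auto
  note h = height_word_one_colour[OF one this]
  have "loops e = {#} + replicate_mset (card cycles) (cyc cycle_word)" by (simp add: e_def loops_prod)
  from rewrite_cycles[OF proper conjunct1[OF e] this]
  have "diag_class n e = diag_class n (e\<lparr>loops := {#} + replicate_mset (card cycles) (cyc [BTriangle, WTriangle])\<rparr>)" by blast
  moreover have "e\<lparr>loops := {#} + replicate_mset (card cycles) (cyc [BTriangle, WTriangle])\<rparr> = dec_A n u fs"
    unfolding dec_A_eq[OF fs] h by (intro ddiag.equality) (simp_all add: e_def prop_vert_def)
  ultimately show ?thesis using e by simp
qed

text \<open>A fork needs a repeated letter. Without forks a strand carries at most one decoration at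
  each end, and two of them differ, so there is nothing to contract.\<close>

lemma distinct_word:
  assumes "distinct u"
  shows "forks n u = {}" "cycles = {}" "x \<in> nodes (n + 2) \<Longrightarrow> final_word x = word prod_diag x"
proof -
  have "(t, b) \<notin> forks n u" for t b
  proof
    assume "(t, b) \<in> forks n u"
    then have "t < b" "b < length u" "u ! t = u ! b" by (auto simp: forks_iff nextin_def)
    then show False using nth_eq_iff_index_eq[OF assms, of t b] by simp
  qed
  then show F: "forks n u = {}" by auto
  then show "cycles = {}" by (auto simp: cycles_def forks_def)
  assume x: "x \<in> nodes (n + 2)"
  have "strand_forks x = []" using strand_forks_iff[OF x] F by (metis empty_iff list.set_intros(1) neq_Nil_conv)
  then have "distinct (word prod_diag x)"
    using strand_word[OF x] by (auto simp: exit_word_def split: if_splits)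
  then show "final_word x = word prod_diag x"
    using final_word_contraction[OF x] contraction_not_distinct by (metis converse_rtranclpE)
qed

text \<open>The decorations of the first letter lie above all others. \<open>P\<close> stands for
  its colour, and the remaining letters contribute only the other one.\<close>

lemma two_colour_vert:
  assumes ring: "ring (diag_alg n)" and a: "a_val other = 1" and u: "u = h # h' # v" and h': "gen_deco n h' = []"
    and no: "\<And>c i. c \<in> set (gen_deco n i) \<Longrightarrow> i \<in> set (h' # v) \<Longrightarrow> \<not> P c" and P: "\<And>c. c \<in> set (gen_deco n h) \<Longrightarrow> P c"
  shows "vert prod_diag = filter P (vert prod_diag) @ filter (\<lambda>c. \<not> P c) (vert prod_diag)"
proof -
  let ?V = "word_diag n (gen_deco n) (h' # v)"
  obtain mid where mid: "vert prod_diag = mid @ vert ?V" "set mid \<subseteq> set (gen_deco n h)"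
    using vert_first_letter[OF alternating_word_axioms[unfolded u] a[unfolded u] h'] unfolding u by blast
  have "decorated_diagram n ?V" using decorated_word_diag[OF ring, where u = "h' # v"] gens u by (simp del: word_diag_simps)
  then have "\<not> P c" if "c \<in> set (vert ?V)" for c using vert_letters[OF _ that] word_diag_letters no by blast
  then have "filter P (vert ?V) = []" "filter (\<lambda>c. \<not> P c) (vert ?V) = vert ?V"
    by (simp_all add: filter_empty_conv filter_id_conv)
  moreover have "filter P mid = mid" "filter (\<lambda>c. \<not> P c) mid = []"
    using mid(2) P by (auto simp: filter_empty_conv filter_id_conv)
  ultimately show ?thesis unfolding mid(1) by simp
qed

text \<open>The word is a run without repeated letters, so nothing contracts and the two diagrams
  are equal outright. Only the order of the colours in \<open>vert\<close> has to be
  compared.\<close>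

lemma dec_A_two_colours:
  assumes ring: "ring (diag_alg n)" and fs: "set fs = forks n u"
    and a: "a_val other = 1" and two: "1 \<in> set u" "n + 1 \<in> set u"
  shows "dec_A n u fs = prod_diag"
proof -
  let ?ws = "concat (map (word prod_diag) (prop_list (n + 2) other))"
  let ?B = "\<exists>i j. u ! i = 1 \<and> u ! j = n + 1 \<and> heap_less n u i j"
  have d: "decorated_diagram n prod_diag" by (rule decorated_word_diag[OF ring gens])
  have f: "filter black ?ws = filter black (vert prod_diag)"
    "filter (\<lambda>c. \<not> black c) ?ws = filter (\<lambda>c. \<not> black c) (vert prod_diag)"
    by (rule decorated_vert(1,2)[OF d a, symmetric])+
  have run: "u = [1..<n + 2] \<or> u = rev [1..<n + 2]" by (rule single_run[OF a two])
  then have dist: "distinct u" by auto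
  have fw: "final_word = word prod_diag"
    using distinct_word(3)[OF dist] mate_outside by (fastforce simp: final_word_def)
  \<comment> \<open>The extreme letter that comes first in the run is the top node of the heap;
    \<open>?B\<close> asks whether it is \<open>1\<close>.\<close>
  have "(if ?B then filter black ?ws @ filter (\<lambda>c. \<not> black c) ?ws else filter (\<lambda>c. \<not> black c) ?ws @ filter black ?ws)
      = vert prod_diag"
    using run
  proof
    assume u: "u = [1..<n + 2]"
    have nth: "k < length u \<Longrightarrow> u ! k = Suc k" for k unfolding u by (simp del: upt_Suc)
    have "heap_less n u 0 (Suc k)" if "Suc k < length u" for k
      using that
    proof (induction k)
      case (Suc k)
      then show ?case using heap_less_trans[of 0 "Suc k" "Suc (Suc k)"] heap_lessI[of "Suc k" "Suc (Suc k)"] nth by simp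
    next
      case 0
      then show ?case using heap_lessI[of 0 "Suc 0"] nth[of 0] nth[of "Suc 0"] by force
    qed
    from this[of "n - 1"] have "heap_less n u 0 n" using n2 unfolding u by simp
    moreover have "n < length u" "0 < length u" unfolding u by (simp_all del: upt_Suc)
    then have "u ! 0 = 1" "u ! n = n + 1" using nth[of 0] nth[of n] by simp_all
    ultimately have B: ?B by blast
    have "[1..<n + 2] = 1 # [Suc 1..<n + 2]" "[Suc 1..<n + 2] = Suc 1 # [Suc (Suc 1)..<n + 2]"
      using n2 by (simp_all add: upt_conv_Cons del: upt_Suc)
    then have u': "u = 1 # 2 # [Suc (Suc 1)..<n + 2]" unfolding u by (simp only: Suc_1)
    have "vert prod_diag = filter black (vert prod_diag) @ filter (\<lambda>c. \<not> black c) (vert prod_diag)"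
      by (rule two_colour_vert[OF ring a u']) (use n2 in \<open>auto simp: gen_deco_def black_def split: if_splits\<close>)
    then show ?thesis using B f by simp
  next
    assume u: "u = rev [1..<n + 2]"
    have nth: "k < length u \<Longrightarrow> u ! k = n + 1 - k" for k unfolding u by (simp add: rev_nth del: upt_Suc)
    have B: "\<not> ?B"
    proof
      assume ?B
      then obtain i j where ij: "u ! i = 1" "u ! j = n + 1" "heap_less n u i j" by blast
      have b: "i < j" "j < length u" using heap_less_bounds[OF ij(3)] by auto
      then show False using nth[of j] ij(2) by simp
    qed
    have "[1..<n + 2] = [1..<n] @ [n, n + 1]" using n2 by simp
    then have u': "u = (n + 1) # n # rev [1..<n]" unfolding u by simp
    have "vert prod_diag = filter (\<lambda>c. \<not> black c) (vert prod_diag) @ filter (\<lambda>c. \<not> \<not> black c) (vert prod_diag)"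
      by (rule two_colour_vert[OF ring a u', where P = "\<lambda>c. \<not> black c"]) (use n2 in \<open>auto simp: gen_deco_def black_def split: if_splits\<close>)
    then show ?thesis unfolding if_not_P[OF B] f by simp
  qed
  then have v: "height_word final_word = vert prod_diag" unfolding height_word_def fw Let_def if_P[OF a] .
  show ?thesis
    unfolding dec_A_eq[OF fs] v
    by (intro ddiag.equality) (simp_all add: fw loops_prod distinct_word(2)[OF dist])
qed

theorem dec_A_class:
  assumes "diag_ideal n \<noteq> UNIV" "set fs = forks n u"
  shows "diag_class n (dec_A n u fs) = diag_class n prod_diag"
proof -
  have ring: "ring (diag_alg n)" using diag_ideal_cases[of n] assms(1) by blast
  show ?thesis
    using dec_A_class_one_colour[OF assms(1) decorated_word_diag[OF ring gens] assms(2)]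
      dec_A_two_colours[OF ring assms(2)] by metis
qed

end

theorem theorem6p3:
  fixes n :: nat
    and w :: "nat list set"
    and u :: "nat list"
    and fs :: "(nat \<times> nat) list"
    and \<theta> :: "(nat list \<Rightarrow>\<^sub>0 int poly) set \<Rightarrow> (ddiag \<Rightarrow>\<^sub>0 int poly) set"
  assumes "n \<ge> 2"
    and "\<theta> \<in> algebra_hom (TL n) (TL_scalar n) (D_alg n) (D_scalar n)"
    and "\<And>i. i \<in> gens n \<Longrightarrow> \<theta> (b_gen n i) = diag_class n (d_gen n i)"
    and "w \<in> ALT n"
    and "u \<in> reduced_exprs w"
    and "distinct fs" and "set fs = forks n u"
  shows "diag_class n (dec_A n u fs) = \<theta> (b_word n u)"
proof -
  have "alternating n u" using assms(4,5) by (simp add: ALT_def)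
  moreover have "w \<in> lists (gens n) // cox_eq n" "u \<in> w"
    using assms(4,5) by (simp_all add: ALT_def FC_def coxeter_group_def reduced_exprs_def)
  then have "set u \<subseteq> gens n" by (auto simp: quotient_def cox_eq_def)
  ultimately interpret alternating_word n u using assms(1) by unfold_locales
  have "\<theta> (b_word n u) = diag_class n prod_diag"
    by (rule conjunct1[OF theta_b_word[OF assms(2,3) decorated_d_gen gens]])
  \<comment> \<open>In the degenerate quotient both classes are \<open>UNIV\<close>.\<close>
  moreover have "diag_class n (dec_A n u fs) = diag_class n prod_diag"
    using dec_A_class[OF _ assms(7)] diag_class_UNIV[of n] by (cases "diag_ideal n = UNIV") simp_all
  ultimately show ?thesis by (rule trans[OF _ sym, rotated])
qed

end
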